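(* In the errors-in-variables model described in the context, assume the following. (1) The vectors $\tilde c_i=(\tilde c_{i1},\dots,\tilde c_{i,n+d})^\top$, $i=1,2,\dots$, are independent with zero mean and finite second moments. (2) For a fixed set $J\subset\{1,\dots,n+d\}$, one has $\mathsf E\,\tilde c_{ij}^2=0$ for every $j\notin J$ and every $i\ge1$; moreover the covariance matrix of the subvector $(\tilde c_{ij},\,j\in J)$ equals $\sigma^2\Sigma_i$, $i\ge 1$, with an unknown factor $\sigma^2>0$ and known matrices $\Sigma_i$. (3) There exists $\varkappa>0$ such that $\lambda_{\min}(\Sigma_i)\ge\varkappa^2$ for every $i\ge1$. (4) $\mathrm{rank}(Z_{0J})=d$. (5) There exists $r\ge2$ with $r>d\left(|J|-\frac{d+1}{2}\right)$ such that $\sup_{i\ge1,\,j\in J}\mathsf E|\tilde c_{ij}|^{2r}<\infty$. (6) For some $\delta>0$, $\sup_{i\ge1,\,j\in J}\mathsf E|\tilde c_{ij}|^{4+2\delta}<\infty$, and for the same $\delta$, $\frac{1}{m^{1+\delta/2}}\sum_{i=1}^m\|a_{0i}\|^{2+\delta}\to0$ as $m\to\infty$. (7) $\frac1m A_0^\top A_0\to V_A$ as $m\to\infty$, where $V_A$ is a nonsingular matrix. (8) $\Sigma_i\to\Sigma_\infty$ as $i\to\infty$, for a certain matrix $\Sigma_\infty$. (9) For all $p,q,r\in J$ (not necessarily distinct) and all $i\ge1$, $\mathsf E\,\tilde c_{ip}\tilde c_{iq}\tilde c_{ir}=0$. (10) For all $p,q,r,u\in J$ (not necessarily distinct), $\frac1m\sum_{i=1}^m\mathsf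 E\,\tilde c_{ip}\tilde c_{iq}\tilde c_{ir}\tilde c_{iu}$ converges to a finite limit $\mu_4(p,q,r,u)$ as $m\to\infty$. Then the EW-TLS estimator $\hat X$ satisfies $$\sqrt m(\hat X-X_0)\ \text{converges in distribution to}\ V_A^{-1}\Gamma(X_0),\qquad m\to\infty,$$ where, with $Z=\begin{bmatrix}X\\-\mathrm I_d\end{bmatrix}$, $$\Gamma(X):=\Gamma_1Z+P_a\Gamma_2Z-[S_a^\infty,S_{ab}^\infty]\,Z(Z^\top S_\infty Z)^{-1}(Z^\top\Gamma_2Z),$$ $P_a$ is the projector with $P_a\begin{bmatrix}a\\ b\end{bmatrix}=a$ for $a\in\mathbb R^n$, $b\in\mathbb R^d$, the pair $\Gamma=(\Gamma_1,\Gamma_2)$ is the Gaussian limit defined in the context, and $$S_\infty=\begin{bmatrix}S_a^\infty&S_{ab}^\infty\\S_{ba}^\infty&S_b^\infty\end{bmatrix}=\lim_{i\to\infty}S_i,\qquad S_a^\infty\in\mathbb R^{n\times n}.$$ Moreover, the limiting random matrix $X_\infty:=V_A^{-1}\Gamma(X_0)$ has a nonsingular covariance structure, i.e., for each nonzero vector $u\in\mathbb R^{d\times1}$, the covariance matrix $\mathbf{cov}(X_\infty u)$ is nonsingular.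
   Context: Model. Fix positive integers $n,d$. Let $X_0\in\mathbb R^{n\times d}$ be the true value of the matrix parameter, let $a_{0i}\in\mathbb R^n$, $i=1,2,\dots$, be nonrandom vectors, and put $b_{0i}=X_0^\top a_{0i}\in\mathbb R^d$. One observes $a_i=a_{0i}+\tilde a_i$, $b_i=b_{0i}+\tilde b_i$, where $\tilde a_i,\tilde b_i$ are random errors. Put $c_i=\begin{bmatrix}a_i\\ b_i\end{bmatrix}$ and $\tilde c_i=\begin{bmatrix}\tilde a_i\\\tilde b_i\end{bmatrix}=(\tilde c_{i1},\dots,\tilde c_{i,n+d})^\top$. For each $m$, the matrices $A,A_0,B$ have rows $a_i^\top,a_{0i}^\top,b_i^\top$, $i=1,\dots,m$, and $C=[A,B]=(c_{ij})$. Notation. $Z_0=\begin{bmatrix}X_0\\-\mathrm I_d\end{bmatrix}$, $Z=Z(X)=\begin{bmatrix}X\\-\mathrm I_d\end{bmatrix}$ for $X\in\mathbb R^{n\times d}$; $Z_{0J}$, $Z_J$ are the submatrices of $Z_0$, $Z$ formed by the rows with indices in $J$. $S_i:=\frac1{\sigma^2}\mathbf{cov}(\tilde c_i)\in\mathbb R^{(n+d)\times(n+d)}$, where $\mathbf{cov}$ denotes the covariance matrix of a random vector. EW-TLS estimator. The EW-TLS problem is to minimize $\sum_{i=1}^m\|\Sigma_i^{-1/2}\Delta c_i^J\|^2$ over $X\in\mathbb R^{n\times d}$, $\Delta A\in\mathbb R^{m\times n}$, $\Delta B\in\mathbb R^{m\times d}$, subject to $(A-\Delta A)X=B-\Delta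 B$ and $\Delta c_{ij}=0$ for $i=1,\dots,m$, $j\notin J$, where $[\Delta A,\Delta B]=(\Delta c_{ij})$ and $\Delta c_i^J=(\Delta c_{ij},\,j\in J)\in\mathbb R^{|J|}$ (column vector). The EW-TLS estimator $\hat X$ of $X_0$ is a Borel measurable mapping of the data matrix $C$ into $\mathbb R^{n\times d}\cup\{\infty\}$ which solves this problem (i.e. is the $X$-component of a minimizer) under the additional constraint $\mathrm{rank}(Z_J)=d$, if a solution exists, and $\hat X=\infty$ otherwise. Under the hypotheses $\hat X$ is finite with probability tending to one; expressions involving $\hat X$ may be given arbitrary values on the event $\{\hat X=\infty\}$. The limit $\Gamma$. Put $W_i=(a_{0i}\tilde c_i^\top,\ \tilde c_i\tilde c_i^\top-\sigma^2S_i)$, a random element of $\mathbb R^{n\times(n+d)}\times\mathbb R^{(n+d)\times(n+d)}$. Under the hypotheses, $\frac1{\sqrt m}\sum_{i=1}^mW_i$ converges in distribution, as $m\to\infty$, to a centered Gaussian random element $\Gamma=(\Gamma_1,\Gamma_2)$ with independent matrix components $\Gamma_1$, $\Gamma_2$; this defines (the law of) $\Gamma$. *)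

theory Defs
  imports "HOL-Probability.Probability"
begin

text \<open>
  The coordinates \<open>1, \<dots>, n + d\<close> are modelled by the sum type \<open>'n + 'd\<close>: a vector of type
  \<open>real ^ ('n + 'd)\<close> is a stacked column \<open>[a; b]\<close> with \<open>a :: real ^ 'n\<close> and \<open>b :: real ^ 'd\<close>, and
  \<open>real ^ 'd ^ 'n\<close> is the type of \<open>n \<times> d\<close> matrices. The number \<open>m\<close> of observations is a natural
  number; the rows of an \<open>m\<close>-row matrix are the values of a function at the indices \<open>i < m\<close>.
\<close>

definition stack :: "'a ^ 'n::finite \<Rightarrow> 'a ^ 'd::finite \<Rightarrow> 'a ^ ('n + 'd)" where
  "stack a b = (\<chi> s. case s of Inl i \<Rightarrow> a $ i | Inr k \<Rightarrow> b $ k)"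

text \<open>Since \<open>'a\<close> may be a row type, these also select blocks of rows of a matrix.\<close>

definition upper :: "'a ^ ('n::finite + 'd::finite) \<Rightarrow> 'a ^ 'n" where
  "upper c = (\<chi> i. c $ Inl i)"

definition lower :: "'a ^ ('n::finite + 'd::finite) \<Rightarrow> 'a ^ 'd" where
  "lower c = (\<chi> k. c $ Inr k)"

text \<open>
  Entries (or rows) with indices in \<open>J\<close>. The set \<open>J\<close> is enumerated by a bijection \<open>e\<close> from a finite
  type \<open>'j\<close> onto \<open>J\<close>, so that vectors of length \<open>card J\<close> have type \<open>real ^ 'j\<close>.
\<close>

definition subrows :: "('j::finite \<Rightarrow> 's::finite) \<Rightarrow> 'a ^ 's \<Rightarrow> 'a ^ 'j" where
  "subrows e c = (\<chi> k. c $ e k)"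

definition outer :: "real ^ 'p \<Rightarrow> real ^ 'q \<Rightarrow> real ^ 'q ^ 'p" where
  "outer x y = (\<chi> p q. x $ p * y $ q)"

definition Zmat :: "real ^ 'd::finite ^ 'n::finite \<Rightarrow> real ^ 'd ^ ('n + 'd)" where
  "Zmat X = stack X (- mat 1)"

definition Pa :: "real ^ ('n::finite + 'd::finite) ^ 'n" where
  "Pa = (\<chi> i s. if s = Inl i then 1 else 0)"

lemma Pa_stack: "Pa *v stack a b = a"
  by (simp add: vec_eq_iff Pa_def stack_def matrix_vector_mult_def if_distrib if_distribR
      cong: if_cong)

definition eigenvals :: "real ^ 'k ^ 'k \<Rightarrow> real set" where
  "eigenvals A = {l. \<exists>v. v \<noteq> 0 \<and> A *v v = l *\<^sub>R v}"

definition lambda_min :: "real ^ 'k ^ 'k \<Rightarrow> real" where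
  "lambda_min A = Min (eigenvals A)"

text \<open>For a symmetric positive definite matrix \<open>A\<close>: the unique symmetric positive definite square
  root of the inverse of \<open>A\<close>.\<close>

definition inv_sqrt :: "real ^ 'k ^ 'k \<Rightarrow> real ^ 'k ^ 'k" where
  "inv_sqrt A =
    (THE R. transpose R = R \<and> (\<forall>x. x \<noteq> 0 \<longrightarrow> x \<bullet> (R *v x) > 0) \<and> R ** R = matrix_inv A)"

definition cov_matrix :: "'w measure \<Rightarrow> ('w \<Rightarrow> real ^ 'k) \<Rightarrow> real ^ 'k ^ 'k" where
  "cov_matrix M Y = (\<chi> p q. \<integral>\<omega>. (Y \<omega> $ p - (\<integral>\<eta>. Y \<eta> $ p \<partial>M)) * (Y \<omega> $ q - (\<integral>\<eta>. Y \<eta> $ q \<partial>M)) \<partial>M)"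

definition conv_in_law :: "(nat \<Rightarrow> 'a::topological_space measure) \<Rightarrow> 'a measure \<Rightarrow> bool" where
  "conv_in_law N L \<longleftrightarrow>
    (\<forall>f :: 'a \<Rightarrow> real. continuous_on UNIV f \<and> bounded (range f) \<longrightarrow>
      (\<lambda>m. \<integral>x. f x \<partial>N m) \<longlonglongrightarrow> (\<integral>x. f x \<partial>L))"

text \<open>Degenerate directions (\<open>s = 0\<close>) are allowed.\<close>

definition centered_gaussian :: "'a::euclidean_space measure \<Rightarrow> bool" where
  "centered_gaussian L \<longleftrightarrow> prob_space L \<and> sets L = sets borel \<and>
    (\<forall>u. \<exists>s\<ge>0. distr L borel (\<lambda>x. u \<bullet> x) =
      (if s = 0 then return borel 0 else density lborel (normal_density 0 s)))"

text \<open>Independence of the two components under a law on a product. The library's \<open>indep_var\<close> needs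
  both random variables to have the same type, hence \<open>indep_set\<close>.\<close>

definition indep_components ::
    "('a::topological_space \<times> 'b::topological_space) measure \<Rightarrow> bool" where
  "indep_components L \<longleftrightarrow>
    prob_space.indep_set L (sets (vimage_algebra (space L) fst borel))
                           (sets (vimage_algebra (space L) snd borel))"

text \<open>
  Feasible points \<open>(X, [\<Delta>A, \<Delta>B])\<close> for the data rows \<open>C i\<close>, \<open>i < m\<close>; \<open>D i\<close> is row \<open>i\<close> of
  \<open>[\<Delta>A, \<Delta>B]\<close>. The first condition is \<open>(A - \<Delta>A) X = B - \<Delta>B\<close> row by row.
\<close>

definition ewtls_feasible ::
    "('n::finite + 'd::finite) set \<Rightarrow> ('j::finite \<Rightarrow> 'n + 'd) \<Rightarrow> nat \<Rightarrow> (nat \<Rightarrow> real ^ ('n + 'd))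
      \<Rightarrow> real ^ 'd ^ 'n \<Rightarrow> (nat \<Rightarrow> real ^ ('n + 'd)) \<Rightarrow> bool" where
  "ewtls_feasible J e m C X D \<longleftrightarrow>
    (\<forall>i<m. upper (C i - D i) v* X = lower (C i - D i)) \<and>
    (\<forall>i<m. \<forall>j. j \<notin> J \<longrightarrow> D i $ j = 0) \<and>
    rank (subrows e (Zmat X)) = CARD('d)"

definition ewtls_objective ::
    "('j::finite \<Rightarrow> 'n::finite + 'd::finite) \<Rightarrow> (nat \<Rightarrow> real ^ 'j ^ 'j) \<Rightarrow> nat \<Rightarrow> (nat \<Rightarrow> real ^ ('n + 'd)) \<Rightarrow> real" where
  "ewtls_objective e Sig m D = (\<Sum>i<m. (norm (inv_sqrt (Sig i) *v subrows e (D i)))\<^sup>2)"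

definition ewtls_solution ::
    "('n::finite + 'd::finite) set \<Rightarrow> ('j::finite \<Rightarrow> 'n + 'd) \<Rightarrow> (nat \<Rightarrow> real ^ 'j ^ 'j) \<Rightarrow> nat
      \<Rightarrow> (nat \<Rightarrow> real ^ ('n + 'd)) \<Rightarrow> real ^ 'd ^ 'n \<Rightarrow> bool" where
  "ewtls_solution J e Sig m C X \<longleftrightarrow>
    (\<exists>D. ewtls_feasible J e m C X D \<and>
      (\<forall>X' D'. ewtls_feasible J e m C X' D' \<longrightarrow>
        ewtls_objective e Sig m D \<le> ewtls_objective e Sig m D'))"

text \<open>The Borel sets of \<open>'a \<union> {\<infinity>}\<close>, with \<open>None\<close> in the role of \<open>\<infinity>\<close>.\<close>

definition borel_infty :: "'a::topological_space option measure" where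
  "borel_infty = sigma UNIV (insert {None} {Some ` B | B. B \<in> sets borel})"

text \<open>\<open>est m\<close> is a function of the data matrix with \<open>m\<close> rows.\<close>

definition ewtls_estimator ::
    "('n::finite + 'd::finite) set \<Rightarrow> ('j::finite \<Rightarrow> 'n + 'd) \<Rightarrow> (nat \<Rightarrow> real ^ 'j ^ 'j)
      \<Rightarrow> (nat \<Rightarrow> (nat \<Rightarrow> real ^ ('n + 'd)) \<Rightarrow> (real ^ 'd ^ 'n) option) \<Rightarrow> bool" where
  "ewtls_estimator J e Sig est \<longleftrightarrow>
    (\<forall>m. est m \<in> measurable (PiM {..<m} (\<lambda>_. borel)) borel_infty \<and>
      (\<forall>C \<in> space (PiM {..<m} (\<lambda>_. borel)).
        case est m C of
          Some X \<Rightarrow> ewtls_solution J e Sig m C X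
        | None \<Rightarrow> \<not> (\<exists>X. ewtls_solution J e Sig m C X)))"

definition obs ::
    "real ^ 'd::finite ^ 'n::finite \<Rightarrow> (nat \<Rightarrow> real ^ 'n) \<Rightarrow> (nat \<Rightarrow> 'w \<Rightarrow> real ^ ('n + 'd))
      \<Rightarrow> nat \<Rightarrow> 'w \<Rightarrow> real ^ ('n + 'd)" where
  "obs X0 a0 ct i \<omega> = stack (a0 i) (transpose X0 *v a0 i) + ct i \<omega>"

definition Smat ::
    "'w measure \<Rightarrow> real \<Rightarrow> (nat \<Rightarrow> 'w \<Rightarrow> real ^ 's) \<Rightarrow> nat \<Rightarrow> real ^ 's ^ 's" where
  "Smat M \<sigma> ct i = (1 / \<sigma>\<^sup>2) *\<^sub>R cov_matrix M (ct i)"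

definition Wpair ::
    "'w measure \<Rightarrow> real \<Rightarrow> (nat \<Rightarrow> real ^ 'n) \<Rightarrow> (nat \<Rightarrow> 'w \<Rightarrow> real ^ 's) \<Rightarrow> nat \<Rightarrow> 'w
      \<Rightarrow> (real ^ 's ^ 'n) \<times> (real ^ 's ^ 's)" where
  "Wpair M \<sigma> a0 ct i \<omega> =
    (outer (a0 i) (ct i \<omega>), outer (ct i \<omega>) (ct i \<omega>) - \<sigma>\<^sup>2 *\<^sub>R Smat M \<sigma> ct i)"

text \<open>\<open>L\<close> is the law of the Gaussian limit \<open>(\<Gamma>\<^sub>1, \<Gamma>\<^sub>2)\<close>. By uniqueness of weak limits there is at most
  one such \<open>L\<close>.\<close>

definition limit_law ::
    "'w measure \<Rightarrow> real \<Rightarrow> (nat \<Rightarrow> real ^ 'n) \<Rightarrow> (nat \<Rightarrow> 'w \<Rightarrow> real ^ 's)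
      \<Rightarrow> ((real ^ 's ^ 'n) \<times> (real ^ 's ^ 's)) measure \<Rightarrow> bool" where
  "limit_law M \<sigma> a0 ct L \<longleftrightarrow>
    centered_gaussian L \<and> indep_components L \<and>
    conv_in_law (\<lambda>m. distr M borel (\<lambda>\<omega>. (1 / sqrt (real m)) *\<^sub>R (\<Sum>i<m. Wpair M \<sigma> a0 ct i \<omega>))) L"

text \<open>\<open>upper Sinf\<close> is the block \<open>[S\<^sub>a, S\<^sub>a\<^sub>b]\<close> of \<open>Sinf\<close>.\<close>

definition Gamma_of ::
    "real ^ ('n::finite + 'd::finite) ^ ('n + 'd) \<Rightarrow> real ^ 'd ^ 'n
      \<Rightarrow> (real ^ ('n + 'd) ^ 'n) \<times> (real ^ ('n + 'd) ^ ('n + 'd)) \<Rightarrow> real ^ 'd ^ 'n" where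
  "Gamma_of Sinf X G =
    (let Z = Zmat X; G1 = fst G; G2 = snd G
     in G1 ** Z + Pa ** G2 ** Z
        - upper Sinf ** Z ** matrix_inv (transpose Z ** Sinf ** Z) ** (transpose Z ** G2 ** Z))"

end

theory Submission
  imports Defs "HOL-Probability.Probability"
begin

text \<open>
  For fixed \<open>X\<close> the optimal corrections are explicit, row by row: with \<open>P\<^sub>i = Z\<^sup>T S\<^sub>i Z\<close> the estimator
  minimizes \<open>Q(X) = \<Sum>i. (Z\<^sup>T c\<^sub>i) \<bullet> P\<^sub>i\<^sup>-\<^sup>1 (Z\<^sup>T c\<^sub>i)\<close> over the \<open>X\<close> with \<open>rank Z\<^sub>J = d\<close>. Weights \<open>\<tau>\<^sub>i \<rightarrow> 1\<close> with
  \<open>\<tau>\<^sub>i \<Sigma>\<^sub>i \<le> \<Sigma>\<^sub>\<infinity>\<close> bound \<open>Q\<close> from below by the same expression with the constant matrix \<open>\<Sigma>\<^sub>\<infinity>\<close>,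
  which involves the data only through averages that obey a law of large numbers; hence every
  minimizer is close to \<open>X\<^sub>0\<close> with probability tending to one.

  Near \<open>X\<^sub>0\<close> the minimizer is a stationary point of \<open>Q\<close>. With \<open>D = \<surd>m (X - X\<^sub>0)\<close> and \<open>S\<^sub>m = m\<^sup>-\<^sup>1\<^sup>/\<^sup>2 \<Sum>W\<^sub>i\<close>, the
  stationarity equation reads \<open>V\<^sub>A D + \<Gamma>(X\<^sub>0)(S\<^sub>m) = o(1) (1 + |D| + |S\<^sub>m|)\<close>. The delicate part of the error,
  where \<open>X\<close> and \<open>\<Sigma>\<^sub>i\<close> both deviate from their limits, is a second difference in \<open>(X, \<Sigma>)\<close>, so it is bounded
  by \<open>|D| m\<^sup>-\<^sup>1 \<Sum>|\<Sigma>\<^sub>i - \<Sigma>\<^sub>\<infinity>| |W\<^sub>i|\<close>, which needs no uniform limit theorem. Thus \<open>D = - V\<^sub>A\<^sup>-\<^sup>1 \<Gamma>(X\<^sub>0)(S\<^sub>m) + o\<^sub>P(1)\<close>, and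
  the Lyapunov central limit theorem applies to \<open>- S\<^sub>m\<close> with the same limit as to \<open>S\<^sub>m\<close>. The third
  moments being zero, \<open>\<Gamma>\<^sub>1\<close> and \<open>\<Gamma>\<^sub>2\<close> are uncorrelated, hence independent, and the variance of
  \<open>\<Gamma>\<^sub>1\<close> alone makes the limiting covariance nonsingular.
\<close>

subsection \<open>Symmetric matrices\<close>

text \<open>The obstacle to consistency is that the admissible set
  \<open>rank (subrows e (Zmat X)) = CARD('d)\<close> is not compact and \<open>Pmat e A X\<close>
  can degenerate along it, so a law of large numbers uniform in X is out of reach. A deterministic
  inequality replaces it: if w is normalized by
  \<open>w \<bullet> (Pmat e Siginf X *v w) = 1\<close>, the J-part of \<open>Zmat X *v w\<close>
  has norm at most 1/\<kappa>, whatever X is. The deviations of three averages from their limits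
  then bound the cost from below uniformly in X, and X - X0 enters through a positive definite form.
  Finiteness of the estimator has to be proved as well: a minimizer exists on the event where every
  point at least as good as X0 lies in a fixed compact ball. No inverse is ever differentiated. The
  cost of a row is the maximum over l of 2 l.y - l.(P l), where y is the residual of the row.
  Inserting the maximizer belonging to a perturbed X into the problem at X bounds the increment of
  the cost to first order; a one-sided limit along rays then gives stationarity. The error of the
  expansion contains the unknown D itself, but with a small factor; absorbing it on the left-hand
  side yields the root-m rate and the limit at once.\<close>

lemma selfadjoint_eigenvector:
  fixes f :: "'a::euclidean_space \<Rightarrow> 'a"
  assumes f: "linear f" and sa: "\<And>x y. f x \<bullet> y = x \<bullet> f y"
    and S: "subspace S" "f ` S \<subseteq> S" "S \<noteq> {0}"
  obtains v \<mu> where "v \<in> S" "norm v = 1" "f v = \<mu> *\<^sub>R v" "\<And>x. x \<in> S \<Longrightarrow> \<mu> * (norm x)\<^sup>2 \<le> x \<bullet> f x"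
proof -
  have 0: "0 \<in> S" using S(1) by (rule subspace_0)
  then obtain x0 where x0: "x0 \<in> S" "x0 \<noteq> 0" using S(3) by blast
  let ?K = "S \<inter> sphere 0 1"
  have "(1 / norm x0) *\<^sub>R x0 \<in> ?K" using x0 S(1) by (auto simp: subspace_scale)
  then have ne: "?K \<noteq> {}" by blast
  have cK: "compact ?K" using closed_subspace[OF S(1)] by (simp add: closed_Int_compact)
  have cf: "continuous_on A f" for A using f by (simp add: linear_continuous_on linear_linear)
  have "continuous_on ?K (\<lambda>x. x \<bullet> f x)" by (intro continuous_intros cf)
  \<comment> \<open>The eigenvector is a minimizer of the Rayleigh quotient on the unit sphere of
    S.\<close>
  from continuous_attains_inf[OF cK ne this] obtain v where
    v: "v \<in> ?K" and vm: "\<And>y. y \<in> ?K \<Longrightarrow> v \<bullet> f v \<le> y \<bullet> f y" by blast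
  define \<mu> where "\<mu> = v \<bullet> f v"
  have nv: "norm v = 1" "v \<in> S" using v by auto
  have R: "\<mu> * (norm x)\<^sup>2 \<le> x \<bullet> f x" if "x \<in> S" for x
  proof (cases "x = 0")
    case False
    have "(1 / norm x) *\<^sub>R x \<in> ?K" using that False S(1) by (auto simp: subspace_scale)
    from vm[OF this] have "\<mu> \<le> (x \<bullet> f x) / (norm x)\<^sup>2"
      by (simp add: \<mu>_def linear_scale[OF f] power2_eq_square)
    then show ?thesis using False by (simp add: field_simps)
  qed (use linear_0[OF f] in simp)
  \<comment> \<open>Minimality makes the quadratic 2 t b + t^2 c nonnegative for all t, which
    forbids a nonzero linear coefficient b; the test values are t = -b if c = 0, t = b/c if c < 0
    and t = -b/c if c > 0. Since the residual itself lies in S, it must vanish.\<close>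
  have orth: "w \<bullet> (f v - \<mu> *\<^sub>R v) = 0" if w: "w \<in> S" for w
  proof (rule ccontr)
    define b where "b = w \<bullet> (f v - \<mu> *\<^sub>R v)"
    assume "w \<bullet> (f v - \<mu> *\<^sub>R v) \<noteq> 0"
    then have b: "b \<noteq> 0" by (simp add: b_def)
    define c where "c = w \<bullet> f w - \<mu> * (norm w)\<^sup>2"
    have key: "0 \<le> 2 * t * b + t\<^sup>2 * c" for t
    proof -
      have "v + t *\<^sub>R w \<in> S" using w nv S(1) by (auto intro: subspace_add subspace_scale)
      from R[OF this] have "\<mu> * (norm (v + t *\<^sub>R w))\<^sup>2 \<le> (v + t *\<^sub>R w) \<bullet> f (v + t *\<^sub>R w)" .
      moreover have "(norm (v + t *\<^sub>R w))\<^sup>2 = 1 + 2 * t * (w \<bullet> v) + t\<^sup>2 * (norm w)\<^sup>2"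
        using nv(1) unfolding power2_norm_eq_inner by (simp add: norm_eq_1 inner_add_left inner_add_right inner_commute power2_eq_square algebra_simps)
      moreover have "(v + t *\<^sub>R w) \<bullet> f (v + t *\<^sub>R w) = \<mu> + 2 * t * (w \<bullet> f v) + t\<^sup>2 * (w \<bullet> f w)"
        using sa[of v w] by (simp add: linear_add[OF f] linear_scale[OF f] inner_add_left inner_add_right \<mu>_def power2_eq_square inner_commute algebra_simps)
      ultimately show ?thesis by (simp add: b_def c_def inner_diff_right algebra_simps)
    qed
    show False
    proof (cases "c = 0")
      case True then show False using key[of "-b"] b by (simp add: power2_eq_square[symmetric])
    next
      case False
      have c: "c > 0"
      proof (rule ccontr)
        assume "\<not> c > 0" then have "c < 0" using False by simp
        then show False using key[of "b/c"] b by (auto simp: power2_eq_square field_simps) 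
          (smt (verit, best) mult_neg_neg mult_pos_pos zero_less_mult_iff)
      qed
      then show False using key[of "-b/c"] b by (simp add: power2_eq_square field_simps) 
          (smt (verit, best) not_real_square_gt_zero)
    qed
  qed
  have "f v - \<mu> *\<^sub>R v \<in> S" using nv S by (auto intro: subspace_diff subspace_scale)
  from orth[OF this] have "f v = \<mu> *\<^sub>R v" by simp
  with nv R that show thesis by blast
qed

text \<open>Induction on the dimension: self-adjointness keeps the orthogonal complement of an
  eigenvector invariant. Invariant subspaces, not only the whole space, are needed to run the
  induction.\<close>

lemma selfadjoint_eigenbasis_subspace:
  fixes f :: "'a::euclidean_space \<Rightarrow> 'a"
  assumes f: "linear f" and sa: "\<And>x y. f x \<bullet> y = x \<bullet> f y"
  shows "subspace S \<Longrightarrow> f ` S \<subseteq> S \<Longrightarrow>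
    \<exists>B l. finite B \<and> pairwise orthogonal B \<and> (\<forall>b\<in>B. norm b = 1 \<and> f b = l b *\<^sub>R b) \<and> span B = S"
proof (induction "dim S" arbitrary: S rule: less_induct)
  case less
  show ?case
  proof (cases "S = {0}")
    case True then show ?thesis by (intro exI[of _ "{}"]) auto
  next
    case False
    obtain v \<mu> where v: "v \<in> S" "norm v = 1" "f v = \<mu> *\<^sub>R v"
      using selfadjoint_eigenvector[OF f sa less.prems False] by blast
    define T where "T = S \<inter> {x. v \<bullet> x = 0}"
    have T: "subspace T" unfolding T_def using less.prems(1) by (intro subspace_inter subspace_hyperplane) 
    have "v \<notin> T" using v by (auto simp: T_def)
    then have "T \<subset> S" using v unfolding T_def by blast
    then have "dim T < dim S" using T less.prems(1) by (intro dim_psubset) (simp add: span_eq_iff[THEN iffD2])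
    moreover have "f ` T \<subseteq> T"
    proof clarify
      fix x assume x: "x \<in> T"
      have "v \<bullet> f x = \<mu> * (v \<bullet> x)" using sa[of v x] v(3) by simp
      then show "f x \<in> T" using x less.prems(2) by (auto simp: T_def)
    qed
    ultimately obtain B l where B: "finite B" "pairwise orthogonal B" "\<forall>b\<in>B. norm b = 1 \<and> f b = l b *\<^sub>R b" "span B = T"
      using less.hyps T by blast
    have BT: "B \<subseteq> T" using B(4) span_superset by blast
    have vB: "v \<notin> B" using BT \<open>v \<notin> T\<close> by blast
    show ?thesis
    proof (intro exI conjI)
      show "finite (insert v B)" using B by simp
      show "pairwise orthogonal (insert v B)"
        using B(2) BT by (auto simp: pairwise_insert T_def orthogonal_def inner_commute)
      show "\<forall>b\<in>insert v B. norm b = 1 \<and> f b = (l(v := \<mu>)) b *\<^sub>R b" using B v vB by auto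
      show "span (insert v B) = S"
      proof
        show "span (insert v B) \<subseteq> S" using v(1) BT less.prems(1)
          by (intro span_minimal) (auto simp: T_def)
        show "S \<subseteq> span (insert v B)"
        proof
          fix x assume x: "x \<in> S"
          have "x - (v \<bullet> x) *\<^sub>R v \<in> T" using x v less.prems(1) 
            by (auto simp: T_def inner_diff_right subspace_diff subspace_scale norm_eq_1)
          then have "x - (v \<bullet> x) *\<^sub>R v \<in> span B" using B(4) by simp
          then show "x \<in> span (insert v B)" by (auto simp: span_insert)
        qed
      qed
    qed
  qed
qed

lemma selfadjoint_eigenbasis:
  fixes f :: "'a::euclidean_space \<Rightarrow> 'a"
  assumes "linear f" "\<And>x y. f x \<bullet> y = x \<bullet> f y"
  obtains B l where "finite B" "pairwise orthogonal B" "\<And>b. b \<in> B \<Longrightarrow> norm b = 1"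
    "\<And>b. b \<in> B \<Longrightarrow> f b = l b *\<^sub>R b" "span B = UNIV"
  using selfadjoint_eigenbasis_subspace[OF assms, of UNIV] by auto

text \<open>The root scales each vector of an eigenbasis by the square root of its eigenvalue, which
  \<open>psd\<close> makes nonnegative. It serves three purposes: \<open>inv_sqrt\<close>, Gaussian
  laws with prescribed covariance, and a quantitative lower bound for \<open>VA\<close>.\<close>

lemma psd_sqrt_exists:
  fixes f :: "'a::euclidean_space \<Rightarrow> 'a"
  assumes f: "linear f" and sa: "\<And>x y. f x \<bullet> y = x \<bullet> f y" and psd: "\<And>x. 0 \<le> x \<bullet> f x"
  obtains g where "linear g" "\<And>x y. g x \<bullet> y = x \<bullet> g y" "\<And>x. 0 \<le> x \<bullet> g x" "\<And>x. g (g x) = f x"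
proof -
  obtain B l where B: "finite B" "pairwise orthogonal B" "\<And>b. b \<in> B \<Longrightarrow> norm b = 1"
    "\<And>b. b \<in> B \<Longrightarrow> f b = l b *\<^sub>R b" "span B = UNIV"
    using selfadjoint_eigenbasis[OF f sa] by metis
  have ex: "(\<Sum>b\<in>B. (x \<bullet> b) *\<^sub>R b) = x" for x
    using B by (intro orthonormal_basis_expand) auto
  have bb: "b \<bullet> c = (if b = c then 1 else 0)" if "b \<in> B" "c \<in> B" for b c
    using B(2,3) that by (auto simp: pairwise_def orthogonal_def norm_eq_1)
  have l0: "l b \<ge> 0" if "b \<in> B" for b
    using psd[of b] B(4)[OF that] bb[OF that that] by simp
  define g where "g x = (\<Sum>b\<in>B. (sqrt (l b) * (x \<bullet> b)) *\<^sub>R b)" for x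
  have gl: "linear g"
    by (rule linearI) (simp_all add: g_def inner_add_left distrib_left scaleR_add_left sum.distrib scaleR_sum_right mult_ac)
  have gx: "g b = sqrt (l b) *\<^sub>R b" if "b \<in> B" for b
  proof -
    have "g b = (\<Sum>c\<in>B. if c = b then sqrt (l b) *\<^sub>R b else 0)"
      unfolding g_def using that by (intro sum.cong) (auto simp: bb)
    then show ?thesis using that B(1) by simp
  qed
  show thesis
  proof
    show "linear g" by fact
    show "g x \<bullet> y = x \<bullet> g y" for x y
      by (simp add: g_def inner_sum_left inner_sum_right inner_commute mult_ac)
    show "0 \<le> x \<bullet> g x" for x
      using l0 by (auto simp: g_def inner_sum_right mult.assoc inner_commute intro!: sum_nonneg mult_nonneg_nonneg[OF real_sqrt_ge_zero])
    have *: "g (g x) = f x" if "x \<in> span B" for x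
    proof (rule linear_eq_on[of "\<lambda>x. g (g x)" f, OF _ f that])
      show "linear (\<lambda>x. g (g x))" using linear_compose[OF gl gl] by (simp add: o_def)
      show "g (g b) = f b" if "b \<in> B" for b
        using that gx[OF that] B(4)[OF that] l0[OF that] by (simp add: linear_scale[OF gl])
    qed
    then show "g (g x) = f x" for x using B(5) by auto
  qed
qed

text \<open>With h = f - g one has f h + h g = f f - g g = 0. Tested on an eigenvector b of h with
  eigenvalue l, this reads l (b.f b + b.g b) = 0, and the bracket is positive.\<close>

lemma pd_sqrt_unique:
  fixes f g :: "'a::euclidean_space \<Rightarrow> 'a"
  assumes f: "linear f" "\<And>x y. f x \<bullet> y = x \<bullet> f y" "\<And>x. x \<noteq> 0 \<Longrightarrow> 0 < x \<bullet> f x"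
    and g: "linear g" "\<And>x y. g x \<bullet> y = x \<bullet> g y" "\<And>x. x \<noteq> 0 \<Longrightarrow> 0 < x \<bullet> g x"
    and eq: "\<And>x. f (f x) = g (g x)"
  shows "f = g"
proof -
  define h where "h x = f x - g x" for x
  have hl: "linear h" unfolding h_def[abs_def] using f(1) g(1) by (rule linear_compose_sub)
  have hs: "h x \<bullet> y = x \<bullet> h y" for x y by (simp add: h_def inner_diff_left inner_diff_right f g)
  obtain B l where B: "finite B" "\<And>b. b \<in> B \<Longrightarrow> norm b = 1"
    "\<And>b. b \<in> B \<Longrightarrow> h b = l b *\<^sub>R b" "span B = UNIV"
    using selfadjoint_eigenbasis[OF hl hs] by metis
  have "h b = 0" if b: "b \<in> B" for b
  proof -
    have "f (h b) + h (g b) = 0" by (simp add: h_def linear_diff[OF f(1)] eq)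
    then have "b \<bullet> f (h b) + b \<bullet> h (g b) = 0" by (metis inner_add_right inner_zero_right)
    then have "l b * (b \<bullet> f b + b \<bullet> g b) = 0"
      using B(3)[OF b] hs[of b "g b"] by (simp add: linear_scale[OF f(1)] distrib_left)
    moreover have "b \<noteq> 0" using B(2)[OF b] by auto
    ultimately have "l b = 0" using f(3)[of b] g(3)[of b] by auto
    then show ?thesis using B(3)[OF b] by simp
  qed
  then have "h x = 0" if "x \<in> span B" for x using linear_eq_on[OF hl linear_zero that] by simp
  then show "f = g" using B(4) by (auto simp: h_def fun_eq_iff)
qed


section \<open>Positive definite matrices, their inverses and inverse square roots\<close>

lemma inner_matrix_vector: "x \<bullet> (A *v y) = (transpose A *v x) \<bullet> (y :: real ^ 'n)" for A :: "real ^ 'n ^ 'm"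
  by (simp add: dot_lmul_matrix)

lemma matrix_inv_right: "invertible A \<Longrightarrow> A ** matrix_inv A = mat 1"
  and matrix_inv_left: "invertible A \<Longrightarrow> matrix_inv A ** A = mat 1"
  unfolding invertible_def matrix_inv_def by (metis (mono_tags, lifting) someI_ex)+

definition pos_def :: "real ^ 'k ^ 'k \<Rightarrow> bool" where
  "pos_def A \<longleftrightarrow> transpose A = A \<and> (\<forall>x. x \<noteq> 0 \<longrightarrow> 0 < x \<bullet> (A *v x))"

lemma symmetric_inner: "transpose A = A \<Longrightarrow> (A *v x) \<bullet> y = x \<bullet> (A *v y)" for A :: "real ^ 'k ^ 'k"
  by (metis inner_matrix_vector)

lemma matrix_transpose_eqI:
  fixes A :: "real ^ 'k ^ 'k"
  assumes "\<And>x y. (A *v x) \<bullet> y = x \<bullet> (A *v y)"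
  shows "transpose A = A"
proof -
  have "transpose A *v x = A *v x" for x
    by (rule vector_eq_rdot[THEN iffD1]) (metis assms inner_matrix_vector)
  then show ?thesis by (simp add: matrix_eq)
qed

lemma pos_def_nonneg: "pos_def A \<Longrightarrow> 0 \<le> x \<bullet> (A *v x)"
  unfolding pos_def_def by (cases "x = 0") (auto intro: less_imp_le)

lemma pos_def_invertible: "pos_def A \<Longrightarrow> invertible A"
  unfolding pos_def_def invertible_left_inverse matrix_left_invertible_ker
  by (metis inner_zero_right less_irrefl)

lemma pos_def_matrix_inv:
  assumes A: "pos_def A"
  shows "pos_def (matrix_inv A)"
proof -
  note inv = matrix_inv_right[OF pos_def_invertible[OF A]] matrix_inv_left[OF pos_def_invertible[OF A]]
  have AA: "A *v (matrix_inv A *v x) = x" "matrix_inv A *v (A *v x) = x" for x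
    by (simp_all add: matrix_vector_mul_assoc inv)
  have sym: "(A *v x) \<bullet> y = x \<bullet> (A *v y)" for x y using A by (simp add: pos_def_def symmetric_inner)
  show ?thesis unfolding pos_def_def
  proof (intro conjI allI impI)
    show "transpose (matrix_inv A) = matrix_inv A"
      by (rule matrix_transpose_eqI) (metis AA(1) sym)
    show "0 < x \<bullet> (matrix_inv A *v x)" if "x \<noteq> 0" for x
    proof -
      have "matrix_inv A *v x \<noteq> 0" using that AA(1)[of x] by auto
      then have "0 < (matrix_inv A *v x) \<bullet> (A *v (matrix_inv A *v x))" using A by (simp add: pos_def_def)
      then show ?thesis by (simp add: AA inner_commute)
    qed
  qed
qed

text \<open>\<open>inv_sqrt\<close> is a definite description, so its properties require existence
  and uniqueness of the root. The semidefinite root g of the inverse is in fact definite: a zero of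
  its form is a zero of g, hence of the invertible \<open>matrix_inv A\<close>.\<close>

lemma inv_sqrt:
  assumes A: "pos_def (A :: real ^ 'k ^ 'k)"
  shows pos_def_inv_sqrt: "pos_def (inv_sqrt A)" and inv_sqrt_square: "inv_sqrt A ** inv_sqrt A = matrix_inv A"
proof -
  let ?f = "(*v) (matrix_inv A)"
  have pd: "pos_def (matrix_inv A)" using A by (rule pos_def_matrix_inv)
  then have sym: "?f x \<bullet> y = x \<bullet> ?f y" for x y by (simp add: pos_def_def symmetric_inner)
  obtain g where g: "linear g" "\<And>x y. g x \<bullet> y = x \<bullet> g y" "\<And>x. 0 \<le> x \<bullet> g x" "\<And>x. g (g x) = ?f x"
    using psd_sqrt_exists[of ?f, OF _ sym pos_def_nonneg[OF pd]] by auto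
  have gR: "matrix g *v x = g x" for x by (simp add: g(1) matrix_works)
  have gpos: "0 < x \<bullet> g x" if "x \<noteq> 0" for x
  proof -
    have "x \<bullet> g x \<noteq> 0"
    proof
      assume z: "x \<bullet> g x = 0"
      \<comment> \<open>Cauchy--Schwarz for the semidefinite form of \<open>g\<close>, applied to \<open>x\<close> and \<open>g x\<close>\<close>
      define a b where "a = g x \<bullet> g x" and "b = g x \<bullet> g (g x)"
      have "0 \<le> (x - t *\<^sub>R g x) \<bullet> g (x - t *\<^sub>R g x)" for t by (rule g(3))
      then have q: "0 \<le> t\<^sup>2 * b - 2 * t * a" for t
        using z by (simp add: linear_diff[OF g(1)] linear_scale[OF g(1)] inner_diff_left inner_diff_right g(2)[symmetric]
            a_def b_def power2_eq_square algebra_simps)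
      have "b \<ge> 0" unfolding b_def by (rule g(3))
      have "a = 0"
      proof (rule ccontr)
        assume "a \<noteq> 0"
        then have a: "a > 0" by (simp add: a_def)
        have "2 * t * a \<le> t\<^sup>2 * b" for t using q[of t] by simp
        \<comment> \<open>The best t would be a/b; the added 1 covers the case b = 0.\<close>
        from this[of "a / (b + 1)"] have "2 * (a / (b + 1)) * a \<le> (a / (b + 1))\<^sup>2 * b" .
        also have "\<dots> = (a / (b+1)) * a * (b / (b+1))" by (simp add: power2_eq_square)
        also have "\<dots> \<le> (a / (b+1)) * a * 1" using a \<open>b \<ge> 0\<close> by (intro mult_left_mono) auto
        finally have "2 * ((a / (b + 1)) * a) \<le> (a / (b + 1)) * a" by simp
        moreover have "0 < (a / (b + 1)) * a" using a \<open>b \<ge> 0\<close> by simp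
        ultimately show False by linarith
      qed
      then have "g x = 0" by (simp add: a_def)
      then have "?f x = 0" using g(4)[of x] linear_0[OF g(1)] by simp
      then show False using that pd by (metis pos_def_def inner_zero_right less_irrefl)
    qed
    then show ?thesis using g(3)[of x] by simp
  qed
  let ?P = "\<lambda>R. transpose R = R \<and> (\<forall>x. x \<noteq> 0 \<longrightarrow> x \<bullet> (R *v x) > 0) \<and> R ** R = matrix_inv A"
  have "?P (matrix g)"
  proof (intro conjI allI impI)
    show "transpose (matrix g) = matrix g" by (rule matrix_transpose_eqI) (simp add: gR g(2))
    show "x \<bullet> (matrix g *v x) > 0" if "x \<noteq> 0" for x using gpos[OF that] by (simp add: gR)
    show "matrix g ** matrix g = matrix_inv A" by (simp add: matrix_eq matrix_vector_mul_assoc[symmetric] gR g(4))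
  qed
  moreover have "R = matrix g" if R: "?P R" for R
  proof -
    have "(*v) R = g"
    proof (rule pd_sqrt_unique)
      show "(R *v x) \<bullet> y = x \<bullet> (R *v y)" for x y using R by (simp add: symmetric_inner)
      show "0 < x \<bullet> (R *v x)" if "x \<noteq> 0" for x using R that by blast
      show "R *v (R *v x) = g (g x)" for x using R by (simp add: g(4) matrix_vector_mul_assoc)
    qed (use g gpos in auto)
    then show ?thesis by (metis matrix_eq gR)
  qed
  ultimately have "?P (inv_sqrt A)" unfolding inv_sqrt_def by (rule theI)
  then show "pos_def (inv_sqrt A)" "inv_sqrt A ** inv_sqrt A = matrix_inv A" by (auto simp: pos_def_def)
qed

lemma norm_inv_sqrt_square:
  assumes "pos_def A"
  shows "(norm (inv_sqrt A *v x))\<^sup>2 = x \<bullet> (matrix_inv A *v x)"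
proof -
  have "(norm (inv_sqrt A *v x))\<^sup>2 = x \<bullet> (inv_sqrt A *v (inv_sqrt A *v x))"
    using pos_def_inv_sqrt[OF assms] unfolding power2_norm_eq_inner by (simp add: pos_def_def symmetric_inner)
  then show ?thesis by (simp add: matrix_vector_mul_assoc inv_sqrt_square[OF assms])
qed

text \<open>\<open>Min\<close> is informative only for a finite nonempty set. Every eigenvalue
  occurs among those of an eigenbasis, which gives finiteness, and the minimum of the Rayleigh
  quotient is itself an eigenvalue, hence at least \<open>lambda_min A\<close>.\<close>

lemma lambda_min_le:
  fixes A :: "real ^ 'k ^ 'k"
  assumes A: "transpose A = A"
  shows "lambda_min A * (norm x)\<^sup>2 \<le> x \<bullet> (A *v x)"
proof -
  have sym: "(A *v x) \<bullet> y = x \<bullet> (A *v y)" for x y using A by (rule symmetric_inner)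
  obtain B l where B: "finite B" "pairwise orthogonal B" "\<And>b. b \<in> B \<Longrightarrow> norm b = 1"
    "\<And>b. b \<in> B \<Longrightarrow> A *v b = l b *\<^sub>R b" "span B = UNIV"
    using selfadjoint_eigenbasis[of "(*v) A", OF _ sym] by auto
  have "eigenvals A \<subseteq> l ` B"
  proof
    fix c assume "c \<in> eigenvals A"
    then obtain v where v: "v \<noteq> 0" "A *v v = c *\<^sub>R v" by (auto simp: eigenvals_def)
    obtain b where b: "b \<in> B" "v \<bullet> b \<noteq> 0"
    proof (rule ccontr)
      assume "\<not> thesis"
      then have "\<And>b. b \<in> B \<Longrightarrow> orthogonal v b" using that by (auto simp: orthogonal_def)
      then have "orthogonal v v" using orthogonal_to_span[of v B v] B(5) by (auto simp: orthogonal_commute)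
      then show False using v by (simp add: orthogonal_def)
    qed
    have "c * (v \<bullet> b) = l b * (v \<bullet> b)" using sym[of v b] v(2) B(4)[OF b(1)] by simp
    then show "c \<in> l ` B" using b by auto
  qed
  then have fin: "finite (eigenvals A)" using B(1) finite_surj by blast
  have ne: "(UNIV :: (real ^ 'k) set) \<noteq> {0}" by (metis UNIV_I empty_iff insert_iff axis_eq_0_iff zero_neq_one)
  obtain v \<mu> where v: "norm v = 1" "A *v v = \<mu> *\<^sub>R v" "\<And>x. \<mu> * (norm x)\<^sup>2 \<le> x \<bullet> (A *v x)"
    using selfadjoint_eigenvector[of "(*v) A" UNIV, OF _ sym _ _ ne] by auto
  have "\<mu> \<in> eigenvals A" using v(1,2) unfolding eigenvals_def by (intro CollectI exI[of _ v]) auto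
  then have "lambda_min A \<le> \<mu>" unfolding lambda_min_def using fin by simp
  then have "lambda_min A * (norm x)\<^sup>2 \<le> \<mu> * (norm x)\<^sup>2" by (intro mult_right_mono) auto
  then show ?thesis using v(3)[of x] by linarith
qed

subsection \<open>Weak convergence and characteristic functions\<close>

definition std_gauss :: "'a::euclidean_space measure" where
  "std_gauss = density lborel (\<lambda>x. ennreal (\<Prod>b\<in>Basis. std_normal_density (x \<bullet> b)))"

lemma sets_std_gauss [simp, measurable_cong]: "sets std_gauss = sets borel"
  by (simp add: std_gauss_def)

lemma space_std_gauss [simp]: "space std_gauss = UNIV"
  by (simp add: std_gauss_def)

lemma prob_space_std_gauss: "prob_space (std_gauss :: 'a::euclidean_space measure)"
proof
  have 1: "(\<integral>\<^sup>+x. ennreal (std_normal_density x) \<partial>lborel) = 1"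
    by (subst nn_integral_eq_integral) auto
  have "emeasure (std_gauss :: 'a measure) (space std_gauss) =
      (\<integral>\<^sup>+x. (\<Prod>b\<in>Basis. ennreal (std_normal_density (x \<bullet> b))) \<partial>(lborel :: 'a measure))"
    by (simp add: std_gauss_def emeasure_density prod_ennreal)
  also have "\<dots> = (\<Prod>b\<in>(Basis::'a set). (\<integral>\<^sup>+x. ennreal (std_normal_density x) \<partial>lborel))"
    by (intro nn_integral_lborel_prod) auto
  finally show "emeasure (std_gauss :: 'a measure) (space std_gauss) = 1" by (simp add: 1)
qed

lemma std_gauss_density_eq:
  "(\<Prod>b\<in>Basis. std_normal_density (x \<bullet> b)) = (1 / sqrt (2 * pi)) ^ DIM('a) * exp (- (norm x)\<^sup>2 / 2)"
  for x :: "'a::euclidean_space"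
proof -
  have "(norm x)\<^sup>2 = (\<Sum>b\<in>Basis. (x \<bullet> b)\<^sup>2)"
    unfolding power2_norm_eq_inner by (subst euclidean_inner) (simp add: power2_eq_square)
  then have "exp (- (norm x)\<^sup>2 / 2) = (\<Prod>b\<in>Basis. exp (- (x \<bullet> b)\<^sup>2 / 2))"
    by (simp add: exp_sum[symmetric] sum_negf sum_divide_distrib)
  then show ?thesis
    unfolding std_normal_density_def prod.distrib by simp
qed

text \<open>The density and the exponential both factor over the basis, which leaves a product of
  one-dimensional characteristic functions.\<close>

lemma std_gauss_char:
  "(\<integral>x. iexp (u \<bullet> x) \<partial>std_gauss) = of_real (exp (- (norm u)\<^sup>2 / 2))" for u :: "'a::euclidean_space"
proof -
  interpret product_sigma_finite "\<lambda>_::'a. lborel :: real measure" by standard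
  have one: "integrable lborel (\<lambda>x. std_normal_density x *\<^sub>R iexp (t * x))"
    "(\<integral>x. std_normal_density x *\<^sub>R iexp (t * x) \<partial>lborel) = of_real (exp (- t\<^sup>2 / 2))" for t
  proof -
    interpret S: real_distribution std_normal_distribution by (rule real_dist_normal_dist)
    have "integrable std_normal_distribution (\<lambda>x. iexp (t * x))"
      by (rule S.integrable_iexp) auto
    then show "integrable lborel (\<lambda>x. std_normal_density x *\<^sub>R iexp (t * x))"
      by (subst (asm) integrable_density) auto
    show "(\<integral>x. std_normal_density x *\<^sub>R iexp (t * x) \<partial>lborel) = of_real (exp (- t\<^sup>2 / 2))"
      using fun_cong[OF char_std_normal_distribution, of t] unfolding char_def
      by (subst (asm) integral_density) auto
  qed
  have "(\<integral>x. iexp (u \<bullet> x) \<partial>std_gauss) =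
      (\<integral>x. (\<Prod>b\<in>Basis. std_normal_density (x \<bullet> b)) *\<^sub>R iexp (u \<bullet> x) \<partial>lborel)"
    unfolding std_gauss_def by (subst integral_density) (auto intro!: prod_nonneg)
  also have "\<dots> = (\<integral>x. (\<Prod>b\<in>Basis. std_normal_density (x \<bullet> b) *\<^sub>R iexp ((u \<bullet> b) * (x \<bullet> b))) \<partial>lborel)"
  proof (rule Bochner_Integration.integral_cong)
    fix x :: 'a
    have "\<i> * complex_of_real (u \<bullet> x) = (\<Sum>b\<in>Basis. \<i> * of_real ((u \<bullet> b) * (x \<bullet> b)))"
      by (subst euclidean_inner) (simp add: sum_distrib_left)
    then have "iexp (u \<bullet> x) = (\<Prod>b\<in>Basis. iexp ((u \<bullet> b) * (x \<bullet> b)))"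
      by (simp add: exp_sum)
    then show "(\<Prod>b\<in>Basis. std_normal_density (x \<bullet> b)) *\<^sub>R iexp (u \<bullet> x) =
       (\<Prod>b\<in>Basis. std_normal_density (x \<bullet> b) *\<^sub>R iexp ((u \<bullet> b) * (x \<bullet> b)))"
      by (simp add: scaleR_conv_of_real prod.distrib of_real_prod)
  qed simp
  also have "\<dots> = (\<integral>x. (\<Prod>b\<in>Basis. std_normal_density (x b) *\<^sub>R iexp ((u \<bullet> b) * x b)) \<partial>(\<Pi>\<^sub>M b\<in>(Basis::'a set). lborel))"
    by (subst lborel_eq, subst integral_distr) (auto cong: prod.cong)
  also have "\<dots> = (\<Prod>b\<in>Basis. \<integral>x. std_normal_density x *\<^sub>R iexp ((u \<bullet> b) * x) \<partial>lborel)"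
    by (rule product_integral_prod) (use one in auto)
  also have "\<dots> = of_real (\<Prod>b\<in>Basis. exp (- (u \<bullet> b)\<^sup>2 / 2))"
    by (simp only: one of_real_prod)
  also have "(\<Prod>b\<in>Basis. exp (- (u \<bullet> b)\<^sup>2 / 2)) = exp (- (norm u)\<^sup>2 / 2)"
    unfolding power2_norm_eq_inner by (subst (2) euclidean_inner) (simp add: exp_sum[symmetric] sum_negf sum_divide_distrib power2_eq_square)
  finally show ?thesis .
qed

text \<open>A Gaussian bump is the characteristic function of \<open>std_gauss\<close> at
  \<open>s *\<^sub>R (x - c)\<close>, so Fubini turns its mean under N into an average of the
  characteristic function of N over Gaussian frequencies.\<close>

lemma gauss_bump_eq:
  assumes N: "prob_space N" "sets N = sets (borel :: 'a::euclidean_space measure)"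
  shows "of_real (\<integral>x. exp (- (norm (s *\<^sub>R (x - c)))\<^sup>2 / 2) \<partial>N) =
    (\<integral>z. iexp (- (s *\<^sub>R c) \<bullet> z) * (\<integral>x. iexp ((s *\<^sub>R z) \<bullet> x) \<partial>N) \<partial>std_gauss)"
proof -
  interpret N: prob_space N by fact
  interpret G: prob_space "std_gauss :: 'a measure" by (rule prob_space_std_gauss)
  interpret P: pair_prob_space "std_gauss :: 'a measure" N by standard
  have [measurable_cong]: "sets N = sets borel" by fact
  have "of_real (\<integral>x. exp (- (norm (s *\<^sub>R (x - c)))\<^sup>2 / 2) \<partial>N) =
      (\<integral>x. complex_of_real (exp (- (norm (s *\<^sub>R (x - c)))\<^sup>2 / 2)) \<partial>N)" by simp
  also have "\<dots> = (\<integral>x. (\<integral>z. iexp ((s *\<^sub>R (x - c)) \<bullet> z) \<partial>std_gauss) \<partial>N)"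
    by (simp only: std_gauss_char)
  also have "\<dots> = (\<integral>z. (\<integral>x. iexp ((s *\<^sub>R (x - c)) \<bullet> z) \<partial>N) \<partial>std_gauss)"
    by (rule P.Fubini_integral) (auto intro!: P.integrable_const_bound[where B=1] simp: split_beta)
  also have "\<dots> = (\<integral>z. (\<integral>x. iexp (- (s *\<^sub>R c) \<bullet> z) * iexp ((s *\<^sub>R z) \<bullet> x) \<partial>N) \<partial>std_gauss)"
    by (simp add: exp_add[symmetric] inner_diff_left inner_diff_right inner_commute algebra_simps)
  finally show ?thesis by simp
qed

lemma gauss_bump_tendsto:
  assumes N: "\<And>m. prob_space (N m)" "\<And>m. sets (N m) = sets (borel :: 'a::euclidean_space measure)"
    and L: "prob_space L" "sets L = sets (borel :: 'a measure)"
    and conv: "\<And>u. (\<lambda>m. \<integral>x. iexp (u \<bullet> x) \<partial>N m) \<longlonglongrightarrow> (\<integral>x. iexp (u \<bullet> x) \<partial>L)"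
  shows "(\<lambda>m. \<integral>x. exp (- (norm (s *\<^sub>R (x - c)))\<^sup>2 / 2) \<partial>N m) \<longlonglongrightarrow> (\<integral>x. exp (- (norm (s *\<^sub>R (x - c)))\<^sup>2 / 2) \<partial>L)"
proof -
  interpret G: prob_space "std_gauss :: 'a measure" by (rule prob_space_std_gauss)
  have meas: "(\<lambda>z. iexp (- (s *\<^sub>R c) \<bullet> z) * (\<integral>x. iexp ((s *\<^sub>R z) \<bullet> x) \<partial>N)) \<in> borel_measurable std_gauss"
    if "prob_space N" "sets N = sets borel" for N :: "'a measure"
  proof -
    interpret N: prob_space N by fact
    have [measurable_cong]: "sets N = sets borel" by fact
    show ?thesis by measurable
  qed
  have bd: "norm (iexp (- (s *\<^sub>R c) \<bullet> z) * (\<integral>x. iexp ((s *\<^sub>R z) \<bullet> x) \<partial>N)) \<le> 1"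
    if "prob_space N" "sets N = sets borel" for N :: "'a measure" and z
  proof -
    interpret N: prob_space N by fact
    have "norm (\<integral>x. iexp ((s *\<^sub>R z) \<bullet> x) \<partial>N) \<le> (\<integral>x. norm (iexp ((s *\<^sub>R z) \<bullet> x)) \<partial>N)"
      by (rule integral_norm_bound)
    also have "\<dots> = 1" by (simp add: N.prob_space del: of_real_mult)
    finally show ?thesis by (simp add: norm_mult del: of_real_mult)
  qed
  have "(\<lambda>m. of_real (\<integral>x. exp (- (norm (s *\<^sub>R (x - c)))\<^sup>2 / 2) \<partial>N m) :: complex) \<longlonglongrightarrow>
      of_real (\<integral>x. exp (- (norm (s *\<^sub>R (x - c)))\<^sup>2 / 2) \<partial>L)"
    unfolding gauss_bump_eq[OF N] gauss_bump_eq[OF L]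
  proof (rule integral_dominated_convergence[where w="\<lambda>_. 1"])
    show "AE z in std_gauss. (\<lambda>m. iexp (- (s *\<^sub>R c) \<bullet> z) * (\<integral>x. iexp ((s *\<^sub>R z) \<bullet> x) \<partial>N m))
        \<longlonglongrightarrow> iexp (- (s *\<^sub>R c) \<bullet> z) * (\<integral>x. iexp ((s *\<^sub>R z) \<bullet> x) \<partial>L)"
      by (intro AE_I2 tendsto_mult_left conv)
  qed (use meas[OF L] meas[OF N] bd[OF N] in auto)
  then show ?thesis by (simp only: tendsto_of_real_iff)
qed

lemma compact_support_uniformly_continuous:
  fixes f :: "'a::euclidean_space \<Rightarrow> real"
  assumes f: "continuous_on UNIV f" and R: "\<And>x. norm x > R \<Longrightarrow> f x = 0"
  shows "uniformly_continuous_on UNIV f" "\<exists>B. \<forall>x. \<bar>f x\<bar> \<le> B"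
proof -
  \<comment> \<open>The margin 1 ensures that two points at distance below 1 either both lie in this
    ball or both lie outside the support.\<close>
  have uc: "uniformly_continuous_on (cball 0 (R + 1)) f"
    by (rule compact_uniformly_continuous) (auto intro: continuous_on_subset[OF f])
  show "uniformly_continuous_on UNIV f"
    unfolding uniformly_continuous_on_def
  proof (intro allI impI)
    fix e :: real assume "e > 0"
    with uc obtain d where d: "d > 0" "\<And>x y. \<lbrakk>norm x \<le> R + 1; norm y \<le> R + 1; dist y x < d\<rbrakk> \<Longrightarrow> dist (f y) (f x) < e"
      unfolding uniformly_continuous_on_def by (auto simp: dist_norm)
    show "\<exists>d>0. \<forall>x\<in>UNIV. \<forall>x'\<in>UNIV. dist x' x < d \<longrightarrow> dist (f x') (f x) < e"
    proof (intro exI[of _ "min d 1"] conjI ballI impI)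
      fix x y :: 'a assume xy: "dist y x < min d 1"
      show "dist (f y) (f x) < e"
      proof (cases "norm x \<le> R + 1 \<and> norm y \<le> R + 1")
        case True then show ?thesis using d xy by auto
      next
        case False
        have "\<bar>norm y - norm x\<bar> \<le> dist y x" by (simp add: dist_norm norm_triangle_ineq3)
        with False xy have "norm x > R" "norm y > R" by auto
        then show ?thesis using R \<open>e > 0\<close> by simp
      qed
    qed (use d in auto)
  qed
  have "bounded (f ` cball 0 R)"
    by (intro compact_imp_bounded compact_continuous_image continuous_on_subset[OF f]) auto
  then obtain B where "\<forall>x\<in>cball 0 R. \<bar>f x\<bar> \<le> B" by (auto simp: bounded_iff)
  then have B: "\<And>x. norm x \<le> R \<Longrightarrow> \<bar>f x\<bar> \<le> B" by auto
  have "\<bar>f x\<bar> \<le> max B 0" for x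
    using B[of x] R[of x] by (cases "norm x \<le> R") auto
  then show "\<exists>B. \<forall>x. \<bar>f x\<bar> \<le> B" by blast
qed

text \<open>Exchanging the integrals moves all dependence on N into the means of Gaussian bumps,
  whose limits are known. The remaining weight f is integrable because it is continuous with compact
  support.\<close>

lemma gauss_smoothing_eq:
  fixes f :: "'a::euclidean_space \<Rightarrow> real"
  assumes f: "continuous_on UNIV f" and R: "\<forall>x. norm x > R \<longrightarrow> f x = 0" and s: "s > 0"
    and N: "prob_space N" "sets N = sets (borel :: 'a measure)"
  shows "(\<integral>x. (\<integral>z. f (x + (1/s) *\<^sub>R z) \<partial>std_gauss) \<partial>N) =
    s ^ DIM('a) * (1 / sqrt (2 * pi)) ^ DIM('a) *
      (\<integral>c. f c * (\<integral>x. exp (- (norm (s *\<^sub>R (x - c)))\<^sup>2 / 2) \<partial>N) \<partial>lborel)"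
    and "integrable lborel f"
proof -
  interpret N: prob_space N by fact
  have [measurable_cong]: "sets N = sets borel" by fact
  have [measurable]: "f \<in> borel_measurable borel" using f by (rule borel_measurable_continuous_onI)
  have "integrable lborel (\<lambda>x. indicator (cball 0 R) x *\<^sub>R f x)"
    by (rule borel_integrable_compact) (auto intro: continuous_on_subset[OF f])
  moreover have "(\<lambda>x. indicator (cball 0 R) x *\<^sub>R f x) = f" using R by (auto simp: fun_eq_iff indicator_def not_le)
  ultimately show int: "integrable lborel f" by simp
  let ?K = "s ^ DIM('a) * (1 / sqrt (2 * pi)) ^ DIM('a)"
  let ?g = "\<lambda>x c. exp (- (norm (s *\<^sub>R (x - c)))\<^sup>2 / 2)"
  have inner: "(\<integral>z. f (x + (1/s) *\<^sub>R z) \<partial>std_gauss) = ?K * (\<integral>c. f c * ?g x c \<partial>lborel)" for x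
  proof -
    have "(\<integral>z. f (x + (1/s) *\<^sub>R z) \<partial>std_gauss) =
        (\<integral>z. (1 / sqrt (2 * pi)) ^ DIM('a) * exp (- (norm z)\<^sup>2 / 2) * f (x + (1/s) *\<^sub>R z) \<partial>lborel)"
      unfolding std_gauss_def by (subst integral_density) (auto intro!: prod_nonneg simp: std_gauss_density_eq)
    \<comment> \<open>Substitution z = s (c - x); its Jacobian is the factor s to the power of the
      dimension.\<close>
    also have "\<dots> = (\<integral>z. (1 / sqrt (2 * pi)) ^ DIM('a) * exp (- (norm z)\<^sup>2 / 2) * f (x + (1/s) *\<^sub>R z)
        \<partial>density (distr lborel borel (\<lambda>c. - s *\<^sub>R x + s *\<^sub>R c)) (\<lambda>_. \<bar>s\<bar> ^ DIM('a)))"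
      using lborel_affine[of s "- s *\<^sub>R x"] s by simp
    also have "\<dots> = (\<integral>c. \<bar>s\<bar> ^ DIM('a) *\<^sub>R ((1 / sqrt (2 * pi)) ^ DIM('a) * exp (- (norm (- s *\<^sub>R x + s *\<^sub>R c))\<^sup>2 / 2)
          * f (x + (1/s) *\<^sub>R (- s *\<^sub>R x + s *\<^sub>R c))) \<partial>lborel)"
      using s by (subst integral_density) (auto simp: integral_distr)
    also have "\<dots> = (\<integral>c. ?K * (f c * ?g x c) \<partial>lborel)"
    proof (rule Bochner_Integration.integral_cong)
      fix c
      have "norm (- s *\<^sub>R x + s *\<^sub>R c) = norm (s *\<^sub>R (x - c))"
        by (metis (no_types, opaque_lifting) norm_minus_commute scaleR_right_diff_distrib add.commute diff_conv_add_uminus scaleR_minus_left)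
      moreover have "x + (1/s) *\<^sub>R (- s *\<^sub>R x + s *\<^sub>R c) = c" using s by (simp add: scaleR_diff_right)
      ultimately show "\<bar>s\<bar> ^ DIM('a) *\<^sub>R ((1 / sqrt (2 * pi)) ^ DIM('a) * exp (- (norm (- s *\<^sub>R x + s *\<^sub>R c))\<^sup>2 / 2)
          * f (x + (1/s) *\<^sub>R (- s *\<^sub>R x + s *\<^sub>R c))) = ?K * (f c * ?g x c)" using s by simp
    qed simp
    finally show ?thesis by simp
  qed
  interpret P: pair_sigma_finite N "lborel :: 'a measure" by standard
  have "integrable (N \<Otimes>\<^sub>M lborel) (\<lambda>(x, c). f c)"
    using int by (intro P.Fubini_integrable) (auto simp: N.prob_space)
  then have "integrable (N \<Otimes>\<^sub>M lborel) (\<lambda>(x, c). f c * ?g x c)"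
    by (rule Bochner_Integration.integrable_bound) (auto simp: split_beta abs_mult mult_left_le)
  then have "(\<integral>c. (\<integral>x. f c * ?g x c \<partial>N) \<partial>lborel) = (\<integral>x. (\<integral>c. f c * ?g x c \<partial>lborel) \<partial>N)"
    by (rule P.Fubini_integral)
  then show "(\<integral>x. (\<integral>z. f (x + (1/s) *\<^sub>R z) \<partial>std_gauss) \<partial>N) = ?K * (\<integral>c. f c * (\<integral>x. ?g x c \<partial>N) \<partial>lborel)"
    by (simp add: inner)
qed

lemma abs_integral_le:
  fixes f g :: "_ \<Rightarrow> real"
  assumes "integrable M f" "integrable M g" "\<And>x. x \<in> space M \<Longrightarrow> \<bar>f x\<bar> \<le> g x"
  shows "\<bar>\<integral>x. f x \<partial>M\<bar> \<le> (\<integral>x. g x \<partial>M)"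
  by (rule order_trans[OF integral_abs_bound integral_mono]) (use assms in auto)

text \<open>No mass escapes: L is a probability measure, so a continuous cutoff of large radius has
  mean near 1 under L, and by the assumed convergence also under \<open>N m\<close> for large m.
  Bounded test functions may therefore be truncated.\<close>

lemma conv_in_law_compact_support:
  fixes N :: "nat \<Rightarrow> 'a::euclidean_space measure"
  assumes N: "\<And>m. prob_space (N m)" "\<And>m. sets (N m) = sets borel"
    and L: "prob_space L" "sets L = sets borel"
    and conv: "\<And>f :: 'a \<Rightarrow> real. continuous_on UNIV f \<Longrightarrow> (\<exists>R. \<forall>x. norm x > R \<longrightarrow> f x = 0) \<Longrightarrow>
      (\<lambda>m. \<integral>x. f x \<partial>N m) \<longlonglongrightarrow> (\<integral>x. f x \<partial>L)"
  shows "conv_in_law N L"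
  unfolding conv_in_law_def
proof (intro allI impI, elim conjE)
  fix f :: "'a \<Rightarrow> real"
  assume f: "continuous_on UNIV f" and "bounded (range f)"
  then obtain B0 where B0: "\<And>x. \<bar>f x\<bar> \<le> B0" by (auto simp: bounded_iff)
  define B where "B = max B0 1"
  have B: "\<bar>f x\<bar> \<le> B" "B > 0" for x using B0[of x] by (auto simp: B_def)
  interpret L: prob_space L by fact
  have [measurable_cong]: "sets L = sets borel" "\<And>m. sets (N m) = sets borel" by fact+
  have [measurable]: "f \<in> borel_measurable borel" using f by (rule borel_measurable_continuous_onI)
  have spL: "space L = UNIV" using L(2) sets_eq_imp_space_eq by fastforce
  define cut where "cut R x = max 0 (min 1 (R + 1 - norm x))" for R and x :: 'a
  have cutc: "continuous_on UNIV (cut R)" for R unfolding cut_def by (intro continuous_intros)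
  then have [measurable]: "cut R \<in> borel_measurable borel" for R by (rule borel_measurable_continuous_onI)
  have cut01: "0 \<le> cut R x" "cut R x \<le> 1" for R x by (auto simp: cut_def)
  have cuts: "\<exists>R'. \<forall>x. norm x > R' \<longrightarrow> cut R x = 0" for R by (intro exI[of _ "R + 1"]) (auto simp: cut_def)
  have fcuts: "\<exists>R'. \<forall>x. norm x > R' \<longrightarrow> f x * cut R x = 0" for R using cuts[of R] by fastforce
  have fcut: "(\<lambda>m. \<integral>x. f x * cut R x \<partial>N m) \<longlonglongrightarrow> (\<integral>x. f x * cut R x \<partial>L)" for R
    using fcuts by (intro conv continuous_intros f cutc) auto
  have split: "\<bar>(\<integral>x. f x \<partial>M) - (\<integral>x. f x * cut R x \<partial>M)\<bar> \<le> B * (1 - (\<integral>x. cut R x \<partial>M))"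
    if M: "prob_space M" "sets M = sets borel" for M R
  proof -
    interpret M: prob_space M by fact
    have [measurable_cong]: "sets M = sets borel" by fact
    have i1: "integrable M f" by (rule M.integrable_const_bound[where B=B]) (use B in auto)
    have i2: "integrable M (cut R)" by (rule M.integrable_const_bound[where B=1]) (use cut01 in auto)
    have i3: "integrable M (\<lambda>x. f x * cut R x)"
      using i1 by (rule Bochner_Integration.integrable_bound) (use cut01 in \<open>auto simp: abs_mult intro!: mult_left_le\<close>)
    have "(\<integral>x. f x \<partial>M) - (\<integral>x. f x * cut R x \<partial>M) = (\<integral>x. f x * (1 - cut R x) \<partial>M)"
      using i1 i3 by (simp add: right_diff_distrib)
    also have "\<bar>\<dots>\<bar> \<le> (\<integral>x. B * (1 - cut R x) \<partial>M)"
    proof (rule abs_integral_le)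
      show "integrable M (\<lambda>x. f x * (1 - cut R x))" using i1 i3 by (simp add: right_diff_distrib)
      show "integrable M (\<lambda>x. B * (1 - cut R x))" using i2 by simp
      show "\<bar>f x * (1 - cut R x)\<bar> \<le> B * (1 - cut R x)" for x
        using mult_right_mono[OF B(1)[of x], of "1 - cut R x"] cut01[of R x] by (simp add: abs_mult)
    qed
    also have "\<dots> = B * (1 - (\<integral>x. cut R x \<partial>M))" using i2 by (simp add: M.prob_space)
    finally show ?thesis .
  qed
  show "(\<lambda>m. \<integral>x. f x \<partial>N m) \<longlonglongrightarrow> (\<integral>x. f x \<partial>L)"
  proof (rule LIMSEQ_I)
    fix e :: real assume e: "e > 0"
    have "(\<lambda>n. \<integral>x. cut (real n) x \<partial>L) \<longlonglongrightarrow> (\<integral>x. 1 \<partial>L)"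
    proof (rule integral_dominated_convergence[where w="\<lambda>_. 1"])
      show "AE x in L. (\<lambda>n. cut (real n) x) \<longlonglongrightarrow> 1"
      proof (intro AE_I2 tendsto_eventually)
        fix x
        show "\<forall>\<^sub>F n in sequentially. cut (real n) x = 1"
          using eventually_ge_at_top[of "nat \<lceil>norm x\<rceil>"] 
          by eventually_elim (auto simp: cut_def nat_le_iff ceiling_le_iff)
      qed
    qed (use cut01 in auto)
    then have "(\<lambda>n. \<integral>x. cut (real n) x \<partial>L) \<longlonglongrightarrow> 1" by (simp add: L.prob_space)
    \<comment> \<open>The two truncation errors cost e/8 each and the truncated means differ by less
      than e/2.\<close>
    from order_tendstoD(1)[OF this, of "1 - e / (8 * B)"] obtain n where
      n: "1 - e / (8 * B) < (\<integral>x. cut (real n) x \<partial>L)" using e B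
      by (auto simp: eventually_sequentially)
    define R where "R = real n"
    have "\<forall>\<^sub>F m in sequentially. (\<integral>x. cut R x \<partial>N m) > 1 - e / (8 * B)"
      using conv[OF cutc cuts, of R] n unfolding R_def by (rule order_tendstoD)
    moreover have "\<forall>\<^sub>F m in sequentially. dist (\<integral>x. f x * cut R x \<partial>N m) (\<integral>x. f x * cut R x \<partial>L) < e/2"
      using fcut e by (intro tendstoD) auto
    ultimately have "\<forall>\<^sub>F m in sequentially. norm ((\<integral>x. f x \<partial>N m) - (\<integral>x. f x \<partial>L)) < e"
    proof eventually_elim
      case (elim m)
      have "B * (1 - (\<integral>x. cut R x \<partial>N m)) \<le> e / 8" using elim(1) B(2) by (simp add: field_simps)
      moreover have "B * (1 - (\<integral>x. cut R x \<partial>L)) \<le> e / 8" using n B(2) by (simp add: field_simps R_def)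
      ultimately show ?case
        using split[OF N, of m R] split[OF L, of R] elim(2) e by (simp add: dist_real_def abs_if split: if_splits)
    qed
    then show "\<exists>no. \<forall>m\<ge>no. norm ((\<integral>x. f x \<partial>N m) - (\<integral>x. f x \<partial>L)) < e"
      by (simp add: eventually_sequentially)
  qed
qed

lemma std_gauss_tail:
  assumes "e > 0" "d > 0"
  shows "\<exists>s>0. measure (std_gauss :: 'a::euclidean_space measure) {z. norm z \<ge> s * d} < e"
proof -
  interpret G: prob_space "std_gauss :: 'a measure" by (rule prob_space_std_gauss)
  let ?A = "\<lambda>n::nat. {z :: 'a. norm z \<ge> (real n + 1) * d}"
  have "(\<lambda>n. G.prob (?A n)) \<longlonglongrightarrow> G.prob (\<Inter>n. ?A n)"
  proof (rule G.finite_Lim_measure_decseq)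
    show "range ?A \<subseteq> sets std_gauss" by auto
    have "(real n + 1) * d \<le> (real m + 1) * d" if "n \<le> m" for n m
      using that assms by (intro mult_right_mono) auto
    then show "decseq ?A" by (auto simp: decseq_def intro: order_trans)
  qed
  moreover have "(\<Inter>n. ?A n) = {}"
  proof safe
    fix z assume z: "z \<in> (\<Inter>n. ?A n)"
    obtain n :: nat where "norm z / d < real n" using reals_Archimedean2 by blast
    then have "norm z < (real n + 1) * d" using assms by (simp add: field_simps)
    then show "z \<in> {}" using z by (auto simp: not_le[symmetric])
  qed
  ultimately have "(\<lambda>n. G.prob (?A n)) \<longlonglongrightarrow> 0" by simp
  from order_tendstoD(2)[OF this assms(1)] obtain n where "G.prob (?A n) < e" by (auto simp: eventually_sequentially)
  then show ?thesis by (intro exI[of _ "real n + 1"]) auto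
qed

lemma gauss_smoothing_close:
  fixes f :: "'a::euclidean_space \<Rightarrow> real"
  assumes f: "continuous_on UNIV f" and R': "\<forall>x. norm x > R \<longrightarrow> f x = 0" and e: "e > 0"
  shows "\<exists>s>0. \<forall>x. \<bar>(\<integral>z. f (x + (1/s) *\<^sub>R z) \<partial>std_gauss) - f x\<bar> \<le> e"
proof -
  have R: "\<And>x. norm x > R \<Longrightarrow> f x = 0" using R' by blast
  interpret G: prob_space "std_gauss :: 'a measure" by (rule prob_space_std_gauss)
  obtain B0 where B0: "\<And>x. \<bar>f x\<bar> \<le> B0" using compact_support_uniformly_continuous(2)[OF f R] by blast
  define B where "B = max B0 1"
  have B: "\<bar>f x\<bar> \<le> B" "B > 0" for x using B0[of x] by (auto simp: B_def)
  obtain d where d: "d > 0" "\<And>x y. dist y x < d \<Longrightarrow> dist (f y) (f x) < e/2"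
    using compact_support_uniformly_continuous(1)[OF f R] e unfolding uniformly_continuous_on_def
    by (metis UNIV_I half_gt_zero)
  \<comment> \<open>Beyond radius s d the integrand is at most 2B, so this probability keeps the
    tail below e/2; inside, the shift z/s is shorter than d.\<close>
  obtain s where s: "s > 0" "G.prob {z. norm z \<ge> s * d} < e / (4 * B)"
    using std_gauss_tail[of "e / (4 * B)" d, where 'a='a] e d B by auto
  have [measurable]: "f \<in> borel_measurable borel" using f by (rule borel_measurable_continuous_onI)
  have "\<bar>(\<integral>z. f (x + (1/s) *\<^sub>R z) \<partial>std_gauss) - f x\<bar> \<le> e" for x
  proof -
    have i: "integrable std_gauss (\<lambda>z. f (x + (1/s) *\<^sub>R z))"
      by (rule G.integrable_const_bound[where B=B]) (use B in auto)
    have A: "{z::'a. norm z \<ge> s * d} \<in> sets std_gauss" by auto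
    have "(\<integral>z. f (x + (1/s) *\<^sub>R z) \<partial>std_gauss) - f x = (\<integral>z. f (x + (1/s) *\<^sub>R z) - f x \<partial>std_gauss)"
      using i by (simp add: G.prob_space[simplified])
    also have "\<bar>\<dots>\<bar> \<le> (\<integral>z. e/2 + 2 * B * indicator {z::'a. norm z \<ge> s * d} z \<partial>std_gauss)"
    proof (rule abs_integral_le)
      show "integrable std_gauss (\<lambda>z. f (x + (1/s) *\<^sub>R z) - f x)" using i by simp
      show "integrable std_gauss (\<lambda>z. e/2 + 2 * B * indicator {z::'a. norm z \<ge> s * d} z)"
        using A by (auto intro!: integrable_real_indicator simp: G.emeasure_finite less_top[symmetric])
      fix z :: 'a
      show "\<bar>f (x + (1/s) *\<^sub>R z) - f x\<bar> \<le> e/2 + 2 * B * indicator {z. norm z \<ge> s * d} z"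
      proof (cases "norm z \<ge> s * d")
        case True then show ?thesis using B(1)[of x] B(1)[of "x + (1/s) *\<^sub>R z"] e by auto
      next
        case False
        then have "dist (x + (1/s) *\<^sub>R z) x < d" using s(1) by (simp add: dist_norm field_simps)
        from d(2)[OF this] show ?thesis using False by (simp add: dist_real_def)
      qed
    qed
    also have "\<dots> = e/2 + 2 * B * G.prob {z. norm z \<ge> s * d}"
      using A by (subst Bochner_Integration.integral_add) 
        (auto intro!: integrable_real_indicator simp: G.emeasure_finite less_top[symmetric] G.prob_space[simplified])
    also have "\<dots> \<le> e" using s(2) B(2) e by (simp add: field_simps)
    finally show ?thesis .
  qed
  then show ?thesis using s(1) by blast
qed

text \<open>Smoothing a test function by a small Gaussian writes its mean as an integral of the characteristic
  function against an integrable weight, so that dominated convergence applies.\<close>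

theorem levy_continuity_euclidean:
  fixes N :: "nat \<Rightarrow> 'a::euclidean_space measure"
  assumes N: "\<And>m. prob_space (N m)" "\<And>m. sets (N m) = sets borel"
    and L: "prob_space L" "sets L = sets borel"
    and conv: "\<And>u. (\<lambda>m. \<integral>x. iexp (u \<bullet> x) \<partial>N m) \<longlonglongrightarrow> (\<integral>x. iexp (u \<bullet> x) \<partial>L)"
  shows "conv_in_law N L"
proof (rule conv_in_law_compact_support[OF N L])
  fix f :: "'a \<Rightarrow> real"
  assume f: "continuous_on UNIV f" and "\<exists>R. \<forall>x. norm x > R \<longrightarrow> f x = 0"
  then obtain R where R': "\<forall>x. norm x > R \<longrightarrow> f x = 0" by blast
  then have R: "\<And>x. norm x > R \<Longrightarrow> f x = 0" by blast
  have [measurable_cong]: "sets L = sets borel" "\<And>m. sets (N m) = sets borel" by fact+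
  have [measurable]: "f \<in> borel_measurable borel" using f by (rule borel_measurable_continuous_onI)
  obtain B where B: "\<And>x. \<bar>f x\<bar> \<le> B" using compact_support_uniformly_continuous(2)[OF f R] by blast
  interpret G: prob_space "std_gauss :: 'a measure" by (rule prob_space_std_gauss)
  let ?F = "\<lambda>s x. \<integral>z. f (x + (1/s) *\<^sub>R z) \<partial>std_gauss"
  have FN: "(\<lambda>m. \<integral>x. ?F s x \<partial>N m) \<longlonglongrightarrow> (\<integral>x. ?F s x \<partial>L)" if s: "s > 0" for s
    unfolding gauss_smoothing_eq(1)[OF f R' s N] gauss_smoothing_eq(1)[OF f R' s L]
  proof (intro tendsto_mult_left integral_dominated_convergence[where w="\<lambda>c. \<bar>f c\<bar>"])
    have int: "integrable lborel f" by (rule gauss_smoothing_eq(2)[OF f R' s L])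
    then show "integrable lborel (\<lambda>c. \<bar>f c\<bar>)" by simp
    have meas: "(\<lambda>c. f c * (\<integral>x. exp (- (norm (s *\<^sub>R (x - c)))\<^sup>2 / 2) \<partial>M)) \<in> borel_measurable lborel"
      if "prob_space M" "sets M = sets borel" for M :: "'a measure"
    proof -
      interpret prob_space M by fact
      have [measurable_cong]: "sets M = sets borel" by fact
      show ?thesis by measurable
    qed
    show "(\<lambda>c. f c * (\<integral>x. exp (- (norm (s *\<^sub>R (x - c)))\<^sup>2 / 2) \<partial>L)) \<in> borel_measurable lborel"
      "\<And>m. (\<lambda>c. f c * (\<integral>x. exp (- (norm (s *\<^sub>R (x - c)))\<^sup>2 / 2) \<partial>N m)) \<in> borel_measurable lborel"
      by (intro meas N L)+
    show "AE c in lborel. (\<lambda>m. f c * (\<integral>x. exp (- (norm (s *\<^sub>R (x - c)))\<^sup>2 / 2) \<partial>N m)) \<longlonglongrightarrow>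
        f c * (\<integral>x. exp (- (norm (s *\<^sub>R (x - c)))\<^sup>2 / 2) \<partial>L)"
      by (intro AE_I2 tendsto_mult_left gauss_bump_tendsto N L conv)
    fix m
    interpret prob_space "N m" by (rule N)
    show "AE c in lborel. norm (f c * (\<integral>x. exp (- (norm (s *\<^sub>R (x - c)))\<^sup>2 / 2) \<partial>N m)) \<le> \<bar>f c\<bar>"
    proof (intro AE_I2)
      fix c
      have "(\<integral>x. exp (- (norm (s *\<^sub>R (x - c)))\<^sup>2 / 2) \<partial>N m) \<le> (\<integral>x. 1 \<partial>N m)"
        by (intro integral_mono integrable_const_bound[where B=1]) auto
      moreover have "0 \<le> (\<integral>x. exp (- (norm (s *\<^sub>R (x - c)))\<^sup>2 / 2) \<partial>N m)" by simp
      ultimately show "norm (f c * (\<integral>x. exp (- (norm (s *\<^sub>R (x - c)))\<^sup>2 / 2) \<partial>N m)) \<le> \<bar>f c\<bar>"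
        by (simp add: abs_mult prob_space mult_left_le)
    qed
  qed
  have close: "\<bar>(\<integral>x. ?F s x \<partial>M) - (\<integral>x. f x \<partial>M)\<bar> \<le> e"
    if M: "prob_space M" "sets M = sets borel" and c: "\<And>x. \<bar>?F s x - f x\<bar> \<le> e" for M :: "'a measure" and s e
  proof -
    interpret M: prob_space M by fact
    have [measurable_cong]: "sets M = sets borel" by fact
    have i1: "integrable M f" by (rule M.integrable_const_bound[where B=B]) (use B in auto)
    have i2: "integrable M (?F s)"
    proof (rule M.integrable_const_bound[where B="B + e"])
      show "AE x in M. norm (?F s x) \<le> B + e" using B c by (intro AE_I2) (smt (verit) real_norm_def)
    qed measurable
    have "(\<integral>x. ?F s x \<partial>M) - (\<integral>x. f x \<partial>M) = (\<integral>x. ?F s x - f x \<partial>M)" using i1 i2 by simp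
    also have "\<bar>\<dots>\<bar> \<le> (\<integral>x. e \<partial>M)" using i1 i2 c by (intro abs_integral_le) auto
    finally show ?thesis by (simp add: M.prob_space)
  qed
  show "(\<lambda>m. \<integral>x. f x \<partial>N m) \<longlonglongrightarrow> (\<integral>x. f x \<partial>L)"
  proof (rule LIMSEQ_I)
    fix e :: real assume e: "e > 0"
    obtain s where s: "s > 0" "\<And>x. \<bar>?F s x - f x\<bar> \<le> e/4"
      using gauss_smoothing_close[OF f R', of "e/4"] e by auto
    from tendstoD[OF FN[OF s(1)], of "e/2"] e
    have "\<forall>\<^sub>F m in sequentially. dist (\<integral>x. ?F s x \<partial>N m) (\<integral>x. ?F s x \<partial>L) < e/2" by auto
    then have "\<forall>\<^sub>F m in sequentially. norm ((\<integral>x. f x \<partial>N m) - (\<integral>x. f x \<partial>L)) < e"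
    proof eventually_elim
      case (elim m)
      then show ?case using close[OF N s(2), of m] close[OF L s(2)] by (simp add: dist_real_def abs_if split: if_splits)
    qed
    then show "\<exists>no. \<forall>m\<ge>no. norm ((\<integral>x. f x \<partial>N m) - (\<integral>x. f x \<partial>L)) < e"
      by (simp add: eventually_sequentially)
  qed
qed

text \<open>It is enough to test compactly supported functions, and these are uniformly continuous:
  where Y and U are closer than d the values differ by less than e/2, and the other event has
  vanishing probability.\<close>

lemma conv_in_law_slutsky:
  fixes U Y :: "nat \<Rightarrow> 'w \<Rightarrow> 'a::euclidean_space"
  assumes M: "prob_space M" and U [measurable]: "\<And>m. U m \<in> borel_measurable M" and Y [measurable]: "\<And>m. Y m \<in> borel_measurable M"
    and L: "prob_space L" "sets L = sets borel"
    and conv: "conv_in_law (\<lambda>m. distr M borel (U m)) L"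
    and close: "\<And>e. e > 0 \<Longrightarrow> (\<lambda>m. measure M {\<omega>\<in>space M. norm (Y m \<omega> - U m \<omega>) \<ge> e}) \<longlonglongrightarrow> 0"
  shows "conv_in_law (\<lambda>m. distr M borel (Y m)) L"
proof (rule conv_in_law_compact_support)
  interpret prob_space M by fact
  show "prob_space (distr M borel (Y m))" for m by (rule prob_space_distr) measurable
  show "prob_space L" "sets L = sets borel" by fact+
  fix f :: "'a \<Rightarrow> real"
  assume f: "continuous_on UNIV f" and "\<exists>R. \<forall>x. norm x > R \<longrightarrow> f x = 0"
  then obtain R where R': "\<forall>x. norm x > R \<longrightarrow> f x = 0" by blast
  then have R: "\<And>x. norm x > R \<Longrightarrow> f x = 0" by blast
  have [measurable]: "f \<in> borel_measurable borel" using f by (rule borel_measurable_continuous_onI)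
  obtain B where B: "\<And>x. \<bar>f x\<bar> \<le> B" using compact_support_uniformly_continuous(2)[OF f R] by blast
  have "bounded (range f)" using B by (auto simp: bounded_iff)
  with conv f have *: "(\<lambda>m. \<integral>x. f x \<partial>distr M borel (U m)) \<longlonglongrightarrow> (\<integral>x. f x \<partial>L)"
    unfolding conv_in_law_def by blast
  have "(\<lambda>m. (\<integral>\<omega>. f (Y m \<omega>) \<partial>M) - (\<integral>\<omega>. f (U m \<omega>) \<partial>M)) \<longlonglongrightarrow> 0"
  proof (rule LIMSEQ_I)
    fix e :: real assume e: "e > 0"
    obtain d where d: "d > 0" "\<And>x y. dist y x < d \<Longrightarrow> dist (f y) (f x) < e/2"
      using compact_support_uniformly_continuous(1)[OF f R] e unfolding uniformly_continuous_on_def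
      by (metis UNIV_I half_gt_zero)
    have "(\<lambda>m. 2 * B * prob {\<omega>\<in>space M. norm (Y m \<omega> - U m \<omega>) \<ge> d}) \<longlonglongrightarrow> 0"
      using close[OF d(1)] tendsto_mult_right_zero by blast
    from order_tendstoD(2)[OF this, of "e/2"] e
    have "\<forall>\<^sub>F m in sequentially. 2 * B * prob {\<omega>\<in>space M. norm (Y m \<omega> - U m \<omega>) \<ge> d} < e/2" by auto
    then have "\<forall>\<^sub>F m in sequentially. norm ((\<integral>\<omega>. f (Y m \<omega>) \<partial>M) - (\<integral>\<omega>. f (U m \<omega>) \<partial>M) - 0) < e"
    proof eventually_elim
      case (elim m)
      let ?A = "{\<omega>\<in>space M. norm (Y m \<omega> - U m \<omega>) \<ge> d}"
      have A: "?A \<in> sets M" by measurable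
      have i: "integrable M (\<lambda>\<omega>. f (Y m \<omega>))" "integrable M (\<lambda>\<omega>. f (U m \<omega>))"
        by (rule integrable_const_bound[where B=B]; use B in auto)+
      have iA: "integrable M (\<lambda>\<omega>. 2 * B * indicator ?A \<omega>)"
        using A by (auto intro!: integrable_real_indicator simp: emeasure_finite less_top[symmetric])
      have "(\<integral>\<omega>. f (Y m \<omega>) \<partial>M) - (\<integral>\<omega>. f (U m \<omega>) \<partial>M) = (\<integral>\<omega>. f (Y m \<omega>) - f (U m \<omega>) \<partial>M)"
        using i by simp
      also have "\<bar>\<dots>\<bar> \<le> (\<integral>\<omega>. e/2 + 2 * B * indicator ?A \<omega> \<partial>M)"
      proof (rule abs_integral_le)
        show "integrable M (\<lambda>\<omega>. f (Y m \<omega>) - f (U m \<omega>))" using i by simp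
        show "integrable M (\<lambda>\<omega>. e/2 + 2 * B * indicator ?A \<omega>)" using iA by (intro Bochner_Integration.integrable_add) auto
        fix \<omega> assume w: "\<omega> \<in> space M"
        show "\<bar>f (Y m \<omega>) - f (U m \<omega>)\<bar> \<le> e/2 + 2 * B * indicator ?A \<omega>"
        proof (cases "\<omega> \<in> ?A")
          case True then show ?thesis using B[of "Y m \<omega>"] B[of "U m \<omega>"] e by auto
        next
          case False
          then have "dist (Y m \<omega>) (U m \<omega>) < d" using w by (simp add: dist_norm)
          from d(2)[OF this] show ?thesis using False by (simp add: dist_real_def)
        qed
      qed
      also have "\<dots> = e/2 + 2 * B * prob ?A"
        using iA A by (subst Bochner_Integration.integral_add) (auto simp: prob_space)
      also have "\<dots> < e" using elim by simp
      finally show ?case by simp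
    qed
    then show "\<exists>no. \<forall>m\<ge>no. norm ((\<integral>\<omega>. f (Y m \<omega>) \<partial>M) - (\<integral>\<omega>. f (U m \<omega>) \<partial>M) - 0) < e"
      by (simp add: eventually_sequentially)
  qed
  from tendsto_add[OF this *] show "(\<lambda>m. \<integral>x. f x \<partial>distr M borel (Y m)) \<longlonglongrightarrow> (\<integral>x. f x \<partial>L)"
    by (simp add: integral_distr)
qed simp

lemma conv_in_law_continuous_map:
  fixes g :: "'a::euclidean_space \<Rightarrow> 'b::euclidean_space"
  assumes U [measurable]: "\<And>m. U m \<in> borel_measurable M" and L: "sets L = sets borel"
    and conv: "conv_in_law (\<lambda>m. distr M borel (U m)) L" and g: "continuous_on UNIV g"
  shows "conv_in_law (\<lambda>m. distr M borel (\<lambda>\<omega>. g (U m \<omega>))) (distr L borel g)"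
  unfolding conv_in_law_def
proof (intro allI impI, elim conjE)
  fix f :: "'b \<Rightarrow> real"
  assume f: "continuous_on UNIV f" "bounded (range f)"
  have [measurable_cong]: "sets L = sets borel" by fact
  have [measurable]: "f \<in> borel_measurable borel" "g \<in> borel_measurable borel"
    using f g by (auto intro: borel_measurable_continuous_onI)
  have "continuous_on UNIV (\<lambda>x. f (g x))" by (rule continuous_on_compose2[OF f(1) g]) auto
  moreover have "bounded (range (\<lambda>x. f (g x)))" using f(2) by (rule bounded_subset) auto
  ultimately have "(\<lambda>m. \<integral>x. f (g x) \<partial>distr M borel (U m)) \<longlonglongrightarrow> (\<integral>x. f (g x) \<partial>L)"
    using conv unfolding conv_in_law_def by blast
  then show "(\<lambda>m. \<integral>x. f x \<partial>distr M borel (\<lambda>\<omega>. g (U m \<omega>))) \<longlonglongrightarrow> (\<integral>x. f x \<partial>distr L borel g)"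
    by (simp add: integral_distr)
qed

subsection \<open>Gaussian measures\<close>

lemma normal_char:
  assumes s: "s > 0"
  shows "char (density lborel (normal_density 0 s)) t = of_real (exp (- (t * s)\<^sup>2 / 2))"
proof -
  have "distributed std_normal_distribution lborel (\<lambda>x. x) std_normal_density"
    by (auto simp: distributed_def distr_id2)
  from prob_space.normal_density_affine[OF prob_space_normal_density[OF zero_less_one] this zero_less_one, of s 0]
  have "distributed std_normal_distribution lborel (\<lambda>x. 0 + s * x) (normal_density (0 + s * 0) (\<bar>s\<bar> * 1))"
    using s by blast
  then have eq: "distr std_normal_distribution borel (\<lambda>x. s * x) = density lborel (normal_density 0 s)"
    using s by (simp add: distributed_def cong: distr_cong)
  have "char (density lborel (normal_density 0 s)) t = (\<integral>x. iexp (t * (s * x)) \<partial>std_normal_distribution)"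
    unfolding char_def eq[symmetric] by (subst integral_distr) auto
  also have "\<dots> = char std_normal_distribution (t * s)" by (simp add: char_def mult.assoc)
  finally show ?thesis by (simp add: char_std_normal_distribution)
qed

text \<open>Here q is the variance form. The characteristic function of the projection at t is that
  of L at t u, and homogeneity of q makes it normal; the degenerate direction q u = 0 gives the
  point mass at 0 and has to be kept apart from the normal densities.\<close>

lemma gaussian_projection:
  fixes L :: "'a::euclidean_space measure"
  assumes L: "prob_space L" "sets L = sets borel"
    and q: "\<And>u. 0 \<le> q u" "\<And>t u. q (t *\<^sub>R u) = t\<^sup>2 * q u"
    and ch: "\<And>u. (\<integral>x. iexp (u \<bullet> x) \<partial>L) = of_real (exp (- q u / 2))"
  shows "distr L borel (\<lambda>x. u \<bullet> x) =
    (if sqrt (q u) = 0 then return borel 0 else density lborel (normal_density 0 (sqrt (q u))))"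
proof (rule Levy_uniqueness)
  have [measurable_cong]: "sets L = sets borel" by fact
  interpret prob_space L by fact
  show "real_distribution (distr L borel ((\<bullet>) u))" by (rule real_distribution_distr) measurable
  show "real_distribution (if sqrt (q u) = 0 then return borel 0 else density lborel (normal_density 0 (sqrt (q u))))"
    using q(1)[of u]
    by (auto simp: real_distribution_def real_distribution_axioms_def intro!: prob_space_return prob_space_normal_density)
  show "char (distr L borel ((\<bullet>) u)) =
      char (if sqrt (q u) = 0 then return borel 0 else density lborel (normal_density 0 (sqrt (q u))))"
  proof
    fix t
    have "char (distr L borel ((\<bullet>) u)) t = (\<integral>x. iexp ((t *\<^sub>R u) \<bullet> x) \<partial>L)"
      unfolding char_def by (subst integral_distr) auto
    also have "\<dots> = of_real (exp (- t\<^sup>2 * q u / 2))" unfolding ch q(2) by simp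
    also have "\<dots> = char (if sqrt (q u) = 0 then return borel 0 else density lborel (normal_density 0 (sqrt (q u)))) t"
    proof (cases "q u = 0")
      case True
      then show ?thesis by (simp add: char_def integral_return)
    next
      case False
      then have "sqrt (q u) > 0" using q(1)[of u] by simp
      then show ?thesis using False q(1)[of u] by (simp add: normal_char power_mult_distrib)
    qed
    finally show "char (distr L borel ((\<bullet>) u)) t =
      char (if sqrt (q u) = 0 then return borel 0 else density lborel (normal_density 0 (sqrt (q u)))) t" .
  qed
qed

lemma centered_gaussianI:
  fixes L :: "'a::euclidean_space measure"
  assumes "prob_space L" "sets L = sets borel" "\<And>u. 0 \<le> q u" "\<And>t u. q (t *\<^sub>R u) = t\<^sup>2 * q u"
    and "\<And>u. (\<integral>x. iexp (u \<bullet> x) \<partial>L) = of_real (exp (- q u / 2))"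
  shows "centered_gaussian L"
  unfolding centered_gaussian_def
proof (intro conjI allI)
  fix u
  show "\<exists>s\<ge>0. distr L borel (\<lambda>x. u \<bullet> x) = (if s = 0 then return borel 0 else density lborel (normal_density 0 s))"
    using gaussian_projection[OF assms, of u] assms(3)[of u] by (intro exI[of _ "sqrt (q u)"] conjI) (rule real_sqrt_ge_zero)
qed (use assms(1,2) in auto)

lemma gaussian_moments:
  fixes L :: "'a::euclidean_space measure"
  assumes L: "prob_space L" "sets L = sets borel"
    and q: "\<And>u. 0 \<le> q u" "\<And>t u. q (t *\<^sub>R u) = t\<^sup>2 * q u"
    and ch: "\<And>u. (\<integral>x. iexp (u \<bullet> x) \<partial>L) = of_real (exp (- q u / 2))"
  shows "integrable L (\<lambda>x. u \<bullet> x)" "(\<integral>x. u \<bullet> x \<partial>L) = 0"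
    "integrable L (\<lambda>x. (u \<bullet> x)\<^sup>2)" "(\<integral>x. (u \<bullet> x)\<^sup>2 \<partial>L) = q u"
proof -
  have [measurable_cong]: "sets L = sets borel" by fact
  define D where "D = distr L borel (\<lambda>x. u \<bullet> x)"
  have D: "D = (if sqrt (q u) = 0 then return borel 0 else density lborel (normal_density 0 (sqrt (q u))))"
    unfolding D_def by (rule gaussian_projection[OF assms])
  have *: "integrable D (\<lambda>x. x) \<and> (\<integral>x. x \<partial>D) = 0 \<and> integrable D (\<lambda>x. x\<^sup>2) \<and> (\<integral>x. x\<^sup>2 \<partial>D) = q u"
  proof (cases "q u = 0")
    case True
    then have "D = return borel 0" by (simp add: D)
    then show ?thesis using True by (simp add: integrable_iff_bounded nn_integral_return integral_return)
  next
    case False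
    then have s: "sqrt (q u) > 0" using q(1)[of u] by simp
    have Dd: "D = density lborel (normal_density 0 (sqrt (q u)))" using False by (simp add: D)
    have "integrable lborel (\<lambda>x. normal_density 0 (sqrt (q u)) x * x ^ k)" for k
      using integrable_normal_moment[OF s, of 0 k] by simp
    then have i: "integrable D (\<lambda>x. x ^ k)" for k
      unfolding Dd by (subst integrable_density) auto
    have "(\<integral>x. x \<partial>D) = 0"
      unfolding Dd using integral_normal_moment_nz_1[OF s, of 0] by (subst integral_density) auto
    moreover have "(\<integral>x. x\<^sup>2 \<partial>D) = q u"
      unfolding Dd using integral_normal_moment_even[OF s, of 0 1] q(1)[of u] by (subst integral_density) (auto simp: fact_numeral)
    ultimately show ?thesis using i[of 1] i[of 2] by simp
  qed
  from * show "integrable L (\<lambda>x. u \<bullet> x)" "(\<integral>x. u \<bullet> x \<partial>L) = 0"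
    "integrable L (\<lambda>x. (u \<bullet> x)\<^sup>2)" "(\<integral>x. (u \<bullet> x)\<^sup>2 \<partial>L) = q u"
    unfolding D_def by (simp_all add: integrable_distr_eq integral_distr)
qed

text \<open>The standard Gaussian is pushed forward by the square root g of the covariance operator,
  since u.(g z) = (g u).z and the square of |g u| is u.(T u).\<close>

lemma gaussian_exists:
  fixes T :: "'a::euclidean_space \<Rightarrow> 'a"
  assumes T: "linear T" "\<And>x y. T x \<bullet> y = x \<bullet> T y" "\<And>x. 0 \<le> x \<bullet> T x"
  obtains L :: "'a measure" where "prob_space L" "sets L = sets borel"
    "\<And>u. (\<integral>x. iexp (u \<bullet> x) \<partial>L) = of_real (exp (- (u \<bullet> T u) / 2))"
proof -
  obtain g where g: "linear g" "\<And>x y. g x \<bullet> y = x \<bullet> g y" "\<And>x. g (g x) = T x"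
    using psd_sqrt_exists[OF T] by metis
  interpret G: prob_space "std_gauss :: 'a measure" by (rule prob_space_std_gauss)
  have [measurable]: "g \<in> borel_measurable borel"
    by (intro borel_measurable_continuous_onI linear_continuous_on) (simp add: g(1) linear_linear)
  show thesis
  proof
    show "prob_space (distr std_gauss borel g)" by (rule G.prob_space_distr) measurable
    show "sets (distr std_gauss borel g) = sets borel" by simp
    show "(\<integral>x. iexp (u \<bullet> x) \<partial>distr std_gauss borel g) = of_real (exp (- (u \<bullet> T u) / 2))" for u
    proof -
      have "(\<integral>x. iexp (u \<bullet> x) \<partial>distr std_gauss borel g) = (\<integral>x. iexp (g u \<bullet> x) \<partial>std_gauss)"
        by (subst integral_distr) (auto simp: g(2))
      also have "(norm (g u))\<^sup>2 = u \<bullet> T u" unfolding power2_norm_eq_inner g(2) g(3) ..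
      then have "(\<integral>x. iexp (g u \<bullet> x) \<partial>std_gauss) = of_real (exp (- (u \<bullet> T u) / 2))"
        by (simp only: std_gauss_char)
      finally show ?thesis .
    qed
  qed
qed

text \<open>A product measure has independent components by construction, and its variance form is
  the sum of the two forms. This is the shape that the central limit theorem produces when the cross
  covariances vanish.\<close>

lemma gaussian_pair:
  fixes L1 :: "'a::euclidean_space measure" and L2 :: "'b::euclidean_space measure"
  assumes L1: "prob_space L1" "sets L1 = sets borel" and L2: "prob_space L2" "sets L2 = sets borel"
    and ch1: "\<And>u. (\<integral>x. iexp (u \<bullet> x) \<partial>L1) = of_real (exp (- q1 u / 2))"
    and ch2: "\<And>u. (\<integral>x. iexp (u \<bullet> x) \<partial>L2) = of_real (exp (- q2 u / 2))"
  shows "prob_space (L1 \<Otimes>\<^sub>M L2)" "sets (L1 \<Otimes>\<^sub>M L2) = sets borel" "indep_components (L1 \<Otimes>\<^sub>M L2)"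
    "(\<integral>x. iexp (u \<bullet> x) \<partial>(L1 \<Otimes>\<^sub>M L2)) = of_real (exp (- (q1 (fst u) + q2 (snd u)) / 2))"
proof -
  interpret A: prob_space L1 by fact
  interpret B: prob_space L2 by fact
  interpret P: pair_prob_space L1 L2 ..
  have [measurable_cong]: "sets L1 = sets borel" "sets L2 = sets borel" by fact+
  have sp: "space L1 = UNIV" "space L2 = UNIV" using sets_eq_imp_space_eq[OF L1(2)] sets_eq_imp_space_eq[OF L2(2)] by simp_all
  show "prob_space (L1 \<Otimes>\<^sub>M L2)" by (rule P.prob_space_axioms)
  show sets: "sets (L1 \<Otimes>\<^sub>M L2) = sets borel"
    unfolding borel_prod[symmetric] by (intro sets_pair_measure_cong L1 L2)
  show "indep_components (L1 \<Otimes>\<^sub>M L2)"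
    unfolding indep_components_def
  proof -
    have sp12: "space (L1 \<Otimes>\<^sub>M L2) = UNIV" by (simp add: space_pair_measure sp)
    show "P.indep_set (sets (vimage_algebra (space (L1 \<Otimes>\<^sub>M L2)) fst borel))
        (sets (vimage_algebra (space (L1 \<Otimes>\<^sub>M L2)) snd borel))"
      unfolding sp12
    proof (rule P.indep_setI)
      show "sets (vimage_algebra UNIV fst borel) \<subseteq> P.events" "sets (vimage_algebra UNIV snd borel) \<subseteq> P.events"
        using measurable_sets[of fst "L1 \<Otimes>\<^sub>M L2" "borel :: 'a measure"] measurable_sets[of snd "L1 \<Otimes>\<^sub>M L2" "borel :: 'b measure"]
        by (auto simp: sets_vimage_algebra2 sp12)
      fix a b :: "('a \<times> 'b) set" assume "a \<in> sets (vimage_algebra UNIV fst (borel :: 'a measure))" "b \<in> sets (vimage_algebra UNIV snd (borel :: 'b measure))"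
      then obtain S T where S: "S \<in> sets borel" "a = fst -` S" and T: "T \<in> sets borel" "b = snd -` T"
        by (auto simp: sets_vimage_algebra2)
      have ab: "a = S \<times> UNIV" "b = UNIV \<times> T" "a \<inter> b = S \<times> T" using S T by auto
      have "UNIV \<in> sets L1" "UNIV \<in> sets L2" "S \<in> sets L1" "T \<in> sets L2" using L1 L2 S T by auto
      then show "P.prob (a \<inter> b) = P.prob a * P.prob b"
        unfolding ab(3) unfolding ab(1,2) using A.prob_space B.prob_space sp
        by (simp add: measure_def B.emeasure_pair_measure_Times enn2real_mult)
    qed
  qed
  have "(\<integral>x. iexp (u \<bullet> x) \<partial>(L1 \<Otimes>\<^sub>M L2)) = (\<integral>x. iexp (fst u \<bullet> fst x) * iexp (snd u \<bullet> snd x) \<partial>(L1 \<Otimes>\<^sub>M L2))"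
    by (simp add: inner_prod_def exp_add[symmetric] distrib_left)
  also have "\<dots> = (\<integral>x. (\<integral>y. iexp (fst u \<bullet> x) * iexp (snd u \<bullet> y) \<partial>L2) \<partial>L1)"
    by (subst P.integral_fst'[symmetric]) (auto intro!: P.integrable_const_bound[where B=1] simp: norm_mult)
  also have "\<dots> = of_real (exp (- q1 (fst u) / 2)) * of_real (exp (- q2 (snd u) / 2))"
    by (simp add: ch1[simplified] ch2[simplified])
  also have "\<dots> = of_real (exp (- (q1 (fst u) + q2 (snd u)) / 2))"
    unfolding of_real_mult[symmetric] exp_add[symmetric] by (simp add: add_divide_distrib)
  finally show "(\<integral>x. iexp (u \<bullet> x) \<partial>(L1 \<Otimes>\<^sub>M L2)) = of_real (exp (- (q1 (fst u) + q2 (snd u)) / 2))" .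
qed

text \<open>On the event in question |x| / (e sqrt n) exceeds 1, so multiplying by its power
  \<delta> only enlarges the left-hand side. This turns Lyapunov's condition into
  Lindeberg's.\<close>

lemma lyapunov_char_bound:
  fixes x :: real
  assumes "0 < e" "0 < \<delta>" "0 < n"
  shows "x\<^sup>2 / n * (if x\<^sup>2 > e\<^sup>2 * n then 1 else 0) \<le> e powr - \<delta> * (\<bar>x\<bar> powr (2 + \<delta>) / n powr (1 + \<delta>/2))"
proof (cases "x\<^sup>2 > e\<^sup>2 * n")
  case True
  then have x: "\<bar>x\<bar> > e * sqrt n" 
    using assms by (metis abs_of_nonneg less_eq_real_def power2_abs power_mult_distrib real_sqrt_abs real_sqrt_less_mono real_sqrt_mult)
  have es: "e * sqrt n > 0" using assms by simp
  have "(e * sqrt n) powr \<delta> \<le> \<bar>x\<bar> powr \<delta>" using x es assms by (intro powr_mono2) auto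
  then have "x\<^sup>2 * (e * sqrt n) powr \<delta> \<le> \<bar>x\<bar> powr (2 + \<delta>)"
    using es x by (simp add: powr_add mult_left_mono)
  moreover have "(e * sqrt n) powr \<delta> = e powr \<delta> * n powr (\<delta>/2)"
    using assms by (simp add: powr_mult powr_half_sqrt[symmetric] powr_powr)
  ultimately have "x\<^sup>2 * (e powr \<delta> * n powr (\<delta>/2)) \<le> \<bar>x\<bar> powr (2 + \<delta>)" by simp
  then have "x\<^sup>2 \<le> \<bar>x\<bar> powr (2 + \<delta>) / (e powr \<delta> * n powr (\<delta>/2))" using assms by (simp add: pos_le_divide_eq)
  then have "x\<^sup>2 / n \<le> \<bar>x\<bar> powr (2 + \<delta>) / (e powr \<delta> * n powr (\<delta>/2)) / n" using assms by (intro divide_right_mono) auto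
  also have "\<dots> = e powr - \<delta> * (\<bar>x\<bar> powr (2 + \<delta>) / n powr (1 + \<delta>/2))"
    using assms by (simp add: powr_minus_divide powr_add)
  finally show ?thesis using True by simp
qed auto

lemma exp_minus_bound: "0 \<le> y \<Longrightarrow> \<bar>exp (- y) - (1 - y)\<bar> \<le> y\<^sup>2" for y :: real
proof -
  assume y: "0 \<le> y"
  have 1: "1 - y \<le> exp (- y)" using exp_ge_add_one_self[of "-y"] by simp
  have "exp (- y) \<le> 1 - y + y\<^sup>2"
  proof -
    have "exp (- y) \<le> 1 / (1 + y)" using exp_ge_add_one_self[of y] y by (simp add: exp_minus field_simps)
    also have "\<dots> \<le> 1 - y + y\<^sup>2" 
    proof -
      have "(1 - y + y\<^sup>2) * (1 + y) = 1 + y ^ 3" by (simp add: power2_eq_square power3_eq_cube algebra_simps)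
      then show ?thesis using y by (simp add: divide_le_eq)
    qed
    finally show ?thesis .
  qed
  with 1 show ?thesis by simp
qed

subsection \<open>A central limit theorem in Euclidean spaces\<close>

text \<open>The normalization is sqrt m and not the standard deviation of the sum, so that v = 0 is
  allowed; degenerate directions do occur, for instance along error-free coordinates. The product of
  characteristic functions is compared factor by factor with the Gaussian factors
  \<open>w m i\<close>, whose product is exp (- A m / 2).\<close>

lemma (in prob_space) lyapunov_char:
  fixes X :: "nat \<Rightarrow> 'a \<Rightarrow> real"
  assumes indep: "indep_vars (\<lambda>_. borel) X UNIV"
    and sq: "\<And>i. integrable M (\<lambda>\<omega>. (X i \<omega>)\<^sup>2)" and zero: "\<And>i. expectation (X i) = 0"
    and var: "(\<lambda>m. 1 / real m * (\<Sum>i<m. expectation (\<lambda>\<omega>. (X i \<omega>)\<^sup>2))) \<longlonglongrightarrow> v"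
    and d: "\<delta> > 0" and ld: "\<And>i. integrable M (\<lambda>\<omega>. \<bar>X i \<omega>\<bar> powr (2 + \<delta>))"
    and lyap: "(\<lambda>m. 1 / real m powr (1 + \<delta> / 2) * (\<Sum>i<m. expectation (\<lambda>\<omega>. \<bar>X i \<omega>\<bar> powr (2 + \<delta>)))) \<longlonglongrightarrow> 0"
  shows "(\<lambda>m. \<integral>\<omega>. iexp (1 / sqrt (real m) * (\<Sum>i<m. X i \<omega>)) \<partial>M) \<longlonglongrightarrow> of_real (exp (- v / 2))"
proof -
  have rv [measurable]: "X i \<in> borel_measurable M" for i using indep unfolding indep_vars_def2 by simp
  have int: "integrable M (X i)" for i by (rule square_integrable_imp_integrable[OF _ sq]) simp
  define s2 where "s2 i = expectation (\<lambda>\<omega>. (X i \<omega>)\<^sup>2)" for i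
  define l where "l i = expectation (\<lambda>\<omega>. \<bar>X i \<omega>\<bar> powr (2 + \<delta>))" for i
  define A where "A m = 1 / real m * (\<Sum>i<m. s2 i)" for m
  define \<Lambda> where "\<Lambda> m = 1 / real m powr (1 + \<delta> / 2) * (\<Sum>i<m. l i)" for m
  have A: "A \<longlonglongrightarrow> v" using var unfolding A_def[abs_def] s2_def .
  have \<Lambda>: "\<Lambda> \<longlonglongrightarrow> 0" using lyap unfolding \<Lambda>_def[abs_def] l_def .
  have s20: "s2 i \<ge> 0" for i by (simp add: s2_def)
  have l0: "l i \<ge> 0" for i by (simp add: l_def)
  have A0: "A m \<ge> 0" for m by (simp add: A_def s20 sum_nonneg)
  have \<Lambda>0: "\<Lambda> m \<ge> 0" for m by (simp add: \<Lambda>_def l0 sum_nonneg)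
  have v0: "v \<ge> 0" using LIMSEQ_le_const[OF A, of 0] A0 by auto
  define \<phi> where "\<phi> m i = char (distr M borel (X i)) (1 / sqrt (real m))" for m i
  define w where "w m i = exp (- (s2 i / (2 * real m)))" for m i
  have prod: "(\<integral>\<omega>. iexp (1 / sqrt (real m) * (\<Sum>i<m. X i \<omega>)) \<partial>M) = (\<Prod>i<m. \<phi> m i)" for m
  proof -
    have "(\<integral>\<omega>. iexp (1 / sqrt (real m) * (\<Sum>i<m. X i \<omega>)) \<partial>M) =
        char (distr M borel (\<lambda>\<omega>. \<Sum>i<m. X i \<omega>)) (1 / sqrt (real m))"
      unfolding char_def by (subst integral_distr) auto
    also have "\<dots> = (\<Prod>i<m. \<phi> m i)" unfolding \<phi>_def
      by (rule char_distr_sum[OF indep_vars_subset[OF indep]]) auto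
    finally show ?thesis .
  qed
  have \<phi>1: "norm (\<phi> m i) \<le> 1" for m i
    unfolding \<phi>_def by (rule real_distribution.cmod_char_le_1) (rule real_distribution_distr, measurable)
  have split: "integrable M (\<lambda>\<omega>. (X i \<omega>)\<^sup>2 / n * (if (X i \<omega>)\<^sup>2 > e\<^sup>2 * n then 1 else 0))"
    "expectation (\<lambda>\<omega>. (X i \<omega>)\<^sup>2 / n * (if (X i \<omega>)\<^sup>2 > e\<^sup>2 * n then 1 else 0)) \<le> e powr - \<delta> * (l i / n powr (1 + \<delta>/2))"
    if "e > 0" "n > 0" for i e n
  proof -
    show i: "integrable M (\<lambda>\<omega>. (X i \<omega>)\<^sup>2 / n * (if (X i \<omega>)\<^sup>2 > e\<^sup>2 * n then 1 else 0))"
      by (rule Bochner_Integration.integrable_bound[of _ "\<lambda>\<omega>. (X i \<omega>)\<^sup>2 / n"]) (use sq[of i] that in auto)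
    have "expectation (\<lambda>\<omega>. (X i \<omega>)\<^sup>2 / n * (if (X i \<omega>)\<^sup>2 > e\<^sup>2 * n then 1 else 0)) \<le>
        expectation (\<lambda>\<omega>. e powr - \<delta> * (\<bar>X i \<omega>\<bar> powr (2 + \<delta>) / n powr (1 + \<delta>/2)))"
      by (rule integral_mono[OF i]) (use ld[of i] lyapunov_char_bound[OF that(1) d that(2)] in auto)
    also have "\<dots> = e powr - \<delta> * (l i / n powr (1 + \<delta>/2))" by (simp add: l_def)
    finally show "expectation (\<lambda>\<omega>. (X i \<omega>)\<^sup>2 / n * (if (X i \<omega>)\<^sup>2 > e\<^sup>2 * n then 1 else 0)) \<le> e powr - \<delta> * (l i / n powr (1 + \<delta>/2))" .
  qed
  \<comment> \<open>The truncation level e is free: first m tends to infinity, which removes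
    \<Lambda>, and then e is taken small.\<close>
  have bound: "norm ((\<Prod>i<m. \<phi> m i) - of_real (exp (- A m / 2))) \<le> e * A m + e powr - \<delta> * \<Lambda> m + (e\<^sup>2 + e powr - \<delta> * \<Lambda> m) * A m"
    if e: "e > 0" and m: "m > 0" for e m
  proof -
    define n where "n = real m"
    have n: "n > 0" using m by (simp add: n_def)
    have \<Lambda>n: "\<Lambda> m = (\<Sum>i<m. l i / n powr (1 + \<delta>/2))" by (simp add: \<Lambda>_def n_def sum_divide_distrib)
    have An: "A m = (\<Sum>i<m. s2 i / n)" by (simp add: A_def n_def sum_divide_distrib)
    \<comment> \<open>No single summand carries a fixed share of the variance. This makes the sum of
      the squares of \<open>s2 i / n\<close>, the error of replacing 1 - y by exp (- y), a small
      multiple of \<open>A m\<close>.\<close>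
    have small: "s2 i / n \<le> e\<^sup>2 + e powr - \<delta> * \<Lambda> m" if i: "i < m" for i
    proof -
      have "s2 i / n = expectation (\<lambda>\<omega>. (X i \<omega>)\<^sup>2 / n)" by (simp add: s2_def)
      also have "\<dots> \<le> expectation (\<lambda>\<omega>. e\<^sup>2 + (X i \<omega>)\<^sup>2 / n * (if (X i \<omega>)\<^sup>2 > e\<^sup>2 * n then 1 else 0))"
      proof (rule integral_mono)
        show "integrable M (\<lambda>\<omega>. e\<^sup>2 + (X i \<omega>)\<^sup>2 / n * (if (X i \<omega>)\<^sup>2 > e\<^sup>2 * n then 1 else 0))"
          using split(1)[OF e n, of i] by (intro Bochner_Integration.integrable_add) auto
        show "(X i \<omega>)\<^sup>2 / n \<le> e\<^sup>2 + (X i \<omega>)\<^sup>2 / n * (if (X i \<omega>)\<^sup>2 > e\<^sup>2 * n then 1 else 0)" for \<omega>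
        proof (cases "(X i \<omega>)\<^sup>2 > e\<^sup>2 * n")
          case False
          then show ?thesis using n by (simp add: pos_divide_le_eq)
        qed simp
      qed (use sq[of i] in auto)
      also have "\<dots> = e\<^sup>2 + expectation (\<lambda>\<omega>. (X i \<omega>)\<^sup>2 / n * (if (X i \<omega>)\<^sup>2 > e\<^sup>2 * n then 1 else 0))"
        using split(1)[OF e n, of i] by (subst Bochner_Integration.integral_add) (auto simp: prob_space)
      also have "\<dots> \<le> e\<^sup>2 + e powr - \<delta> * (l i / n powr (1 + \<delta>/2))" using split(2)[OF e n, of i] by simp
      also have "l i / n powr (1 + \<delta>/2) \<le> \<Lambda> m" unfolding \<Lambda>n using i l0
        by (intro member_le_sum) auto
      finally show ?thesis using e by (simp add: mult_left_mono)
    qed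
    have term_bd: "norm (\<phi> m i - of_real (w m i)) \<le> (e * (s2 i / n) + e powr - \<delta> * (l i / n powr (1 + \<delta>/2)))
        + (e\<^sup>2 + e powr - \<delta> * \<Lambda> m) * (s2 i / n)" if i: "i < m" for i
    proof -
      have "variance (X i) = s2 i" by (simp add: zero s2_def)
      from char_approx3'[OF rv int sq zero this refl, of "1 / sqrt n"]
      have "norm (\<phi> m i - (1 - (1 / sqrt n)\<^sup>2 * s2 i / 2)) \<le> ((1 / sqrt n)\<^sup>2 / 6) * expectation (\<lambda>x. min (6 * (X i x)^2) (\<bar>1 / sqrt n\<bar> * \<bar>X i x\<bar>^3))"
        by (simp add: \<phi>_def n_def)
      also have "\<dots> = expectation (\<lambda>x. ((1 / sqrt n)\<^sup>2 / 6) * min (6 * (X i x)^2) (\<bar>1 / sqrt n\<bar> * \<bar>X i x\<bar>^3))" by simp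
      \<comment> \<open>Where |X| is at most e sqrt n the cubic branch of the minimum is used and
        yields a factor e; elsewhere the quadratic branch, which the Lyapunov bound
        controls.\<close>
      also have "\<dots> \<le> expectation (\<lambda>\<omega>. e * ((X i \<omega>)\<^sup>2 / n) + (X i \<omega>)\<^sup>2 / n * (if (X i \<omega>)\<^sup>2 > e\<^sup>2 * n then 1 else 0))"
      proof (rule integral_mono)
        show "integrable M (\<lambda>x. ((1 / sqrt n)\<^sup>2 / 6) * min (6 * (X i x)^2) (\<bar>1 / sqrt n\<bar> * \<bar>X i x\<bar>^3))"
          by (rule Bochner_Integration.integrable_bound[of _ "\<lambda>\<omega>. (X i \<omega>)\<^sup>2 / n"]) (use sq[of i] n in \<open>auto simp: power_divide field_simps\<close>)
        show "integrable M (\<lambda>\<omega>. e * ((X i \<omega>)\<^sup>2 / n) + (X i \<omega>)\<^sup>2 / n * (if (X i \<omega>)\<^sup>2 > e\<^sup>2 * n then 1 else 0))"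
          using split(1)[OF e n, of i] sq[of i] by auto
        fix \<omega>
        define x where "x = X i \<omega>"
        show "((1 / sqrt n)\<^sup>2 / 6) * min (6 * (X i \<omega>)^2) (\<bar>1 / sqrt n\<bar> * \<bar>X i \<omega>\<bar>^3) \<le>
          e * ((X i \<omega>)\<^sup>2 / n) + (X i \<omega>)\<^sup>2 / n * (if (X i \<omega>)\<^sup>2 > e\<^sup>2 * n then 1 else 0)"
          unfolding x_def[symmetric]
        proof (cases "x\<^sup>2 > e\<^sup>2 * n")
          case True
          have "((1 / sqrt n)\<^sup>2 / 6) * min (6 * x^2) (\<bar>1 / sqrt n\<bar> * \<bar>x\<bar>^3) \<le> ((1 / sqrt n)\<^sup>2 / 6) * (6 * x^2)"
            by (intro mult_left_mono) auto
          also have "\<dots> = x\<^sup>2 / n" using n by (simp add: power_divide)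
          finally show "((1 / sqrt n)\<^sup>2 / 6) * min (6 * x^2) (\<bar>1 / sqrt n\<bar> * \<bar>x\<bar>^3) \<le>
            e * (x\<^sup>2 / n) + x\<^sup>2 / n * (if x\<^sup>2 > e\<^sup>2 * n then 1 else 0)"
            using True e n by (simp add: add_increasing)
        next
          case False
          then have "sqrt (x\<^sup>2) \<le> sqrt (e\<^sup>2 * n)" by (intro real_sqrt_le_mono) simp
          then have "\<bar>x\<bar> \<le> e * sqrt n" using e by (simp add: real_sqrt_mult)
          then have x: "\<bar>x\<bar> / sqrt n \<le> e" using n by (simp add: pos_divide_le_eq)
          have "((1 / sqrt n)\<^sup>2 / 6) * min (6 * x^2) (\<bar>1 / sqrt n\<bar> * \<bar>x\<bar>^3) \<le> ((1 / sqrt n)\<^sup>2 / 6) * (\<bar>1 / sqrt n\<bar> * \<bar>x\<bar>^3)"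
            by (intro mult_left_mono) auto
          also have "\<dots> = (\<bar>x\<bar> / sqrt n) * (x\<^sup>2 / n) / 6" using n by (simp add: power_divide power3_eq_cube power2_eq_square mult_ac)
          also have "\<dots> \<le> e * (x\<^sup>2 / n) / 6" using x n by (intro divide_right_mono mult_right_mono) auto
          also have "\<dots> \<le> e * (x\<^sup>2 / n)"
          proof -
            have "t / 6 \<le> t" if "0 \<le> t" for t :: real using that by simp
            moreover have "0 \<le> e * (x\<^sup>2 / n)" using e n by simp
            ultimately show ?thesis by blast
          qed
          finally show "((1 / sqrt n)\<^sup>2 / 6) * min (6 * x^2) (\<bar>1 / sqrt n\<bar> * \<bar>x\<bar>^3) \<le>
            e * (x\<^sup>2 / n) + x\<^sup>2 / n * (if x\<^sup>2 > e\<^sup>2 * n then 1 else 0)"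
            using False by simp
        qed
      qed
      also have "\<dots> = e * (s2 i / n) + expectation (\<lambda>\<omega>. (X i \<omega>)\<^sup>2 / n * (if (X i \<omega>)\<^sup>2 > e\<^sup>2 * n then 1 else 0))"
        using split(1)[OF e n, of i] sq[of i] by (subst Bochner_Integration.integral_add) (auto simp: s2_def)
      also have "\<dots> \<le> e * (s2 i / n) + e powr - \<delta> * (l i / n powr (1 + \<delta>/2))" using split(2)[OF e n, of i] by simp
      finally have 1: "norm (\<phi> m i - (1 - (1 / sqrt n)\<^sup>2 * s2 i / 2)) \<le> e * (s2 i / n) + e powr - \<delta> * (l i / n powr (1 + \<delta>/2))" .
      define y where "y = s2 i / (2 * n)"
      have y: "y \<ge> 0" using s20 n by (simp add: y_def)
      have "norm (complex_of_real (1 - y) - of_real (w m i)) = \<bar>exp (- y) - (1 - y)\<bar>"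
        unfolding of_real_diff[symmetric] norm_of_real by (simp add: w_def y_def n_def abs_minus_commute)
      also have "\<dots> \<le> y * y" using exp_minus_bound[OF y] by (simp add: power2_eq_square)
      also have "\<dots> \<le> (s2 i / n) * (s2 i / n)" using s20[of i] n by (intro mult_mono) (auto simp: y_def field_simps)
      also have "\<dots> \<le> (e\<^sup>2 + e powr - \<delta> * \<Lambda> m) * (s2 i / n)" using small[OF i] s20[of i] n by (intro mult_right_mono) auto
      finally have 2: "norm (complex_of_real (1 - y) - of_real (w m i)) \<le> (e\<^sup>2 + e powr - \<delta> * \<Lambda> m) * (s2 i / n)" .
      have "(1 / sqrt n)\<^sup>2 * s2 i / 2 = y" using n by (simp add: y_def power_divide)
      with 1 have "norm (\<phi> m i - of_real (1 - y)) \<le> e * (s2 i / n) + e powr - \<delta> * (l i / n powr (1 + \<delta>/2))" by simp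
      with 2 show ?thesis using norm_triangle_ineq[of "\<phi> m i - of_real (1 - y)" "of_real (1 - y) - of_real (w m i)"] by simp
    qed
    have "exp (- A m / 2) = (\<Prod>i<m. w m i)"
      by (simp add: w_def exp_sum[symmetric] An n_def sum_negf sum_divide_distrib mult.commute)
    then have "norm ((\<Prod>i<m. \<phi> m i) - of_real (exp (- A m / 2))) = norm ((\<Prod>i<m. \<phi> m i) - (\<Prod>i<m. of_real (w m i)))" by simp
    also have "\<dots> \<le> (\<Sum>i<m. norm (\<phi> m i - of_real (w m i)))"
      using \<phi>1 s20 by (intro norm_prod_diff) (auto simp: w_def)
    also have "\<dots> \<le> (\<Sum>i<m. (e * (s2 i / n) + e powr - \<delta> * (l i / n powr (1 + \<delta>/2)))
        + (e\<^sup>2 + e powr - \<delta> * \<Lambda> m) * (s2 i / n))" using term_bd by (intro sum_mono) auto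
    also have "\<dots> = e * A m + e powr - \<delta> * \<Lambda> m + (e\<^sup>2 + e powr - \<delta> * \<Lambda> m) * A m"
      unfolding sum.distrib sum_distrib_left[symmetric] An[symmetric] \<Lambda>n[symmetric] ..
    finally show ?thesis .
  qed
  have "(\<lambda>m. (\<Prod>i<m. \<phi> m i) - of_real (exp (- A m / 2))) \<longlonglongrightarrow> 0"
  proof (rule LIMSEQ_I)
    fix r :: real assume r: "r > 0"
    \<comment> \<open>The bound tends to e v + e^2 v, which is at most 2 e v because e is at most
      1.\<close>
    define e where "e = min 1 (r / (2 * (2 * v + 1)))"
    have e: "e > 0" "e \<le> 1" using r v0 by (auto simp: e_def)
    have "e * v + e powr - \<delta> * 0 + (e\<^sup>2 + e powr - \<delta> * 0) * v = e * v + e * (e * v)" by (simp add: power2_eq_square)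
    also have "\<dots> \<le> e * (2 * v)" using e v0 by (simp add: algebra_simps mult_left_le_one_le)
    also have "\<dots> \<le> r / (2 * (2 * v + 1)) * (2 * v)" using v0 by (intro mult_right_mono) (auto simp: e_def)
    also have "\<dots> < r" using r v0 by (simp add: field_simps add_pos_nonneg)
    finally have lim: "e * v + e powr - \<delta> * 0 + (e\<^sup>2 + e powr - \<delta> * 0) * v < r" .
    have "(\<lambda>m. e * A m + e powr - \<delta> * \<Lambda> m + (e\<^sup>2 + e powr - \<delta> * \<Lambda> m) * A m) \<longlonglongrightarrow>
        e * v + e powr - \<delta> * 0 + (e\<^sup>2 + e powr - \<delta> * 0) * v"
      by (intro tendsto_intros A \<Lambda>)
    from order_tendstoD(2)[OF this lim] eventually_gt_at_top[of 0]
    have "\<forall>\<^sub>F m in sequentially. norm ((\<Prod>i<m. \<phi> m i) - of_real (exp (- A m / 2)) - 0) < r"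
    proof eventually_elim
      case (elim m)
      then show ?case using bound[OF e(1), of m] by simp
    qed
    then show "\<exists>no. \<forall>m\<ge>no. norm ((\<Prod>i<m. \<phi> m i) - of_real (exp (- A m / 2)) - 0) < r"
      by (simp add: eventually_sequentially)
  qed
  moreover have "(\<lambda>m. complex_of_real (exp (- A m / 2))) \<longlonglongrightarrow> of_real (exp (- v / 2))"
    by (intro tendsto_intros A) auto
  ultimately have "(\<lambda>m. (\<Prod>i<m. \<phi> m i)) \<longlonglongrightarrow> of_real (exp (- v / 2))"
    using tendsto_add by fastforce
  then show ?thesis by (simp only: prod)
qed

text \<open>The characteristic function at u is that of the scalar sum of the u.W_i at 1 / sqrt m,
  so the one-dimensional result and the continuity theorem suffice.\<close>

theorem (in prob_space) lyapunov_clt_euclidean: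
  fixes W :: "nat \<Rightarrow> 'a \<Rightarrow> 'b::euclidean_space"
  assumes indep: "indep_vars (\<lambda>_. borel) W UNIV"
    and sq: "\<And>i u. integrable M (\<lambda>\<omega>. (u \<bullet> W i \<omega>)\<^sup>2)" and zero: "\<And>i u. expectation (\<lambda>\<omega>. u \<bullet> W i \<omega>) = 0"
    and var: "\<And>u. (\<lambda>m. 1 / real m * (\<Sum>i<m. expectation (\<lambda>\<omega>. (u \<bullet> W i \<omega>)\<^sup>2))) \<longlonglongrightarrow> q u"
    and d: "\<delta> > 0" and ld: "\<And>i u. integrable M (\<lambda>\<omega>. \<bar>u \<bullet> W i \<omega>\<bar> powr (2 + \<delta>))"
    and lyap: "\<And>u. (\<lambda>m. 1 / real m powr (1 + \<delta> / 2) * (\<Sum>i<m. expectation (\<lambda>\<omega>. \<bar>u \<bullet> W i \<omega>\<bar> powr (2 + \<delta>)))) \<longlonglongrightarrow> 0"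
    and L: "prob_space L" "sets L = sets borel"
    and ch: "\<And>u. (\<integral>x. iexp (u \<bullet> x) \<partial>L) = of_real (exp (- q u / 2))"
  shows "conv_in_law (\<lambda>m. distr M borel (\<lambda>\<omega>. (1 / sqrt (real m)) *\<^sub>R (\<Sum>i<m. W i \<omega>))) L"
proof (rule levy_continuity_euclidean)
  have rv [measurable]: "W i \<in> borel_measurable M" for i using indep unfolding indep_vars_def2 by simp
  show "prob_space (distr M borel (\<lambda>\<omega>. (1 / sqrt (real m)) *\<^sub>R (\<Sum>i<m. W i \<omega>)))" for m
    by (rule prob_space_distr) measurable
  fix u
  have "(\<lambda>m. \<integral>\<omega>. iexp (1 / sqrt (real m) * (\<Sum>i<m. u \<bullet> W i \<omega>)) \<partial>M) \<longlonglongrightarrow> of_real (exp (- q u / 2))"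
  proof (rule lyapunov_char[OF _ sq zero var d ld lyap])
    show "indep_vars (\<lambda>_. borel) (\<lambda>i \<omega>. u \<bullet> W i \<omega>) UNIV"
      by (rule indep_vars_compose2[OF indep]) auto
  qed
  then show "(\<lambda>m. \<integral>x. iexp (u \<bullet> x) \<partial>distr M borel (\<lambda>\<omega>. (1 / sqrt (real m)) *\<^sub>R (\<Sum>i<m. W i \<omega>))) \<longlonglongrightarrow> (\<integral>x. iexp (u \<bullet> x) \<partial>L)"
    by (simp add: ch[simplified] integral_distr inner_sum_right)
qed (use L in auto)

subsection \<open>Mixed Lipschitz estimates\<close>

lemma bounded_bilinear_matrix_mult:
  "bounded_bilinear ((**) :: real ^ 'n ^ 'm \<Rightarrow> real ^ 'p ^ 'n \<Rightarrow> real ^ 'p ^ 'm)"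
proof -
  have "bilinear ((**) :: real ^ 'n ^ 'm \<Rightarrow> real ^ 'p ^ 'n \<Rightarrow> real ^ 'p ^ 'm)"
    unfolding bilinear_def
    by (intro conjI allI linearI)
      (simp_all add: vec_eq_iff matrix_matrix_mult_def distrib_left distrib_right sum.distrib sum_distrib_left mult_ac)
  then show ?thesis by (simp add: bilinear_conv_bounded_bilinear)
qed

lemma bounded_bilinear_matrix_vector_mult:
  "bounded_bilinear ((*v) :: real ^ 'n ^ 'm \<Rightarrow> real ^ 'n \<Rightarrow> real ^ 'm)"
proof -
  have "bilinear ((*v) :: real ^ 'n ^ 'm \<Rightarrow> real ^ 'n \<Rightarrow> real ^ 'm)"
    unfolding bilinear_def
    by (intro conjI allI linearI)
      (simp_all add: vec_eq_iff matrix_vector_mult_def distrib_left distrib_right sum.distrib sum_distrib_left mult_ac)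
  then show ?thesis by (simp add: bilinear_conv_bounded_bilinear)
qed

text \<open>The last condition, a Lipschitz bound on second differences, is what separates the effect of
  \<open>X \<noteq> X\<^sub>0\<close> from that of \<open>\<Sigma>\<^sub>i \<noteq> \<Sigma>\<^sub>\<infinity>\<close>; the class is closed under products and inverses.\<close>

definition mixed_lipschitz_with ::
  "real \<Rightarrow> 'x::metric_space set \<Rightarrow> 's::metric_space set \<Rightarrow> ('x \<Rightarrow> 's \<Rightarrow> 'v::real_normed_vector) \<Rightarrow> bool" where
  "mixed_lipschitz_with C U V f \<longleftrightarrow> C \<ge> 0 \<and> (\<forall>x\<in>U. \<forall>x'\<in>U. \<forall>s\<in>V. \<forall>s'\<in>V.
    norm (f x s) \<le> C \<and> norm (f x s - f x' s) \<le> C * dist x x' \<and> norm (f x s - f x s') \<le> C * dist s s' \<and>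
    norm (f x s - f x s' - f x' s + f x' s') \<le> C * dist x x' * dist s s')"

definition mixed_lipschitz ::
  "'x::metric_space set \<Rightarrow> 's::metric_space set \<Rightarrow> ('x \<Rightarrow> 's \<Rightarrow> 'v::real_normed_vector) \<Rightarrow> bool" where
  "mixed_lipschitz U V f \<longleftrightarrow> (\<exists>C. mixed_lipschitz_with C U V f)"

lemma mixed_lipschitzI:
  assumes "C \<ge> 0"
    and "\<And>x s. x \<in> U \<Longrightarrow> s \<in> V \<Longrightarrow> norm (f x s) \<le> C"
    and "\<And>x x' s. x \<in> U \<Longrightarrow> x' \<in> U \<Longrightarrow> s \<in> V \<Longrightarrow> norm (f x s - f x' s) \<le> C * dist x x'"
    and "\<And>x s s'. x \<in> U \<Longrightarrow> s \<in> V \<Longrightarrow> s' \<in> V \<Longrightarrow> norm (f x s - f x s') \<le> C * dist s s'"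
    and "\<And>x x' s s'. x \<in> U \<Longrightarrow> x' \<in> U \<Longrightarrow> s \<in> V \<Longrightarrow> s' \<in> V \<Longrightarrow>
      norm (f x s - f x s' - f x' s + f x' s') \<le> C * dist x x' * dist s s'"
  shows "mixed_lipschitz U V f"
  unfolding mixed_lipschitz_def mixed_lipschitz_with_def
proof (intro exI conjI ballI)
  show "0 \<le> C" by (rule assms(1))
  fix x x' s s' assume *: "x \<in> U" "x' \<in> U" "s \<in> V" "s' \<in> V"
  show "norm (f x s) \<le> C" by (rule assms(2)[OF *(1,3)])
  show "norm (f x s - f x' s) \<le> C * dist x x'" by (rule assms(3)[OF *(1-3)])
  show "norm (f x s - f x s') \<le> C * dist s s'" by (rule assms(4)[OF *(1,3,4)])
  show "norm (f x s - f x s' - f x' s + f x' s') \<le> C * dist x x' * dist s s'" by (rule assms(5)[OF *])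
qed

lemma mixed_lipschitz_withD:
  assumes "mixed_lipschitz_with C U V f"
  shows "C \<ge> 0"
    and "x \<in> U \<Longrightarrow> s \<in> V \<Longrightarrow> norm (f x s) \<le> C"
    and "x \<in> U \<Longrightarrow> x' \<in> U \<Longrightarrow> s \<in> V \<Longrightarrow> norm (f x s - f x' s) \<le> C * dist x x'"
    and "x \<in> U \<Longrightarrow> s \<in> V \<Longrightarrow> s' \<in> V \<Longrightarrow> norm (f x s - f x s') \<le> C * dist s s'"
    and "x \<in> U \<Longrightarrow> x' \<in> U \<Longrightarrow> s \<in> V \<Longrightarrow> s' \<in> V \<Longrightarrow>
      norm (f x s - f x s' - f x' s + f x' s') \<le> C * dist x x' * dist s s'"
proof -
  note D = assms[unfolded mixed_lipschitz_with_def, THEN conjunct2, rule_format]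
  show "C \<ge> 0" using assms unfolding mixed_lipschitz_with_def by (rule conjunct1)
  show "x \<in> U \<Longrightarrow> s \<in> V \<Longrightarrow> norm (f x s) \<le> C" using D[of x x s s] by simp
  show "x \<in> U \<Longrightarrow> x' \<in> U \<Longrightarrow> s \<in> V \<Longrightarrow> norm (f x s - f x' s) \<le> C * dist x x'" using D[of x x' s s] by simp
  show "x \<in> U \<Longrightarrow> s \<in> V \<Longrightarrow> s' \<in> V \<Longrightarrow> norm (f x s - f x s') \<le> C * dist s s'" using D[of x x s s'] by simp
  show "x \<in> U \<Longrightarrow> x' \<in> U \<Longrightarrow> s \<in> V \<Longrightarrow> s' \<in> V \<Longrightarrow>
      norm (f x s - f x s' - f x' s + f x' s') \<le> C * dist x x' * dist s s'" using D[of x x' s s'] by simp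
qed

lemma mixed_lipschitz_const: "mixed_lipschitz U V (\<lambda>_ _. c)"
proof (rule mixed_lipschitzI)
  show "norm c \<le> norm c" ..
qed simp_all

lemma mixed_lipschitz_fst:
  fixes U :: "'v::real_normed_vector set"
  assumes "bounded U"
  shows "mixed_lipschitz U V (\<lambda>x _. x)"
proof -
  obtain B where B: "\<And>x. x \<in> U \<Longrightarrow> norm x \<le> B" using assms by (auto simp: bounded_iff)
  show ?thesis
  proof (rule mixed_lipschitzI[of "max B 1"])
    show "norm (x - x') \<le> max B 1 * dist x x'" for x x' :: 'v
      using mult_right_mono[of 1 "max B 1" "dist x x'"] by (simp add: dist_norm)
    show "norm x \<le> max B 1" if "x \<in> U" for x using B[OF that] by simp
  qed auto
qed

lemma mixed_lipschitz_snd: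
  fixes V :: "'v::real_normed_vector set"
  assumes "bounded V"
  shows "mixed_lipschitz U V (\<lambda>_ s. s)"
proof -
  obtain B where B: "\<And>x. x \<in> V \<Longrightarrow> norm x \<le> B" using assms by (auto simp: bounded_iff)
  show ?thesis
  proof (rule mixed_lipschitzI[of "max B 1"])
    show "norm (x - x') \<le> max B 1 * dist x x'" for x x' :: 'v
      using mult_right_mono[of 1 "max B 1" "dist x x'"] by (simp add: dist_norm)
    show "norm x \<le> max B 1" if "x \<in> V" for x using B[OF that] by simp
  qed auto
qed

lemma mixed_lipschitz_add:
  assumes f: "mixed_lipschitz U V f" and g: "mixed_lipschitz U V g"
  shows "mixed_lipschitz U V (\<lambda>x s. f x s + g x s)"
proof -
  obtain C where "mixed_lipschitz_with C U V f" using f unfolding mixed_lipschitz_def by blast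
  note C = mixed_lipschitz_withD[OF this]
  obtain D where "mixed_lipschitz_with D U V g" using g unfolding mixed_lipschitz_def by blast
  note D = mixed_lipschitz_withD[OF this]
  show ?thesis
  proof (rule mixed_lipschitzI[of "C + D"])
    show "norm (f x s + g x s) \<le> C + D" if "x \<in> U" "s \<in> V" for x s
      using C(2)[OF that] D(2)[OF that] norm_triangle_ineq[of "f x s" "g x s"] by linarith
    show "norm (f x s + g x s - (f x' s + g x' s)) \<le> (C + D) * dist x x'" if "x \<in> U" "x' \<in> U" "s \<in> V" for x x' s
      using C(3)[OF that] D(3)[OF that] norm_triangle_ineq[of "f x s - f x' s" "g x s - g x' s"]
      by (simp add: algebra_simps)
    show "norm (f x s + g x s - (f x s' + g x s')) \<le> (C + D) * dist s s'" if "x \<in> U" "s \<in> V" "s' \<in> V" for x s s'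
      using C(4)[OF that] D(4)[OF that] norm_triangle_ineq[of "f x s - f x s'" "g x s - g x s'"]
      by (simp add: algebra_simps)
    show "norm (f x s + g x s - (f x s' + g x s') - (f x' s + g x' s) + (f x' s' + g x' s')) \<le> (C + D) * dist x x' * dist s s'"
      if "x \<in> U" "x' \<in> U" "s \<in> V" "s' \<in> V" for x x' s s'
      using C(5)[OF that] D(5)[OF that]
        norm_triangle_ineq[of "f x s - f x s' - f x' s + f x' s'" "g x s - g x s' - g x' s + g x' s'"]
      by (simp add: algebra_simps)
  qed (use C D in auto)
qed

lemma mixed_lipschitz_bilinear:
  assumes h: "bounded_bilinear h" and f: "mixed_lipschitz U V f" and g: "mixed_lipschitz U V g"
  shows "mixed_lipschitz U V (\<lambda>x s. h (f x s) (g x s))"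
proof -
  interpret bounded_bilinear h by fact
  obtain K where K: "K \<ge> 0" "\<And>a b. norm (h a b) \<le> norm a * norm b * K" using nonneg_bounded by blast
  obtain C where "mixed_lipschitz_with C U V f" using f unfolding mixed_lipschitz_def by blast
  note C = mixed_lipschitz_withD[OF this]
  obtain D where "mixed_lipschitz_with D U V g" using g unfolding mixed_lipschitz_def by blast
  note D = mixed_lipschitz_withD[OF this]
  have hb: "norm (h a b) \<le> p * q * K" if "norm a \<le> p" "norm b \<le> q" for a b p q
    using K that by (meson mult_mono mult_right_mono norm_ge_zero order_trans)
  have nn: "0 \<le> C * D * K" using C D K by simp
  show ?thesis
  proof (rule mixed_lipschitzI[of "4 * (C * D * K)"])
    show "norm (h (f x s) (g x s)) \<le> 4 * (C * D * K)" if "x \<in> U" "s \<in> V" for x s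
      using hb[OF C(2)[OF that] D(2)[OF that]] nn by linarith
    show "norm (h (f x s) (g x s) - h (f x' s) (g x' s)) \<le> 4 * (C * D * K) * dist x x'"
      if "x \<in> U" "x' \<in> U" "s \<in> V" for x x' s
    proof -
      have "h (f x s) (g x s) - h (f x' s) (g x' s) = h (f x s - f x' s) (g x s) + h (f x' s) (g x s - g x' s)"
        by (simp add: diff_left diff_right)
      also have "norm \<dots> \<le> (C * dist x x') * D * K + C * (D * dist x x') * K"
        using that by (intro norm_triangle_le add_mono hb C D)
      also have "\<dots> = 2 * (C * D * K * dist x x')" by (simp add: algebra_simps)
      finally show ?thesis using mult_nonneg_nonneg[OF nn zero_le_dist[of x x']] by linarith
    qed
    show "norm (h (f x s) (g x s) - h (f x s') (g x s')) \<le> 4 * (C * D * K) * dist s s'"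
      if "x \<in> U" "s \<in> V" "s' \<in> V" for x s s'
    proof -
      have "h (f x s) (g x s) - h (f x s') (g x s') = h (f x s - f x s') (g x s) + h (f x s') (g x s - g x s')"
        by (simp add: diff_left diff_right)
      also have "norm \<dots> \<le> (C * dist s s') * D * K + C * (D * dist s s') * K"
        using that by (intro norm_triangle_le add_mono hb C D)
      also have "\<dots> = 2 * (C * D * K * dist s s')" by (simp add: algebra_simps)
      finally show ?thesis using mult_nonneg_nonneg[OF nn zero_le_dist[of s s']] by linarith
    qed
    show "norm (h (f x s) (g x s) - h (f x s') (g x s') - h (f x' s) (g x' s) + h (f x' s') (g x' s'))
        \<le> 4 * (C * D * K) * dist x x' * dist s s'"
      if "x \<in> U" "x' \<in> U" "s \<in> V" "s' \<in> V" for x x' s s'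
    proof -
      \<comment> \<open>Leibniz rule for second differences: each of the four terms contains either
        a second difference of one factor or one first difference in each variable. This is the
        origin of the constant 4.\<close>
      have "h (f x s) (g x s) - h (f x s') (g x s') - h (f x' s) (g x' s) + h (f x' s') (g x' s') =
          h (f x s - f x s' - f x' s + f x' s') (g x s) + h (f x' s - f x' s') (g x s - g x' s)
          + h (f x s' - f x' s') (g x s - g x s') + h (f x' s') (g x s - g x s' - g x' s + g x' s')"
        by (simp add: diff_left diff_right add_left add_right)
      also have "norm \<dots> \<le> (C * dist x x' * dist s s') * D * K + (C * dist s s') * (D * dist x x') * K
          + (C * dist x x') * (D * dist s s') * K + C * (D * dist x x' * dist s s') * K"
        using that by (intro norm_triangle_le add_mono hb C D)
      also have "\<dots> = 4 * (C * D * K) * dist x x' * dist s s'" by (simp add: algebra_simps)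
      finally show ?thesis .
    qed
  qed (use nn in auto)
qed

lemma mixed_lipschitz_linear:
  assumes h: "bounded_linear h" and f: "mixed_lipschitz U V f"
  shows "mixed_lipschitz U V (\<lambda>x s. h (f x s))"
proof -
  interpret bounded_linear h by fact
  obtain K where K: "K \<ge> 0" "\<And>a. norm (h a) \<le> norm a * K" using nonneg_bounded by blast
  obtain C where "mixed_lipschitz_with C U V f" using f unfolding mixed_lipschitz_def by blast
  note C = mixed_lipschitz_withD[OF this]
  have hb: "norm (h a) \<le> K * p" if "norm a \<le> p" for a p
    using order_trans[OF K(2) mult_right_mono[OF that K(1)]] by (simp add: mult.commute)
  show ?thesis
  proof (rule mixed_lipschitzI[of "K * C"])
    show "0 \<le> K * C" using K C by simp
    show "norm (h (f x s)) \<le> K * C" if "x \<in> U" "s \<in> V" for x s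
      by (rule hb[OF C(2)[OF that]])
    show "norm (h (f x s) - h (f x' s)) \<le> K * C * dist x x'" if "x \<in> U" "x' \<in> U" "s \<in> V" for x x' s
      using hb[OF C(3)[OF that]] by (simp add: diff mult.assoc)
    show "norm (h (f x s) - h (f x s')) \<le> K * C * dist s s'" if "x \<in> U" "s \<in> V" "s' \<in> V" for x s s'
      using hb[OF C(4)[OF that]] by (simp add: diff mult.assoc)
    show "norm (h (f x s) - h (f x s') - h (f x' s) + h (f x' s')) \<le> K * C * dist x x' * dist s s'"
      if "x \<in> U" "x' \<in> U" "s \<in> V" "s' \<in> V" for x x' s s'
      using hb[OF C(5)[OF that]] by (simp add: diff add mult.assoc)
  qed
qed

lemma mixed_lipschitz_minus: "mixed_lipschitz U V f \<Longrightarrow> mixed_lipschitz U V (\<lambda>x s. - f x s)"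
  using mixed_lipschitz_linear[OF bounded_linear_minus[OF bounded_linear_ident]] .

lemma mixed_lipschitz_diff:
  "mixed_lipschitz U V f \<Longrightarrow> mixed_lipschitz U V g \<Longrightarrow> mixed_lipschitz U V (\<lambda>x s. f x s - g x s)"
  unfolding diff_conv_add_uminus by (intro mixed_lipschitz_add mixed_lipschitz_minus)

text \<open>The resolvent identity B - B' = B (P' - P) B' expresses differences of the inverse
  through those of P and, applied once more, its second differences. The uniform bound on the
  inverses supplies the constants.\<close>

lemma mixed_lipschitz_matrix_inv:
  fixes P :: "'x::metric_space \<Rightarrow> 's::metric_space \<Rightarrow> real ^ 'k ^ 'k"
  assumes P: "mixed_lipschitz U V P" and inv: "\<And>x s. x \<in> U \<Longrightarrow> s \<in> V \<Longrightarrow> invertible (P x s)"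
    and bd: "\<And>x s. x \<in> U \<Longrightarrow> s \<in> V \<Longrightarrow> norm (matrix_inv (P x s)) \<le> b"
  shows "mixed_lipschitz U V (\<lambda>x s. matrix_inv (P x s))"
proof -
  interpret bounded_bilinear "(**) :: real ^ 'k ^ 'k \<Rightarrow> real ^ 'k ^ 'k \<Rightarrow> real ^ 'k ^ 'k"
    by (rule bounded_bilinear_matrix_mult)
  obtain K where K: "K \<ge> 0" "\<And>(A :: real ^ 'k ^ 'k) (B :: real ^ 'k ^ 'k). norm (A ** B) \<le> norm A * norm B * K" using nonneg_bounded by blast
  obtain C where "mixed_lipschitz_with C U V P" using P unfolding mixed_lipschitz_def by blast
  note C = mixed_lipschitz_withD(1,3-5)[OF this]
  define B where "B x s = matrix_inv (P x s)" for x s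
  define b' where "b' = max b 0"
  have b': "b' \<ge> 0" "\<And>x s. x \<in> U \<Longrightarrow> s \<in> V \<Longrightarrow> norm (B x s) \<le> b'"
    using bd by (auto simp: b'_def B_def le_max_iff_disj)
  have hb: "norm (A ** B) \<le> p * q * K" if "norm A \<le> p" "norm B \<le> q" for A B :: "real ^ 'k ^ 'k" and p q
    using K that by (meson mult_mono mult_right_mono norm_ge_zero order_trans)
  have res: "B x s - B x' s' = B x s ** (P x' s' - P x s) ** B x' s'"
    if "x \<in> U" "s \<in> V" "x' \<in> U" "s' \<in> V" for x x' s s'
  proof -
    have "B x s ** (P x' s' - P x s) ** B x' s' = B x s ** (P x' s' ** B x' s') - (B x s ** P x s) ** B x' s'"
      by (simp add: diff_left diff_right matrix_mul_assoc)
    also have "\<dots> = B x s - B x' s'"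
      using that inv by (simp add: B_def matrix_inv_left matrix_inv_right)
    finally show ?thesis by simp
  qed
  define c where "c = b' * C * K * b' * K"
  have c0: "c \<ge> 0" using b'(1) C(1) K(1) by (simp add: c_def)
  have d1: "norm (B x s - B x' s) \<le> c * dist x x'" if "x \<in> U" "x' \<in> U" "s \<in> V" for x x' s
  proof -
    have "norm (B x s - B x' s) \<le> b' * (C * dist x' x) * K * b' * K"
      unfolding res[OF that(1,3,2,3)] using that by (intro hb b' C)
    then show ?thesis by (simp add: c_def dist_commute mult_ac)
  qed
  have d2: "norm (B x s - B x s') \<le> c * dist s s'" if "x \<in> U" "s \<in> V" "s' \<in> V" for x s s'
  proof -
    have "norm (B x s - B x s') \<le> b' * (C * dist s' s) * K * b' * K"
      unfolding res[OF that(1,2,1,3)] using that by (intro hb b' C)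
    then show ?thesis by (simp add: c_def dist_commute mult_ac)
  qed
  \<comment> \<open>One term carries the second difference of P and contributes c; the other two
    carry a first difference of P and one of the inverse.\<close>
  define c2 where "c2 = c + (2 * (c * C * K * b' * K))"
  have "0 \<le> c * C * K * b' * K" using c0 b'(1) C(1) K(1) by simp
  then have c2: "c \<le> c2" "c2 \<ge> 0" using c0 by (auto simp: c2_def)
  have "mixed_lipschitz U V B"
  proof (rule mixed_lipschitzI[of "max c2 b'"])
    show "norm (B x s - B x' s) \<le> max c2 b' * dist x x'" if "x \<in> U" "x' \<in> U" "s \<in> V" for x x' s
      using d1[OF that] c2 by (smt (verit) mult_right_mono zero_le_dist)
    show "norm (B x s - B x s') \<le> max c2 b' * dist s s'" if "x \<in> U" "s \<in> V" "s' \<in> V" for x s s'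
      using d2[OF that] c2 by (smt (verit) mult_right_mono zero_le_dist)
    show "norm (B x s - B x s' - B x' s + B x' s') \<le> max c2 b' * dist x x' * dist s s'"
      if "x \<in> U" "x' \<in> U" "s \<in> V" "s' \<in> V" for x x' s s'
    proof -
      have "B x s - B x s' - B x' s + B x' s' = (B x s - B x s') - (B x' s - B x' s')" by simp
      also have "\<dots> = (B x s - B x' s) ** (P x s' - P x s) ** B x s'
          + B x' s ** (P x s' - P x s - P x' s' + P x' s) ** B x s' + B x' s ** (P x' s' - P x' s) ** (B x s' - B x' s')"
        unfolding res[OF that(1,3,1,4)] res[OF that(2,3,2,4)]
        by (simp add: diff_left diff_right add_left add_right matrix_mul_assoc)
      also have "norm \<dots> \<le> (c * dist x x') * (C * dist s' s) * K * b' * K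
          + b' * (C * dist x x' * dist s' s) * K * b' * K + b' * (C * dist s' s) * K * (c * dist x x') * K"
        using that by (intro norm_triangle_le add_mono hb b' C d1)
      also have "\<dots> = c2 * dist x x' * dist s s'" by (simp add: c2_def c_def dist_commute algebra_simps)
      also have "\<dots> \<le> max c2 b' * dist x x' * dist s s'" by (intro mult_right_mono) auto
      finally show ?thesis .
    qed
  qed (use c2 b' in \<open>auto intro: le_max_iff_disj[THEN iffD2]\<close>)
  then show ?thesis unfolding B_def[abs_def] .
qed

subsection \<open>Elimination of the corrections\<close>

lemma upper_stack [simp]: "upper (stack a b) = a" and lower_stack [simp]: "lower (stack a b) = b"
  by (simp_all add: upper_def lower_def stack_def vec_eq_iff)

lemma inner_upper_lower: "c \<bullet> c' = upper c \<bullet> upper c' + lower c \<bullet> lower c'"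
  for c c' :: "real ^ ('n::finite + 'd::finite)"
proof -
  have "sum f (UNIV :: ('n + 'd) set) = (\<Sum>i\<in>UNIV. f (Inl i)) + (\<Sum>k\<in>UNIV. f (Inr k))" for f :: "'n + 'd \<Rightarrow> real"
    by (subst UNIV_Plus_UNIV[symmetric], subst sum.Plus) auto
  then show ?thesis by (simp add: inner_vec_def upper_def lower_def)
qed

lemma Zmat_mult: "Zmat X *v w = stack (X *v w) (- w)"
proof -
  have "(Zmat X *v w) $ s = stack (X *v w) (- w) $ s" for s
  proof (cases s)
    case (Inl i) then show ?thesis by (simp add: Zmat_def stack_def matrix_vector_mult_def)
  next
    case (Inr k)
    have "(Zmat X *v w) $ s = (\<Sum>j\<in>UNIV. - (if k = j then w $ j else 0))"
      unfolding Inr by (simp add: Zmat_def stack_def matrix_vector_mult_def mat_def if_distrib if_distribR cong: if_cong)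
    then show ?thesis using Inr by (simp add: stack_def sum_negf)
  qed
  then show ?thesis by (simp add: vec_eq_iff)
qed

lemma vector_Zmat: "c v* Zmat X = upper c v* X - lower c" for X :: "real ^ 'd::finite ^ 'n::finite"
  by (rule vector_eq_rdot[THEN iffD1]) (simp add: dot_lmul_matrix Zmat_mult inner_upper_lower inner_diff_left)

lemma Zmat_add: "Zmat (X + E) *v w = Zmat X *v w + stack (E *v w) 0"
  by (simp add: Zmat_mult vec_eq_iff stack_def matrix_vector_mult_add_rdistrib split: sum.split)

lemma vector_matrix_add: "(u + v) v* A = u v* A + v v* A" 
  and vector_matrix_diff: "(u - v) v* A = u v* A - v v* A" 
  and vector_matrix_scaleR: "(r *\<^sub>R u) v* A = r *\<^sub>R (u v* A)" for A :: "real ^ 'n ^ 'm"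
  by (rule vector_eq_rdot[THEN iffD1], simp add: dot_lmul_matrix inner_add_left inner_diff_left)+

text \<open>As a 0-1 matrix, selection has a transpose: \<open>u v* sel e\<close> extends a J-vector
  by zero, so both operations take part in matrix algebra.\<close>

definition sel :: "('j::finite \<Rightarrow> 's::finite) \<Rightarrow> real ^ 's ^ 'j" where
  "sel e = (\<chi> k s. if s = e k then 1 else 0)"

lemma sel_mult: "sel e *v x = subrows e x"
  by (simp add: vec_eq_iff sel_def subrows_def matrix_vector_mult_def if_distrib if_distribR cong: if_cong)

lemma subrows_mult: "subrows e (Z *v w) = subrows e Z *v w"
  by (simp add: subrows_def vec_eq_iff matrix_vector_mult_def)

lemma subrows_add: "subrows e (x + y) = subrows e x + subrows e (y :: real ^ 's)"
  and subrows_diff: "subrows e (x - y) = subrows e x - subrows e (y :: real ^ 's)"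
  and subrows_scaleR: "subrows e (r *\<^sub>R x) = r *\<^sub>R subrows e (x :: real ^ 's)"
  by (simp_all add: subrows_def vec_eq_iff)

lemma sel_vector_component:
  assumes "inj e"
  shows "(u v* sel e) $ e k = u $ k" "s \<notin> range e \<Longrightarrow> (u v* sel e) $ s = 0"
proof -
  have "(u v* sel e) $ e k = (\<Sum>j\<in>UNIV. if k = j then u $ j else 0)"
    using assms by (simp add: vector_matrix_mult_def sel_def inj_eq if_distrib cong: if_cong)
  then show "(u v* sel e) $ e k = u $ k" by simp
  show "(u v* sel e) $ s = 0" if "s \<notin> range e"
    unfolding vector_matrix_mult_def sel_def using that by (auto intro!: sum.neutral)
qed

lemma subrows_sel: "inj e \<Longrightarrow> subrows e (u v* sel e) = u"
  by (simp add: subrows_def vec_eq_iff sel_vector_component)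

lemma supported_eq_sel:
  assumes "inj e" "\<forall>s. s \<notin> range e \<longrightarrow> x $ s = 0"
  shows "x = subrows e x v* sel e"
proof -
  have "x $ s = (subrows e x v* sel e) $ s" for s
    by (cases "s \<in> range e") (use assms in \<open>auto simp: sel_vector_component subrows_def\<close>)
  then show ?thesis by (simp add: vec_eq_iff)
qed

lemma supported_inner:
  fixes x y :: "real ^ 's::finite"
  assumes "inj e" "\<forall>s. s \<notin> range e \<longrightarrow> x $ s = 0"
  shows "x \<bullet> y = subrows e x \<bullet> subrows e y"
  by (subst supported_eq_sel[OF assms]) (simp_all add: dot_lmul_matrix sel_mult)

text \<open>For \<open>A = \<Sigma>\<^sub>i\<close> this is the matrix \<open>S\<^sub>i\<close> of the model.\<close>

definition pad :: "('j::finite \<Rightarrow> 's::finite) \<Rightarrow> real ^ 'j ^ 'j \<Rightarrow> real ^ 's ^ 's" where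
  "pad e A = transpose (sel e) ** A ** sel e"

lemma pad_mult: "pad e A *v x = (A *v subrows e x) v* sel e"
  by (simp add: pad_def matrix_vector_mul_assoc[symmetric] sel_mult)

lemma inner_vector_matrix: "v \<bullet> (u v* A) = (A *v v) \<bullet> u" for A :: "real ^ 'n ^ 'm"
  by (metis dot_lmul_matrix inner_commute)

lemma pad_inner: "x \<bullet> (pad e A *v y) = subrows e x \<bullet> (A *v subrows e y)"
  by (simp add: pad_mult inner_vector_matrix sel_mult)

lemma transpose_pad: "transpose A = A \<Longrightarrow> transpose (pad e A) = pad e A"
  by (rule matrix_transpose_eqI) (simp add: pad_inner inner_commute[of "pad e A *v _"], metis inner_commute symmetric_inner)

section \<open>Optimal correction of one row and its cost\<close>

definition Pmat :: "('j::finite \<Rightarrow> 'n::finite + 'd::finite) \<Rightarrow> real ^ 'j ^ 'j \<Rightarrow> real ^ 'd ^ 'n \<Rightarrow> real ^ 'd ^ 'd" where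
  "Pmat e A X = transpose (Zmat X) ** pad e A ** Zmat X"

lemma Pmat_mult: "Pmat e A X *v w = (pad e A *v (Zmat X *v w)) v* Zmat X"
  by (simp add: Pmat_def matrix_vector_mul_assoc[symmetric])

lemma Pmat_inner: "v \<bullet> (Pmat e A X *v w) = (Zmat X *v v) \<bullet> (pad e A *v (Zmat X *v w))"
  by (simp add: Pmat_mult inner_vector_matrix)

lemma Pmat_pos_def:
  assumes A: "pos_def A" and r: "\<And>w. w \<noteq> 0 \<Longrightarrow> subrows e (Zmat X *v w) \<noteq> 0"
  shows "pos_def (Pmat e A X)"
  unfolding pos_def_def
proof (intro conjI allI impI)
  have sym: "transpose A = A" using A by (simp add: pos_def_def)
  show "transpose (Pmat e A X) = Pmat e A X"
    by (rule matrix_transpose_eqI)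
      (simp add: Pmat_inner inner_commute[of "Pmat e A X *v _"] pad_inner, metis inner_commute symmetric_inner[OF sym])
  show "0 < w \<bullet> (Pmat e A X *v w)" if "w \<noteq> 0" for w
    using A r[OF that] by (simp add: Pmat_inner pad_inner pos_def_def)
qed

text \<open>The Lagrange multiplier of the constraint of one row, and the minimal cost of correcting that row.\<close>

definition multiplier :: "('j::finite \<Rightarrow> 'n::finite + 'd::finite) \<Rightarrow> real ^ 'j ^ 'j \<Rightarrow> real ^ ('n + 'd) \<Rightarrow> real ^ 'd ^ 'n \<Rightarrow> real ^ 'd" where
  "multiplier e A c X = matrix_inv (Pmat e A X) *v (c v* Zmat X)"

definition qcost :: "('j::finite \<Rightarrow> 'n::finite + 'd::finite) \<Rightarrow> real ^ 'j ^ 'j \<Rightarrow> real ^ ('n + 'd) \<Rightarrow> real ^ 'd ^ 'n \<Rightarrow> real" where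
  "qcost e A c X = (c v* Zmat X) \<bullet> multiplier e A c X"

lemma Pmat_multiplier: "pos_def (Pmat e A X) \<Longrightarrow> Pmat e A X *v multiplier e A c X = c v* Zmat X"
  by (simp add: multiplier_def matrix_vector_mul_assoc matrix_inv_right pos_def_invertible)

lemma qcost_alt: "pos_def (Pmat e A X) \<Longrightarrow>
    qcost e A c X = 2 * (multiplier e A c X \<bullet> (c v* Zmat X)) - multiplier e A c X \<bullet> (Pmat e A X *v multiplier e A c X)"
  by (simp add: qcost_def Pmat_multiplier inner_commute)

text \<open>Completing the square in l. The cost is thus the maximum of a concave quadratic function
  of l, attained at the multiplier as in \<open>qcost_alt\<close>; any other l gives a lower bound
  free of inverses. Both the comparison of different \<Sigma> and the first-order condition rest on
  this.\<close>

lemma qcost_ge: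
  assumes P: "pos_def (Pmat e A X)"
  shows "2 * (l \<bullet> (c v* Zmat X)) - l \<bullet> (Pmat e A X *v l) \<le> qcost e A c X"
proof -
  let ?P = "Pmat e A X" and ?m = "multiplier e A c X"
  have "0 \<le> (l - ?m) \<bullet> (?P *v (l - ?m))" by (rule pos_def_nonneg[OF P])
  also have "\<dots> = l \<bullet> (?P *v l) - 2 * (l \<bullet> (c v* Zmat X)) + qcost e A c X"
    using P symmetric_inner[of ?P ?m l]
    by (simp add: matrix_vector_mult_diff_distrib inner_diff_left inner_diff_right Pmat_multiplier[OF P] qcost_def inner_commute pos_def_def)
  finally show ?thesis by simp
qed

text \<open>The excess cost of D over the optimum is the square of its distance from the optimal
  correction \<open>A *v ?u\<close>, measured in the metric of \<open>matrix_inv A\<close>.\<close>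

lemma feasible_cost_ge:
  assumes A: "pos_def A" and e: "inj e" and P: "pos_def (Pmat e A X)"
    and D: "\<forall>s. s \<notin> range e \<longrightarrow> D $ s = 0" "(c - D) v* Zmat X = 0"
  shows "qcost e A c X \<le> (norm (inv_sqrt A *v subrows e D))\<^sup>2"
proof -
  let ?l = "multiplier e A c X"
  let ?u = "subrows e (Zmat X *v ?l)" and ?d = "subrows e D"
  have y: "c v* Zmat X = D v* Zmat X" using D(2) by (simp add: vector_matrix_diff)
  have AA: "A *v (matrix_inv A *v x) = x" "matrix_inv A *v (A *v x) = x" for x
    by (simp_all add: matrix_vector_mul_assoc matrix_inv_right matrix_inv_left pos_def_invertible[OF A])
  have sym: "(matrix_inv A *v x) \<bullet> y = x \<bullet> (matrix_inv A *v y)" for x y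
    using pos_def_matrix_inv[OF A] by (simp add: pos_def_def symmetric_inner)
  have "?u \<bullet> (A *v ?u) = qcost e A c X"
    unfolding pad_inner[symmetric] Pmat_inner[symmetric] Pmat_multiplier[OF P] qcost_def by (rule inner_commute)
  moreover have "?d \<bullet> ?u = qcost e A c X"
    using supported_inner[OF e D(1), of "Zmat X *v ?l"] by (simp add: qcost_def y dot_lmul_matrix)
  moreover have "0 \<le> (?d - A *v ?u) \<bullet> (matrix_inv A *v (?d - A *v ?u))"
    by (rule pos_def_nonneg[OF pos_def_matrix_inv[OF A]])
  moreover have "(?d - A *v ?u) \<bullet> (matrix_inv A *v (?d - A *v ?u)) =
      ?d \<bullet> (matrix_inv A *v ?d) - 2 * (?d \<bullet> ?u) + ?u \<bullet> (A *v ?u)"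
    using sym[of "A *v ?u" ?d]
    by (simp add: matrix_vector_mult_diff_distrib inner_diff_left inner_diff_right AA inner_commute)
  ultimately show ?thesis by (simp add: norm_inv_sqrt_square[OF A])
qed

lemma optimal_correction:
  fixes X :: "real ^ 'd::finite ^ 'n::finite" and c :: "real ^ ('n + 'd)"
  assumes A: "pos_def A" and e: "inj e" and P: "pos_def (Pmat e A X)"
  defines "D \<equiv> pad e A *v (Zmat X *v multiplier e A c X)"
  shows "\<And>s. s \<notin> range e \<Longrightarrow> D $ s = 0" "(c - D) v* Zmat X = 0" "(norm (inv_sqrt A *v subrows e D))\<^sup>2 = qcost e A c X"
proof -
  let ?l = "multiplier e A c X"
  let ?u = "subrows e (Zmat X *v ?l)"
  show "D $ s = 0" if "s \<notin> range e" for s unfolding D_def pad_mult by (rule sel_vector_component(2)[OF e that])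
  show "(c - D) v* Zmat X = 0"
    using Pmat_multiplier[OF P, of c] by (simp add: vector_matrix_diff D_def Pmat_mult)
  have u: "subrows e D = A *v ?u" by (simp add: D_def pad_mult subrows_sel[OF e])
  have "matrix_inv A *v (A *v ?u) = ?u"
    by (simp add: matrix_vector_mul_assoc matrix_inv_left pos_def_invertible[OF A])
  then have "(norm (inv_sqrt A *v subrows e D))\<^sup>2 = (A *v ?u) \<bullet> ?u"
    by (simp only: u norm_inv_sqrt_square[OF A])
  also have "\<dots> = qcost e A c X"
    unfolding inner_commute[of "A *v ?u"] pad_inner[symmetric] Pmat_inner[symmetric] Pmat_multiplier[OF P] qcost_def by (rule inner_commute)
  finally show "(norm (inv_sqrt A *v subrows e D))\<^sup>2 = qcost e A c X" .
qed

lemma full_rank_iff: "rank (subrows e (Zmat X)) = CARD('d) \<longleftrightarrow> (\<forall>w. w \<noteq> 0 \<longrightarrow> subrows e (Zmat X *v w) \<noteq> 0)"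
  for X :: "real ^ 'd::finite ^ 'n::finite"
  unfolding full_rank_injective linear_injective_0[OF matrix_vector_mul_linear] subrows_mult by blast

lemma feasible_iff: "(upper c' v* X = lower c') \<longleftrightarrow> c' v* Zmat X = 0" for X :: "real ^ 'd::finite ^ 'n::finite"
  by (simp add: vector_Zmat)

text \<open>For fixed X neither the constraint nor the objective couples different rows, so the
  corrections can be optimized row by row. The optimum is attained for every admissible X, which
  makes the reduced problem equivalent and not merely a bound.\<close>

theorem ewtls_solution_iff:
  fixes X :: "real ^ 'd::finite ^ 'n::finite"
  assumes A: "\<And>i. pos_def (Sig i)" and e: "bij_betw e UNIV J"
  shows "ewtls_solution J e Sig m C X \<longleftrightarrow> rank (subrows e (Zmat X)) = CARD('d) \<and>
    (\<forall>X' :: real ^ 'd ^ 'n. rank (subrows e (Zmat X')) = CARD('d) \<longrightarrow>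
      (\<Sum>i<m. qcost e (Sig i) (C i) X) \<le> (\<Sum>i<m. qcost e (Sig i) (C i) X'))"
proof -
  have inj: "inj e" and J: "range e = J" using e by (auto simp: bij_betw_def)
  define D where "D X i = pad e (Sig i) *v (Zmat X *v multiplier e (Sig i) (C i) X)" for X :: "real ^ 'd ^ 'n" and i
  have P: "pos_def (Pmat e (Sig i) X)" if "rank (subrows e (Zmat X)) = CARD('d)" for X :: "real ^ 'd ^ 'n" and i
    using that unfolding full_rank_iff by (intro Pmat_pos_def A) auto
  have feas: "ewtls_feasible J e m C X (D X)" if r: "rank (subrows e (Zmat X)) = CARD('d)" for X :: "real ^ 'd ^ 'n"
    unfolding ewtls_feasible_def feasible_iff D_def
    using optimal_correction(1,2)[OF A inj P[OF r]] r J by auto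
  have obj: "ewtls_objective e Sig m (D X) = (\<Sum>i<m. qcost e (Sig i) (C i) X)"
    if r: "rank (subrows e (Zmat X)) = CARD('d)" for X :: "real ^ 'd ^ 'n"
    unfolding ewtls_objective_def D_def using optimal_correction(3)[OF A inj P[OF r]] by simp
  have ge: "(\<Sum>i<m. qcost e (Sig i) (C i) X) \<le> ewtls_objective e Sig m D'"
    if f: "ewtls_feasible J e m C X D'" for X :: "real ^ 'd ^ 'n" and D'
  proof -
    from f have r: "rank (subrows e (Zmat X)) = CARD('d)" by (simp add: ewtls_feasible_def)
    show ?thesis unfolding ewtls_objective_def
    proof (rule sum_mono)
      fix i assume "i \<in> {..<m}"
      then show "qcost e (Sig i) (C i) X \<le> (norm (inv_sqrt (Sig i) *v subrows e (D' i)))\<^sup>2"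
        using f J by (intro feasible_cost_ge[OF A inj P[OF r]]) (auto simp: ewtls_feasible_def feasible_iff)
    qed
  qed
  show ?thesis
  proof
    assume "ewtls_solution J e Sig m C X"
    then obtain D' where D': "ewtls_feasible J e m C X D'"
      and opt: "\<And>X' D''. ewtls_feasible J e m C X' D'' \<Longrightarrow> ewtls_objective e Sig m D' \<le> ewtls_objective e Sig m D''"
      unfolding ewtls_solution_def by blast
    have "(\<Sum>i<m. qcost e (Sig i) (C i) X) \<le> (\<Sum>i<m. qcost e (Sig i) (C i) X')"
      if "rank (subrows e (Zmat X')) = CARD('d)" for X' :: "real ^ 'd ^ 'n"
      using ge[OF D'] opt[OF feas[OF that]] obj[OF that] by simp
    then show "rank (subrows e (Zmat X)) = CARD('d) \<and>
      (\<forall>X' :: real ^ 'd ^ 'n. rank (subrows e (Zmat X')) = CARD('d) \<longrightarrow>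
        (\<Sum>i<m. qcost e (Sig i) (C i) X) \<le> (\<Sum>i<m. qcost e (Sig i) (C i) X'))"
      using D' by (simp add: ewtls_feasible_def)
  next
    assume R: "rank (subrows e (Zmat X)) = CARD('d) \<and>
      (\<forall>X' :: real ^ 'd ^ 'n. rank (subrows e (Zmat X')) = CARD('d) \<longrightarrow>
        (\<Sum>i<m. qcost e (Sig i) (C i) X) \<le> (\<Sum>i<m. qcost e (Sig i) (C i) X'))"
    show "ewtls_solution J e Sig m C X" unfolding ewtls_solution_def
    proof (intro exI conjI allI impI)
      show "ewtls_feasible J e m C X (D X)" using R feas by blast
      fix X' D' assume f: "ewtls_feasible J e m C X' D'"
      then have "rank (subrows e (Zmat X')) = CARD('d)" by (simp add: ewtls_feasible_def)
      with R have "(\<Sum>i<m. qcost e (Sig i) (C i) X) \<le> (\<Sum>i<m. qcost e (Sig i) (C i) X')" by blast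
      with ge[OF f] obj R show "ewtls_objective e Sig m (D X) \<le> ewtls_objective e Sig m D'" by simp
    qed
  qed
qed

subsection \<open>First-order condition\<close>

lemma norm_matrix_le:
  fixes A :: "real ^ 'n::finite ^ 'm::finite"
  assumes "\<And>w. norm (A *v w) \<le> b * norm w" "b \<ge> 0"
  shows "norm A \<le> b * CARD('m)"
proof -
  have row: "norm (A $ i) \<le> b" for i
  proof (cases "A $ i = 0")
    case False
    have "norm (A $ i) * norm (A $ i) = (A *v (A $ i)) $ i"
      by (simp add: matrix_vector_mul_component power2_norm_eq_inner[symmetric] power2_eq_square)
    also have "\<dots> \<le> norm (A *v (A $ i))" using component_le_norm_cart[of "A *v (A $ i)" i] by linarith
    also have "\<dots> \<le> b * norm (A $ i)" by (rule assms)
    finally show ?thesis using False by simp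
  qed (use assms in simp)
  have "norm A \<le> (\<Sum>i\<in>UNIV. norm (A $ i))" unfolding norm_vec_def by (rule L2_set_le_sum) simp
  also have "\<dots> \<le> (\<Sum>i\<in>(UNIV::'m set). b)" by (intro sum_mono row)
  finally show ?thesis by (simp add: mult.commute)
qed

lemma bounded_linear_vector_matrix: "bounded_linear (\<lambda>X :: real ^ 'd::finite ^ 'n::finite. u v* X)"
  unfolding linear_conv_bounded_linear[symmetric]
  by (rule linearI) (simp_all add: vec_eq_iff vector_matrix_mult_def distrib_left distrib_right sum.distrib sum_distrib_left mult_ac)

lemma bounded_linear_Zmat_part:
  "bounded_linear (\<lambda>X :: real ^ 'd::finite ^ 'n::finite. stack X (0 :: real ^ 'd ^ 'd))"
  unfolding linear_conv_bounded_linear[symmetric]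
  by (rule linearI) (auto simp: vec_eq_iff stack_def split: sum.split)

lemma Zmat_eq: "Zmat X = stack X 0 + stack 0 (- mat 1)" for X :: "real ^ 'd::finite ^ 'n::finite"
  by (auto simp: vec_eq_iff Zmat_def stack_def split: sum.split)

lemma bounded_linear_transpose: "bounded_linear (transpose :: real ^ 'n::finite ^ 'm::finite \<Rightarrow> real ^ 'm ^ 'n)"
  unfolding linear_conv_bounded_linear[symmetric] by (rule linearI) (simp_all add: vec_eq_iff transpose_def)

lemma outer_mult: "outer x y *v z = (y \<bullet> z) *\<^sub>R x"
  by (simp add: vec_eq_iff outer_def matrix_vector_mult_def inner_vec_def sum_distrib_right mult_ac sum_distrib_left)

lemma inner_outer: "E \<bullet> outer x y = x \<bullet> (E *v y)"
  by (simp add: inner_vec_def outer_def matrix_vector_mult_def sum_distrib_left mult_ac)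

text \<open>The deterministic side of the argument: no probability enters, and k will be the square
  of \<kappa>.\<close>

locale ewtls_setting =
  fixes e :: "'j::finite \<Rightarrow> 'n::finite + 'd::finite" and X0 :: "real ^ 'd ^ 'n"
    and Sig :: "nat \<Rightarrow> real ^ 'j ^ 'j" and Siginf :: "real ^ 'j ^ 'j" and k :: real
  assumes inj: "inj e" and rank0: "rank (subrows e (Zmat X0)) = CARD('d)"
    and k: "k > 0" and sym: "\<And>i. transpose (Sig i) = Sig i"
    and lower: "\<And>i x. k * (norm x)\<^sup>2 \<le> x \<bullet> (Sig i *v x)"
    and lim: "Sig \<longlonglongrightarrow> Siginf"
begin

text \<open>A bounded set containing all the \<open>Sig i\<close> together with their limit;
  constants valid on it are uniform in i.\<close>

definition V where "V = insert Siginf (range Sig)"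

lemma sym_inf: "transpose Siginf = Siginf"
proof -
  have "(\<lambda>i. transpose (Sig i)) \<longlonglongrightarrow> transpose Siginf"
    by (rule bounded_linear.tendsto[OF bounded_linear_transpose lim])
  then show ?thesis using lim LIMSEQ_unique by (simp add: sym)
qed

lemma lower_inf: "k * (norm x)\<^sup>2 \<le> x \<bullet> (Siginf *v x)"
proof -
  have "(\<lambda>i. x \<bullet> (Sig i *v x)) \<longlonglongrightarrow> x \<bullet> (Siginf *v x)"
    by (intro tendsto_intros bounded_bilinear.tendsto[OF bounded_bilinear_matrix_vector_mult] lim)
  then show ?thesis by (rule LIMSEQ_le_const) (use lower in auto)
qed

lemma V_lower: "A \<in> V \<Longrightarrow> k * (norm x)\<^sup>2 \<le> x \<bullet> (A *v x)" and V_sym: "A \<in> V \<Longrightarrow> transpose A = A"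
  using lower lower_inf sym sym_inf by (auto simp: V_def)

lemma V_pos_def: "A \<in> V \<Longrightarrow> pos_def A"
  unfolding pos_def_def using V_lower V_sym k by (metis mult_pos_pos zero_less_norm_iff zero_less_power order_less_le_trans)

lemma V_bounded: "bounded V"
  unfolding V_def bounded_insert using lim by (rule convergent_imp_bounded)

lemma Sig_V: "Sig i \<in> V" and Siginf_V: "Siginf \<in> V" by (auto simp: V_def)

text \<open>Injectivity with a quantitative bound is an open condition: within radius b / (2K) the
  perturbation uses up at most half of the lower bound b valid at X0.\<close>

lemma rank_neighbourhood:
  obtains c \<rho> where "c > 0" "\<rho> > 0" "\<And>X w. X \<in> cball X0 \<rho> \<Longrightarrow> c * norm w \<le> norm (subrows e (Zmat X *v w))"
proof -
  have "inj ((*v) (subrows e (Zmat X0)))" using rank0 full_rank_injective by blast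
  then obtain b where b: "b > 0" "\<And>w. b * norm w \<le> norm (subrows e (Zmat X0) *v w)"
    using linear_inj_bounded_below_pos[of "(*v) (subrows e (Zmat X0))"] by auto
  obtain K where K: "K > 0" "\<And>(A :: real ^ 'd ^ 'n) w. norm (A *v w) \<le> norm A * norm w * K"
    using bounded_bilinear.pos_bounded[OF bounded_bilinear_matrix_vector_mult] by blast
  have sub: "norm (subrows e (stack v 0)) \<le> norm v" for v :: "real ^ 'n"
  proof -
    let ?s = "stack v 0 :: real ^ ('n + 'd)"
    let ?u = "subrows e ?s"
    have "norm ?u * norm ?u = (?u v* sel e) \<bullet> ?s"
      by (simp add: dot_lmul_matrix sel_mult power2_norm_eq_inner[symmetric] power2_eq_square)
    also have "\<dots> \<le> norm (?u v* sel e) * norm ?s" by (rule norm_cauchy_schwarz)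
    also have "norm (?u v* sel e) = norm ?u"
      by (simp add: norm_eq_sqrt_inner dot_lmul_matrix sel_mult subrows_sel[OF inj])
    also have "norm ?s = norm v" by (simp add: norm_eq_sqrt_inner inner_upper_lower)
    finally show ?thesis by (cases "norm ?u = 0") auto
  qed
  show thesis
  proof
    show "b / 2 > 0" "b / (2 * K) > 0" using b K by auto
    fix X w assume X: "X \<in> cball X0 (b / (2 * K))"
    have "norm ((X - X0) *v w) \<le> norm (X - X0) * norm w * K" by (rule K)
    also have "\<dots> \<le> b / (2 * K) * norm w * K" using X K by (intro mult_right_mono) (auto simp: dist_norm norm_minus_commute)
    also have "\<dots> = b / 2 * norm w" using K by simp
    finally have 1: "norm (subrows e (stack ((X - X0) *v w) 0)) \<le> b / 2 * norm w" using sub order_trans by blast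
    have "subrows e (Zmat X *v w) = subrows e (Zmat X0 *v w) + subrows e (stack ((X - X0) *v w) 0)"
      using Zmat_add[of X0 "X - X0" w] by (simp add: subrows_add)
    then have "norm (subrows e (Zmat X0 *v w)) \<le> norm (subrows e (Zmat X *v w)) + norm (subrows e (stack ((X - X0) *v w) 0))"
      by (metis add_diff_cancel_right' norm_triangle_ineq4)
    with 1 b(2)[of w] show "b / 2 * norm w \<le> norm (subrows e (Zmat X *v w))" by (simp add: subrows_mult)
  qed
qed

text \<open>The first component is the lower bound for the J-rows of Z, the second the radius on
  which it holds. Fixing one choice lets all later constants refer to the same ball.\<close>

definition nbhd :: "real \<times> real" where
  "nbhd = (SOME p. fst p > 0 \<and> snd p > 0 \<and> (\<forall>X w. X \<in> cball X0 (snd p) \<longrightarrow> fst p * norm w \<le> norm (subrows e (Zmat X *v w))))"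

definition U where "U = cball X0 (snd nbhd)"

lemma nbhd: "fst nbhd > 0" "snd nbhd > 0" "X \<in> U \<Longrightarrow> fst nbhd * norm w \<le> norm (subrows e (Zmat X *v w))"
proof -
  obtain c \<rho> where "c > 0" "\<rho> > 0" "\<And>X w. X \<in> cball X0 \<rho> \<Longrightarrow> c * norm w \<le> norm (subrows e (Zmat X *v w))"
    using rank_neighbourhood by blast
  then have "\<exists>p. fst p > 0 \<and> snd p > 0 \<and> (\<forall>X w. X \<in> cball X0 (snd p) \<longrightarrow> fst p * norm w \<le> norm (subrows e (Zmat X *v w)))"
    by (intro exI[of _ "(c, \<rho>)"]) auto
  from someI_ex[OF this] show "fst nbhd > 0" "snd nbhd > 0" "X \<in> U \<Longrightarrow> fst nbhd * norm w \<le> norm (subrows e (Zmat X *v w))"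
    unfolding nbhd_def[symmetric] U_def by blast+
qed

lemma X0_U: "X0 \<in> U" using nbhd(2) by (simp add: U_def)

lemma U_nonzero: "X \<in> U \<Longrightarrow> w \<noteq> 0 \<Longrightarrow> subrows e (Zmat X *v w) \<noteq> 0"
  using nbhd(3)[of X w] nbhd(1) by (metis mult_pos_pos norm_zero not_less zero_less_norm_iff)

lemma U_rank: "X \<in> U \<Longrightarrow> rank (subrows e (Zmat X)) = CARD('d)"
  unfolding full_rank_iff using U_nonzero by blast

lemma rank_Pmat: "rank (subrows e (Zmat X)) = CARD('d) \<Longrightarrow> A \<in> V \<Longrightarrow> pos_def (Pmat e A X)" for X :: "real ^ 'd ^ 'n"
  unfolding full_rank_iff by (intro Pmat_pos_def V_pos_def) auto

lemma U_Pmat: "X \<in> U \<Longrightarrow> A \<in> V \<Longrightarrow> pos_def (Pmat e A X)"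
  by (intro rank_Pmat U_rank)

lemma U_Pmat_lower: "X \<in> U \<Longrightarrow> A \<in> V \<Longrightarrow> k * (fst nbhd)\<^sup>2 * (norm w)\<^sup>2 \<le> w \<bullet> (Pmat e A X *v w)"
proof -
  assume X: "X \<in> U" and A: "A \<in> V"
  have "(fst nbhd * norm w)\<^sup>2 \<le> (norm (subrows e (Zmat X *v w)))\<^sup>2"
    using nbhd(3)[OF X, of w] nbhd(1) by (intro power_mono) auto
  then have "k * (fst nbhd)\<^sup>2 * (norm w)\<^sup>2 \<le> k * (norm (subrows e (Zmat X *v w)))\<^sup>2"
    using k by (simp add: power_mult_distrib mult.assoc)
  also have "\<dots> \<le> w \<bullet> (Pmat e A X *v w)" unfolding Pmat_inner pad_inner by (rule V_lower[OF A])
  finally show ?thesis .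
qed

lemma U_inverse_bounded:
  assumes "X \<in> U" "A \<in> V"
  shows "norm (matrix_inv (Pmat e A X)) \<le> 1 / (k * (fst nbhd)\<^sup>2) * CARD('d)"
proof (rule norm_matrix_le)
  define c where "c = k * (fst nbhd)\<^sup>2"
  have c: "c > 0" using k nbhd(1) by (simp add: c_def)
  show "norm (matrix_inv (Pmat e A X) *v w) \<le> 1 / (k * (fst nbhd)\<^sup>2) * norm w" for w
  proof -
    let ?v = "matrix_inv (Pmat e A X) *v w"
    have Pv: "Pmat e A X *v ?v = w"
      by (simp add: matrix_vector_mul_assoc matrix_inv_right pos_def_invertible U_Pmat assms)
    have "c * (norm ?v)\<^sup>2 \<le> ?v \<bullet> (Pmat e A X *v ?v)" unfolding c_def by (rule U_Pmat_lower[OF assms])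
    also have "\<dots> \<le> norm ?v * norm w" unfolding Pv by (rule norm_cauchy_schwarz)
    finally have "(c * norm ?v) * norm ?v \<le> norm w * norm ?v" by (simp add: power2_eq_square mult_ac)
    then have "c * norm ?v \<le> norm w" by (cases "?v = 0") auto
    then show ?thesis using c unfolding c_def[symmetric] by (simp add: field_simps)
  qed
  show "1 / (k * (fst nbhd)\<^sup>2) \<ge> 0" using c unfolding c_def by simp
qed

lemma mixed_lipschitz_Zmat: "mixed_lipschitz U V (\<lambda>X _. Zmat X)"
  unfolding Zmat_eq
  by (intro mixed_lipschitz_add mixed_lipschitz_const mixed_lipschitz_linear[OF bounded_linear_Zmat_part] mixed_lipschitz_fst)
    (simp add: U_def)

lemmas mixed_lipschitz_mult = mixed_lipschitz_bilinear[OF bounded_bilinear_matrix_mult]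

lemma mixed_lipschitz_pad: "mixed_lipschitz U V (\<lambda>_ A. pad e A)"
  unfolding pad_def by (intro mixed_lipschitz_mult mixed_lipschitz_const mixed_lipschitz_snd V_bounded)

lemma mixed_lipschitz_Pmat: "mixed_lipschitz U V (\<lambda>X A. Pmat e A X)"
  unfolding Pmat_def
  by (intro mixed_lipschitz_mult mixed_lipschitz_pad mixed_lipschitz_Zmat mixed_lipschitz_linear[OF bounded_linear_transpose])

lemma mixed_lipschitz_inverse: "mixed_lipschitz U V (\<lambda>X A. matrix_inv (Pmat e A X))"
  by (rule mixed_lipschitz_matrix_inv[OF mixed_lipschitz_Pmat pos_def_invertible[OF U_Pmat] U_inverse_bounded])

lemma continuous_multiplier:
  assumes A: "A \<in> V"
  shows "continuous_on U (multiplier e A c)"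
proof -
  obtain C where "mixed_lipschitz_with C U V (\<lambda>X A. matrix_inv (Pmat e A X))"
    using mixed_lipschitz_inverse by (auto simp: mixed_lipschitz_def)
  note C = mixed_lipschitz_withD(1,3)[OF this]
  have "continuous_on U (\<lambda>X. matrix_inv (Pmat e A X))"
    by (rule lipschitz_on_continuous_on) (rule lipschitz_onI[of U _ C], use C A in \<open>auto simp: dist_norm\<close>)
  moreover have "continuous_on U (\<lambda>X :: real ^ 'd ^ 'n. c v* Zmat X)"
    unfolding vector_Zmat by (intro continuous_intros linear_continuous_on bounded_linear_vector_matrix)
  ultimately show ?thesis unfolding multiplier_def[abs_def]
    by (rule bounded_bilinear.continuous_on[OF bounded_bilinear_matrix_vector_mult])
qed

lemma continuous_qcost:
  assumes A: "A \<in> V"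
  shows "continuous_on U (qcost e A c)"
proof -
  have "continuous_on U (\<lambda>X :: real ^ 'd ^ 'n. c v* Zmat X)"
    unfolding vector_Zmat by (intro continuous_intros linear_continuous_on bounded_linear_vector_matrix)
  then show ?thesis unfolding qcost_def[abs_def] by (intro continuous_intros continuous_multiplier A)
qed

lemma first_order_condition:
  assumes X: "X \<in> ball X0 (snd nbhd)"
    and opt: "\<And>X'. X' \<in> U \<Longrightarrow> (\<Sum>i<m. qcost e (Sig i) (c i) X) \<le> (\<Sum>i<m. qcost e (Sig i) (c i) X')"
  shows "(\<Sum>i<m. outer (upper (c i - pad e (Sig i) *v (Zmat X *v multiplier e (Sig i) (c i) X))) (multiplier e (Sig i) (c i) X)) = 0"
proof -
  define r where "r i X' = upper (c i - pad e (Sig i) *v (Zmat X *v multiplier e (Sig i) (c i) X'))" for i X'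
  define l where "l i = multiplier e (Sig i) (c i)" for i
  have XU: "X \<in> U" using X by (auto simp: U_def)
  have pos: "0 \<le> (\<Sum>i<m. (E *v l i X) \<bullet> r i X)" for E
  proof -
    define f where "f X' = (\<Sum>i<m. (E *v l i X') \<bullet> r i X')" for X'
    have "continuous_on (ball X0 (snd nbhd)) (l i)" for i
      unfolding l_def by (rule continuous_on_subset[OF continuous_multiplier[OF Sig_V]]) (auto simp: U_def)
    then have lc: "isCont (l i) X" for i using X by (simp add: continuous_on_eq_continuous_at)
    have bl: "bounded_linear (upper :: real ^ ('n + 'd) \<Rightarrow> real ^ 'n)"
      unfolding linear_conv_bounded_linear[symmetric] by (rule linearI) (simp_all add: vec_eq_iff upper_def)
    have rc: "isCont (r i) X" for i
      unfolding r_def[abs_def] l_def[symmetric]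
      by (intro bounded_linear.isCont[OF bl] bounded_linear.isCont[OF matrix_vector_mul_bounded_linear] continuous_diff continuous_const lc)
    have fc: "isCont f X" unfolding f_def[abs_def]
      by (intro continuous_sum continuous_inner bounded_linear.isCont[OF matrix_vector_mul_bounded_linear] lc rc)
    \<comment> \<open>One-sided limits suffice: 2 t f (X + t E) dominates the increment of the cost,
      which is nonnegative, so f X is nonnegative by continuity for every direction E.\<close>
    have "((\<lambda>t. X + t *\<^sub>R E) \<longlongrightarrow> X + 0 *\<^sub>R E) (at_right 0)" by (intro tendsto_intros)
    then have Xt: "((\<lambda>t. X + t *\<^sub>R E) \<longlongrightarrow> X) (at_right 0)" by simp
    have "\<forall>\<^sub>F t in at_right 0. X + t *\<^sub>R E \<in> ball X0 (snd nbhd)"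
      by (rule topological_tendstoD[OF Xt]) (use X in auto)
    moreover have "\<forall>\<^sub>F t :: real in at_right 0. t > 0" by (simp add: eventually_at_right_less)
    ultimately have "\<forall>\<^sub>F t in at_right 0. 0 \<le> f (X + t *\<^sub>R E)"
    proof eventually_elim
      case (elim t)
      let ?X = "X + t *\<^sub>R E"
      have U': "?X \<in> U" using elim(1) by (auto simp: U_def)
      \<comment> \<open>Envelope argument: \<open>?l\<close> is optimal at the perturbed point and
        merely admissible at X. The term quadratic in t enters with a minus sign and is
        dropped.\<close>
      have term_le: "qcost e (Sig i) (c i) ?X - qcost e (Sig i) (c i) X \<le> 2 * t * ((E *v l i ?X) \<bullet> r i ?X)" for i
      proof -
        let ?l = "l i ?X" and ?S = "pad e (Sig i)"
        let ?z = "Zmat X *v ?l" and ?d = "stack (E *v ?l) 0 :: real ^ ('n + 'd)"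
        have symS: "(?S *v x) \<bullet> y = x \<bullet> (?S *v y)" for x y by (rule symmetric_inner[OF transpose_pad[OF sym]])
        have Z: "Zmat ?X *v ?l = ?z + t *\<^sub>R ?d"
          unfolding Zmat_add by (simp add: vec_eq_iff stack_def scaleR_matrix_vector_assoc[symmetric] split: sum.split)
        have gen: "q' - q0 \<le> 2 * t * er"
          if "q' = 2 * L1' - L2'" "2 * L1 - L2 \<le> q0" "L1' = L1 + t * e1" "L2' = L2 + 2 * t * e2 + D" "0 \<le> D" "er = e1 - e2"
          for q' q0 er L1 L1' L2 L2' e1 e2 D :: real
          using that(1,2,5) unfolding that(3,4,6) by (simp add: algebra_simps)
        have f1: "qcost e (Sig i) (c i) ?X = 2 * (?l \<bullet> (c i v* Zmat ?X)) - ?l \<bullet> (Pmat e (Sig i) ?X *v ?l)"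
          unfolding l_def by (rule qcost_alt[OF U_Pmat[OF U' Sig_V]])
        have f2: "2 * (?l \<bullet> (c i v* Zmat X)) - ?l \<bullet> (Pmat e (Sig i) X *v ?l) \<le> qcost e (Sig i) (c i) X"
          by (rule qcost_ge[OF U_Pmat[OF XU Sig_V]])
        have f3: "?l \<bullet> (c i v* Zmat ?X) = ?l \<bullet> (c i v* Zmat X) + t * ((E *v ?l) \<bullet> upper (c i))"
          unfolding inner_commute[of ?l] dot_lmul_matrix Z
          by (simp add: inner_add_right inner_upper_lower[of _ ?d] inner_commute)
        have f4: "?l \<bullet> (Pmat e (Sig i) ?X *v ?l) = ?l \<bullet> (Pmat e (Sig i) X *v ?l) + 2 * t * ((E *v ?l) \<bullet> upper (?S *v ?z)) + t\<^sup>2 * (?d \<bullet> (?S *v ?d))"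
        proof -
          have "?d \<bullet> (?S *v ?z) = (E *v ?l) \<bullet> upper (?S *v ?z)" by (simp add: inner_upper_lower)
          moreover have "?z \<bullet> (?S *v ?d) = ?d \<bullet> (?S *v ?z)" using symS[of ?z ?d] by (simp add: inner_commute)
          ultimately show ?thesis unfolding Pmat_inner Z
            by (simp add: matrix_vector_right_distrib matrix_vector_mult_scaleR inner_add_left inner_add_right power2_eq_square algebra_simps)
        qed
        have f5: "0 \<le> t\<^sup>2 * (?d \<bullet> (?S *v ?d))"
          unfolding pad_inner by (intro mult_nonneg_nonneg pos_def_nonneg V_pos_def Sig_V) simp
        have f6: "(E *v ?l) \<bullet> r i ?X = (E *v ?l) \<bullet> upper (c i) - (E *v ?l) \<bullet> upper (?S *v ?z)"
          unfolding r_def l_def[symmetric] by (simp add: linear_diff[OF bounded_linear.linear[OF bl]] inner_diff_right)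
        show ?thesis by (rule gen[OF f1 f2 f3 f4 f5 f6])
      qed
      have "0 \<le> (\<Sum>i<m. qcost e (Sig i) (c i) ?X) - (\<Sum>i<m. qcost e (Sig i) (c i) X)" using opt[OF U'] by simp
      also have "\<dots> \<le> (\<Sum>i<m. 2 * t * ((E *v l i ?X) \<bullet> r i ?X))"
        unfolding sum_subtractf[symmetric] by (intro sum_mono term_le)
      also have "\<dots> = 2 * t * f ?X" by (simp add: f_def sum_distrib_left)
      finally show ?case using elim(2) by (simp add: zero_le_mult_iff)
    qed
    moreover have "((\<lambda>t. f (X + t *\<^sub>R E)) \<longlongrightarrow> f X) (at_right 0)"
      by (rule isCont_tendsto_compose[OF fc Xt])
    ultimately have "0 \<le> f X" by (intro tendsto_lowerbound) auto
    then show ?thesis by (simp add: f_def)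
  qed
  define T where "T = (\<Sum>i<m. outer (r i X) (l i X))"
  have eq: "(\<Sum>i<m. (E *v l i X) \<bullet> r i X) = E \<bullet> T" for E
    by (simp add: T_def inner_sum_right inner_outer inner_commute)
  \<comment> \<open>The linear form given by T is nonnegative in every direction; the direction -T
    shows that T = 0.\<close>
  have "0 \<le> (- T) \<bullet> T" using pos[of "- T"] unfolding eq .
  then have "T \<bullet> T = 0" using inner_ge_zero[of T] by simp
  then show ?thesis by (simp add: T_def r_def l_def)
qed

end

subsection \<open>Averages and convergence in probability\<close>

text \<open>Beyond some n the weights are below e, and the first n terms are a constant divided by
  m. This is how \<open>Sig i\<close> tending to \<open>Siginf\<close> is exploited throughout: no
  rate is involved, only bounded averages of the quantities weighted.\<close>

lemma cesaro_weighted: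
  fixes d x :: "nat \<Rightarrow> real"
  assumes d: "d \<longlonglongrightarrow> 0" "\<And>i. 0 \<le> d i" and x: "\<And>i. 0 \<le> x i" "\<And>m. 1 / real m * (\<Sum>i<m. x i) \<le> B"
  shows "(\<lambda>m. 1 / real m * (\<Sum>i<m. d i * x i)) \<longlonglongrightarrow> 0"
proof (rule LIMSEQ_I)
  fix r :: real assume r: "r > 0"
  \<comment> \<open>At m = 0 the average is 0 because 1 / 0 = 0.\<close>
  have B: "B \<ge> 0" using x(2)[of 0] by simp
  define e where "e = r / (2 * (B + 1))"
  have e: "e > 0" using r B by (simp add: e_def)
  obtain n where n: "\<And>i. i \<ge> n \<Longrightarrow> d i < e"
    using order_tendstoD(2)[OF d(1) e] by (auto simp: eventually_sequentially)
  define c where "c = (\<Sum>i<n. d i * x i)"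
  have c: "c \<ge> 0" unfolding c_def using d x by (intro sum_nonneg) auto
  have bound: "(\<Sum>i<m. d i * x i) \<le> c + e * (\<Sum>i<m. x i)" for m
  proof -
    have "(\<Sum>i<m. d i * x i) \<le> (\<Sum>i<m. (if i < n then d i * x i else 0) + e * x i)"
      using less_imp_le[OF n] d x e by (intro sum_mono) (auto simp: not_less intro!: mult_right_mono)
    also have "\<dots> = (\<Sum>i<m. if i < n then d i * x i else 0) + e * (\<Sum>i<m. x i)"
      by (simp add: sum.distrib sum_distrib_left)
    also have "(\<Sum>i<m. if i < n then d i * x i else 0) = (\<Sum>i\<in>{..<m} \<inter> {..<n}. d i * x i)"
      by (simp add: sum.inter_restrict) 
    also have "\<dots> \<le> c" unfolding c_def using d x by (intro sum_mono2) auto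
    finally show ?thesis by simp
  qed
  have "(\<lambda>m. c / real m) \<longlonglongrightarrow> 0" by (rule lim_const_over_n)
  from order_tendstoD(2)[OF this, of "r/2"] r
  obtain n' where n': "\<And>m. m \<ge> n' \<Longrightarrow> c / real m < r / 2" by (auto simp: eventually_sequentially)
  have "norm (1 / real m * (\<Sum>i<m. d i * x i) - 0) < r" if m: "m \<ge> n'" for m
  proof -
    have "0 \<le> 1 / real m * (\<Sum>i<m. d i * x i)" using d x by (intro mult_nonneg_nonneg sum_nonneg) auto
    moreover have "1 / real m * (\<Sum>i<m. d i * x i) \<le> 1 / real m * (c + e * (\<Sum>i<m. x i))"
      by (intro mult_left_mono bound) simp
    moreover have "1 / real m * (c + e * (\<Sum>i<m. x i)) = c / real m + e * (1 / real m * (\<Sum>i<m. x i))"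
      by (simp add: field_simps add_divide_distrib)
    moreover have "e * (1 / real m * (\<Sum>i<m. x i)) \<le> e * B" using e by (intro mult_left_mono x) auto
    moreover have "e * B \<le> r / 2" using r B by (simp add: e_def field_simps)
    ultimately show ?thesis using n'[OF m] by simp
  qed
  then show "\<exists>no. \<forall>m\<ge>no. norm (1 / real m * (\<Sum>i<m. d i * x i) - 0) < r" by blast
qed

lemma cesaro_product:
  fixes f g :: "nat \<Rightarrow> real"
  assumes f: "f \<longlonglongrightarrow> l" and g: "(\<lambda>m. 1 / real m * (\<Sum>i<m. g i)) \<longlonglongrightarrow> h"
    and B: "\<And>m. 1 / real m * (\<Sum>i<m. \<bar>g i\<bar>) \<le> B"
  shows "(\<lambda>m. 1 / real m * (\<Sum>i<m. f i * g i)) \<longlonglongrightarrow> l * h"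
proof -
  have "(\<lambda>i. \<bar>f i - l\<bar>) \<longlonglongrightarrow> 0" using f by (simp add: LIM_zero tendsto_rabs_zero)
  from cesaro_weighted[OF this _ _ B] have 0: "(\<lambda>m. 1 / real m * (\<Sum>i<m. \<bar>f i - l\<bar> * \<bar>g i\<bar>)) \<longlonglongrightarrow> 0" by simp
  have "(\<lambda>m. 1 / real m * (\<Sum>i<m. (f i - l) * g i)) \<longlonglongrightarrow> 0"
  proof (rule Lim_null_comparison[OF always_eventually 0], rule allI)
    fix m
    have "\<bar>\<Sum>i<m. (f i - l) * g i\<bar> \<le> (\<Sum>i<m. \<bar>f i - l\<bar> * \<bar>g i\<bar>)"
      by (rule order_trans[OF sum_abs]) (simp add: abs_mult)
    then show "norm (1 / real m * (\<Sum>i<m. (f i - l) * g i)) \<le> 1 / real m * (\<Sum>i<m. \<bar>f i - l\<bar> * \<bar>g i\<bar>)"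
      by (simp add: abs_mult divide_right_mono)
  qed
  moreover have "1 / real m * (\<Sum>i<m. f i * g i) = 1 / real m * (\<Sum>i<m. (f i - l) * g i) + l * (1 / real m * (\<Sum>i<m. g i))" for m
    by (simp add: left_diff_distrib sum_subtractf sum_distrib_left[symmetric] diff_divide_distrib)
  ultimately show ?thesis using tendsto_add[OF _ tendsto_mult_left[OF g, of l]] by fastforce
qed

section \<open>Convergence to zero in probability\<close>

definition null_in_prob :: "'w measure \<Rightarrow> (nat \<Rightarrow> 'w \<Rightarrow> 'b::real_normed_vector) \<Rightarrow> bool" where
  "null_in_prob M Y \<longleftrightarrow> (\<forall>e>0. (\<lambda>m. measure M {\<omega>\<in>space M. norm (Y m \<omega>) \<ge> e}) \<longlonglongrightarrow> 0)"

context prob_space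
begin

lemma null_in_prob_L1:
  fixes Y :: "nat \<Rightarrow> 'a \<Rightarrow> 'b::euclidean_space"
  assumes int: "\<And>m. integrable M (\<lambda>\<omega>. norm (Y m \<omega>))" and lim: "(\<lambda>m. expectation (\<lambda>\<omega>. norm (Y m \<omega>))) \<longlonglongrightarrow> 0"
  shows "null_in_prob M Y"
  unfolding null_in_prob_def
proof (intro allI impI)
  fix e :: real assume e: "e > 0"
  have "(\<lambda>m. expectation (\<lambda>\<omega>. norm (Y m \<omega>)) / e) \<longlonglongrightarrow> 0 / e" using e by (intro tendsto_divide lim) auto
  then have "(\<lambda>m. expectation (\<lambda>\<omega>. norm (Y m \<omega>)) / e) \<longlonglongrightarrow> 0" by simp
  moreover have "\<forall>\<^sub>F m in sequentially. norm (prob {\<omega>\<in>space M. norm (Y m \<omega>) \<ge> e}) \<le> expectation (\<lambda>\<omega>. norm (Y m \<omega>)) / e"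
    by (intro always_eventually allI) (simp add: integral_Markov_inequality_measure[OF int sets.top _ e])
  ultimately show "(\<lambda>m. prob {\<omega>\<in>space M. norm (Y m \<omega>) \<ge> e}) \<longlonglongrightarrow> 0" by (rule Lim_null_comparison[rotated])
qed

lemma prob_norm_ge_square:
  fixes Y :: "'a \<Rightarrow> 'b::euclidean_space"
  assumes [measurable]: "Y \<in> borel_measurable M" and int: "integrable M (\<lambda>\<omega>. (norm (Y \<omega>))\<^sup>2)" and e: "e > 0"
  shows "prob {\<omega>\<in>space M. norm (Y \<omega>) \<ge> e} \<le> expectation (\<lambda>\<omega>. (norm (Y \<omega>))\<^sup>2) / e\<^sup>2"
  using second_moment_method[of "\<lambda>\<omega>. norm (Y \<omega>)" e] int e by simp

lemma null_in_prob_L2: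
  fixes Y :: "nat \<Rightarrow> 'a \<Rightarrow> 'b::euclidean_space"
  assumes [measurable]: "\<And>m. Y m \<in> borel_measurable M" and int: "\<And>m. integrable M (\<lambda>\<omega>. (norm (Y m \<omega>))\<^sup>2)"
    and bd: "\<And>m. expectation (\<lambda>\<omega>. (norm (Y m \<omega>))\<^sup>2) \<le> b m" and lim: "b \<longlonglongrightarrow> 0"
  shows "null_in_prob M Y"
  unfolding null_in_prob_def
proof (intro allI impI)
  fix e :: real assume e: "e > 0"
  have "(\<lambda>m. b m / e\<^sup>2) \<longlonglongrightarrow> 0 / e\<^sup>2" using e by (intro tendsto_divide lim) auto
  then have "(\<lambda>m. b m / e\<^sup>2) \<longlonglongrightarrow> 0" by simp
  moreover have "\<forall>\<^sub>F m in sequentially. norm (prob {\<omega>\<in>space M. norm (Y m \<omega>) \<ge> e}) \<le> b m / e\<^sup>2"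
  proof (intro always_eventually allI)
    fix m
    have "prob {\<omega>\<in>space M. norm (Y m \<omega>) \<ge> e} \<le> expectation (\<lambda>\<omega>. (norm (Y m \<omega>))\<^sup>2) / e\<^sup>2"
      by (rule prob_norm_ge_square[OF _ int e]) measurable
    also have "\<dots> \<le> b m / e\<^sup>2" by (intro divide_right_mono bd) simp
    finally show "norm (prob {\<omega>\<in>space M. norm (Y m \<omega>) \<ge> e}) \<le> b m / e\<^sup>2" by simp
  qed
  ultimately show "(\<lambda>m. prob {\<omega>\<in>space M. norm (Y m \<omega>) \<ge> e}) \<longlonglongrightarrow> 0" by (rule Lim_null_comparison[rotated])
qed

lemma null_in_prob_le:
  fixes Y :: "nat \<Rightarrow> 'a \<Rightarrow> 'b::real_normed_vector" and Z :: "nat \<Rightarrow> 'a \<Rightarrow> 'c::euclidean_space"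
  assumes Z: "null_in_prob M Z" and [measurable]: "\<And>m. Z m \<in> borel_measurable M"
    and le: "\<And>m \<omega>. \<omega> \<in> space M \<Longrightarrow> norm (Y m \<omega>) \<le> norm (Z m \<omega>) + b m" and b: "b \<longlonglongrightarrow> 0"
  shows "null_in_prob M Y"
  unfolding null_in_prob_def
proof (intro allI impI)
  fix e :: real assume e: "e > 0"
  have "(\<lambda>m. prob {\<omega>\<in>space M. norm (Z m \<omega>) \<ge> e/2}) \<longlonglongrightarrow> 0" 
    by (rule Z[unfolded null_in_prob_def, rule_format]) (use e in simp)
  moreover have "\<forall>\<^sub>F m in sequentially. b m < e/2" using b e by (intro order_tendstoD) auto
  then have "\<forall>\<^sub>F m in sequentially. norm (prob {\<omega>\<in>space M. norm (Y m \<omega>) \<ge> e}) \<le> prob {\<omega>\<in>space M. norm (Z m \<omega>) \<ge> e/2}"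
  proof eventually_elim
    case (elim m)
    have "{\<omega>\<in>space M. norm (Y m \<omega>) \<ge> e} \<subseteq> {\<omega>\<in>space M. norm (Z m \<omega>) \<ge> e/2}"
      using le[of _ m] elim by fastforce
    then show ?case by (simp add: finite_measure_mono)
  qed
  ultimately show "(\<lambda>m. prob {\<omega>\<in>space M. norm (Y m \<omega>) \<ge> e}) \<longlonglongrightarrow> 0" by (rule Lim_null_comparison[rotated])
qed

lemma null_in_prob_add:
  fixes Y Z :: "nat \<Rightarrow> 'a \<Rightarrow> real"
  assumes Y: "null_in_prob M Y" and Z: "null_in_prob M Z"
    and [measurable]: "\<And>m. Y m \<in> borel_measurable M" "\<And>m. Z m \<in> borel_measurable M"
  shows "null_in_prob M (\<lambda>m \<omega>. Y m \<omega> + Z m \<omega>)"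
  unfolding null_in_prob_def
proof (intro allI impI)
  fix e :: real assume e: "e > 0"
  let ?A = "\<lambda>m. {\<omega>\<in>space M. norm (Y m \<omega>) \<ge> e/2}" and ?B = "\<lambda>m. {\<omega>\<in>space M. norm (Z m \<omega>) \<ge> e/2}"
  have "(\<lambda>m. prob (?A m) + prob (?B m)) \<longlonglongrightarrow> 0 + 0"
    by (rule tendsto_add[OF Y[unfolded null_in_prob_def, rule_format] Z[unfolded null_in_prob_def, rule_format]]) (use e in simp_all)
  then have "(\<lambda>m. prob (?A m) + prob (?B m)) \<longlonglongrightarrow> 0" by simp
  moreover have "\<forall>\<^sub>F m in sequentially. norm (prob {\<omega>\<in>space M. norm (Y m \<omega> + Z m \<omega>) \<ge> e}) \<le> prob (?A m) + prob (?B m)"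
  proof (intro always_eventually allI)
    fix m
    have "prob {\<omega>\<in>space M. norm (Y m \<omega> + Z m \<omega>) \<ge> e} \<le> prob (?A m \<union> ?B m)"
      by (rule finite_measure_mono) auto
    also have "\<dots> \<le> prob (?A m) + prob (?B m)" by (rule measure_Un_le) auto
    finally show "norm (prob {\<omega>\<in>space M. norm (Y m \<omega> + Z m \<omega>) \<ge> e}) \<le> prob (?A m) + prob (?B m)" by simp
  qed
  ultimately show "(\<lambda>m. prob {\<omega>\<in>space M. norm (Y m \<omega> + Z m \<omega>) \<ge> e}) \<longlonglongrightarrow> 0" by (rule Lim_null_comparison[rotated])
qed

text \<open>Independent centred vectors are orthogonal in mean square. The mixed terms are treated
  coordinate by coordinate, where independence factorizes the expectation of a product of
  scalars.\<close>

lemma expectation_norm_sum_square: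
  fixes \<xi> :: "nat \<Rightarrow> 'a \<Rightarrow> 'b::euclidean_space"
  assumes indep: "indep_vars (\<lambda>_. borel) \<xi> UNIV" and sq: "\<And>i. integrable M (\<lambda>\<omega>. (norm (\<xi> i \<omega>))\<^sup>2)"
    and zero: "\<And>i b. expectation (\<lambda>\<omega>. b \<bullet> \<xi> i \<omega>) = 0"
  shows "integrable M (\<lambda>\<omega>. (norm (\<Sum>i<m. \<xi> i \<omega>))\<^sup>2)"
    "expectation (\<lambda>\<omega>. (norm (\<Sum>i<m. \<xi> i \<omega>))\<^sup>2) = (\<Sum>i<m. expectation (\<lambda>\<omega>. (norm (\<xi> i \<omega>))\<^sup>2))"
proof -
  have rv [measurable]: "\<xi> i \<in> borel_measurable M" for i using indep unfolding indep_vars_def2 by simp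
  have sqb: "integrable M (\<lambda>\<omega>. (b \<bullet> \<xi> i \<omega>)\<^sup>2)" if "b \<in> Basis" for b i
  proof (rule Bochner_Integration.integrable_bound[OF sq[of i]])
    have "(b \<bullet> \<xi> i \<omega>)\<^sup>2 \<le> (norm (\<xi> i \<omega>))\<^sup>2" for \<omega>
      using power_mono[OF Basis_le_norm[OF that, of "\<xi> i \<omega>"], of 2] by (simp add: inner_commute)
    then show "AE \<omega> in M. norm ((b \<bullet> \<xi> i \<omega>)\<^sup>2) \<le> norm ((norm (\<xi> i \<omega>))\<^sup>2)" by simp
  qed measurable
  have int1: "integrable M (\<lambda>\<omega>. b \<bullet> \<xi> i \<omega>)" if "b \<in> Basis" for b i
    by (rule square_integrable_imp_integrable[OF _ sqb[OF that]]) measurable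
  have off: "integrable M (\<lambda>\<omega>. (b \<bullet> \<xi> i \<omega>) * (b \<bullet> \<xi> j \<omega>)) \<and> expectation (\<lambda>\<omega>. (b \<bullet> \<xi> i \<omega>) * (b \<bullet> \<xi> j \<omega>)) = 0"
    if "i \<noteq> j" "b \<in> Basis" for i j b
  proof -
    have ind: "indep_vars (\<lambda>_. borel) (\<lambda>k \<omega>. b \<bullet> \<xi> k \<omega>) {i, j}"
      by (rule indep_vars_compose2[OF indep_vars_subset[OF indep]]) auto
    show ?thesis
      using indep_vars_lebesgue_integral[OF _ ind] indep_vars_integrable[OF _ ind] int1[OF that(2)] that zero by simp
  qed
  have prod: "integrable M (\<lambda>\<omega>. \<xi> i \<omega> \<bullet> \<xi> j \<omega>) \<and>
      expectation (\<lambda>\<omega>. \<xi> i \<omega> \<bullet> \<xi> j \<omega>) = (if i = j then expectation (\<lambda>\<omega>. (norm (\<xi> i \<omega>))\<^sup>2) else 0)" for i j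
  proof (cases "i = j")
    case True then show ?thesis using sq[of i] by (simp add: power2_norm_eq_inner)
  next
    case False
    have "(\<lambda>\<omega>. \<xi> i \<omega> \<bullet> \<xi> j \<omega>) = (\<lambda>\<omega>. \<Sum>b\<in>Basis. (b \<bullet> \<xi> i \<omega>) * (b \<bullet> \<xi> j \<omega>))"
      by (subst euclidean_inner) (simp add: inner_commute)
    then show ?thesis using off[OF False] False by simp
  qed
  have eq: "(norm (\<Sum>i<m. \<xi> i \<omega>))\<^sup>2 = (\<Sum>i<m. \<Sum>j<m. \<xi> i \<omega> \<bullet> \<xi> j \<omega>)" for \<omega>
    unfolding power2_norm_eq_inner inner_sum_left inner_sum_right by (rule refl | rule sum.swap)
  show "integrable M (\<lambda>\<omega>. (norm (\<Sum>i<m. \<xi> i \<omega>))\<^sup>2)" unfolding eq using prod by simp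
  show "expectation (\<lambda>\<omega>. (norm (\<Sum>i<m. \<xi> i \<omega>))\<^sup>2) = (\<Sum>i<m. expectation (\<lambda>\<omega>. (norm (\<xi> i \<omega>))\<^sup>2))"
    unfolding eq using prod by (simp add: sum.delta)
qed

end

text \<open>The moment assumptions give convergence of each variance separately, whereas a Gaussian
  law is built from an operator. Polarization recovers the limit of the bilinear forms, and
  linearity, symmetry and nonnegativity pass to the limit.\<close>

lemma quadratic_form_operator:
  fixes b :: "nat \<Rightarrow> 'a::euclidean_space \<Rightarrow> 'a \<Rightarrow> real"
  assumes lin: "\<And>m u. linear (b m u)" and sym: "\<And>m u v. b m u v = b m v u" and nn: "\<And>m u. 0 \<le> b m u u"
    and lim: "\<And>u. (\<lambda>m. b m u u) \<longlonglongrightarrow> q u"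
  obtains T where "linear T" "\<And>x y. T x \<bullet> y = x \<bullet> T y" "\<And>x. q x = x \<bullet> T x" "\<And>x. 0 \<le> x \<bullet> T x"
proof -
  define \<beta> where "\<beta> u v = (q (u + v) - q u - q v) / 2" for u v
  have add2: "b m u (v + w) = b m u v + b m u w" and scale2: "b m u (r *\<^sub>R v) = r * b m u v" for m u v w r
    using linear_add[OF lin] linear_scale[OF lin] by auto
  have lim\<beta>: "(\<lambda>m. b m u v) \<longlonglongrightarrow> \<beta> u v" for u v
  proof -
    have eq: "b m u v = (b m (u + v) (u + v) - b m u u - b m v v) / 2" for m
      using sym[of m "u + v" u] sym[of m "u + v" v] sym[of m v u] by (simp add: add2)
    show ?thesis unfolding \<beta>_def eq by (intro tendsto_intros lim) auto
  qed
  have \<beta>add: "\<beta> u (v + w) = \<beta> u v + \<beta> u w" for u v w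
    using LIMSEQ_unique[OF lim\<beta>[of u "v + w"]] tendsto_add[OF lim\<beta>[of u v] lim\<beta>[of u w]] by (simp add: add2)
  have \<beta>scale: "\<beta> u (r *\<^sub>R v) = r * \<beta> u v" for u v r
    using LIMSEQ_unique[OF lim\<beta>[of u "r *\<^sub>R v"]] tendsto_mult_left[OF lim\<beta>[of u v], of r] by (simp add: scale2)
  have \<beta>sym: "\<beta> u v = \<beta> v u" for u v by (simp add: \<beta>_def add.commute)
  have \<beta>lin: "linear (\<beta> u)" for u by (rule linearI) (simp_all add: \<beta>add \<beta>scale)
  have q\<beta>: "\<beta> u u = q u" for u using LIMSEQ_unique[OF lim\<beta> lim] .
  define T where "T v = (\<Sum>c\<in>Basis. \<beta> c v *\<^sub>R c)" for v
  have T: "u \<bullet> T v = \<beta> u v" for u v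
  proof -
    have "\<beta> u v = \<beta> v (\<Sum>c\<in>Basis. (u \<bullet> c) *\<^sub>R c)" by (simp add: euclidean_representation \<beta>sym)
    also have "\<dots> = (\<Sum>c\<in>Basis. (u \<bullet> c) * \<beta> v c)" by (simp add: linear_sum[OF \<beta>lin] \<beta>scale)
    also have "\<dots> = u \<bullet> T v" by (simp add: T_def inner_sum_right \<beta>sym mult.commute)
    finally show ?thesis by simp
  qed
  show thesis
  proof (rule that)
    show "linear T" by (rule linearI) (simp_all add: T_def \<beta>add \<beta>scale scaleR_add_left sum.distrib scaleR_sum_right)
    show "T x \<bullet> y = x \<bullet> T y" for x y using T[of y x] T[of x y] \<beta>sym[of x y] by (simp add: inner_commute)
    show "q x = x \<bullet> T x" for x by (simp add: T q\<beta>)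
    show "0 \<le> x \<bullet> T x" for x unfolding T q\<beta> by (rule LIMSEQ_le_const[OF lim]) (use nn in auto)
  qed
qed

subsection \<open>Consistency\<close>

lemma norm_matrix_vector_le: "norm (A *v x) \<le> norm A * norm x" for A :: "real ^ 'n::finite ^ 'm::finite"
proof -
  have "norm (A *v x) = L2_set (\<lambda>i. norm ((A *v x) $ i)) UNIV" by (simp add: norm_vec_def)
  also have "\<dots> \<le> L2_set (\<lambda>i. norm (A $ i) * norm x) UNIV"
    by (rule L2_set_mono) (auto simp: matrix_vector_mul_component Cauchy_Schwarz_ineq2)
  also have "\<dots> = L2_set (\<lambda>i. norm (A $ i)) UNIV * norm x" by (rule L2_set_left_distrib[symmetric]) simp
  finally show ?thesis by (simp add: norm_vec_def)
qed

lemma norm_sel: "inj e \<Longrightarrow> norm (u v* sel e) = norm u"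
  by (simp add: norm_eq_sqrt_inner dot_lmul_matrix sel_mult subrows_sel)

lemma norm_subrows_le:
  assumes "inj e"
  shows "norm (subrows e x) \<le> norm (x :: real ^ 's::finite)"
proof -
  let ?u = "subrows e x"
  have "norm ?u * norm ?u = (?u v* sel e) \<bullet> x"
    by (simp add: dot_lmul_matrix sel_mult power2_norm_eq_inner[symmetric] power2_eq_square)
  also have "\<dots> \<le> norm (?u v* sel e) * norm x" by (rule norm_cauchy_schwarz)
  finally have "norm ?u * norm ?u \<le> norm ?u * norm x" by (simp add: norm_sel[OF assms])
  then show ?thesis by (cases "norm ?u = 0") auto
qed

lemma linear_quadratic: "linear (\<lambda>M :: real ^ 'n::finite ^ 'm::finite. x \<bullet> (M *v z))"
  by (rule linearI) (simp_all add: matrix_vector_mult_add_rdistrib inner_add_right scaleR_matrix_vector_assoc[symmetric])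

context ewtls_setting
begin

text \<open>Chosen so that \<open>tau i *\<^sub>R Sig i \<le> Siginf\<close> as quadratic forms: \<open>Siginf \<ge> k\<close> absorbs the difference.\<close>

definition tau where "tau i = 1 / (1 + norm (Sig i - Siginf) / k)"

lemma tau: "0 < tau i" "tau i \<le> 1" "tau \<longlonglongrightarrow> 1"
proof -
  have *: "0 \<le> norm (Sig i - Siginf) / k" using k by simp
  show "0 < tau i" "tau i \<le> 1" using * by (auto simp: tau_def intro: add_pos_nonneg)
  have "(\<lambda>i. norm (Sig i - Siginf)) \<longlonglongrightarrow> 0" using lim by (simp add: LIM_zero tendsto_norm_zero)
  then have "(\<lambda>i. 1 / (1 + norm (Sig i - Siginf) / k)) \<longlonglongrightarrow> 1 / (1 + 0 / k)"
    using k by (intro tendsto_intros) auto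
  then show "tau \<longlonglongrightarrow> 1" by (simp add: tau_def[abs_def])
qed

lemma Sig_le: "tau i * (x \<bullet> (Sig i *v x)) \<le> x \<bullet> (Siginf *v x)"
proof -
  have "x \<bullet> (Sig i *v x) = x \<bullet> (Siginf *v x) + x \<bullet> ((Sig i - Siginf) *v x)"
    by (simp add: matrix_vector_mult_diff_rdistrib inner_diff_right)
  also have "x \<bullet> ((Sig i - Siginf) *v x) \<le> norm x * (norm (Sig i - Siginf) * norm x)"
    by (rule order_trans[OF norm_cauchy_schwarz mult_left_mono[OF norm_matrix_vector_le]]) simp
  also have "\<dots> = norm (Sig i - Siginf) / k * (k * (norm x)\<^sup>2)" using k by (simp add: power2_eq_square)
  also have "\<dots> \<le> norm (Sig i - Siginf) / k * (x \<bullet> (Siginf *v x))" using k by (intro mult_left_mono lower_inf) auto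
  finally have "x \<bullet> (Sig i *v x) \<le> (1 + norm (Sig i - Siginf) / k) * (x \<bullet> (Siginf *v x))" by (simp add: algebra_simps)
  moreover have "0 < 1 + norm (Sig i - Siginf) / k" using k by (simp add: add_pos_nonneg)
  ultimately show ?thesis by (simp add: tau_def pos_divide_le_eq mult.commute)
qed

text \<open>In the dual bound \<open>qcost_ge\<close> for \<open>Sig i\<close>, the multiplier l of
  \<open>Siginf\<close> is inserted after scaling by \<open>tau i\<close>. The quadratic term is
  then at most \<tau> l.y, which leaves 2 \<tau> l.y - \<tau> l.y, and l.y is the cost for
  \<open>Siginf\<close>.\<close>

lemma qcost_tau:
  assumes r: "rank (subrows e (Zmat X)) = CARD('d)"
  shows "tau i * qcost e Siginf c X \<le> qcost e (Sig i) c X"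
proof -
  let ?l = "multiplier e Siginf c X" and ?y = "c v* Zmat X"
  have P: "?l \<bullet> (Pmat e Siginf X *v ?l) = ?l \<bullet> ?y" by (simp add: Pmat_multiplier rank_Pmat[OF r Siginf_V])
  have "tau i * (?l \<bullet> (Pmat e (Sig i) X *v ?l)) \<le> ?l \<bullet> ?y"
    using Sig_le[of i "subrows e (Zmat X *v ?l)"] unfolding P[symmetric] Pmat_inner pad_inner .
  then have "tau i * (tau i * (?l \<bullet> (Pmat e (Sig i) X *v ?l))) \<le> tau i * (?l \<bullet> ?y)"
    using tau(1)[of i] by (intro mult_left_mono) auto
  moreover have "2 * ((tau i *\<^sub>R ?l) \<bullet> ?y) - (tau i *\<^sub>R ?l) \<bullet> (Pmat e (Sig i) X *v (tau i *\<^sub>R ?l)) \<le> qcost e (Sig i) c X"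
    by (rule qcost_ge[OF rank_Pmat[OF r Sig_V]])
  ultimately show ?thesis by (simp add: matrix_vector_mult_scaleR qcost_def inner_commute)
qed

text \<open>Writing \<open>P\<^sup>-\<^sup>1\<close> as a sum of squares reduces the lower bound on the cost to directions \<open>Z w\<close> one at a time.\<close>

lemma diagonalizing_rows:
  assumes P: "pos_def (P :: real ^ 'k ^ 'k)"
  defines "R \<equiv> inv_sqrt P"
  shows "y \<bullet> (matrix_inv P *v y) = (\<Sum>j\<in>UNIV. ((R $ j) \<bullet> y)\<^sup>2)"
    and "(R $ j) \<bullet> (P *v (R $ j)) = 1"
    and "\<exists>u. w = (\<Sum>j\<in>UNIV. (u $ j) *\<^sub>R (R $ j)) \<and> (norm u)\<^sup>2 = w \<bullet> (P *v w)"
proof -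
  have R: "pos_def R" "R ** R = matrix_inv P" unfolding R_def using pos_def_inv_sqrt[OF P] inv_sqrt_square[OF P] by auto
  have Rs: "transpose R = R" using R(1) by (simp add: pos_def_def)
  have sym: "(R *v x) \<bullet> y = x \<bullet> (R *v y)" for x y by (rule symmetric_inner[OF Rs])
  show "y \<bullet> (matrix_inv P *v y) = (\<Sum>j\<in>UNIV. ((R $ j) \<bullet> y)\<^sup>2)"
  proof -
    have "y \<bullet> (matrix_inv P *v y) = (R *v y) \<bullet> (R *v y)" unfolding R(2)[symmetric] sym by (simp add: matrix_vector_mul_assoc)
    then show ?thesis by (simp add: inner_vec_def matrix_vector_mul_component power2_eq_square)
  qed
  have "R ** (R ** P) = mat 1" by (simp add: matrix_mul_assoc R(2) matrix_inv_left pos_def_invertible[OF P])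
  then have RPR: "(R ** P) ** R = mat 1" and RRP: "R ** (R ** P) = mat 1" using matrix_left_right_inverse by blast+
  have row: "R $ j = R *v axis j 1" for j
    using Rs by (simp add: vec_eq_iff matrix_vector_mult_basis column_def transpose_def)
  have RPRv: "R *v (P *v (R *v x)) = x" for x
    using RPR by (simp add: matrix_vector_mul_assoc matrix_mul_assoc)
  show "(R $ j) \<bullet> (P *v (R $ j)) = 1"
    unfolding row sym by (simp add: RPRv inner_axis_axis)
  show "\<exists>u. w = (\<Sum>j\<in>UNIV. (u $ j) *\<^sub>R (R $ j)) \<and> (norm u)\<^sup>2 = w \<bullet> (P *v w)"
  proof (intro exI conjI)
    let ?u = "(R ** P) *v w"
    have w: "R *v ?u = w" by (simp add: matrix_vector_mul_assoc RRP)
    show "w = (\<Sum>j\<in>UNIV. (?u $ j) *\<^sub>R (R $ j))"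
    proof -
      have "R *v ?u = (\<Sum>j\<in>UNIV. (?u $ j) *s (column j R))" by (rule matrix_mult_sum)
      moreover have "column j R = R $ j" for j unfolding row by (simp add: matrix_vector_mult_basis)
      ultimately show ?thesis unfolding w by (simp add: scalar_mult_eq_scaleR)
    qed
    show "(norm ?u)\<^sup>2 = w \<bullet> (P *v w)"
      unfolding power2_norm_eq_inner by (subst (1) matrix_vector_mul_assoc[symmetric]) (simp add: sym w inner_commute)
  qed
qed

definition obsv where "obsv a t = stack a (transpose X0 *v a) + (t :: real ^ ('n + 'd))"

text \<open>The true row is annihilated by \<open>Zmat X0\<close>, so the deterministic part of the
  residual is linear in X - X0.\<close>

lemma inner_obsv_Zmat: "(obsv a t v* Zmat X) \<bullet> w = ((X - X0) *v w) \<bullet> a + t \<bullet> (Zmat X *v w)"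
proof -
  have "stack a (transpose X0 *v a) \<bullet> (Zmat X *v w) = a \<bullet> (X *v w) - a \<bullet> (X0 *v w)"
    unfolding Zmat_mult by (subst inner_upper_lower) (simp add: dot_lmul_matrix)
  then show ?thesis
    unfolding dot_lmul_matrix obsv_def inner_add_left
    by (simp only: matrix_vector_mult_diff_rdistrib inner_diff_right inner_commute[of _ a])
qed

text \<open>The average is a quadratic form in h = (X - X0) w and the J-part z of Zw. Errors in h
  are absorbed by the form of \<open>VA\<close>, which is why \<epsilon> is at most v / 4; errors in
  z are harmless because the normalization of w bounds z by a constant independent of X.\<close>

lemma average_lower_bound:
  fixes s2 \<epsilon> v :: real and VA :: "real ^ 'n ^ 'n"
  assumes m: "m > 0" and t: "\<And>i s. s \<notin> range e \<Longrightarrow> t i $ s = 0"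
    and v: "v > 0" "\<And>h. v * (norm h)\<^sup>2 \<le> h \<bullet> (VA *v h)" and \<epsilon>: "0 < \<epsilon>" "\<epsilon> \<le> v / 4"
    and 1: "norm ((1 / real m) *\<^sub>R (\<Sum>i<m. tau i *\<^sub>R outer (a i) (a i)) - VA) \<le> \<epsilon>"
    and 2: "norm ((1 / real m) *\<^sub>R (\<Sum>i<m. tau i *\<^sub>R outer (a i) (t i))) \<le> \<epsilon>"
    and 3: "norm ((1 / real m) *\<^sub>R (\<Sum>i<m. tau i *\<^sub>R outer (t i) (t i)) - s2 *\<^sub>R pad e Siginf) \<le> \<epsilon>"
    and w: "w \<bullet> (Pmat e Siginf X *v w) = 1"
  shows "v / 2 * (norm ((X - X0) *v w))\<^sup>2 + s2 - 2 * \<epsilon> / k \<le>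
    1 / real m * (\<Sum>i<m. tau i * ((obsv (a i) (t i) v* Zmat X) \<bullet> w)\<^sup>2)"
proof -
  define h where "h = (X - X0) *v w"
  \<comment> \<open>Errors vanish outside J, so Zw may be replaced by its J-part. That part is all
    that \<open>Pmat\<close> measures, hence all that the normalization of w controls.\<close>
  define z where "z = subrows e (Zmat X *v w) v* sel e"
  define VM where "VM = (1 / real m) *\<^sub>R (\<Sum>i<m. tau i *\<^sub>R outer (a i) (a i))"
  define N where "N = (1 / real m) *\<^sub>R (\<Sum>i<m. tau i *\<^sub>R outer (a i) (t i))"
  define T where "T = (1 / real m) *\<^sub>R (\<Sum>i<m. tau i *\<^sub>R outer (t i) (t i))"
  have zJ: "subrows e z = subrows e (Zmat X *v w)" by (simp add: z_def subrows_sel[OF inj])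
  have zS: "z \<bullet> (pad e Siginf *v z) = 1" using w unfolding Pmat_inner pad_inner zJ .
  have zk: "k * (norm z)\<^sup>2 \<le> 1"
    using lower_inf[of "subrows e z"] zS unfolding pad_inner by (simp add: z_def norm_sel[OF inj] subrows_sel[OF inj])
  have ts: "\<forall>s. s \<notin> range e \<longrightarrow> t i $ s = 0" for i using t by blast
  have tz: "t i \<bullet> (Zmat X *v w) = t i \<bullet> z" for i
    unfolding supported_inner[OF inj ts, of i "Zmat X *v w"] supported_inner[OF inj ts, of i z] zJ ..
  have sq: "((obsv (a i) (t i) v* Zmat X) \<bullet> w)\<^sup>2 =
      h \<bullet> (outer (a i) (a i) *v h) + 2 * (h \<bullet> (outer (a i) (t i) *v z)) + z \<bullet> (outer (t i) (t i) *v z)" for i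
    unfolding inner_obsv_Zmat h_def[symmetric] tz outer_mult by (simp add: power2_eq_square inner_commute algebra_simps)
  have lin: "x \<bullet> (((1 / real m) *\<^sub>R (\<Sum>i<m. tau i *\<^sub>R F i)) *v y) = 1 / real m * (\<Sum>i<m. tau i * (x \<bullet> (F i *v y)))"
    for x y and F :: "nat \<Rightarrow> real ^ 'p::finite ^ 'q::finite"
    using linear_quadratic[of x y] by (simp add: linear_scale[OF linear_quadratic] linear_sum[OF linear_quadratic])
  have avg: "1 / real m * (\<Sum>i<m. tau i * ((obsv (a i) (t i) v* Zmat X) \<bullet> w)\<^sup>2) =
      h \<bullet> (VM *v h) + 2 * (h \<bullet> (N *v z)) + z \<bullet> (T *v z)"
    unfolding sq VM_def N_def T_def lin by (simp add: distrib_left sum.distrib sum_distrib_left mult_ac)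
  have b: "\<bar>x \<bullet> (M *v y)\<bar> \<le> \<epsilon> * (norm x * norm y)" if "norm M \<le> \<epsilon>" for x y and M :: "real ^ 'p::finite ^ 'q::finite"
  proof -
    have "\<bar>x \<bullet> (M *v y)\<bar> \<le> norm x * norm (M *v y)" by (rule Cauchy_Schwarz_ineq2)
    also have "\<dots> \<le> norm x * (norm M * norm y)" by (intro mult_left_mono norm_matrix_vector_le) simp
    also have "\<dots> \<le> norm x * (\<epsilon> * norm y)" using that by (intro mult_left_mono mult_right_mono) auto
    finally show ?thesis by (simp add: mult_ac)
  qed
  have "h \<bullet> (VM *v h) = h \<bullet> (VA *v h) + h \<bullet> ((VM - VA) *v h)" by (simp add: matrix_vector_mult_diff_rdistrib inner_diff_right)
  then have i1: "v * (norm h)\<^sup>2 - \<epsilon> * (norm h)\<^sup>2 \<le> h \<bullet> (VM *v h)"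
    using v(2)[of h] b[OF 1, of h h, folded VM_def] by (simp add: power2_eq_square abs_le_iff)
  have "\<bar>h \<bullet> (N *v z)\<bar> \<le> \<epsilon> * (norm h * norm z)" using b[OF 2] unfolding N_def .
  moreover have "2 * (norm h * norm z) \<le> (norm h)\<^sup>2 + (norm z)\<^sup>2" using sum_squares_bound[of "norm h" "norm z"] by simp
  then have "\<epsilon> * (2 * (norm h * norm z)) \<le> \<epsilon> * ((norm h)\<^sup>2 + (norm z)\<^sup>2)" using \<epsilon> by (intro mult_left_mono) auto
  ultimately have i2: "- (\<epsilon> * (norm h)\<^sup>2 + \<epsilon> * (norm z)\<^sup>2) \<le> 2 * (h \<bullet> (N *v z))" by (simp add: distrib_left)
  have "z \<bullet> (T *v z) = s2 + z \<bullet> ((T - s2 *\<^sub>R pad e Siginf) *v z)"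
    using zS by (simp add: matrix_vector_mult_diff_rdistrib inner_diff_right scaleR_matrix_vector_assoc[symmetric])
  then have i3: "s2 - \<epsilon> * (norm z)\<^sup>2 \<le> z \<bullet> (T *v z)"
    using b[OF 3, of z z, folded T_def] by (simp add: power2_eq_square abs_le_iff)
  have "(norm z)\<^sup>2 \<le> 1 / k" using zk k by (simp add: pos_le_divide_eq mult.commute)
  then have i4: "2 * (\<epsilon> * (norm z)\<^sup>2) \<le> 2 * \<epsilon> / k" using \<epsilon> mult_left_mono[of "(norm z)\<^sup>2" "1/k" \<epsilon>] by simp
  have "\<epsilon> * (norm h)\<^sup>2 \<le> v / 4 * (norm h)\<^sup>2" using \<epsilon> by (intro mult_right_mono) auto
  then show ?thesis unfolding avg h_def[symmetric] using i1 i2 i3 i4 by linarith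
qed

text \<open>Summing the bound over the rows of \<open>inv_sqrt\<close> of P produces the noise level
  \<open>s2 * CARD('d)\<close>, which cancels against the cost at X0 and leaves (X - X0) of order
  sqrt \<epsilon> on those rows. They expand every w, with coefficients controlled by the J-part of
  Zw; that J-part exceeds its value at X0 by at most |(X - X0) w|, which is absorbed on the
  left.\<close>

lemma consistency:
  fixes s2 v \<rho> :: real and VA :: "real ^ 'n ^ 'n"
  assumes v: "v > 0" "\<And>h. v * (norm h)\<^sup>2 \<le> h \<bullet> (VA *v h)" and \<rho>: "\<rho> > 0"
  obtains \<epsilon> where "\<epsilon> > 0" "\<And>m a t X. m > 0 \<Longrightarrow> (\<And>i s. s \<notin> range e \<Longrightarrow> t i $ s = 0) \<Longrightarrow>
    norm ((1 / real m) *\<^sub>R (\<Sum>i<m. tau i *\<^sub>R outer (a i) (a i)) - VA) \<le> \<epsilon> \<Longrightarrow>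
    norm ((1 / real m) *\<^sub>R (\<Sum>i<m. tau i *\<^sub>R outer (a i) (t i))) \<le> \<epsilon> \<Longrightarrow>
    norm ((1 / real m) *\<^sub>R (\<Sum>i<m. tau i *\<^sub>R outer (t i) (t i)) - s2 *\<^sub>R pad e Siginf) \<le> \<epsilon> \<Longrightarrow>
    1 / real m * (\<Sum>i<m. qcost e (Sig i) (obsv (a i) (t i)) X0) \<le> s2 * CARD('d) + \<epsilon> \<Longrightarrow>
    rank (subrows e (Zmat X)) = CARD('d) \<Longrightarrow>
    (\<Sum>i<m. qcost e (Sig i) (obsv (a i) (t i)) X) \<le> (\<Sum>i<m. qcost e (Sig i) (obsv (a i) (t i)) X0) \<Longrightarrow>
    dist X X0 < \<rho>"
proof -
  define dd where "dd = real CARD('d)"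
  define K0 where "K0 = norm (subrows e (Zmat X0))"
  define C1 where "C1 = 2 / v * (1 + 2 * dd / k)"
  \<comment> \<open>\<delta> bounds |(X - X0) w| relative to the J-part of Zw: 1/2 permits the
    absorption, and the other bound makes 2 \<delta> K0 CARD('n) smaller than \<rho>. Then
    \<epsilon> is chosen such that dd sqrt (C1 \<epsilon> N) is at most \<delta>. The summands 4 and
    1 keep the denominators positive.\<close>
  define \<delta> where "\<delta> = min (1/2) (\<rho> / (4 * K0 * CARD('n) + 4))"
  define N where "N = norm Siginf"
  define \<epsilon> where "\<epsilon> = min (v / 4) (\<delta>\<^sup>2 / (dd\<^sup>2 * C1 * N + 1))"
  have dd: "dd > 0" by (simp add: dd_def)
  have K0: "K0 \<ge> 0" and N: "N \<ge> 0" by (simp_all add: K0_def N_def)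
  have C1: "C1 > 0" using v dd k by (simp add: C1_def add_pos_nonneg)
  have "0 < 4 * K0 * CARD('n) + 4" using K0 by (intro add_nonneg_pos) auto
  then have \<delta>: "\<delta> > 0" "\<delta> \<le> 1/2" "\<delta> \<le> \<rho> / (4 * K0 * CARD('n) + 4)"
    unfolding \<delta>_def using \<rho> by (simp, intro min.cobounded1, intro min.cobounded2)
  have D1: "dd\<^sup>2 * C1 * N + 1 > 0" using C1 N by (simp add: add_nonneg_pos)
  have \<epsilon>: "\<epsilon> > 0" "\<epsilon> \<le> v / 4" unfolding \<epsilon>_def using v(1) \<delta>(1) D1 by (simp, intro min.cobounded1)
  have \<epsilon>2: "dd\<^sup>2 * C1 * N * \<epsilon> \<le> \<delta>\<^sup>2"
  proof -
    have "dd\<^sup>2 * C1 * N * \<epsilon> \<le> (dd\<^sup>2 * C1 * N + 1) * \<epsilon>" using \<epsilon> by (intro mult_right_mono) auto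
    also have "\<dots> \<le> (dd\<^sup>2 * C1 * N + 1) * (\<delta>\<^sup>2 / (dd\<^sup>2 * C1 * N + 1))" using D1 by (intro mult_left_mono) (auto simp: \<epsilon>_def)
    finally show ?thesis using D1 by simp
  qed
  show thesis
  proof (rule that[OF \<epsilon>(1)])
    fix m :: nat and a :: "nat \<Rightarrow> real ^ 'n" and t :: "nat \<Rightarrow> real ^ ('n + 'd)" and X
    assume m: "m > 0" and t: "\<And>i s. s \<notin> range e \<Longrightarrow> t i $ s = 0"
      and 1: "norm ((1 / real m) *\<^sub>R (\<Sum>i<m. tau i *\<^sub>R outer (a i) (a i)) - VA) \<le> \<epsilon>"
      and 2: "norm ((1 / real m) *\<^sub>R (\<Sum>i<m. tau i *\<^sub>R outer (a i) (t i))) \<le> \<epsilon>"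
      and 3: "norm ((1 / real m) *\<^sub>R (\<Sum>i<m. tau i *\<^sub>R outer (t i) (t i)) - s2 *\<^sub>R pad e Siginf) \<le> \<epsilon>"
      and 4: "1 / real m * (\<Sum>i<m. qcost e (Sig i) (obsv (a i) (t i)) X0) \<le> s2 * CARD('d) + \<epsilon>"
      and r: "rank (subrows e (Zmat X)) = CARD('d)"
      and Q: "(\<Sum>i<m. qcost e (Sig i) (obsv (a i) (t i)) X) \<le> (\<Sum>i<m. qcost e (Sig i) (obsv (a i) (t i)) X0)"
    let ?P = "Pmat e Siginf X"
    let ?R = "inv_sqrt ?P"
    let ?y = "\<lambda>i. obsv (a i) (t i) v* Zmat X"
    have P: "pos_def ?P" by (rule rank_Pmat[OF r Siginf_V])
    define al where "al j = norm ((X - X0) *v (?R $ j))" for j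
    have "(\<Sum>j\<in>UNIV. v / 2 * (al j)\<^sup>2 + s2 - 2 * \<epsilon> / k) \<le> (\<Sum>j\<in>UNIV. 1 / real m * (\<Sum>i<m. tau i * (?y i \<bullet> (?R $ j))\<^sup>2))"
      unfolding al_def by (intro sum_mono average_lower_bound[OF m t v \<epsilon> 1 2 3] diagonalizing_rows(2)[OF P])
    also have "\<dots> = 1 / real m * (\<Sum>i<m. tau i * (\<Sum>j\<in>UNIV. ((?R $ j) \<bullet> ?y i)\<^sup>2))"
      unfolding sum_distrib_left[of "1 / real m", symmetric] by (subst sum.swap) (simp add: sum_distrib_left inner_commute)
    also have "\<dots> = 1 / real m * (\<Sum>i<m. tau i * qcost e Siginf (obsv (a i) (t i)) X)"
      by (simp add: qcost_def multiplier_def diagonalizing_rows(1)[OF P])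
    also have "\<dots> \<le> 1 / real m * (\<Sum>i<m. qcost e (Sig i) (obsv (a i) (t i)) X)"
      by (intro mult_left_mono sum_mono qcost_tau[OF r]) simp
    also have "\<dots> \<le> 1 / real m * (\<Sum>i<m. qcost e (Sig i) (obsv (a i) (t i)) X0)" using Q by (intro mult_left_mono) auto
    also note 4
    finally have "v / 2 * (\<Sum>j\<in>UNIV. (al j)\<^sup>2) + dd * s2 - dd * (2 * \<epsilon> / k) \<le> s2 * dd + \<epsilon>"
      by (simp add: sum.distrib sum_subtractf sum_distrib_left[symmetric] sum_divide_distrib[symmetric] dd_def)
    then have "v / 2 * (\<Sum>j\<in>UNIV. (al j)\<^sup>2) \<le> \<epsilon> * (1 + 2 * dd / k)" by (simp add: algebra_simps)
    then have S: "(\<Sum>j\<in>UNIV. (al j)\<^sup>2) \<le> C1 * \<epsilon>" using v(1) by (simp add: C1_def field_simps)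
    have al: "al j \<le> sqrt (C1 * \<epsilon>)" for j
    proof (rule real_le_rsqrt)
      have "(al j)\<^sup>2 \<le> (\<Sum>j\<in>UNIV. (al j)\<^sup>2)" by (rule member_le_sum) auto
      with S show "(al j)\<^sup>2 \<le> C1 * \<epsilon>" by linarith
    qed
    define \<eta> where "\<eta> = dd * sqrt (C1 * \<epsilon>) * sqrt N"
    have \<eta>0: "\<eta> \<ge> 0" using dd C1 \<epsilon> N by (simp add: \<eta>_def)
    have "\<eta>\<^sup>2 = dd\<^sup>2 * C1 * N * \<epsilon>" using C1 \<epsilon> N by (simp add: \<eta>_def power_mult_distrib)
    then have "\<eta>\<^sup>2 \<le> \<delta>\<^sup>2" using \<epsilon>2 by simp
    then have \<eta>: "\<eta> \<le> \<delta>" by (rule power2_le_imp_le) (use \<delta>(1) in simp)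
    have "norm ((X - X0) *v w) \<le> 2 * \<delta> * K0 * norm w" for w
    proof -
      obtain u where u: "w = (\<Sum>j\<in>UNIV. (u $ j) *\<^sub>R (?R $ j))" "(norm u)\<^sup>2 = w \<bullet> (?P *v w)"
        using diagonalizing_rows(3)[OF P] by blast
      let ?z = "subrows e (Zmat X *v w)" and ?g = "norm ((X - X0) *v w)"
      have "(norm u)\<^sup>2 = ?z \<bullet> (Siginf *v ?z)" unfolding u(2) Pmat_inner pad_inner ..
      also have "\<dots> \<le> norm ?z * (N * norm ?z)" unfolding N_def
        by (rule order_trans[OF norm_cauchy_schwarz mult_left_mono[OF norm_matrix_vector_le]]) simp
      also have "\<dots> = (sqrt N * norm ?z)\<^sup>2" using N by (simp add: power2_eq_square)
      finally have "(norm u)\<^sup>2 \<le> (sqrt N * norm ?z)\<^sup>2" .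
      then have un: "norm u \<le> sqrt N * norm ?z" by (rule power2_le_imp_le) (use N in simp)
      have "?g = norm (\<Sum>j\<in>UNIV. (u $ j) *\<^sub>R ((X - X0) *v (?R $ j)))"
        by (subst u(1)) (simp add: linear_sum[OF matrix_vector_mul_linear] matrix_vector_mult_scaleR)
      also have "\<dots> \<le> (\<Sum>j\<in>UNIV. norm ((u $ j) *\<^sub>R ((X - X0) *v (?R $ j))))" by (rule norm_sum)
      also have "\<dots> \<le> (\<Sum>j\<in>(UNIV::'d set). norm u * sqrt (C1 * \<epsilon>))"
        using al component_le_norm_cart[of u] unfolding al_def by (intro sum_mono) (auto intro!: mult_mono)
      also have "\<dots> = dd * sqrt (C1 * \<epsilon>) * norm u" by (simp add: dd_def)
      also have "\<dots> \<le> dd * sqrt (C1 * \<epsilon>) * (sqrt N * norm ?z)" using un dd C1 \<epsilon> by (intro mult_left_mono) auto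
      finally have g1: "?g \<le> \<eta> * norm ?z" by (simp add: \<eta>_def mult_ac)
      have "?z = subrows e (Zmat X0) *v w + subrows e (stack ((X - X0) *v w) 0)"
        using Zmat_add[of X0 "X - X0" w] by (simp add: subrows_add subrows_mult)
      then have "norm ?z \<le> norm (subrows e (Zmat X0) *v w) + norm (subrows e (stack ((X - X0) *v w) 0))"
        by (simp add: norm_triangle_ineq)
      also have "\<dots> \<le> K0 * norm w + norm (stack ((X - X0) *v w) (0 :: real ^ 'd))"
        unfolding K0_def by (intro add_mono norm_matrix_vector_le norm_subrows_le inj)
      also have "norm (stack ((X - X0) *v w) (0 :: real ^ 'd)) = ?g" by (simp add: norm_eq_sqrt_inner inner_upper_lower)
      finally have z: "norm ?z \<le> K0 * norm w + ?g" .
      have "?g \<le> \<delta> * (K0 * norm w + ?g)"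
        using g1 z \<eta> \<eta>0 \<delta>(1) by (meson mult_mono norm_ge_zero order_trans less_imp_le)
      moreover have "\<delta> * ?g \<le> 1/2 * ?g" using \<delta>(2) by (intro mult_right_mono) auto
      ultimately show ?thesis by (simp add: algebra_simps)
    qed
    then have "norm (X - X0) \<le> 2 * \<delta> * K0 * CARD('n)" using \<delta>(1) K0 by (intro norm_matrix_le) auto
    also have "\<dots> \<le> 2 * (\<rho> / (4 * K0 * CARD('n) + 4)) * K0 * CARD('n)" using \<delta>(3) K0 by (intro mult_right_mono mult_left_mono) auto
    also have "\<dots> < \<rho>"
    proof -
      have "0 < 4 * K0 * CARD('n) + 4" using K0 by (simp add: add_nonneg_pos)
      then have "2 * (\<rho> / (4 * K0 * CARD('n) + 4)) * K0 * CARD('n) = \<rho> * ((2 * K0 * CARD('n)) / (4 * K0 * CARD('n) + 4))" by simp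
      also have "\<dots> < \<rho> * 1" using \<rho> K0 \<open>0 < 4 * K0 * CARD('n) + 4\<close>
        by (intro mult_strict_left_mono) (auto simp: pos_divide_less_eq intro: order_le_less_trans[of _ "4 * K0 * CARD('n)"])
      finally show ?thesis by simp
    qed
    finally show "dist X X0 < \<rho>" by (simp add: dist_norm)
  qed
qed

text \<open>Compactness is missing on the admissible set, but every competitor at least as good as
  X0 lies in the compact ball U, on which the cost is continuous; so a minimizer over U is a global
  one.\<close>

lemma minimizer_exists:
  assumes close: "\<And>X. rank (subrows e (Zmat X)) = CARD('d) \<Longrightarrow>
      (\<Sum>i<m. qcost e (Sig i) (c i) X) \<le> (\<Sum>i<m. qcost e (Sig i) (c i) X0) \<Longrightarrow> X \<in> U"
  shows "\<exists>X. rank (subrows e (Zmat X)) = CARD('d) \<and>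
    (\<forall>X'. rank (subrows e (Zmat X')) = CARD('d) \<longrightarrow> (\<Sum>i<m. qcost e (Sig i) (c i) X) \<le> (\<Sum>i<m. qcost e (Sig i) (c i) X'))"
proof -
  have "continuous_on U (\<lambda>X. \<Sum>i<m. qcost e (Sig i) (c i) X)" by (intro continuous_on_sum continuous_qcost Sig_V)
  moreover have "compact U" "U \<noteq> {}" using X0_U by (auto simp: U_def)
  ultimately obtain X where X: "X \<in> U" "\<And>X'. X' \<in> U \<Longrightarrow> (\<Sum>i<m. qcost e (Sig i) (c i) X) \<le> (\<Sum>i<m. qcost e (Sig i) (c i) X')"
    using continuous_attains_inf[of U "\<lambda>X. \<Sum>i<m. qcost e (Sig i) (c i) X"] by blast
  have "(\<Sum>i<m. qcost e (Sig i) (c i) X) \<le> (\<Sum>i<m. qcost e (Sig i) (c i) X')"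
    if r: "rank (subrows e (Zmat X')) = CARD('d)" for X'
  proof (rule ccontr)
    assume n: "\<not> ?thesis"
    then have "(\<Sum>i<m. qcost e (Sig i) (c i) X') \<le> (\<Sum>i<m. qcost e (Sig i) (c i) X0)" using X(2)[OF X0_U] by linarith
    then have "X' \<in> U" by (rule close[OF r])
    then show False using X(2) n by blast
  qed
  then show ?thesis using X(1) U_rank by blast
qed

end

subsection \<open>Expansion of the score\<close>

lemma norm_vector_matrix_le: "norm (u v* B) \<le> norm u * norm B" for B :: "real ^ 'n::finite ^ 'm::finite"
proof -
  have "norm (u v* B) * norm (u v* B) = u \<bullet> (B *v (u v* B))"
    by (simp add: power2_norm_eq_inner[symmetric] power2_eq_square dot_lmul_matrix[symmetric])
  also have "\<dots> \<le> norm u * (norm B * norm (u v* B))"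
    by (rule order_trans[OF norm_cauchy_schwarz mult_left_mono[OF norm_matrix_vector_le]]) simp
  finally have "norm (u v* B) * norm (u v* B) \<le> (norm u * norm B) * norm (u v* B)" by (simp add: mult.assoc)
  then show ?thesis by (cases "norm (u v* B) = 0") auto
qed

lemma norm_matrix_mult_le: "norm (A ** B) \<le> norm A * norm B"
  for A :: "real ^ 'n::finite ^ 'm::finite" and B :: "real ^ 'p::finite ^ 'n"
proof -
  have row: "(A ** B) $ i = A $ i v* B" for i
    by (simp add: vec_eq_iff matrix_matrix_mult_def vector_matrix_mult_def mult.commute)
  have "norm (A ** B) = L2_set (\<lambda>i. norm (A $ i v* B)) UNIV" by (simp add: norm_vec_def[of "A ** B"] row)
  also have "\<dots> \<le> L2_set (\<lambda>i. norm (A $ i) * norm B) UNIV" by (rule L2_set_mono) (auto simp: norm_vector_matrix_le)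
  also have "\<dots> = L2_set (\<lambda>i. norm (A $ i)) UNIV * norm B" by (rule L2_set_left_distrib[symmetric]) simp
  finally show ?thesis by (simp add: norm_vec_def[of A])
qed

lemma norm_matrix_mult_mono: "norm A \<le> a \<Longrightarrow> norm B \<le> b \<Longrightarrow> norm (A ** B) \<le> a * b"
  for A :: "real ^ 'n::finite ^ 'm::finite" and B :: "real ^ 'p::finite ^ 'n"
  by (rule order_trans[OF norm_matrix_mult_le mult_mono]) (auto intro: order_trans[OF norm_ge_zero])

lemma norm_outer: "norm (outer x y) = norm x * norm y"
proof -
  have "outer x y $ i = x $ i *\<^sub>R y" for i by (simp add: vec_eq_iff outer_def)
  then have "norm (outer x y) = L2_set (\<lambda>i. norm (x $ i) * norm y) UNIV" by (simp add: norm_vec_def[of "outer x y"])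
  also have "\<dots> = L2_set (\<lambda>i. norm (x $ i)) UNIV * norm y" by (rule L2_set_left_distrib[symmetric]) simp
  finally show ?thesis by (simp add: norm_vec_def[of x])
qed

lemma norm_transpose: "norm (transpose A) = norm A" for A :: "real ^ 'n::finite ^ 'm::finite"
proof -
  have "transpose A \<bullet> transpose A = A \<bullet> A"
    unfolding inner_vec_def transpose_def by (simp, rule sum.swap)
  then show ?thesis by (simp add: norm_eq_sqrt_inner)
qed

lemma transpose_outer: "transpose (outer x y) = outer y x"
  by (simp add: transpose_def outer_def vec_eq_iff mult.commute)

lemma upper_Pa: "Pa *v c = upper c"
  by (simp add: vec_eq_iff Pa_def upper_def matrix_vector_mult_def if_distrib if_distribR cong: if_cong)

lemma upper_matrix_Pa: "Pa ** M = upper M" for M :: "real ^ 'p::finite ^ ('n::finite + 'd::finite)"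
  by (simp add: vec_eq_iff Pa_def upper_def matrix_matrix_mult_def if_distrib if_distribR cong: if_cong)

lemmas matrix_mult_distribs =
  bounded_bilinear.add_left[OF bounded_bilinear_matrix_mult] bounded_bilinear.add_right[OF bounded_bilinear_matrix_mult]
  bounded_bilinear.diff_left[OF bounded_bilinear_matrix_mult] bounded_bilinear.diff_right[OF bounded_bilinear_matrix_mult]
  bounded_bilinear.scaleR_left[OF bounded_bilinear_matrix_mult] bounded_bilinear.scaleR_right[OF bounded_bilinear_matrix_mult]

text \<open>Upgrades an estimate for each basis vector to one proportional to \<open>norm w\<close>,
  so that constants found for fixed W can be summed over the random \<open>W i\<close>. The factor d
  carries the distances.\<close>

lemma linear_bound_Basis:
  fixes E :: "'w::euclidean_space \<Rightarrow> 'v::real_normed_vector"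
  assumes E: "linear E" and b: "\<And>b. b \<in> Basis \<Longrightarrow> norm (E b) \<le> C b * d"
  shows "norm (E w) \<le> sum C Basis * norm w * d"
proof -
  have "E w = E (\<Sum>b\<in>Basis. (w \<bullet> b) *\<^sub>R b)" by (simp add: euclidean_representation)
  also have "\<dots> = (\<Sum>b\<in>Basis. (w \<bullet> b) *\<^sub>R E b)" by (simp add: linear_sum[OF E] linear_scale[OF E])
  finally have "norm (E w) \<le> (\<Sum>b\<in>Basis. norm ((w \<bullet> b) *\<^sub>R E b))" by (simp only: norm_sum)
  also have "\<dots> \<le> (\<Sum>b\<in>Basis. norm w * (C b * d))"
    using b by (intro sum_mono) (auto intro!: mult_mono Basis_le_norm)
  also have "\<dots> = sum C Basis * norm w * d" by (simp add: sum_distrib_left[symmetric] sum_distrib_right[symmetric] mult_ac)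
  finally show ?thesis .
qed

context ewtls_setting
begin

text \<open>\<open>Lmap\<close> is \<open>[S\<^sub>a, S\<^sub>a\<^sub>b] Z P\<^sup>-\<^sup>1\<close>, and \<open>Gmap\<close> is the part of the score that is linear in the errors.\<close>

definition Lmap where "Lmap X A = Pa ** pad e A ** Zmat X ** matrix_inv (Pmat e A X)"

definition Gmap :: "real ^ 'd ^ 'n \<Rightarrow> real ^ 'j ^ 'j \<Rightarrow> (real ^ ('n + 'd) ^ 'n) \<times> (real ^ ('n + 'd) ^ ('n + 'd)) \<Rightarrow> real ^ 'd ^ 'n" where
  "Gmap X A W = (fst W ** Zmat X + (Pa - Lmap X A ** transpose (Zmat X)) ** snd W ** Zmat X
    + (Pa - Lmap X A ** transpose (Zmat X)) ** transpose (fst W) ** (X - X0)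
    - Lmap X A ** transpose (X - X0) ** fst W ** Zmat X) ** matrix_inv (Pmat e A X)"

lemma linear_Gmap: "linear (Gmap X A)"
  by (rule linearI) (simp_all add: Gmap_def matrix_mult_distribs linear_add[OF bounded_linear.linear[OF bounded_linear_transpose]]
    linear_scale[OF bounded_linear.linear[OF bounded_linear_transpose]] algebra_simps)

lemma mixed_lipschitz_X: "mixed_lipschitz U V (\<lambda>X _. X)"
  by (rule mixed_lipschitz_fst) (simp add: U_def)

lemma mixed_lipschitz_Lmap: "mixed_lipschitz U V (\<lambda>X A. Lmap X A)"
  unfolding Lmap_def
  by (intro mixed_lipschitz_mult mixed_lipschitz_const mixed_lipschitz_pad mixed_lipschitz_Zmat mixed_lipschitz_inverse)

lemma mixed_lipschitz_Gmap: "mixed_lipschitz U V (\<lambda>X A. Gmap X A W)"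
  unfolding Gmap_def
  by (intro mixed_lipschitz_mult mixed_lipschitz_add mixed_lipschitz_diff mixed_lipschitz_const mixed_lipschitz_Zmat
      mixed_lipschitz_inverse mixed_lipschitz_Lmap mixed_lipschitz_linear[OF bounded_linear_transpose] mixed_lipschitz_X)

lemma Gmap_bounds:
  obtains C where "C \<ge> 0" "\<And>W. mixed_lipschitz_with (C * norm W) U V (\<lambda>X A. Gmap X A W)"
proof -
  have "\<forall>b. \<exists>C. mixed_lipschitz_with C U V (\<lambda>X A. Gmap X A b)"
    using mixed_lipschitz_Gmap unfolding mixed_lipschitz_def by blast
  then obtain Cb where "\<And>b. mixed_lipschitz_with (Cb b) U V (\<lambda>X A. Gmap X A b)" by metis
  note Cb = mixed_lipschitz_withD[OF this]
  show thesis
  proof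
    show C: "sum Cb Basis \<ge> 0" by (intro sum_nonneg Cb)
    fix W
    show "mixed_lipschitz_with (sum Cb Basis * norm W) U V (\<lambda>X A. Gmap X A W)"
      unfolding mixed_lipschitz_with_def
    proof (intro conjI ballI)
      show "0 \<le> sum Cb Basis * norm W" using C by simp
      fix x x' s s' assume *: "x \<in> U" "x' \<in> U" "s \<in> V" "s' \<in> V"
      show "norm (Gmap x s W) \<le> sum Cb Basis * norm W"
        using linear_bound_Basis[OF linear_Gmap, of x s Cb 1 W] Cb(2)[OF *(1,3)] by simp
      show "norm (Gmap x s W - Gmap x' s W) \<le> sum Cb Basis * norm W * dist x x'"
        by (rule linear_bound_Basis[OF linear_compose_sub[OF linear_Gmap linear_Gmap]]) (rule Cb(3)[OF *(1-3)])
      show "norm (Gmap x s W - Gmap x s' W) \<le> sum Cb Basis * norm W * dist s s'"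
        by (rule linear_bound_Basis[OF linear_compose_sub[OF linear_Gmap linear_Gmap]]) (rule Cb(4)[OF *(1,3,4)])
      show "norm (Gmap x s W - Gmap x s' W - Gmap x' s W + Gmap x' s' W) \<le> sum Cb Basis * norm W * dist x x' * dist s s'"
        using linear_bound_Basis[OF linear_compose_add[OF linear_compose_sub[OF linear_compose_sub[OF linear_Gmap[of x s] linear_Gmap[of x s']] linear_Gmap[of x' s]] linear_Gmap[of x' s']], of Cb "dist x x' * dist s s'" W]
          Cb(5)[OF *] by (simp add: mult.assoc)
    qed
  qed
qed

text \<open>At X0 the terms containing X - X0 drop out, and what remains is the \<Gamma> of the
  theorem up to the right factor \<open>matrix_inv (Pmat e A X0)\<close>.\<close>

lemma Gmap_X0: "Gmap X0 A W = Gamma_of (pad e A) X0 W ** matrix_inv (Pmat e A X0)"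
  by (simp add: Gmap_def Gamma_of_def Let_def Lmap_def upper_matrix_Pa[symmetric] Pmat_def matrix_mult_distribs matrix_mul_assoc
    bounded_bilinear.zero_left[OF bounded_bilinear_matrix_mult] bounded_bilinear.zero_right[OF bounded_bilinear_matrix_mult]
    linear_0[OF bounded_linear.linear[OF bounded_linear_transpose]])

text \<open>This is an exact identity and not a Taylor expansion: the errors enter only through the
  linear map \<open>Gmap\<close>, applied to their centred products. Both sides are compared on a
  vector x, where only the two scalars \<alpha> and \<beta> occur, the contributions of the true row
  and of the error to the multiplier.\<close>

lemma score_identity:
  fixes X :: "real ^ 'd ^ 'n" and A :: "real ^ 'j ^ 'j" and a :: "real ^ 'n" and t :: "real ^ ('n + 'd)" and s2 :: real
  assumes X: "X \<in> U" and A: "A \<in> V"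
  defines "c \<equiv> obsv a t" and "B \<equiv> matrix_inv (Pmat e A X)"
  shows "outer (upper (c - pad e A *v (Zmat X *v multiplier e A c X))) (multiplier e A c X) =
    outer a a ** (X - X0) ** B - Lmap X A ** transpose (X - X0) ** outer a a ** (X - X0) ** B
    + Gmap X A (outer a t, outer t t - s2 *\<^sub>R pad e A)"
proof -
  let ?Z = "Zmat X" and ?S = "pad e A" and ?D = "X - X0" and ?L = "Lmap X A"
  have P: "pos_def (Pmat e A X)" by (rule U_Pmat[OF X A])
  have BP: "B ** Pmat e A X = mat 1" unfolding B_def by (rule matrix_inv_left[OF pos_def_invertible[OF P]])
  have Bsym: "(B *v x) \<bullet> y = x \<bullet> (B *v y)" for x y
    using pos_def_matrix_inv[OF P] unfolding B_def by (simp add: pos_def_def symmetric_inner)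
  have "(c v* ?Z) \<bullet> z = (a v* ?D + t v* ?Z) \<bullet> z" for z
    unfolding c_def inner_obsv_Zmat by (simp add: inner_add_left dot_lmul_matrix inner_commute[of _ a])
  then have y: "c v* ?Z = a v* ?D + t v* ?Z" using vector_eq_rdot by blast
  have Lv: "?L *v w = upper (?S *v (?Z *v (B *v w)))" for w
    by (simp add: Lmap_def B_def matrix_vector_mul_assoc[symmetric] upper_Pa)
  have LP: "?L *v ((?S *v (?Z *v w)) v* ?Z) = Pa *v (?S *v (?Z *v w))" for w
  proof -
    have "B *v ((?S *v (?Z *v w)) v* ?Z) = w"
      unfolding Pmat_mult[symmetric] by (simp add: matrix_vector_mul_assoc BP)
    then show ?thesis by (simp add: Lv upper_Pa)
  qed
  have uadd: "upper (u + v) = upper u + upper v" "upper (u - v) = upper u - upper v" for u v :: "real ^ ('n + 'd)"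
    by (simp_all add: upper_def vec_eq_iff)
  have m: "multiplier e A c X = B *v (c v* ?Z)" by (simp add: multiplier_def B_def)
  have r: "upper (c - ?S *v (?Z *v multiplier e A c X)) = a + Pa *v t - ?L *v (a v* ?D) - ?L *v (t v* ?Z)"
  proof -
    have "upper (c - ?S *v (?Z *v multiplier e A c X)) = upper c - ?L *v (c v* ?Z)"
      by (simp add: uadd Lv m)
    also have "upper c = a + Pa *v t" by (simp add: c_def obsv_def uadd upper_Pa)
    finally show ?thesis by (simp add: y matrix_vector_right_distrib)
  qed
  show ?thesis
  proof (rule matrix_eq[THEN iffD2], rule allI)
    fix x
    define \<alpha> where "\<alpha> = a \<bullet> (?D *v (B *v x))"
    define \<beta> where "\<beta> = t \<bullet> (?Z *v (B *v x))"
    have l: "multiplier e A c X \<bullet> x = \<alpha> + \<beta>"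
      by (simp add: m Bsym y inner_add_left dot_lmul_matrix \<alpha>_def \<beta>_def)
    have 1: "(outer a a ** ?D ** B) *v x = \<alpha> *\<^sub>R a"
      by (simp add: matrix_vector_mul_assoc[symmetric] outer_mult \<alpha>_def)
    have 2: "(?L ** transpose ?D ** outer a a ** ?D ** B) *v x = \<alpha> *\<^sub>R (?L *v (a v* ?D))"
      by (simp add: matrix_vector_mul_assoc[symmetric] outer_mult \<alpha>_def vector_matrix_scaleR matrix_vector_mult_scaleR)
    have 3: "Gmap X A (outer a t, outer t t - s2 *\<^sub>R ?S) *v x = \<beta> *\<^sub>R a + \<beta> *\<^sub>R (Pa *v t - ?L *v (t v* ?Z))
        + \<alpha> *\<^sub>R (Pa *v t - ?L *v (t v* ?Z)) - \<beta> *\<^sub>R (?L *v (a v* ?D))"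
    proof -
      let ?Q = "Pa - ?L ** transpose ?Z"
      have Q: "?Q *v u = Pa *v u - ?L *v (u v* ?Z)" for u
        by (simp add: matrix_vector_mult_diff_rdistrib matrix_vector_mul_assoc[symmetric])
      \<comment> \<open>This cancellation makes the score unbiased at X0: the covariance matrix can
        be subtracted from \<open>outer t t\<close> without changing the value, for any s2.\<close>
      have "?Q *v (?S *v (?Z *v w)) = 0" for w by (simp add: Q LP)
      then have s: "(?Q ** (outer t t - s2 *\<^sub>R ?S) ** ?Z ** B) *v x = \<beta> *\<^sub>R (?Q *v t)"
        by (simp add: matrix_vector_mul_assoc[symmetric] matrix_vector_mult_diff_rdistrib outer_mult \<beta>_def
            matrix_vector_mult_diff_distrib matrix_vector_mult_scaleR scaleR_matrix_vector_assoc[symmetric])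
      have f: "(outer a t ** ?Z ** B) *v x = \<beta> *\<^sub>R a"
        by (simp add: matrix_vector_mul_assoc[symmetric] outer_mult \<beta>_def)
      have g: "(?Q ** transpose (outer a t) ** ?D ** B) *v x = \<alpha> *\<^sub>R (?Q *v t)"
        unfolding transpose_outer by (simp add: matrix_vector_mul_assoc[symmetric] outer_mult \<alpha>_def matrix_vector_mult_scaleR)
      have h: "(?L ** transpose ?D ** outer a t ** ?Z ** B) *v x = \<beta> *\<^sub>R (?L *v (a v* ?D))"
        by (simp add: matrix_vector_mul_assoc[symmetric] outer_mult \<beta>_def vector_matrix_scaleR matrix_vector_mult_scaleR)
      have "Gmap X A (outer a t, outer t t - s2 *\<^sub>R ?S) = outer a t ** ?Z ** B + ?Q ** (outer t t - s2 *\<^sub>R ?S) ** ?Z ** B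
          + ?Q ** transpose (outer a t) ** ?D ** B - ?L ** transpose ?D ** outer a t ** ?Z ** B"
        unfolding Gmap_def B_def[symmetric] fst_conv snd_conv
        by (simp only: bounded_bilinear.add_left[OF bounded_bilinear_matrix_mult, where b = B]
          bounded_bilinear.diff_left[OF bounded_bilinear_matrix_mult, where b = B])
      then have "Gmap X A (outer a t, outer t t - s2 *\<^sub>R ?S) *v x =
          \<beta> *\<^sub>R a + \<beta> *\<^sub>R (?Q *v t) + \<alpha> *\<^sub>R (?Q *v t) - \<beta> *\<^sub>R (?L *v (a v* ?D))"
        by (simp only: matrix_vector_mult_diff_rdistrib[of _ _ x] matrix_vector_mult_add_rdistrib[of _ _ x] f s g h)
      then show ?thesis unfolding Q .
    qed
    show "outer (upper (c - ?S *v (?Z *v multiplier e A c X))) (multiplier e A c X) *v x =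
      (outer a a ** ?D ** B - ?L ** transpose ?D ** outer a a ** ?D ** B
       + Gmap X A (outer a t, outer t t - s2 *\<^sub>R ?S)) *v x"
      unfolding outer_mult l r matrix_vector_mult_add_rdistrib matrix_vector_mult_diff_rdistrib 1 2 3
      by (simp add: algebra_simps)
  qed
qed

end

context ewtls_setting
begin

text \<open>\<open>score\<close> is half the gradient of the cost at \<open>X\<close>.\<close>

definition Wd where "Wd s2 a t i = (outer (a i) (t i), outer (t i) (t i) - s2 *\<^sub>R pad e (Sig i))"
definition Sm where "Sm s2 a t m = (1 / sqrt (real m)) *\<^sub>R (\<Sum>i<m. Wd s2 a t i)"
definition score where "score a t m X = (\<Sum>i<m. outer (upper (obsv (a i) (t i) - pad e (Sig i) *v (Zmat X *v multiplier e (Sig i) (obsv (a i) (t i)) X)))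
  (multiplier e (Sig i) (obsv (a i) (t i)) X))"
text \<open>The fluctuation caused by \<Sigma> alone, at X = X0. It will be a centred sum with
  coefficients tending to 0, hence null even at the scale 1 / sqrt m.\<close>

definition remd where "remd s2 a t m = (1 / sqrt (real m)) *\<^sub>R (\<Sum>i<m. Gmap X0 (Sig i) (Wd s2 a t i) - Gmap X0 Siginf (Wd s2 a t i))"

lemma norm_mean_le:
  assumes "\<And>i. i < m \<Longrightarrow> norm (F i) \<le> f i" "r \<ge> 0"
  shows "norm (r *\<^sub>R (\<Sum>i<m. F i)) \<le> r * (\<Sum>i<m. f i)"
proof -
  have "norm (\<Sum>i<m. F i) \<le> (\<Sum>i<m. f i)" using assms(1) by (intro order_trans[OF norm_sum] sum_mono) auto
  then show ?thesis using assms(2) by (simp add: mult_left_mono)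
qed

text \<open>The score divided by sqrt m, with X replaced by X0 and \<open>Sig i\<close> by
  \<open>Siginf\<close>. The four error terms come from the inverse together with the quadratic term
  in X - X0, from \<open>Gmap\<close> at X instead of X0, from the second difference, and from
  \<open>remd\<close>. Three of them carry D or X - X0 as a factor.\<close>

lemma expansion:
  obtains C where "C \<ge> 0" "\<And>m a t s2 X. m > 0 \<Longrightarrow> X \<in> U \<Longrightarrow> score a t m X = 0 \<Longrightarrow>
    norm (((1 / real m) *\<^sub>R (\<Sum>i<m. outer (a i) (a i))) ** (sqrt (real m) *\<^sub>R (X - X0)) ** matrix_inv (Pmat e Siginf X0)
      + Gmap X0 Siginf (Sm s2 a t m)) \<le>
    C * norm (sqrt (real m) *\<^sub>R (X - X0)) * (1 / real m * (\<Sum>i<m. (norm (a i))\<^sup>2 * (2 * dist X X0 + dist (Sig i) Siginf)))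
    + C * dist X X0 * norm (Sm s2 a t m)
    + C * norm (sqrt (real m) *\<^sub>R (X - X0)) * (1 / real m * (\<Sum>i<m. dist (Sig i) Siginf * norm (Wd s2 a t i)))
    + norm (remd s2 a t m)"
proof -
  obtain C1 where "mixed_lipschitz_with C1 U V (\<lambda>X A. matrix_inv (Pmat e A X))"
    using mixed_lipschitz_inverse unfolding mixed_lipschitz_def by blast
  note B = mixed_lipschitz_withD[OF this]
  obtain C2 where "mixed_lipschitz_with C2 U V (\<lambda>X A. Lmap X A)"
    using mixed_lipschitz_Lmap unfolding mixed_lipschitz_def by blast
  note L = mixed_lipschitz_withD[OF this]
  obtain C3 where C3: "C3 \<ge> 0" "\<And>W. mixed_lipschitz_with (C3 * norm W) U V (\<lambda>X A. Gmap X A W)"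
    using Gmap_bounds by blast
  note G = mixed_lipschitz_withD[OF C3(2)]
  define C where "C = C1 + C2 * C1 + C3"
  have C0: "C \<ge> 0" "C1 \<le> C" "C2 * C1 \<le> C" "C3 \<le> C" using B(1) L(1) C3(1) by (auto simp: C_def)
  show thesis
  proof (rule that[OF C0(1)])
    fix m :: nat and a t s2 X
    assume m: "m > 0" and X: "X \<in> U" and sc: "score a t m X = 0"
    define q where "q = sqrt (real m)"
    have q: "q > 0" "q * q = real m" using m by (auto simp: q_def)
    let ?D = "q *\<^sub>R (X - X0)" and ?B = "\<lambda>i. matrix_inv (Pmat e (Sig i) X)" and ?Binf = "matrix_inv (Pmat e Siginf X0)"
      and ?W = "\<lambda>i. Wd s2 a t i" and ?S = "Sm s2 a t m"
    define H where "H i = Lmap X (Sig i) ** transpose (X - X0) ** outer (a i) (a i) ** ?D ** ?B i" for i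
    \<comment> \<open>Second difference of \<open>Gmap\<close> in (X, \<Sigma>). Subtracting it
      decouples the two deviations: what is left varies in X only at \<open>Siginf\<close>, and in
      \<Sigma> only at X0.\<close>
    define F where "F i = Gmap X (Sig i) (?W i) - Gmap X Siginf (?W i) - Gmap X0 (Sig i) (?W i) + Gmap X0 Siginf (?W i)" for i
    have rq: "(1 / real m) *\<^sub>R (q *\<^sub>R M) = (1 / q) *\<^sub>R M" for M :: "real ^ 'd ^ 'n"
      using q by (simp add: q(2)[symmetric])
    have sc_i: "(1 / q) *\<^sub>R outer (upper (obsv (a i) (t i) - pad e (Sig i) *v (Zmat X *v multiplier e (Sig i) (obsv (a i) (t i)) X)))
        (multiplier e (Sig i) (obsv (a i) (t i)) X) =
      (1 / real m) *\<^sub>R (outer (a i) (a i) ** ?D ** ?B i) - (1 / real m) *\<^sub>R H i + (1 / q) *\<^sub>R Gmap X (Sig i) (?W i)" for i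
      unfolding score_identity[OF X Sig_V, where ?s2.0=s2] Wd_def H_def
      by (simp add: matrix_mult_distribs rq scaleR_add_right scaleR_diff_right del: scaleR_scaleR)
    have "(1 / q) *\<^sub>R score a t m X = (1 / real m) *\<^sub>R (\<Sum>i<m. outer (a i) (a i) ** ?D ** ?B i) - (1 / real m) *\<^sub>R (\<Sum>i<m. H i)
        + (1 / q) *\<^sub>R (\<Sum>i<m. Gmap X (Sig i) (?W i))"
      unfolding score_def scaleR_sum_right sc_i by (simp add: sum.distrib sum_subtractf)
    then have zero: "(1 / real m) *\<^sub>R (\<Sum>i<m. outer (a i) (a i) ** ?D ** ?B i) - (1 / real m) *\<^sub>R (\<Sum>i<m. H i)
        + (1 / q) *\<^sub>R (\<Sum>i<m. Gmap X (Sig i) (?W i)) = 0" using sc by simp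
    have GS: "Gmap Y A ?S = (1 / q) *\<^sub>R (\<Sum>i<m. Gmap Y A (?W i))" for Y A
      by (simp add: Sm_def q_def linear_scale[OF linear_Gmap] linear_sum[OF linear_Gmap])
    have VD: "((1 / real m) *\<^sub>R (\<Sum>i<m. outer (a i) (a i))) ** ?D ** ?Binf = (1 / real m) *\<^sub>R (\<Sum>i<m. outer (a i) (a i) ** ?D ** ?Binf)"
      by (simp only: matrix_mult_distribs(5) bounded_bilinear.sum_left[OF bounded_bilinear_matrix_mult])
    have eq: "((1 / real m) *\<^sub>R (\<Sum>i<m. outer (a i) (a i))) ** ?D ** ?Binf + Gmap X0 Siginf ?S =
      (1 / real m) *\<^sub>R (\<Sum>i<m. outer (a i) (a i) ** ?D ** (?Binf - ?B i)) + (1 / real m) *\<^sub>R (\<Sum>i<m. H i)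
      - (1 / q) *\<^sub>R (\<Sum>i<m. F i) - (Gmap X Siginf ?S - Gmap X0 Siginf ?S) - remd s2 a t m"
    proof -
      have 1: "(\<Sum>i<m. outer (a i) (a i) ** ?D ** (?Binf - ?B i)) = (\<Sum>i<m. outer (a i) (a i) ** ?D ** ?Binf) - (\<Sum>i<m. outer (a i) (a i) ** ?D ** ?B i)"
        by (simp only: matrix_mult_distribs(4) sum_subtractf)
      have 2: "(\<Sum>i<m. F i) = (\<Sum>i<m. Gmap X (Sig i) (?W i)) - (\<Sum>i<m. Gmap X Siginf (?W i)) - (\<Sum>i<m. Gmap X0 (Sig i) (?W i)) + (\<Sum>i<m. Gmap X0 Siginf (?W i))"
        by (simp add: F_def sum.distrib sum_subtractf)
      have 3: "remd s2 a t m = (1 / q) *\<^sub>R (\<Sum>i<m. Gmap X0 (Sig i) (?W i)) - (1 / q) *\<^sub>R (\<Sum>i<m. Gmap X0 Siginf (?W i))"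
        by (simp add: remd_def q_def sum_subtractf scaleR_diff_right)
      show ?thesis unfolding VD GS 1 2 3 using zero by (simp add: scaleR_diff_right scaleR_add_right algebra_simps)
    qed
    have d: "dist X X0 = norm (X - X0)" by (simp add: dist_norm)
    have n1: "norm ((1 / real m) *\<^sub>R (\<Sum>i<m. outer (a i) (a i) ** ?D ** (?Binf - ?B i))) \<le>
        1 / real m * (\<Sum>i<m. C * norm ?D * ((norm (a i))\<^sup>2 * (dist X X0 + dist (Sig i) Siginf)))"
    proof (rule norm_mean_le)
      fix i
      have "norm (?Binf - ?B i) \<le> norm (matrix_inv (Pmat e Siginf X0) - matrix_inv (Pmat e (Sig i) X0)) + norm (matrix_inv (Pmat e (Sig i) X0) - ?B i)"
        using norm_triangle_ineq[of "?Binf - matrix_inv (Pmat e (Sig i) X0)" "matrix_inv (Pmat e (Sig i) X0) - ?B i"] by simp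
      also have "\<dots> \<le> C1 * dist Siginf (Sig i) + C1 * dist X0 X" by (intro add_mono B X0_U X Sig_V Siginf_V)
      also have "\<dots> \<le> C * (dist X X0 + dist (Sig i) Siginf)"
        using mult_right_mono[OF C0(2), of "dist Siginf (Sig i)"] mult_right_mono[OF C0(2), of "dist X0 X"]
        by (simp add: distrib_left dist_commute)
      finally have Bi: "norm (?Binf - ?B i) \<le> C * (dist X X0 + dist (Sig i) Siginf)" .
      have "norm (outer (a i) (a i) ** ?D ** (?Binf - ?B i)) \<le> (norm (a i) * norm (a i)) * norm ?D * (C * (dist X X0 + dist (Sig i) Siginf))"
        by (intro norm_matrix_mult_mono Bi) (auto simp: norm_outer)
      then show "norm (outer (a i) (a i) ** ?D ** (?Binf - ?B i)) \<le> C * norm ?D * ((norm (a i))\<^sup>2 * (dist X X0 + dist (Sig i) Siginf))"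
        by (simp add: power2_eq_square mult_ac)
    qed simp
    have n2: "norm ((1 / real m) *\<^sub>R (\<Sum>i<m. H i)) \<le> 1 / real m * (\<Sum>i<m. C * norm ?D * ((norm (a i))\<^sup>2 * dist X X0))"
    proof (rule norm_mean_le)
      fix i
      have "norm (H i) \<le> C2 * dist X X0 * (norm (a i) * norm (a i)) * norm ?D * C1"
        unfolding H_def by (intro norm_matrix_mult_mono B L X Sig_V) (auto simp: norm_outer norm_transpose d)
      also have "\<dots> = (C2 * C1) * (norm ?D * ((norm (a i))\<^sup>2 * dist X X0))" by (simp add: power2_eq_square mult_ac)
      also have "\<dots> \<le> C * (norm ?D * ((norm (a i))\<^sup>2 * dist X X0))" by (intro mult_right_mono C0) auto
      finally show "norm (H i) \<le> C * norm ?D * ((norm (a i))\<^sup>2 * dist X X0)" by (simp add: mult.assoc)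
    qed simp
    have n3: "norm ((1 / q) *\<^sub>R (\<Sum>i<m. F i)) \<le> 1 / q * (\<Sum>i<m. C * dist X X0 * (dist (Sig i) Siginf * norm (?W i)))"
    proof (rule norm_mean_le)
      fix i
      have "norm (F i) \<le> C3 * norm (?W i) * dist X X0 * dist (Sig i) Siginf"
        unfolding F_def by (intro G X X0_U Sig_V Siginf_V)
      also have "\<dots> = C3 * (dist X X0 * (dist (Sig i) Siginf * norm (?W i)))" by (simp add: mult_ac)
      also have "\<dots> \<le> C * (dist X X0 * (dist (Sig i) Siginf * norm (?W i)))" by (intro mult_right_mono C0) auto
      finally show "norm (F i) \<le> C * dist X X0 * (dist (Sig i) Siginf * norm (?W i))" by (simp add: mult.assoc)
    qed (use q in simp)
    \<comment> \<open>The factor |X - X0| / sqrt m equals |D| / m, so the sum of second differences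
      becomes an average, for which first moments are sufficient.\<close>
    have pr: "1 / q * (C * dist X X0) = C * norm ?D * (1 / real m)"
      using q by (simp add: d q(2)[symmetric])
    have "1 / q * (\<Sum>i<m. C * dist X X0 * (dist (Sig i) Siginf * norm (?W i))) =
        (1 / q * (C * dist X X0)) * (\<Sum>i<m. dist (Sig i) Siginf * norm (?W i))"
      by (simp only: sum_distrib_left mult.assoc)
    then have n3': "1 / q * (\<Sum>i<m. C * dist X X0 * (dist (Sig i) Siginf * norm (?W i))) =
        C * norm ?D * (1 / real m * (\<Sum>i<m. dist (Sig i) Siginf * norm (?W i)))"
      by (simp only: pr mult.assoc)
    have n4: "norm (Gmap X Siginf ?S - Gmap X0 Siginf ?S) \<le> C * dist X X0 * norm ?S"
    proof -
      have "norm (Gmap X Siginf ?S - Gmap X0 Siginf ?S) \<le> C3 * norm ?S * dist X X0" by (intro G X X0_U Siginf_V)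
      also have "\<dots> \<le> C * norm ?S * dist X X0" by (intro mult_right_mono C0) auto
      finally show ?thesis by (simp add: mult_ac)
    qed
    have n12: "1 / real m * (\<Sum>i<m. C * norm ?D * ((norm (a i))\<^sup>2 * (dist X X0 + dist (Sig i) Siginf)))
        + 1 / real m * (\<Sum>i<m. C * norm ?D * ((norm (a i))\<^sup>2 * dist X X0)) =
        C * norm ?D * (1 / real m * (\<Sum>i<m. (norm (a i))\<^sup>2 * (2 * dist X X0 + dist (Sig i) Siginf)))"
      unfolding sum_distrib_left[symmetric]
      by (simp add: sum.distrib sum_distrib_left distrib_left mult_ac)
    have tri: "norm (x1 + x2 - x3 - x4 - x5) \<le> norm x1 + norm x2 + norm x3 + norm x4 + norm x5" for x1 x2 x3 x4 x5 :: "real ^ 'd ^ 'n"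
      by (intro norm_triangle_le norm_triangle_le_diff add_mono order_refl)
    show "norm (((1 / real m) *\<^sub>R (\<Sum>i<m. outer (a i) (a i))) ** (sqrt (real m) *\<^sub>R (X - X0)) ** ?Binf + Gmap X0 Siginf ?S) \<le>
      C * norm (sqrt (real m) *\<^sub>R (X - X0)) * (1 / real m * (\<Sum>i<m. (norm (a i))\<^sup>2 * (2 * dist X X0 + dist (Sig i) Siginf)))
      + C * dist X X0 * norm ?S
      + C * norm (sqrt (real m) *\<^sub>R (X - X0)) * (1 / real m * (\<Sum>i<m. dist (Sig i) Siginf * norm (?W i)))
      + norm (remd s2 a t m)"
      unfolding q_def[symmetric] eq n12[symmetric] n3'[symmetric]
      by (rule order_trans[OF tri]) (use n1 n2 n3 n4 in linarith)
  qed
qed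

text \<open>The right-hand side of \<open>expansion\<close> still contains |D|. Its coefficient
  after multiplication by the inverse of VA and by P is at most 1/2 for small \<eta>, which first
  bounds |D| by a multiple of 1 + |S| and then, inserted again, gives the error of order
  \<eta>.\<close>

lemma normal_approximation:
  assumes VA: "invertible VA" and vb: "vb \<ge> 0"
  obtains C \<eta>0 where "C > 0" "\<eta>0 > 0" "\<And>m a t s2 X \<eta>. m > 0 \<Longrightarrow> 0 < \<eta> \<Longrightarrow> \<eta> \<le> \<eta>0 \<Longrightarrow> X \<in> U \<Longrightarrow> score a t m X = 0 \<Longrightarrow>
    norm ((1 / real m) *\<^sub>R (\<Sum>i<m. outer (a i) (a i)) - VA) \<le> \<eta> \<Longrightarrow>
    1 / real m * (\<Sum>i<m. (norm (a i))\<^sup>2) \<le> vb \<Longrightarrow>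
    1 / real m * (\<Sum>i<m. (norm (a i))\<^sup>2 * dist (Sig i) Siginf) \<le> \<eta> \<Longrightarrow> dist X X0 \<le> \<eta> \<Longrightarrow>
    1 / real m * (\<Sum>i<m. dist (Sig i) Siginf * norm (Wd s2 a t i)) \<le> \<eta> \<Longrightarrow> norm (remd s2 a t m) \<le> \<eta> \<Longrightarrow>
    norm (sqrt (real m) *\<^sub>R (X - X0) + matrix_inv VA ** Gamma_of (pad e Siginf) X0 (Sm s2 a t m)) \<le> C * \<eta> * (1 + norm (Sm s2 a t m))"
proof -
  obtain C where C: "C \<ge> 0" "\<And>m a t s2 X. m > 0 \<Longrightarrow> X \<in> U \<Longrightarrow> score a t m X = 0 \<Longrightarrow>
    norm (((1 / real m) *\<^sub>R (\<Sum>i<m. outer (a i) (a i))) ** (sqrt (real m) *\<^sub>R (X - X0)) ** matrix_inv (Pmat e Siginf X0)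
      + Gmap X0 Siginf (Sm s2 a t m)) \<le>
    C * norm (sqrt (real m) *\<^sub>R (X - X0)) * (1 / real m * (\<Sum>i<m. (norm (a i))\<^sup>2 * (2 * dist X X0 + dist (Sig i) Siginf)))
    + C * dist X X0 * norm (Sm s2 a t m)
    + C * norm (sqrt (real m) *\<^sub>R (X - X0)) * (1 / real m * (\<Sum>i<m. dist (Sig i) Siginf * norm (Wd s2 a t i)))
    + norm (remd s2 a t m)"
    using expansion by blast
  obtain CG where CG: "CG \<ge> 0" "\<And>W. mixed_lipschitz_with (CG * norm W) U V (\<lambda>X A. Gmap X A W)"
    using Gmap_bounds by blast
  define b0 where "b0 = norm (matrix_inv (Pmat e Siginf X0))"
  define c3 where "c3 = norm (matrix_inv VA) * norm (Pmat e Siginf X0) + 1"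
  define C2 where "C2 = b0 + C * (2 * vb + 2) + 1"
  have b0: "b0 \<ge> 0" by (simp add: b0_def)
  have c3: "c3 > 0" unfolding c3_def by (intro add_nonneg_pos mult_nonneg_nonneg) auto
  have cv: "0 \<le> C * (2 * vb + 2)" using C(1) vb by simp
  have "C * 1 \<le> C * (2 * vb + 2)" using C(1) vb by (intro mult_left_mono) auto
  then have C2: "C2 > 0" "b0 + C * (2 * vb + 2) \<le> C2" "C \<le> C2" "1 \<le> C2"
    using b0 cv unfolding C2_def by linarith+
  define c4 where "c4 = c3 * CG"
  have c4: "c4 \<ge> 0" using c3 CG(1) by (simp add: c4_def)
  \<comment> \<open>Ensures c3 C2 \<eta> at most 1/2, the factor needed to absorb |D|.\<close>
  define \<eta>0 where "\<eta>0 = 1 / (2 * c3 * C2)"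
  show thesis
  proof (rule that)
    show "c3 * C2 * (2 + 2 * c4) > 0" using c3 C2 c4 by (intro mult_pos_pos) auto
    show "\<eta>0 > 0" using c3 C2 by (simp add: \<eta>0_def)
    fix m :: nat and a t s2 X and \<eta> :: real
    assume m: "m > 0" and \<eta>: "0 < \<eta>" "\<eta> \<le> \<eta>0" and X: "X \<in> U" and sc: "score a t m X = 0"
      and 1: "norm ((1 / real m) *\<^sub>R (\<Sum>i<m. outer (a i) (a i)) - VA) \<le> \<eta>"
      and 2: "1 / real m * (\<Sum>i<m. (norm (a i))\<^sup>2) \<le> vb"
      and 3: "1 / real m * (\<Sum>i<m. (norm (a i))\<^sup>2 * dist (Sig i) Siginf) \<le> \<eta>" and 4: "dist X X0 \<le> \<eta>"
      and 5: "1 / real m * (\<Sum>i<m. dist (Sig i) Siginf * norm (Wd s2 a t i)) \<le> \<eta>" and 6: "norm (remd s2 a t m) \<le> \<eta>"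
    define D where "D = sqrt (real m) *\<^sub>R (X - X0)"
    define S where "S = Sm s2 a t m"
    define Vm where "Vm = (1 / real m) *\<^sub>R (\<Sum>i<m. outer (a i) (a i))"
    let ?Binf = "matrix_inv (Pmat e Siginf X0)" and ?Pinf = "Pmat e Siginf X0"
    define E where "E = VA ** D ** ?Binf + Gmap X0 Siginf S"
    have VAi: "matrix_inv VA ** VA = mat 1" by (rule matrix_inv_left[OF VA])
    have BP: "?Binf ** ?Pinf = mat 1" by (rule matrix_inv_left[OF pos_def_invertible[OF U_Pmat[OF X0_U Siginf_V]]])
    have Gam: "Gamma_of (pad e Siginf) X0 S = Gmap X0 Siginf S ** ?Pinf"
      unfolding Gmap_X0 matrix_mul_assoc[symmetric] BP by simp
    have DE: "D + matrix_inv VA ** Gamma_of (pad e Siginf) X0 S = matrix_inv VA ** E ** ?Pinf"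
    proof -
      have "matrix_inv VA ** (VA ** D ** ?Binf) ** ?Pinf = (matrix_inv VA ** VA) ** D ** (?Binf ** ?Pinf)"
        by (simp add: matrix_mul_assoc)
      then have "matrix_inv VA ** (VA ** D ** ?Binf) ** ?Pinf = D" by (simp add: VAi BP)
      then show ?thesis unfolding E_def Gam by (simp add: matrix_mult_distribs matrix_mul_assoc)
    qed
    have c3m: "norm (matrix_inv VA ** M ** ?Pinf) \<le> c3 * norm M" for M
    proof -
      have "norm (matrix_inv VA ** M ** ?Pinf) \<le> norm (matrix_inv VA) * norm M * norm ?Pinf"
        by (intro norm_matrix_mult_mono order_refl)
      also have "\<dots> = (norm (matrix_inv VA) * norm ?Pinf) * norm M" by simp
      also have "\<dots> \<le> c3 * norm M" by (intro mult_right_mono) (simp_all add: c3_def)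
      finally show ?thesis .
    qed
    have "E = (VA - Vm) ** D ** ?Binf + (Vm ** D ** ?Binf + Gmap X0 Siginf S)"
      by (simp add: E_def matrix_mult_distribs)
    then have "norm E \<le> norm ((VA - Vm) ** D ** ?Binf) + norm (Vm ** D ** ?Binf + Gmap X0 Siginf S)"
      by (simp add: norm_triangle_ineq)
    also have "norm ((VA - Vm) ** D ** ?Binf) \<le> \<eta> * norm D * b0"
      unfolding b0_def using 1 by (intro norm_matrix_mult_mono order_refl) (simp add: Vm_def norm_minus_commute)
    also have "norm (Vm ** D ** ?Binf + Gmap X0 Siginf S) \<le>
        C * norm D * (1 / real m * (\<Sum>i<m. (norm (a i))\<^sup>2 * (2 * dist X X0 + dist (Sig i) Siginf)))
        + C * dist X X0 * norm S + C * norm D * (1 / real m * (\<Sum>i<m. dist (Sig i) Siginf * norm (Wd s2 a t i)))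
        + norm (remd s2 a t m)"
      unfolding Vm_def D_def S_def by (rule C(2)[OF m X sc])
    also have "\<dots> \<le> C * norm D * (2 * \<eta> * vb + \<eta>) + C * \<eta> * norm S + C * norm D * \<eta> + \<eta>"
    proof (intro add_mono mult_left_mono mult_right_mono 5 6 4)
      have "1 / real m * (\<Sum>i<m. (norm (a i))\<^sup>2 * (2 * dist X X0 + dist (Sig i) Siginf)) =
          2 * dist X X0 * (1 / real m * (\<Sum>i<m. (norm (a i))\<^sup>2)) + 1 / real m * (\<Sum>i<m. (norm (a i))\<^sup>2 * dist (Sig i) Siginf)"
        by (simp add: distrib_left sum.distrib sum_distrib_left mult_ac)
      also have "\<dots> \<le> 2 * \<eta> * vb + \<eta>"
        using 2 3 4 \<eta> by (intro add_mono mult_mono) (auto intro!: sum_nonneg divide_nonneg_nonneg)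
      finally show "1 / real m * (\<Sum>i<m. (norm (a i))\<^sup>2 * (2 * dist X X0 + dist (Sig i) Siginf)) \<le> 2 * \<eta> * vb + \<eta>" .
    qed (use C(1) in auto)
    finally have "norm E \<le> \<eta> * ((b0 + C * (2 * vb + 2)) * norm D + C * norm S + 1)"
      by (simp add: algebra_simps)
    also have "\<dots> \<le> \<eta> * (C2 * norm D + C2 * norm S + C2)"
      using \<eta> C2 by (intro mult_left_mono add_mono mult_right_mono) auto
    finally have E: "norm E \<le> C2 * \<eta> * (norm D + norm S + 1)" by (simp add: algebra_simps)
    have half: "c3 * (C2 * \<eta>) \<le> 1/2"
    proof -
      have "c3 * (C2 * \<eta>) \<le> c3 * (C2 * \<eta>0)" using c3 C2 \<eta> by (intro mult_left_mono) auto
      also have "\<dots> = 1/2" using c3 C2 by (simp add: \<eta>0_def)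
      finally show ?thesis .
    qed
    have "norm (matrix_inv VA ** Gamma_of (pad e Siginf) X0 S) \<le> c4 * norm S"
    proof -
      have "norm (matrix_inv VA ** Gmap X0 Siginf S ** ?Pinf) \<le> c3 * norm (Gmap X0 Siginf S)" by (rule c3m)
      also have "norm (Gmap X0 Siginf S) \<le> CG * norm S" by (rule mixed_lipschitz_withD(2)[OF CG(2) X0_U Siginf_V])
      finally show ?thesis unfolding Gam c4_def using c3 by (simp add: matrix_mul_assoc mult.assoc mult_left_mono)
    qed
    moreover have "norm (matrix_inv VA ** E ** ?Pinf) \<le> 1/2 * (norm D + norm S + 1)"
    proof -
      have "norm (matrix_inv VA ** E ** ?Pinf) \<le> c3 * (C2 * \<eta> * (norm D + norm S + 1))"
        using c3m[of E] mult_left_mono[OF E, of c3] c3 by linarith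
      also have "\<dots> = c3 * (C2 * \<eta>) * (norm D + norm S + 1)" by (simp add: mult.assoc)
      also have "\<dots> \<le> 1/2 * (norm D + norm S + 1)" using half by (intro mult_right_mono) auto
      finally show ?thesis .
    qed
    moreover have "norm D \<le> norm (matrix_inv VA ** E ** ?Pinf) + norm (matrix_inv VA ** Gamma_of (pad e Siginf) X0 S)"
    proof -
      have "D = matrix_inv VA ** E ** ?Pinf - matrix_inv VA ** Gamma_of (pad e Siginf) X0 S"
        unfolding DE[symmetric] by simp
      then show ?thesis by (metis norm_triangle_ineq4)
    qed
    moreover have "d \<le> s + 1 + 2 * r" if "b \<le> r" "c \<le> 1/2 * (d + s + 1)" "d \<le> c + b" for b c d r s :: real
      using that by simp
    ultimately have D: "norm D \<le> norm S + 1 + 2 * (c4 * norm S)" by blast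
    have "norm D + norm S + 1 \<le> (2 + 2 * c4) * (1 + norm S)"
      using D c4 by (simp add: algebra_simps)
    then have "C2 * \<eta> * (norm D + norm S + 1) \<le> C2 * \<eta> * ((2 + 2 * c4) * (1 + norm S))"
      using C2 \<eta> by (intro mult_left_mono) auto
    with E have "norm E \<le> C2 * \<eta> * ((2 + 2 * c4) * (1 + norm S))" by linarith
    then have "c3 * norm E \<le> c3 * (C2 * \<eta> * ((2 + 2 * c4) * (1 + norm S)))" using c3 by (intro mult_left_mono) auto
    with c3m[of E] show "norm (sqrt (real m) *\<^sub>R (X - X0) + matrix_inv VA ** Gamma_of (pad e Siginf) X0 (Sm s2 a t m)) \<le>
        c3 * C2 * (2 + 2 * c4) * \<eta> * (1 + norm (Sm s2 a t m))"
      unfolding D_def[symmetric] S_def[symmetric] DE by (simp add: mult_ac)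
  qed
qed

end

subsection \<open>The errors-in-variables model\<close>

lemma powr_sum_le:
  fixes x :: "'i \<Rightarrow> real"
  assumes "finite I" "\<And>i. i \<in> I \<Longrightarrow> 0 \<le> x i" "p \<ge> 0"
  shows "(\<Sum>i\<in>I. x i) powr p \<le> real (card I) powr p * (\<Sum>i\<in>I. x i powr p)"
proof (cases "I = {}")
  case False
  define mx where "mx = Max (x ` I)"
  have mx: "\<And>i. i \<in> I \<Longrightarrow> x i \<le> mx" "mx \<in> x ` I" using assms(1) False by (auto simp: mx_def)
  then have mx0: "mx \<ge> 0" using assms(2) by auto
  have "(\<Sum>i\<in>I. x i) \<le> real (card I) * mx" using mx(1) by (intro sum_bounded_above) auto
  then have "(\<Sum>i\<in>I. x i) powr p \<le> (real (card I) * mx) powr p"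
    using assms by (intro powr_mono2) (auto intro: sum_nonneg)
  also have "\<dots> = real (card I) powr p * mx powr p" using mx0 by (simp add: powr_mult)
  also have "mx powr p \<le> (\<Sum>i\<in>I. x i powr p)"
  proof -
    obtain i where i: "i \<in> I" "mx = x i" using mx(2) by blast
    show ?thesis unfolding i(2) using assms(1) i(1) by (intro member_le_sum) auto
  qed
  finally show ?thesis by (simp add: mult_left_mono)
qed simp

lemma one_plus_powr_le: "(1 + y) powr p \<le> 2 powr p * (1 + y powr p)" if "y \<ge> 0" "p \<ge> 0" for y p :: real
proof -
  have "(1 + y) powr p \<le> (2 * max 1 y) powr p" using that by (intro powr_mono2) auto
  also have "\<dots> = 2 powr p * max 1 y powr p" by (simp add: powr_mult)
  also have "max 1 y powr p \<le> 1 + y powr p" by (auto simp: max_def)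
  finally show ?thesis by (simp add: mult_left_mono)
qed

lemma (in prob_space) covariance_operator:
  fixes W :: "nat \<Rightarrow> 'a \<Rightarrow> 'b::euclidean_space"
  assumes [measurable]: "\<And>i. W i \<in> borel_measurable M" and sq: "\<And>i. integrable M (\<lambda>\<omega>. (norm (W i \<omega>))\<^sup>2)"
    and lim: "\<And>u. (\<lambda>m. 1 / real m * (\<Sum>i<m. expectation (\<lambda>\<omega>. (u \<bullet> W i \<omega>)\<^sup>2))) \<longlonglongrightarrow> q u"
  obtains T where "linear T" "\<And>x y. T x \<bullet> y = x \<bullet> T y" "\<And>x. q x = x \<bullet> T x" "\<And>x. 0 \<le> x \<bullet> T x"
proof -
  have int: "integrable M (\<lambda>\<omega>. (u \<bullet> W i \<omega>) * (v \<bullet> W i \<omega>))" for u v i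
  proof (rule Bochner_Integration.integrable_bound[of _ "\<lambda>\<omega>. norm u * norm v * (norm (W i \<omega>))\<^sup>2"])
    show "integrable M (\<lambda>\<omega>. norm u * norm v * (norm (W i \<omega>))\<^sup>2)" using sq by simp
    have "\<bar>(u \<bullet> W i \<omega>) * (v \<bullet> W i \<omega>)\<bar> \<le> norm u * norm v * (norm (W i \<omega>))\<^sup>2" for \<omega>
      using mult_mono[OF Cauchy_Schwarz_ineq2[of u "W i \<omega>"] Cauchy_Schwarz_ineq2[of v "W i \<omega>"]]
      by (simp add: abs_mult power2_eq_square mult_ac)
    then show "AE \<omega> in M. norm ((u \<bullet> W i \<omega>) * (v \<bullet> W i \<omega>)) \<le> norm (norm u * norm v * (norm (W i \<omega>))\<^sup>2)" by simp
  qed measurable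
  define b where "b m u v = 1 / real m * (\<Sum>i<m. expectation (\<lambda>\<omega>. (u \<bullet> W i \<omega>) * (v \<bullet> W i \<omega>)))" for m u v
  show thesis
  proof (rule quadratic_form_operator[of b q])
    show "linear (b m u)" for m u
    proof (rule linearI)
      show "b m u (v + w) = b m u v + b m u w" for v w
        using int by (simp add: b_def inner_add_left distrib_left sum.distrib)
      show "b m u (r *\<^sub>R v) = r *\<^sub>R b m u v" for r v
      proof -
        have "expectation (\<lambda>\<omega>. (u \<bullet> W i \<omega>) * (r * (v \<bullet> W i \<omega>))) = r * expectation (\<lambda>\<omega>. (u \<bullet> W i \<omega>) * (v \<bullet> W i \<omega>))" for i
          by (subst integral_mult_right_zero[symmetric]) (simp add: mult_ac)
        then show ?thesis by (simp add: b_def sum_distrib_left)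
      qed
    qed
    show "b m u v = b m v u" for m u v by (simp add: b_def mult.commute)
    show "0 \<le> b m u u" for m u by (simp add: b_def sum_nonneg)
    show "(\<lambda>m. b m u u) \<longlonglongrightarrow> q u" for u using lim[of u] by (simp add: b_def power2_eq_square)
  qed (rule that)
qed

locale eiv = prob_space M for M :: "'w measure" +
  fixes X0 :: "real ^ 'd::finite ^ 'n::finite" and a0 :: "nat \<Rightarrow> real ^ 'n" and ct :: "nat \<Rightarrow> 'w \<Rightarrow> real ^ ('n + 'd)"
    and J :: "('n + 'd) set" and e :: "'j::finite \<Rightarrow> 'n + 'd" and Sig :: "nat \<Rightarrow> real ^ 'j ^ 'j"
    and Siginf :: "real ^ 'j ^ 'j" and VA :: "real ^ 'n ^ 'n" and \<sigma> \<delta> :: real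
    and mu4 :: "'n + 'd \<Rightarrow> 'n + 'd \<Rightarrow> 'n + 'd \<Rightarrow> 'n + 'd \<Rightarrow> real"
  assumes enum: "bij_betw e UNIV J"
    and indep: "indep_vars (\<lambda>_. borel) ct UNIV"
    and second_moments: "\<And>i. integrable M (\<lambda>\<omega>. (norm (ct i \<omega>))\<^sup>2)"
    and zero_mean: "\<And>i. (\<integral>\<omega>. ct i \<omega> \<partial>M) = 0"
    and error_free: "\<And>i j. j \<notin> J \<Longrightarrow> (\<integral>\<omega>. (ct i \<omega> $ j)\<^sup>2 \<partial>M) = 0"
    and sigma_pos: "\<sigma> > 0"
    and cov_J: "\<And>i. cov_matrix M (\<lambda>\<omega>. subrows e (ct i \<omega>)) = \<sigma>\<^sup>2 *\<^sub>R Sig i"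
    and \<delta>: "\<delta> > 0"
    and moments: "(SUP (i, j) \<in> UNIV \<times> J. \<integral>\<^sup>+\<omega>. ennreal (\<bar>ct i \<omega> $ j\<bar> powr (4 + 2 * \<delta>)) \<partial>M) < \<infinity>"
    and lyapunov: "(\<lambda>m. 1 / real m powr (1 + \<delta> / 2) * (\<Sum>i<m. norm (a0 i) powr (2 + \<delta>))) \<longlonglongrightarrow> 0"
    and VA_lim: "(\<lambda>m. (1 / real m) *\<^sub>R (\<Sum>i<m. outer (a0 i) (a0 i))) \<longlonglongrightarrow> VA"
    and Sig_lim: "Sig \<longlonglongrightarrow> Siginf"
    and third: "\<And>i p q r. p \<in> J \<Longrightarrow> q \<in> J \<Longrightarrow> r \<in> J \<Longrightarrow>
      (\<integral>\<omega>. ct i \<omega> $ p * ct i \<omega> $ q * ct i \<omega> $ r \<partial>M) = 0"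
    and fourth: "\<And>p q r u. p \<in> J \<Longrightarrow> q \<in> J \<Longrightarrow> r \<in> J \<Longrightarrow> u \<in> J \<Longrightarrow>
      (\<lambda>m. 1 / real m * (\<Sum>i<m. \<integral>\<omega>. ct i \<omega> $ p * ct i \<omega> $ q * ct i \<omega> $ r * ct i \<omega> $ u \<partial>M))
        \<longlonglongrightarrow> mu4 p q r u"
begin

lemma inj: "inj e" and range: "range e = J" using enum by (auto simp: bij_betw_def)

lemma rv [measurable]: "ct i \<in> borel_measurable M" using indep unfolding indep_vars_def2 by simp

lemma rv_comp [measurable]: "(\<lambda>\<omega>. ct i \<omega> $ s) \<in> borel_measurable M"
  by (rule measurable_compose[OF rv borel_measurable_continuous_onI]) (intro continuous_intros)

lemma error_free_AE: "s \<notin> J \<Longrightarrow> AE \<omega> in M. ct i \<omega> $ s = 0"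
proof -
  assume s: "s \<notin> J"
  have "integrable M (\<lambda>\<omega>. (ct i \<omega> $ s)\<^sup>2)"
    by (rule Bochner_Integration.integrable_bound[OF second_moments[of i]])
      (auto simp: abs_le_square_iff[symmetric] component_le_norm_cart)
  then have "AE \<omega> in M. (ct i \<omega> $ s)\<^sup>2 = 0"
    using error_free[OF s, of i] by (subst (asm) integral_nonneg_eq_0_iff_AE) auto
  then show ?thesis by simp
qed

text \<open>One null set serves all i and s; outside it the deterministic results on errors
  supported in J apply path by path.\<close>

lemma supported_AE: "AE \<omega> in M. \<forall>i s. s \<notin> J \<longrightarrow> ct i \<omega> $ s = 0"
  unfolding AE_all_countable
proof (intro allI)
  fix i s
  show "AE \<omega> in M. s \<notin> J \<longrightarrow> ct i \<omega> $ s = 0" using error_free_AE[of s i] by (cases "s \<in> J") auto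
qed

text \<open>Dominates every product of at most two coordinates of \<open>ct i \<omega>\<close>, and has a bounded moment of order \<open>2 + \<delta>\<close>.\<close>

definition Y where "Y i \<omega> = 1 + (norm (ct i \<omega>))\<^sup>2"

lemma Y_ge1: "Y i \<omega> \<ge> 1" by (simp add: Y_def)

lemma Y_measurable [measurable]: "Y i \<in> borel_measurable M" unfolding Y_def[abs_def] by measurable

text \<open>The square in Y turns the order 4 + 2 \<delta> of the moment assumption into 2 +
  \<delta>. Coordinates outside J vanish almost everywhere and satisfy the same bound.\<close>

lemma Y_moment: "\<exists>C\<ge>1. \<forall>i. integrable M (\<lambda>\<omega>. Y i \<omega> powr (2 + \<delta>)) \<and> expectation (\<lambda>\<omega>. Y i \<omega> powr (2 + \<delta>)) \<le> C"
proof -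
  let ?p = "2 + \<delta>" and ?N = "real CARD('n + 'd)"
  obtain K where K: "K \<ge> 0" "(SUP (i, j) \<in> UNIV \<times> J. \<integral>\<^sup>+\<omega>. ennreal (\<bar>ct i \<omega> $ j\<bar> powr (4 + 2 * \<delta>)) \<partial>M) = ennreal K"
    using ennreal_enn2real[of "SUP (i, j) \<in> UNIV \<times> J. \<integral>\<^sup>+\<omega>. ennreal (\<bar>ct i \<omega> $ j\<bar> powr (4 + 2 * \<delta>)) \<partial>M"] moments
    by (metis enn2real_nonneg infinity_ennreal_def)
  have bd: "integrable M (\<lambda>\<omega>. \<bar>ct i \<omega> $ s\<bar> powr (4 + 2 * \<delta>)) \<and> expectation (\<lambda>\<omega>. \<bar>ct i \<omega> $ s\<bar> powr (4 + 2 * \<delta>)) \<le> K" for i s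
  proof -
    have nn: "(\<integral>\<^sup>+\<omega>. ennreal (\<bar>ct i \<omega> $ s\<bar> powr (4 + 2 * \<delta>)) \<partial>M) \<le> ennreal K"
    proof (cases "s \<in> J")
      case True
      show ?thesis unfolding K(2)[symmetric] by (rule SUP_upper2[where i="(i, s)"]) (use True in auto)
    next
      case False
      have "(\<integral>\<^sup>+\<omega>. ennreal (\<bar>ct i \<omega> $ s\<bar> powr (4 + 2 * \<delta>)) \<partial>M) = (\<integral>\<^sup>+\<omega>. 0 \<partial>M)"
        by (rule nn_integral_cong_AE) (use error_free_AE[OF False, of i] in eventually_elim, simp)
      then show ?thesis by simp
    qed
    have int: "integrable M (\<lambda>\<omega>. \<bar>ct i \<omega> $ s\<bar> powr (4 + 2 * \<delta>))"
      using nn by (intro integrableI_nonneg) (auto simp: ennreal_less_top[THEN order_le_less_trans[rotated]])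
    moreover have "ennreal (expectation (\<lambda>\<omega>. \<bar>ct i \<omega> $ s\<bar> powr (4 + 2 * \<delta>))) \<le> ennreal K"
      using nn by (subst nn_integral_eq_integral[symmetric, OF int]) auto
    ultimately show ?thesis using K(1) by simp
  qed
  let ?F = "\<lambda>i \<omega>. 2 powr ?p * (1 + ?N powr ?p * (\<Sum>s\<in>UNIV. \<bar>ct i \<omega> $ s\<bar> powr (4 + 2 * \<delta>)))"
  have le: "Y i \<omega> powr ?p \<le> ?F i \<omega>" for i \<omega>
  proof -
    have n: "(norm (ct i \<omega>))\<^sup>2 = (\<Sum>s\<in>UNIV. (ct i \<omega> $ s)\<^sup>2)"
      unfolding power2_norm_eq_inner by (simp add: inner_vec_def power2_eq_square)
    have "Y i \<omega> powr ?p \<le> 2 powr ?p * (1 + ((norm (ct i \<omega>))\<^sup>2) powr ?p)"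
      unfolding Y_def using \<delta> by (intro one_plus_powr_le) auto
    also have "((norm (ct i \<omega>))\<^sup>2) powr ?p \<le> ?N powr ?p * (\<Sum>s\<in>UNIV. ((ct i \<omega> $ s)\<^sup>2) powr ?p)"
      unfolding n using \<delta> by (intro powr_sum_le) auto
    also have "(\<lambda>s. ((ct i \<omega> $ s)\<^sup>2) powr ?p) = (\<lambda>s. \<bar>ct i \<omega> $ s\<bar> powr (4 + 2 * \<delta>))"
    proof
      fix s
      have "(ct i \<omega> $ s)\<^sup>2 = \<bar>ct i \<omega> $ s\<bar> powr 2" by (cases "ct i \<omega> $ s = 0") auto
      then show "((ct i \<omega> $ s)\<^sup>2) powr ?p = \<bar>ct i \<omega> $ s\<bar> powr (4 + 2 * \<delta>)"
        by (simp only: powr_powr) (simp add: distrib_left)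
    qed
    finally show ?thesis by (simp add: mult_left_mono)
  qed
  have Fint: "integrable M (?F i)" for i using bd by auto
  have FE: "expectation (?F i) \<le> 2 powr ?p * (1 + ?N powr ?p * (\<Sum>s\<in>(UNIV :: ('n + 'd) set). K))" for i
  proof -
    have "expectation (?F i) = 2 powr ?p * (1 + ?N powr ?p * (\<Sum>s\<in>UNIV. expectation (\<lambda>\<omega>. \<bar>ct i \<omega> $ s\<bar> powr (4 + 2 * \<delta>))))"
      using bd by (simp add: prob_space)
    also have "\<dots> \<le> 2 powr ?p * (1 + ?N powr ?p * (\<Sum>s\<in>(UNIV :: ('n + 'd) set). K))"
      using bd by (intro mult_left_mono add_left_mono sum_mono) auto
    finally show ?thesis .
  qed
  have int: "integrable M (\<lambda>\<omega>. Y i \<omega> powr ?p)" for i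
    by (rule Bochner_Integration.integrable_bound[OF Fint[of i]]) (use le[of i] in \<open>auto intro: order_trans[OF _ abs_ge_self]\<close>)
  have "expectation (\<lambda>\<omega>. Y i \<omega> powr ?p) \<le> max 1 (2 powr ?p * (1 + ?N powr ?p * (\<Sum>s\<in>(UNIV :: ('n + 'd) set). K)))" for i
    using order_trans[OF integral_mono[OF int Fint le, of i] FE[of i]] by (rule max.coboundedI2)
  with int show ?thesis by (intro exI[of _ "max 1 (2 powr ?p * (1 + ?N powr ?p * (\<Sum>s\<in>(UNIV :: ('n + 'd) set). K)))"]) auto
qed

definition CY where "CY = (SOME C. C \<ge> 1 \<and> (\<forall>i. integrable M (\<lambda>\<omega>. Y i \<omega> powr (2 + \<delta>)) \<and> expectation (\<lambda>\<omega>. Y i \<omega> powr (2 + \<delta>)) \<le> C))"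

lemma CY: "CY \<ge> 1" "integrable M (\<lambda>\<omega>. Y i \<omega> powr (2 + \<delta>))" "expectation (\<lambda>\<omega>. Y i \<omega> powr (2 + \<delta>)) \<le> CY"
proof -
  have "CY \<ge> 1 \<and> (\<forall>i. integrable M (\<lambda>\<omega>. Y i \<omega> powr (2 + \<delta>)) \<and> expectation (\<lambda>\<omega>. Y i \<omega> powr (2 + \<delta>)) \<le> CY)"
    unfolding CY_def by (rule someI_ex) (rule Y_moment)
  then show "CY \<ge> 1" "integrable M (\<lambda>\<omega>. Y i \<omega> powr (2 + \<delta>))" "expectation (\<lambda>\<omega>. Y i \<omega> powr (2 + \<delta>)) \<le> CY" by auto
qed

text \<open>The summand 1 in Y makes Y at least 1, so low powers are dominated by the power 2 +
  \<delta>.\<close>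

lemma Y_power:
  assumes "k \<le> 2"
  shows "integrable M (\<lambda>\<omega>. Y i \<omega> ^ k)" "expectation (\<lambda>\<omega>. Y i \<omega> ^ k) \<le> CY"
proof -
  have le: "Y i \<omega> ^ k \<le> Y i \<omega> powr (2 + \<delta>)" for \<omega>
  proof -
    have "Y i \<omega> ^ k = Y i \<omega> powr real k" using Y_ge1[of i \<omega>] by (simp add: powr_realpow)
    also have "\<dots> \<le> Y i \<omega> powr (2 + \<delta>)" using Y_ge1[of i \<omega>] assms \<delta> by (intro powr_mono) auto
    finally show ?thesis .
  qed
  have nn: "0 \<le> Y i \<omega>" for \<omega> using Y_ge1[of i \<omega>] by simp
  show int: "integrable M (\<lambda>\<omega>. Y i \<omega> ^ k)"
    by (rule Bochner_Integration.integrable_bound[OF CY(2)[of i]]) (use le nn in auto)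
  show "expectation (\<lambda>\<omega>. Y i \<omega> ^ k) \<le> CY"
    using integral_mono[OF int CY(2) le] CY(3)[of i] by linarith
qed

lemma norm_ct_le: "norm (ct i \<omega>) \<le> Y i \<omega>"
proof -
  have "0 \<le> (norm (ct i \<omega>) - 1)\<^sup>2" by simp
  then show ?thesis by (simp add: Y_def power2_eq_square algebra_simps) (smt (verit) norm_ge_zero)
qed

lemma ct_le: "\<bar>ct i \<omega> $ p\<bar> \<le> Y i \<omega>" "\<bar>ct i \<omega> $ p * ct i \<omega> $ q\<bar> \<le> Y i \<omega>"
  using component_le_norm_cart[of "ct i \<omega>" p] norm_ct_le[of i \<omega>] apply linarith
  using mult_mono[OF component_le_norm_cart[of "ct i \<omega>" p] component_le_norm_cart[of "ct i \<omega>" q]]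
  by (simp add: Y_def abs_mult power2_eq_square)

lemma int1: "integrable M (\<lambda>\<omega>. ct i \<omega> $ p)"
  by (rule Bochner_Integration.integrable_bound[OF Y_power(1)[of 1 i]]) (auto intro!: AE_I2 order_trans[OF ct_le(1) abs_ge_self])

lemma int2: "integrable M (\<lambda>\<omega>. ct i \<omega> $ p * ct i \<omega> $ q)"
  by (rule Bochner_Integration.integrable_bound[OF Y_power(1)[of 1 i]]) (auto intro!: AE_I2 order_trans[OF ct_le(2) abs_ge_self])

lemma int4: "integrable M (\<lambda>\<omega>. ct i \<omega> $ p * ct i \<omega> $ q * ct i \<omega> $ r * ct i \<omega> $ s)"
proof (rule Bochner_Integration.integrable_bound[OF Y_power(1)[of 2 i]])
  have "\<bar>ct i \<omega> $ p * ct i \<omega> $ q * ct i \<omega> $ r * ct i \<omega> $ s\<bar> \<le> Y i \<omega> ^ 2" for \<omega>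
    using mult_mono[OF ct_le(2)[of i \<omega> p q] ct_le(2)[of i \<omega> r s]] Y_ge1[of i \<omega>]
    by (simp add: abs_mult power2_eq_square mult.assoc)
  then show "AE \<omega> in M. norm (ct i \<omega> $ p * ct i \<omega> $ q * ct i \<omega> $ r * ct i \<omega> $ s) \<le> norm (Y i \<omega> ^ 2)" by simp
qed auto

lemma int3: "integrable M (\<lambda>\<omega>. ct i \<omega> $ p * ct i \<omega> $ q * ct i \<omega> $ r)"
proof (rule Bochner_Integration.integrable_bound[OF Y_power(1)[of 2 i]])
  have "\<bar>ct i \<omega> $ p * ct i \<omega> $ q * ct i \<omega> $ r\<bar> \<le> Y i \<omega> ^ 2" for \<omega>
    using mult_mono[OF ct_le(2)[of i \<omega> p q] ct_le(1)[of i \<omega> r]] Y_ge1[of i \<omega>]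
    by (simp add: abs_mult power2_eq_square mult.assoc)
  then show "AE \<omega> in M. norm (ct i \<omega> $ p * ct i \<omega> $ q * ct i \<omega> $ r) \<le> norm (Y i \<omega> ^ 2)" by simp
qed auto

lemma mean1: "expectation (\<lambda>\<omega>. ct i \<omega> $ p) = 0"
proof -
  have "integrable M (ct i)"
    by (rule Bochner_Integration.integrable_bound[OF Y_power(1)[of 1 i]]) (auto intro!: AE_I2 order_trans[OF norm_ct_le abs_ge_self])
  from integral_inner_right[of "axis p 1", OF this] show ?thesis
    using zero_mean[of i] by (simp add: inner_axis')
qed

lemma third_all: "expectation (\<lambda>\<omega>. ct i \<omega> $ p * ct i \<omega> $ q * ct i \<omega> $ r) = 0"
proof (cases "p \<in> J \<and> q \<in> J \<and> r \<in> J")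
  case True then show ?thesis by (simp add: third)
next
  case False
  have "expectation (\<lambda>\<omega>. ct i \<omega> $ p * ct i \<omega> $ q * ct i \<omega> $ r) = expectation (\<lambda>\<omega>. 0)"
    by (rule integral_cong_AE) (use supported_AE False in \<open>auto elim!: eventually_mono\<close>)
  then show ?thesis by simp
qed

lemma fourth_all: "\<exists>l. (\<lambda>m. 1 / real m * (\<Sum>i<m. expectation (\<lambda>\<omega>. ct i \<omega> $ p * ct i \<omega> $ q * ct i \<omega> $ r * ct i \<omega> $ u))) \<longlonglongrightarrow> l"
proof (cases "p \<in> J \<and> q \<in> J \<and> r \<in> J \<and> u \<in> J")
  case True then show ?thesis using fourth by blast
next
  case False
  have "expectation (\<lambda>\<omega>. ct i \<omega> $ p * ct i \<omega> $ q * ct i \<omega> $ r * ct i \<omega> $ u) = expectation (\<lambda>\<omega>. 0)" for i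
    by (rule integral_cong_AE) (use supported_AE False in \<open>auto elim!: eventually_mono\<close>)
  then show ?thesis by auto
qed

lemma pad_entry: "pad e A $ e k $ e l = A $ k $ l" "s \<notin> J \<or> s' \<notin> J \<Longrightarrow> pad e A $ s $ s' = 0"
proof -
  have eq: "pad e A $ s $ s' = axis s 1 \<bullet> (pad e A *v axis s' 1)" for s s'
    by (simp add: matrix_vector_mult_basis inner_axis' column_def)
  have sa: "subrows e (axis (e k) (1::real)) = axis k 1" for k
    using inj by (auto simp: vec_eq_iff subrows_def axis_def inj_eq)
  have s0: "subrows e (axis s (1::real)) = 0" if "s \<notin> J" for s
    using that range by (auto simp: vec_eq_iff subrows_def axis_def)
  show "pad e A $ e k $ e l = A $ k $ l"
    unfolding eq pad_inner sa by (simp add: matrix_vector_mult_basis inner_axis' column_def)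
  show "pad e A $ s $ s' = 0" if "s \<notin> J \<or> s' \<notin> J"
    using that unfolding eq pad_inner by (auto simp: s0)
qed

lemma cov_entry: "expectation (\<lambda>\<omega>. ct i \<omega> $ p * ct i \<omega> $ q) = \<sigma>\<^sup>2 * pad e (Sig i) $ p $ q"
proof (cases "p \<in> J \<and> q \<in> J")
  case True
  then obtain k l where kl: "p = e k" "q = e l" using range by blast
  have "cov_matrix M (\<lambda>\<omega>. subrows e (ct i \<omega>)) $ k $ l = expectation (\<lambda>\<omega>. ct i \<omega> $ p * ct i \<omega> $ q)"
    by (simp add: cov_matrix_def subrows_def mean1 kl)
  then show ?thesis unfolding cov_J by (simp add: kl pad_entry)
next
  case False
  have "expectation (\<lambda>\<omega>. ct i \<omega> $ p * ct i \<omega> $ q) = expectation (\<lambda>\<omega>. 0)"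
    by (rule integral_cong_AE) (use supported_AE False in \<open>auto elim!: eventually_mono\<close>)
  then show ?thesis using False by (simp add: pad_entry)
qed

lemma Smat_eq: "Smat M \<sigma> ct i = pad e (Sig i)"
  using sigma_pos by (simp add: vec_eq_iff Smat_def cov_matrix_def mean1 cov_entry)

lemma Wpair_eq: "Wpair M \<sigma> a0 ct i \<omega> = (outer (a0 i) (ct i \<omega>), outer (ct i \<omega>) (ct i \<omega>) - \<sigma>\<^sup>2 *\<^sub>R pad e (Sig i))"
  by (simp add: Wpair_def Smat_eq)

end

lemma bounded_bilinear_outer: "bounded_bilinear (outer :: real ^ 'p::finite \<Rightarrow> real ^ 'q::finite \<Rightarrow> real ^ 'q ^ 'p)"
proof -
  have "bilinear (outer :: real ^ 'p \<Rightarrow> real ^ 'q \<Rightarrow> real ^ 'q ^ 'p)"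
    unfolding bilinear_def by (intro conjI allI linearI) (simp_all add: vec_eq_iff outer_def algebra_simps)
  then show ?thesis by (simp add: bilinear_conv_bounded_bilinear)
qed

lemma bounded_linear_pad: "bounded_linear (pad e :: real ^ 'j::finite ^ 'j \<Rightarrow> real ^ 's::finite ^ 's)"
  unfolding linear_conv_bounded_linear[symmetric] by (rule linearI) (simp_all add: pad_def matrix_mult_distribs)

lemma inner_matrix_sum: "U \<bullet> outer x x = (\<Sum>p\<in>UNIV. \<Sum>q\<in>UNIV. U $ p $ q * (x $ p * x $ q))"
  by (simp add: inner_vec_def outer_def)

lemma norm_fst: "norm (fst p) \<le> norm p" and norm_snd: "norm (snd p) \<le> norm p"
  by (metis norm_fst_le prod.collapse, metis norm_snd_le prod.collapse)

section \<open>Moments of the summands \<open>W i\<close>\<close>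

context eiv
begin

definition W where "W i \<omega> = Wpair M \<sigma> a0 ct i \<omega>"

lemma W_eq: "W i \<omega> = (outer (a0 i) (ct i \<omega>), outer (ct i \<omega>) (ct i \<omega>) - \<sigma>\<^sup>2 *\<^sub>R pad e (Sig i))"
  by (simp add: W_def Wpair_eq)

lemma pad_lim: "(\<lambda>i. pad e (Sig i)) \<longlonglongrightarrow> pad e Siginf"
  by (rule bounded_linear.tendsto[OF bounded_linear_pad Sig_lim])

lemma Smat_lim: "lim (Smat M \<sigma> ct) = pad e Siginf"
proof -
  have "Smat M \<sigma> ct = (\<lambda>i. pad e (Sig i))" by (rule ext) (rule Smat_eq)
  then show ?thesis using pad_lim by (simp add: limI)
qed

definition Kw where "Kw = (SOME K. K \<ge> 1 \<and> (\<forall>i. norm (\<sigma>\<^sup>2 *\<^sub>R pad e (Sig i)) + 1 \<le> K))"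

lemma Kw: "Kw \<ge> 1" "norm (\<sigma>\<^sup>2 *\<^sub>R pad e (Sig i)) + 1 \<le> Kw"
proof -
  have "bounded (range (\<lambda>i. \<sigma>\<^sup>2 *\<^sub>R pad e (Sig i)))"
    by (rule convergent_imp_bounded[OF tendsto_scaleR[OF tendsto_const pad_lim]])
  then obtain B where B: "\<And>i. norm (\<sigma>\<^sup>2 *\<^sub>R pad e (Sig i)) \<le> B" by (auto simp: bounded_iff)
  have "B \<ge> 0" using order_trans[OF norm_ge_zero B] .
  then have "B + 1 \<ge> 1 \<and> (\<forall>i. norm (\<sigma>\<^sup>2 *\<^sub>R pad e (Sig i)) + 1 \<le> B + 1)" using B by auto
  then have "Kw \<ge> 1 \<and> (\<forall>i. norm (\<sigma>\<^sup>2 *\<^sub>R pad e (Sig i)) + 1 \<le> Kw)" unfolding Kw_def by (rule someI)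
  then show "Kw \<ge> 1" "norm (\<sigma>\<^sup>2 *\<^sub>R pad e (Sig i)) + 1 \<le> Kw" by auto
qed

text \<open>Separates the nonrandom regressor from the error: each moment of \<open>W i\<close> is
  then a power of 1 + |a0 i| times a moment of Y that is bounded in i.\<close>

lemma norm_W: "norm (W i \<omega>) \<le> Kw * (1 + norm (a0 i)) * Y i \<omega>"
proof -
  let ?S = "\<sigma>\<^sup>2 *\<^sub>R pad e (Sig i)" and ?c = "ct i \<omega>" and ?a = "a0 i"
  have "norm (W i \<omega>) \<le> norm (outer ?a ?c) + norm (outer ?c ?c - ?S)"
    unfolding W_eq by (rule norm_Pair_le)
  also have "\<dots> \<le> norm ?a * norm ?c + (norm ?c * norm ?c + norm ?S)"
    using norm_triangle_ineq4[of "outer ?c ?c" ?S] by (simp add: norm_outer)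
  also have "\<dots> \<le> norm ?a * Y i \<omega> + (Y i \<omega> + norm ?S * Y i \<omega>)"
    using norm_ct_le[of i \<omega>] Y_ge1[of i \<omega>]
    by (intro add_mono mult_left_mono) (auto simp: Y_def power2_eq_square intro: mult_left_le[of _ 1, simplified] order_trans[OF _ mult_left_mono[of 1]])
  also have "\<dots> \<le> (norm ?S + 1) * (1 + norm ?a) * Y i \<omega>"
    using Y_ge1[of i \<omega>] by (simp add: algebra_simps)
  also have "\<dots> \<le> Kw * (1 + norm ?a) * Y i \<omega>"
    using Y_ge1[of i \<omega>] Kw(2)[of i] by (intro mult_right_mono) auto
  finally show ?thesis .
qed

lemma W_continuous: "continuous_on UNIV (\<lambda>c. (outer (a0 i) c, outer c c - \<sigma>\<^sup>2 *\<^sub>R pad e (Sig i)))"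
  by (intro continuous_intros bounded_bilinear.continuous_on[OF bounded_bilinear_outer])

lemma W_measurable [measurable]: "W i \<in> borel_measurable M"
  unfolding W_eq[abs_def] by (rule measurable_compose[OF rv borel_measurable_continuous_onI[OF W_continuous]])

lemma W_indep: "indep_vars (\<lambda>_. borel) W UNIV"
  unfolding W_eq[abs_def]
  by (rule indep_vars_compose2[OF indep]) (rule borel_measurable_continuous_onI[OF W_continuous])

lemma W_square: "integrable M (\<lambda>\<omega>. (norm (W i \<omega>))\<^sup>2)"
  "expectation (\<lambda>\<omega>. (norm (W i \<omega>))\<^sup>2) \<le> Kw\<^sup>2 * CY * (1 + norm (a0 i))\<^sup>2"
proof -
  have le: "(norm (W i \<omega>))\<^sup>2 \<le> Kw\<^sup>2 * (1 + norm (a0 i))\<^sup>2 * (Y i \<omega>)\<^sup>2" for \<omega>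
    using power_mono[OF norm_W[of i \<omega>], of 2] by (simp add: power_mult_distrib)
  have I: "integrable M (\<lambda>\<omega>. Kw\<^sup>2 * (1 + norm (a0 i))\<^sup>2 * (Y i \<omega>)\<^sup>2)" using Y_power(1)[of 2 i] by simp
  show int: "integrable M (\<lambda>\<omega>. (norm (W i \<omega>))\<^sup>2)"
    by (rule Bochner_Integration.integrable_bound[OF I]) (use le in auto)
  have "expectation (\<lambda>\<omega>. (norm (W i \<omega>))\<^sup>2) \<le> expectation (\<lambda>\<omega>. Kw\<^sup>2 * (1 + norm (a0 i))\<^sup>2 * (Y i \<omega>)\<^sup>2)"
    by (rule integral_mono[OF int I le])
  also have "\<dots> = Kw\<^sup>2 * (1 + norm (a0 i))\<^sup>2 * expectation (\<lambda>\<omega>. (Y i \<omega>)\<^sup>2)" by simp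
  also have "\<dots> \<le> Kw\<^sup>2 * (1 + norm (a0 i))\<^sup>2 * CY" by (intro mult_left_mono Y_power(2)) auto
  finally show "expectation (\<lambda>\<omega>. (norm (W i \<omega>))\<^sup>2) \<le> Kw\<^sup>2 * CY * (1 + norm (a0 i))\<^sup>2" by (simp add: mult_ac)
qed

lemma W_norm_mean: "integrable M (\<lambda>\<omega>. norm (W i \<omega>))" "expectation (\<lambda>\<omega>. norm (W i \<omega>)) \<le> Kw * CY * (1 + norm (a0 i))"
proof -
  have I: "integrable M (\<lambda>\<omega>. Kw * (1 + norm (a0 i)) * Y i \<omega>)" using Y_power(1)[of 1 i] by simp
  show int: "integrable M (\<lambda>\<omega>. norm (W i \<omega>))"
    by (rule Bochner_Integration.integrable_bound[OF I]) (use norm_W in \<open>auto intro: order_trans[OF _ abs_ge_self]\<close>)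
  have "expectation (\<lambda>\<omega>. norm (W i \<omega>)) \<le> expectation (\<lambda>\<omega>. Kw * (1 + norm (a0 i)) * Y i \<omega>)"
    by (rule integral_mono[OF int I norm_W])
  also have "\<dots> = Kw * (1 + norm (a0 i)) * expectation (\<lambda>\<omega>. Y i \<omega>)" by simp
  also have "\<dots> \<le> Kw * (1 + norm (a0 i)) * CY" using Kw(1) Y_power(2)[of 1 i] by (intro mult_left_mono) auto
  finally show "expectation (\<lambda>\<omega>. norm (W i \<omega>)) \<le> Kw * CY * (1 + norm (a0 i))" by (simp add: mult_ac)
qed

lemma W_powr: "integrable M (\<lambda>\<omega>. \<bar>u \<bullet> W i \<omega>\<bar> powr (2 + \<delta>))"
  "expectation (\<lambda>\<omega>. \<bar>u \<bullet> W i \<omega>\<bar> powr (2 + \<delta>)) \<le> (norm u * Kw) powr (2 + \<delta>) * CY * (1 + norm (a0 i)) powr (2 + \<delta>)"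
proof -
  let ?p = "2 + \<delta>"
  let ?K = "(norm u * Kw) powr ?p * (1 + norm (a0 i)) powr ?p"
  have le: "\<bar>u \<bullet> W i \<omega>\<bar> powr ?p \<le> ?K * Y i \<omega> powr ?p" for \<omega>
  proof -
    have Y0: "0 \<le> Y i \<omega>" using Y_ge1[of i \<omega>] by simp
    have "\<bar>u \<bullet> W i \<omega>\<bar> \<le> norm u * (Kw * (1 + norm (a0 i)) * Y i \<omega>)"
      by (rule order_trans[OF Cauchy_Schwarz_ineq2 mult_left_mono[OF norm_W]]) simp
    then have "\<bar>u \<bullet> W i \<omega>\<bar> powr ?p \<le> ((norm u * Kw) * (1 + norm (a0 i)) * Y i \<omega>) powr ?p"
      using \<delta> by (intro powr_mono2) (auto simp: mult_ac)
    also have "\<dots> = ?K * Y i \<omega> powr ?p" using Kw(1) Y0 by (simp add: powr_mult)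
    finally show ?thesis .
  qed
  have I: "integrable M (\<lambda>\<omega>. ?K * Y i \<omega> powr ?p)" using CY(2) by simp
  show int: "integrable M (\<lambda>\<omega>. \<bar>u \<bullet> W i \<omega>\<bar> powr ?p)"
    by (rule Bochner_Integration.integrable_bound[OF I]) (use le in \<open>auto intro: order_trans[OF _ abs_ge_self]\<close>)
  have "expectation (\<lambda>\<omega>. \<bar>u \<bullet> W i \<omega>\<bar> powr ?p) \<le> expectation (\<lambda>\<omega>. ?K * Y i \<omega> powr ?p)"
    by (rule integral_mono[OF int I le])
  also have "\<dots> = ?K * expectation (\<lambda>\<omega>. Y i \<omega> powr ?p)" by simp
  also have "\<dots> \<le> ?K * CY" by (intro mult_left_mono CY(3)) auto
  finally show "expectation (\<lambda>\<omega>. \<bar>u \<bullet> W i \<omega>\<bar> powr ?p) \<le> (norm u * Kw) powr ?p * CY * (1 + norm (a0 i)) powr ?p"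
    by (simp add: mult_ac)
qed

text \<open>The power of 1 + |a0 i| splits in two: the constant part contributes m divided by m to
  the power 1 + \<delta>/2, which tends to 0, and the other part is the assumption on the
  regressors.\<close>

lemma W_lyapunov:
  "(\<lambda>m. 1 / real m powr (1 + \<delta> / 2) * (\<Sum>i<m. expectation (\<lambda>\<omega>. \<bar>u \<bullet> W i \<omega>\<bar> powr (2 + \<delta>)))) \<longlonglongrightarrow> 0"
proof -
  let ?p = "2 + \<delta>" and ?r = "\<lambda>m. 1 / real m powr (1 + \<delta> / 2)"
  let ?K = "(norm u * Kw) powr ?p * CY * 2 powr ?p"
  have K0: "?K \<ge> 0" using CY(1) by simp
  have "(\<lambda>m. ?r m * real m) \<longlonglongrightarrow> 0"
  proof -
    have lim: "(\<lambda>m. real m powr - (\<delta> / 2)) \<longlonglongrightarrow> 0"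
      by (rule tendsto_neg_powr) (use \<delta> in \<open>auto intro: filterlim_real_sequentially\<close>)
    have eq: "?r m * real m = real m powr - (\<delta> / 2)" if "m > 0" for m
      using that by (simp add: powr_add powr_minus_divide)
    show ?thesis
      by (rule Lim_transform_eventually[OF lim eventually_mono[OF eventually_gt_at_top[of 0]]]) (rule eq[symmetric])
  qed
  from tendsto_mult_left[OF tendsto_add[OF this lyapunov], of ?K]
  have lim: "(\<lambda>m. ?K * (?r m * real m + ?r m * (\<Sum>i<m. norm (a0 i) powr ?p))) \<longlonglongrightarrow> 0" by simp
  have bound: "norm (?r m * (\<Sum>i<m. expectation (\<lambda>\<omega>. \<bar>u \<bullet> W i \<omega>\<bar> powr ?p))) \<le> ?K * (?r m * real m + ?r m * (\<Sum>i<m. norm (a0 i) powr ?p))" for m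
  proof -
    have "(\<Sum>i<m. expectation (\<lambda>\<omega>. \<bar>u \<bullet> W i \<omega>\<bar> powr ?p)) \<le> (\<Sum>i<m. ?K * (1 + norm (a0 i) powr ?p))"
    proof (rule sum_mono)
      fix i
      have "(norm u * Kw) powr ?p * CY * (1 + norm (a0 i)) powr ?p \<le> (norm u * Kw) powr ?p * CY * (2 powr ?p * (1 + norm (a0 i) powr ?p))"
        using CY(1) \<delta> by (intro mult_left_mono one_plus_powr_le) auto
      then show "expectation (\<lambda>\<omega>. \<bar>u \<bullet> W i \<omega>\<bar> powr ?p) \<le> ?K * (1 + norm (a0 i) powr ?p)"
        using W_powr(2)[of u i] by (simp add: mult.assoc)
    qed
    also have "\<dots> = ?K * (real m + (\<Sum>i<m. norm (a0 i) powr ?p))" by (simp add: sum_distrib_left[symmetric] sum.distrib)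
    finally have "?r m * (\<Sum>i<m. expectation (\<lambda>\<omega>. \<bar>u \<bullet> W i \<omega>\<bar> powr ?p)) \<le> ?r m * (?K * (real m + (\<Sum>i<m. norm (a0 i) powr ?p)))"
      by (intro mult_left_mono) auto
    moreover have "?r m * (\<Sum>i<m. expectation (\<lambda>\<omega>. \<bar>u \<bullet> W i \<omega>\<bar> powr ?p)) \<ge> 0"
      by (intro mult_nonneg_nonneg sum_nonneg) auto
    ultimately show ?thesis by (simp add: distrib_left mult_ac)
  qed
  show ?thesis by (rule Lim_null_comparison[OF always_eventually[OF allI[OF bound]] lim])
qed

section \<open>Means, covariances and limiting variances of the two components of
  \<open>W i\<close>\<close>

lemma quad_expectation: "expectation (\<lambda>\<omega>. U \<bullet> outer (ct i \<omega>) (ct i \<omega>)) = \<sigma>\<^sup>2 * (U \<bullet> pad e (Sig i))"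
  "integrable M (\<lambda>\<omega>. U \<bullet> outer (ct i \<omega>) (ct i \<omega>))"
proof -
  show "integrable M (\<lambda>\<omega>. U \<bullet> outer (ct i \<omega>) (ct i \<omega>))" unfolding inner_matrix_sum using int2 by simp
  have "expectation (\<lambda>\<omega>. U \<bullet> outer (ct i \<omega>) (ct i \<omega>)) = (\<Sum>p\<in>UNIV. \<Sum>q\<in>UNIV. U $ p $ q * (\<sigma>\<^sup>2 * pad e (Sig i) $ p $ q))"
    unfolding inner_matrix_sum using int2 by (simp add: cov_entry)
  also have "\<dots> = \<sigma>\<^sup>2 * (U \<bullet> pad e (Sig i))" by (simp add: inner_vec_def sum_distrib_left mult_ac)
  finally show "expectation (\<lambda>\<omega>. U \<bullet> outer (ct i \<omega>) (ct i \<omega>)) = \<sigma>\<^sup>2 * (U \<bullet> pad e (Sig i))" .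
qed

lemma fst_inner: "u \<bullet> fst (W i \<omega>) = (\<Sum>p\<in>UNIV. (a0 i v* u) $ p * ct i \<omega> $ p)"
proof -
  have "u \<bullet> fst (W i \<omega>) = (a0 i v* u) \<bullet> ct i \<omega>" by (simp add: W_eq inner_outer dot_lmul_matrix)
  then show ?thesis by (simp add: inner_vec_def)
qed

lemma snd_inner: "u \<bullet> snd (W i \<omega>) = (\<Sum>p\<in>UNIV. \<Sum>q\<in>UNIV. u $ p $ q * (ct i \<omega> $ p * ct i \<omega> $ q)) - \<sigma>\<^sup>2 * (u \<bullet> pad e (Sig i))"
  by (simp add: W_eq inner_diff_right inner_matrix_sum)

lemma mean_fst: "expectation (\<lambda>\<omega>. u \<bullet> fst (W i \<omega>)) = 0" "integrable M (\<lambda>\<omega>. u \<bullet> fst (W i \<omega>))"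
  unfolding fst_inner using int1 by (simp_all add: mean1)

lemma mean_snd: "expectation (\<lambda>\<omega>. u \<bullet> snd (W i \<omega>)) = 0" "integrable M (\<lambda>\<omega>. u \<bullet> snd (W i \<omega>))"
  using quad_expectation[of u i] by (simp_all add: W_eq inner_diff_right prob_space)

lemma mean_W: "expectation (\<lambda>\<omega>. u \<bullet> W i \<omega>) = 0"
proof -
  have "(\<lambda>\<omega>. u \<bullet> W i \<omega>) = (\<lambda>\<omega>. fst u \<bullet> fst (W i \<omega>) + snd u \<bullet> snd (W i \<omega>))" by (simp add: inner_prod_def)
  then show ?thesis using mean_fst mean_snd by simp
qed

lemma W_parts_measurable [measurable]: "(\<lambda>\<omega>. fst (W i \<omega>)) \<in> borel_measurable M" "(\<lambda>\<omega>. snd (W i \<omega>)) \<in> borel_measurable M"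
  by (rule measurable_compose[OF W_measurable borel_measurable_continuous_onI], intro continuous_intros)+

lemma sq_part: "integrable M (\<lambda>\<omega>. (norm (fst (W i \<omega>)))\<^sup>2)" "integrable M (\<lambda>\<omega>. (norm (snd (W i \<omega>)))\<^sup>2)"
  by (rule Bochner_Integration.integrable_bound[OF W_square(1)[of i]],
      auto intro!: AE_I2 power_mono norm_fst norm_snd)+

lemma sq_inner:
  fixes Z :: "'w \<Rightarrow> 'b::euclidean_space"
  assumes [measurable]: "Z \<in> borel_measurable M" and "integrable M (\<lambda>\<omega>. (norm (Z \<omega>))\<^sup>2)"
  shows "integrable M (\<lambda>\<omega>. (u \<bullet> Z \<omega>)\<^sup>2)"
proof (rule Bochner_Integration.integrable_bound[of _ "\<lambda>\<omega>. (norm u)\<^sup>2 * (norm (Z \<omega>))\<^sup>2"])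
  show "integrable M (\<lambda>\<omega>. (norm u)\<^sup>2 * (norm (Z \<omega>))\<^sup>2)" using assms by simp
  have "(u \<bullet> Z \<omega>)\<^sup>2 \<le> (norm u)\<^sup>2 * (norm (Z \<omega>))\<^sup>2" for \<omega>
    using power_mono[OF Cauchy_Schwarz_ineq2[of u "Z \<omega>"], of 2] by (simp add: power_mult_distrib)
  then show "AE \<omega> in M. norm ((u \<bullet> Z \<omega>)\<^sup>2) \<le> norm ((norm u)\<^sup>2 * (norm (Z \<omega>))\<^sup>2)" by simp
qed measurable

text \<open>The product is a cubic form in the error minus a linear one. The vanishing third moments
  remove the first and the zero mean the second; this is the source of the independence of the
  components of \<Gamma>.\<close>

lemma cross_zero: "integrable M (\<lambda>\<omega>. (u \<bullet> fst (W i \<omega>)) * (v \<bullet> snd (W i \<omega>)))"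
  "expectation (\<lambda>\<omega>. (u \<bullet> fst (W i \<omega>)) * (v \<bullet> snd (W i \<omega>))) = 0"
proof -
  let ?b = "a0 i v* u" and ?k = "\<sigma>\<^sup>2 * (v \<bullet> pad e (Sig i))"
  have eq: "(u \<bullet> fst (W i \<omega>)) * (v \<bullet> snd (W i \<omega>)) =
      (\<Sum>p\<in>UNIV. \<Sum>q\<in>UNIV. \<Sum>r\<in>UNIV. v $ p $ q * ?b $ r * (ct i \<omega> $ p * ct i \<omega> $ q * ct i \<omega> $ r))
      - (\<Sum>r\<in>UNIV. ?k * ?b $ r * ct i \<omega> $ r)" for \<omega>
    unfolding fst_inner snd_inner right_diff_distrib sum_distrib_right sum_distrib_left
    by (simp add: mult_ac)
  show "integrable M (\<lambda>\<omega>. (u \<bullet> fst (W i \<omega>)) * (v \<bullet> snd (W i \<omega>)))" unfolding eq using int3 int1 by simp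
  show "expectation (\<lambda>\<omega>. (u \<bullet> fst (W i \<omega>)) * (v \<bullet> snd (W i \<omega>))) = 0"
    unfolding eq using int3 int1 by (simp add: third_all mean1)
qed

lemma var_split: "expectation (\<lambda>\<omega>. (u \<bullet> W i \<omega>)\<^sup>2) =
  expectation (\<lambda>\<omega>. (fst u \<bullet> fst (W i \<omega>))\<^sup>2) + expectation (\<lambda>\<omega>. (snd u \<bullet> snd (W i \<omega>))\<^sup>2)"
proof -
  have eq: "(u \<bullet> W i \<omega>)\<^sup>2 = (fst u \<bullet> fst (W i \<omega>))\<^sup>2 + (snd u \<bullet> snd (W i \<omega>))\<^sup>2 + 2 * ((fst u \<bullet> fst (W i \<omega>)) * (snd u \<bullet> snd (W i \<omega>)))" for \<omega>
    by (simp add: inner_prod_def power2_eq_square algebra_simps)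
  have "integrable M (\<lambda>\<omega>. (fst u \<bullet> fst (W i \<omega>))\<^sup>2)" "integrable M (\<lambda>\<omega>. (snd u \<bullet> snd (W i \<omega>))\<^sup>2)"
    by (rule sq_inner[OF W_parts_measurable(1) sq_part(1)], rule sq_inner[OF W_parts_measurable(2) sq_part(2)])
  then show ?thesis unfolding eq using cross_zero[of "fst u" i "snd u"] by simp
qed

text \<open>The inner product with \<open>mat 1\<close> is the trace, and the trace of the averaged
  outer products is the average of the squared norms; it converges and is therefore bounded.\<close>

lemma a0_mean_square: "\<exists>B\<ge>0. \<forall>m. 1 / real m * (\<Sum>i<m. (norm (a0 i))\<^sup>2) \<le> B"
proof -
  have "(\<lambda>m. mat 1 \<bullet> ((1 / real m) *\<^sub>R (\<Sum>i<m. outer (a0 i) (a0 i)))) \<longlonglongrightarrow> mat 1 \<bullet> VA"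
    by (intro tendsto_intros VA_lim)
  moreover have "mat 1 \<bullet> ((1 / real m) *\<^sub>R (\<Sum>i<m. outer (a0 i) (a0 i))) = 1 / real m * (\<Sum>i<m. (norm (a0 i))\<^sup>2)" for m
    by (simp add: inner_sum_right inner_outer power2_norm_eq_inner)
  ultimately have "(\<lambda>m. 1 / real m * (\<Sum>i<m. (norm (a0 i))\<^sup>2)) \<longlonglongrightarrow> mat 1 \<bullet> VA" by (simp only:)
  from convergent_imp_bounded[OF this] have "bounded (range (\<lambda>m. 1 / real m * (\<Sum>i<m. (norm (a0 i))\<^sup>2)))" .
  then obtain B where B: "\<And>m. \<bar>1 / real m * (\<Sum>i<m. (norm (a0 i))\<^sup>2)\<bar> \<le> B" by (auto simp: bounded_iff)
  have "0 \<le> B" using B[of 0] by simp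
  moreover have "1 / real m * (\<Sum>i<m. (norm (a0 i))\<^sup>2) \<le> B" for m using B[of m] by (rule abs_le_D1)
  ultimately show ?thesis by blast
qed

definition vb where "vb = (SOME B. B \<ge> 0 \<and> (\<forall>m. 1 / real m * (\<Sum>i<m. (norm (a0 i))\<^sup>2) \<le> B))"

lemma vb: "vb \<ge> 0" "1 / real m * (\<Sum>i<m. (norm (a0 i))\<^sup>2) \<le> vb"
proof -
  have "vb \<ge> 0 \<and> (\<forall>m. 1 / real m * (\<Sum>i<m. (norm (a0 i))\<^sup>2) \<le> vb)"
    unfolding vb_def by (rule someI_ex) (use a0_mean_square in blast)
  then show "vb \<ge> 0" "1 / real m * (\<Sum>i<m. (norm (a0 i))\<^sup>2) \<le> vb" by auto
qed

lemma a0_mean_one_plus: "1 / real m * (\<Sum>i<m. (1 + norm (a0 i))\<^sup>2) \<le> 2 + 2 * vb"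
proof -
  have "(1 + norm (a0 i))\<^sup>2 \<le> 2 + 2 * (norm (a0 i))\<^sup>2" for i
    using zero_le_power2[of "1 - norm (a0 i)"] by (simp add: power2_eq_square algebra_simps)
  then have "(\<Sum>i<m. (1 + norm (a0 i))\<^sup>2) \<le> (\<Sum>i<m. 2 + 2 * (norm (a0 i))\<^sup>2)" by (intro sum_mono)
  also have "\<dots> = 2 * real m + 2 * (\<Sum>i<m. (norm (a0 i))\<^sup>2)" by (simp add: sum.distrib sum_distrib_left)
  finally have "1 / real m * (\<Sum>i<m. (1 + norm (a0 i))\<^sup>2) \<le> 1 / real m * (2 * real m + 2 * (\<Sum>i<m. (norm (a0 i))\<^sup>2))"
    by (intro mult_left_mono) auto
  also have "\<dots> = 1 / real m * (2 * real m) + 2 * (1 / real m * (\<Sum>i<m. (norm (a0 i))\<^sup>2))" by (simp add: distrib_left)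
  also have "\<dots> \<le> 2 + 2 * vb" using vb(2)[of m] by (intro add_mono) auto
  finally show ?thesis .
qed

text \<open>The deviation of the weights from their limit is averaged against the squared norms of
  the regressors, whose averages are bounded; the constant weight G is covered by the convergence to
  \<open>VA\<close>.\<close>

lemma weighted_outer_lim:
  fixes F :: "nat \<Rightarrow> real ^ 'n ^ 'n"
  assumes F: "F \<longlonglongrightarrow> G"
  shows "(\<lambda>m. 1 / real m * (\<Sum>i<m. F i \<bullet> outer (a0 i) (a0 i))) \<longlonglongrightarrow> G \<bullet> VA"
proof -
  have "(\<lambda>i. norm (F i - G)) \<longlonglongrightarrow> 0" using F by (simp add: LIM_zero tendsto_norm_zero)
  from cesaro_weighted[OF this _ _ vb(2)] have 0: "(\<lambda>m. 1 / real m * (\<Sum>i<m. norm (F i - G) * (norm (a0 i))\<^sup>2)) \<longlonglongrightarrow> 0" by simp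
  have "(\<lambda>m. 1 / real m * (\<Sum>i<m. (F i - G) \<bullet> outer (a0 i) (a0 i))) \<longlonglongrightarrow> 0"
  proof (rule Lim_null_comparison[OF always_eventually 0], rule allI)
    fix m
    have "\<bar>\<Sum>i<m. (F i - G) \<bullet> outer (a0 i) (a0 i)\<bar> \<le> (\<Sum>i<m. norm (F i - G) * (norm (a0 i))\<^sup>2)"
      by (rule order_trans[OF sum_abs sum_mono])
        (use Cauchy_Schwarz_ineq2[of "F _ - G" "outer (a0 _) (a0 _)"] in \<open>simp add: norm_outer power2_eq_square\<close>)
    then show "norm (1 / real m * (\<Sum>i<m. (F i - G) \<bullet> outer (a0 i) (a0 i))) \<le> 1 / real m * (\<Sum>i<m. norm (F i - G) * (norm (a0 i))\<^sup>2)"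
      by (simp add: abs_mult divide_right_mono)
  qed
  moreover have "(\<lambda>m. G \<bullet> ((1 / real m) *\<^sub>R (\<Sum>i<m. outer (a0 i) (a0 i)))) \<longlonglongrightarrow> G \<bullet> VA"
    by (intro tendsto_intros VA_lim)
  ultimately have "(\<lambda>m. 1 / real m * (\<Sum>i<m. (F i - G) \<bullet> outer (a0 i) (a0 i)) + G \<bullet> ((1 / real m) *\<^sub>R (\<Sum>i<m. outer (a0 i) (a0 i)))) \<longlonglongrightarrow> 0 + G \<bullet> VA"
    by (rule tendsto_add)
  moreover have "1 / real m * (\<Sum>i<m. (F i - G) \<bullet> outer (a0 i) (a0 i)) + G \<bullet> ((1 / real m) *\<^sub>R (\<Sum>i<m. outer (a0 i) (a0 i)))
      = 1 / real m * (\<Sum>i<m. F i \<bullet> outer (a0 i) (a0 i))" for m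
    by (simp add: inner_sum_right inner_diff_left sum_subtractf diff_divide_distrib)
  ultimately show ?thesis by simp
qed

text \<open>The variance of \<open>u \<bullet> \<Gamma>\<^sub>1\<close>.\<close>

definition q1 where "q1 u = \<sigma>\<^sup>2 * ((u ** pad e Siginf ** transpose u) \<bullet> VA)"

lemma var_fst: "expectation (\<lambda>\<omega>. (u \<bullet> fst (W i \<omega>))\<^sup>2) = \<sigma>\<^sup>2 * ((u ** pad e (Sig i) ** transpose u) \<bullet> outer (a0 i) (a0 i))"
proof -
  let ?b = "a0 i v* u"
  have eq: "(u \<bullet> fst (W i \<omega>))\<^sup>2 = outer ?b ?b \<bullet> outer (ct i \<omega>) (ct i \<omega>)" for \<omega>
  proof -
    have "u \<bullet> fst (W i \<omega>) = ?b \<bullet> ct i \<omega>" by (simp add: W_eq inner_outer dot_lmul_matrix)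
    then show ?thesis by (simp add: inner_outer outer_mult power2_eq_square inner_commute)
  qed
  have "expectation (\<lambda>\<omega>. (u \<bullet> fst (W i \<omega>))\<^sup>2) = \<sigma>\<^sup>2 * (outer ?b ?b \<bullet> pad e (Sig i))"
    unfolding eq by (rule quad_expectation)
  also have "outer ?b ?b \<bullet> pad e (Sig i) = ?b \<bullet> (pad e (Sig i) *v ?b)" by (subst inner_commute) (rule inner_outer)
  also have "\<dots> = (u ** pad e (Sig i) ** transpose u) \<bullet> outer (a0 i) (a0 i)"
    by (simp add: inner_outer dot_lmul_matrix matrix_vector_mul_assoc[symmetric])
  finally show ?thesis .
qed

lemma var_fst_lim: "(\<lambda>m. 1 / real m * (\<Sum>i<m. expectation (\<lambda>\<omega>. (u \<bullet> fst (W i \<omega>))\<^sup>2))) \<longlonglongrightarrow> q1 u"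
proof -
  have "(\<lambda>i. u ** pad e (Sig i) ** transpose u) \<longlonglongrightarrow> u ** pad e Siginf ** transpose u"
    by (intro bounded_bilinear.tendsto[OF bounded_bilinear_matrix_mult] tendsto_const pad_lim)
  from tendsto_mult_left[OF weighted_outer_lim[OF this], of "\<sigma>\<^sup>2"]
  show ?thesis unfolding var_fst q1_def by (simp add: sum_distrib_left[symmetric])
qed

text \<open>The variance is the fourth-order form minus the square of the mean. Averages of the
  former converge by the assumption on fourth moments, those of the latter because
  \<open>Sig i\<close> converges. No formula for the limit is required, so existence
  suffices.\<close>

lemma var_snd_lim: "\<exists>l. (\<lambda>m. 1 / real m * (\<Sum>i<m. expectation (\<lambda>\<omega>. (u \<bullet> snd (W i \<omega>))\<^sup>2))) \<longlonglongrightarrow> l"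
proof -
  let ?E = "\<lambda>i p q r s. expectation (\<lambda>\<omega>. ct i \<omega> $ p * ct i \<omega> $ q * ct i \<omega> $ r * ct i \<omega> $ s)"
  let ?k = "\<lambda>i. \<sigma>\<^sup>2 * (u \<bullet> pad e (Sig i))"
  define l where "l p q r s = (SOME l. (\<lambda>m. 1 / real m * (\<Sum>i<m. ?E i p q r s)) \<longlonglongrightarrow> l)" for p q r s
  have l: "(\<lambda>m. 1 / real m * (\<Sum>i<m. ?E i p q r s)) \<longlonglongrightarrow> l p q r s" for p q r s
    unfolding l_def by (rule someI_ex[OF fourth_all])
  have var: "expectation (\<lambda>\<omega>. (u \<bullet> snd (W i \<omega>))\<^sup>2) =
      (\<Sum>p\<in>UNIV. \<Sum>q\<in>UNIV. \<Sum>r\<in>UNIV. \<Sum>s\<in>UNIV. u $ p $ q * u $ r $ s * ?E i p q r s) - (?k i)\<^sup>2" for i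
  proof -
    let ?Q = "\<lambda>\<omega>. u \<bullet> outer (ct i \<omega>) (ct i \<omega>)"
    have Q2: "(?Q \<omega>)\<^sup>2 = (\<Sum>p\<in>UNIV. \<Sum>q\<in>UNIV. \<Sum>r\<in>UNIV. \<Sum>s\<in>UNIV. u $ p $ q * u $ r $ s * (ct i \<omega> $ p * ct i \<omega> $ q * ct i \<omega> $ r * ct i \<omega> $ s))" for \<omega>
      unfolding inner_matrix_sum power2_eq_square sum_distrib_right sum_distrib_left
      by (intro sum.cong refl) (simp only: mult_ac)
    have iQ2: "integrable M (\<lambda>\<omega>. (?Q \<omega>)\<^sup>2)" unfolding Q2 using int4 by simp
    have "expectation (\<lambda>\<omega>. (u \<bullet> snd (W i \<omega>))\<^sup>2) = expectation (\<lambda>\<omega>. (?Q \<omega>)\<^sup>2 - 2 * ?k i * ?Q \<omega> + (?k i)\<^sup>2)"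
      by (simp add: W_eq inner_diff_right power2_diff algebra_simps)
    also have "\<dots> = expectation (\<lambda>\<omega>. (?Q \<omega>)\<^sup>2) - 2 * ?k i * ?k i + (?k i)\<^sup>2"
      using iQ2 quad_expectation[of u i] by (simp add: prob_space)
    also have "\<dots> = expectation (\<lambda>\<omega>. (?Q \<omega>)\<^sup>2) - (?k i)\<^sup>2" by (simp add: power2_eq_square)
    finally show ?thesis unfolding Q2 using int4 by simp
  qed
  have k: "(\<lambda>m. 1 / real m * (\<Sum>i<m. (?k i)\<^sup>2 * 1)) \<longlonglongrightarrow> (\<sigma>\<^sup>2 * (u \<bullet> pad e Siginf))\<^sup>2 * 1"
  proof (rule cesaro_product)
    show "(\<lambda>i. (?k i)\<^sup>2) \<longlonglongrightarrow> (\<sigma>\<^sup>2 * (u \<bullet> pad e Siginf))\<^sup>2" by (intro tendsto_intros pad_lim)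
    show "(\<lambda>m. 1 / real m * (\<Sum>i<m. 1)) \<longlonglongrightarrow> (1::real)"
      by (rule tendsto_eventually) (use eventually_gt_at_top[of 0] in \<open>eventually_elim, simp\<close>)
    show "1 / real m * (\<Sum>i<m. \<bar>1::real\<bar>) \<le> 1" for m by simp
  qed
  have "(\<lambda>m. (\<Sum>p\<in>UNIV. \<Sum>q\<in>UNIV. \<Sum>r\<in>UNIV. \<Sum>s\<in>UNIV. u $ p $ q * u $ r $ s * (1 / real m * (\<Sum>i<m. ?E i p q r s)))
      - 1 / real m * (\<Sum>i<m. (?k i)\<^sup>2 * 1)) \<longlonglongrightarrow>
      (\<Sum>p\<in>UNIV. \<Sum>q\<in>UNIV. \<Sum>r\<in>UNIV. \<Sum>s\<in>UNIV. u $ p $ q * u $ r $ s * l p q r s) - (\<sigma>\<^sup>2 * (u \<bullet> pad e Siginf))\<^sup>2 * 1"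
    by (intro tendsto_intros l k)
  moreover have "(\<Sum>p\<in>UNIV. \<Sum>q\<in>UNIV. \<Sum>r\<in>UNIV. \<Sum>s\<in>UNIV. u $ p $ q * u $ r $ s * (1 / real m * (\<Sum>i<m. ?E i p q r s)))
      - 1 / real m * (\<Sum>i<m. (?k i)\<^sup>2 * 1) = 1 / real m * (\<Sum>i<m. expectation (\<lambda>\<omega>. (u \<bullet> snd (W i \<omega>))\<^sup>2))" for m
  proof -
    have sw: "(\<Sum>i<m. \<Sum>p\<in>UNIV. \<Sum>q\<in>UNIV. \<Sum>r\<in>UNIV. \<Sum>s\<in>UNIV. u $ p $ q * u $ r $ s * ?E i p q r s) =
        (\<Sum>p\<in>UNIV. \<Sum>q\<in>UNIV. \<Sum>r\<in>UNIV. \<Sum>s\<in>UNIV. u $ p $ q * u $ r $ s * (\<Sum>i<m. ?E i p q r s))"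
      unfolding sum_distrib_left
      by (subst sum.swap, rule sum.cong[OF refl], subst sum.swap, rule sum.cong[OF refl], subst sum.swap, rule sum.cong[OF refl], rule sum.swap)
    show ?thesis unfolding var sum_subtractf sw by (simp add: sum_distrib_left diff_divide_distrib sum_divide_distrib)
  qed
  ultimately show ?thesis by auto
qed

end

subsection \<open>The Gaussian limit\<close>

lemma linear_functional_inner:
  fixes \<phi> :: "'a::euclidean_space \<Rightarrow> real"
  assumes "linear \<phi>"
  obtains c where "\<And>x. \<phi> x = c \<bullet> x"
proof
  fix x
  have "\<phi> x = \<phi> (\<Sum>b\<in>Basis. (x \<bullet> b) *\<^sub>R b)" by (simp add: euclidean_representation)
  also have "\<dots> = (\<Sum>b\<in>Basis. (x \<bullet> b) * \<phi> b)" by (simp add: linear_sum[OF assms] linear_scale[OF assms])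
  also have "\<dots> = (\<Sum>b\<in>Basis. \<phi> b *\<^sub>R b) \<bullet> x" by (simp add: inner_sum_left inner_commute[of x] mult.commute)
  finally show "\<phi> x = (\<Sum>b\<in>Basis. \<phi> b *\<^sub>R b) \<bullet> x" .
qed

lemma linear_Gamma_of: "linear (Gamma_of S X)"
  by (rule linearI) (simp_all add: Gamma_of_def Let_def matrix_mult_distribs algebra_simps)

text \<open>The left-hand side is the variance of the scalar v.f, and as f is linear this scalar is
  represented by a single vector c.\<close>

lemma cov_quadratic:
  fixes L :: "'a::euclidean_space measure" and f :: "'a \<Rightarrow> real ^ 'k::finite"
  assumes f: "linear f" and mean: "\<And>c. (\<integral>x. c \<bullet> x \<partial>L) = 0" and sq: "\<And>c. integrable L (\<lambda>x. (c \<bullet> x)\<^sup>2)"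
    and c: "\<And>x. v \<bullet> f x = c \<bullet> x"
  shows "v \<bullet> (cov_matrix L f *v v) = (\<integral>x. (c \<bullet> x)\<^sup>2 \<partial>L)"
proof -
  have ex: "\<exists>l. \<forall>x. f x $ p = l \<bullet> x" for p
  proof -
    have "linear (\<lambda>x. f x $ p)" by (rule linearI) (simp_all add: linear_add[OF f] linear_scale[OF f])
    then show ?thesis by (rule linear_functional_inner) blast
  qed
  have "\<forall>p. \<exists>l. \<forall>x. f x $ p = l \<bullet> x" using ex by blast
  from choice[OF this] obtain l where l: "\<And>p x. f x $ p = l p \<bullet> x" by blast
  have int: "integrable L (\<lambda>x. (l p \<bullet> x) * (l q \<bullet> x))" for p q
  proof -
    have eq: "(l p \<bullet> x) * (l q \<bullet> x) = (((l p + l q) \<bullet> x)\<^sup>2 - (l p \<bullet> x)\<^sup>2 - (l q \<bullet> x)\<^sup>2) / 2" for x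
      by (simp add: inner_add_left power2_eq_square algebra_simps)
    show ?thesis unfolding eq using sq by simp
  qed
  have "v \<bullet> (cov_matrix L f *v v) = (\<Sum>p\<in>UNIV. \<Sum>q\<in>UNIV. v $ p * v $ q * (\<integral>x. (l p \<bullet> x) * (l q \<bullet> x) \<partial>L))"
    by (simp add: inner_vec_def matrix_vector_mult_def cov_matrix_def l mean sum_distrib_left mult_ac)
  also have "\<dots> = (\<integral>x. (\<Sum>p\<in>UNIV. \<Sum>q\<in>UNIV. v $ p * v $ q * ((l p \<bullet> x) * (l q \<bullet> x))) \<partial>L)"
    using int by simp
  also have "\<dots> = (\<integral>x. (c \<bullet> x)\<^sup>2 \<partial>L)"
  proof (rule Bochner_Integration.integral_cong)
    fix x
    have "c \<bullet> x = (\<Sum>p\<in>UNIV. v $ p * (l p \<bullet> x))" unfolding c[symmetric] by (simp add: inner_vec_def l)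
    then show "(\<Sum>p\<in>UNIV. \<Sum>q\<in>UNIV. v $ p * v $ q * ((l p \<bullet> x) * (l q \<bullet> x))) = (c \<bullet> x)\<^sup>2"
      by (simp add: power2_eq_square sum_product mult_ac)
  qed simp
  finally show ?thesis .
qed

context eiv
begin

definition S where "S m \<omega> = (1 / sqrt (real m)) *\<^sub>R (\<Sum>i<m. W i \<omega>)"

lemma S_measurable [measurable]: "S m \<in> borel_measurable M" unfolding S_def[abs_def] by measurable

text \<open>The law L is built beforehand as a product of two Gaussian measures, one for each
  limiting variance form, and is only then recognized as the limit. Reversing the sign of
  \<open>W i\<close> leaves all even quantities in the central limit theorem unchanged.\<close>

theorem gaussian_limit:
  obtains L q2 where "prob_space L" "sets L = sets borel" "indep_components L"
    "\<And>u. (\<integral>x. iexp (u \<bullet> x) \<partial>L) = of_real (exp (- (q1 (fst u) + q2 (snd u)) / 2))"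
    "\<And>u. 0 \<le> q1 u" "\<And>u. 0 \<le> q2 u" "\<And>t u. q1 (t *\<^sub>R u) = t\<^sup>2 * q1 u" "\<And>t u. q2 (t *\<^sub>R u) = t\<^sup>2 * q2 u"
    "conv_in_law (\<lambda>m. distr M borel (S m)) L" "conv_in_law (\<lambda>m. distr M borel (\<lambda>\<omega>. - S m \<omega>)) L"
proof -
  have "\<forall>u. \<exists>l. (\<lambda>m. 1 / real m * (\<Sum>i<m. expectation (\<lambda>\<omega>. (u \<bullet> snd (W i \<omega>))\<^sup>2))) \<longlonglongrightarrow> l"
    using var_snd_lim by blast
  from choice[OF this] obtain q2 where q2: "\<And>u. (\<lambda>m. 1 / real m * (\<Sum>i<m. expectation (\<lambda>\<omega>. (u \<bullet> snd (W i \<omega>))\<^sup>2))) \<longlonglongrightarrow> q2 u"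
    by blast
  have m1: "(\<lambda>\<omega>. fst (W i \<omega>)) \<in> borel_measurable M" for i by measurable
  have m2: "(\<lambda>\<omega>. snd (W i \<omega>)) \<in> borel_measurable M" for i by measurable
  obtain T1 where T1: "linear T1" "\<And>x y. T1 x \<bullet> y = x \<bullet> T1 y" "\<And>x. q1 x = x \<bullet> T1 x" "\<And>x. 0 \<le> x \<bullet> T1 x"
    using covariance_operator[OF m1 sq_part(1) var_fst_lim] by blast
  obtain T2 where T2: "linear T2" "\<And>x y. T2 x \<bullet> y = x \<bullet> T2 y" "\<And>x. q2 x = x \<bullet> T2 x" "\<And>x. 0 \<le> x \<bullet> T2 x"
    using covariance_operator[OF m2 sq_part(2) q2] by blast
  obtain L1 :: "(real ^ ('n + 'd) ^ 'n) measure" where L1: "prob_space L1" "sets L1 = sets borel"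
    "\<And>u. (\<integral>x. iexp (u \<bullet> x) \<partial>L1) = of_real (exp (- (u \<bullet> T1 u) / 2))"
    using gaussian_exists[OF T1(1,2,4)] by blast
  obtain L2 :: "(real ^ ('n + 'd) ^ ('n + 'd)) measure" where L2: "prob_space L2" "sets L2 = sets borel"
    "\<And>u. (\<integral>x. iexp (u \<bullet> x) \<partial>L2) = of_real (exp (- (u \<bullet> T2 u) / 2))"
    using gaussian_exists[OF T2(1,2,4)] by blast
  let ?q = "\<lambda>u. q1 (fst u) + q2 (snd u)"
  note L = gaussian_pair[OF L1(1,2) L2(1,2) L1(3)[folded T1(3)] L2(3)[folded T2(3)]]
  have var: "(\<lambda>m. 1 / real m * (\<Sum>i<m. expectation (\<lambda>\<omega>. (u \<bullet> W i \<omega>)\<^sup>2))) \<longlonglongrightarrow> ?q u" for u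
    using tendsto_add[OF var_fst_lim[of "fst u"] q2[of "snd u"]] by (simp add: var_split sum.distrib distrib_left)
  have sq: "integrable M (\<lambda>\<omega>. (u \<bullet> W i \<omega>)\<^sup>2)" for u i by (rule sq_inner[OF W_measurable W_square(1)])
  show thesis
  proof (rule that[OF L(1-3)])
    show "(\<integral>x. iexp (u \<bullet> x) \<partial>(L1 \<Otimes>\<^sub>M L2)) = of_real (exp (- (q1 (fst u) + q2 (snd u)) / 2))" for u by (rule L(4))
    show "0 \<le> q1 u" "0 \<le> q2 v" for u v using T1(3,4) T2(3,4) by simp_all
    show "q1 (t *\<^sub>R u) = t\<^sup>2 * q1 u" "q2 (t *\<^sub>R v) = t\<^sup>2 * q2 v" for t u v
      by (simp_all add: T1(3) T2(3) linear_scale[OF T1(1)] linear_scale[OF T2(1)] power2_eq_square)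
    show "conv_in_law (\<lambda>m. distr M borel (S m)) (L1 \<Otimes>\<^sub>M L2)"
      unfolding S_def[abs_def]
      by (rule lyapunov_clt_euclidean[OF W_indep sq mean_W var \<delta> W_powr(1) W_lyapunov L(1,2,4)])
    have ind: "indep_vars (\<lambda>_. borel) (\<lambda>i \<omega>. - W i \<omega>) UNIV" by (rule indep_vars_compose2[OF W_indep]) auto
    have "conv_in_law (\<lambda>m. distr M borel (\<lambda>\<omega>. (1 / sqrt (real m)) *\<^sub>R (\<Sum>i<m. - W i \<omega>))) (L1 \<Otimes>\<^sub>M L2)"
      by (rule lyapunov_clt_euclidean[OF ind _ _ _ \<delta> _ _ L(1,2,4)])
        (use sq mean_W var W_powr(1) W_lyapunov in simp_all)
    then show "conv_in_law (\<lambda>m. distr M borel (\<lambda>\<omega>. - S m \<omega>)) (L1 \<Otimes>\<^sub>M L2)"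
      by (simp add: S_def sum_negf)
  qed
qed

section \<open>Positivity of \<open>VA\<close> and of the limiting covariance\<close>

lemma VA_symmetric: "transpose VA = VA"
proof -
  have "(\<lambda>m. transpose ((1 / real m) *\<^sub>R (\<Sum>i<m. outer (a0 i) (a0 i)))) \<longlonglongrightarrow> transpose VA"
    by (rule bounded_linear.tendsto[OF bounded_linear_transpose VA_lim])
  moreover have "transpose ((1 / real m) *\<^sub>R (\<Sum>i<m. outer (a0 i) (a0 i))) = (1 / real m) *\<^sub>R (\<Sum>i<m. outer (a0 i) (a0 i))" for m
    by (simp only: linear_scale[OF bounded_linear.linear[OF bounded_linear_transpose]]
        linear_sum[OF bounded_linear.linear[OF bounded_linear_transpose]] transpose_outer)
  ultimately show ?thesis using VA_lim LIMSEQ_unique by simp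
qed

lemma VA_nonneg: "0 \<le> x \<bullet> (VA *v x)"
proof -
  have lim: "(\<lambda>m. outer x x \<bullet> ((1 / real m) *\<^sub>R (\<Sum>i<m. outer (a0 i) (a0 i)))) \<longlonglongrightarrow> outer x x \<bullet> VA"
    by (intro tendsto_intros VA_lim)
  have "0 \<le> outer x x \<bullet> ((1 / real m) *\<^sub>R (\<Sum>i<m. outer (a0 i) (a0 i)))" for m
    by (auto simp: inner_sum_right inner_outer outer_mult inner_commute[of x] intro!: divide_nonneg_nonneg sum_nonneg)
  then have "0 \<le> outer x x \<bullet> VA" by (intro LIMSEQ_le_const[OF lim]) blast
  then show ?thesis by (simp add: inner_commute[of "outer x x"] inner_outer)
qed

text \<open>A nonsingular nonnegative symmetric matrix has an injective square root, and injectivity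
  in finite dimension is quantitative.\<close>

lemma VA_lower:
  assumes VA: "invertible VA"
  obtains v where "v > 0" "\<And>h. v * (norm h)\<^sup>2 \<le> h \<bullet> (VA *v h)"
proof -
  obtain g where g: "linear g" "\<And>x y. g x \<bullet> y = x \<bullet> g y" "\<And>x. g (g x) = VA *v x"
    by (rule psd_sqrt_exists[of "(*v) VA", OF _ symmetric_inner[OF VA_symmetric] VA_nonneg]) (simp, blast)
  have "inj g"
  proof (rule linear_injective_0[OF g(1), THEN iffD2], intro allI impI)
    fix x assume "g x = 0"
    then have "VA *v x = VA *v 0" using g(3)[of x] linear_0[OF g(1)] by simp
    then show "x = 0" by (rule injD[OF inj_matrix_vector_mult[OF VA]])
  qed
  then obtain b where b: "b > 0" "\<And>x. b * norm x \<le> norm (g x)"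
    using linear_inj_bounded_below_pos[OF g(1)] by blast
  show thesis
  proof
    show "b\<^sup>2 > 0" using b by simp
    fix h
    have "(b * norm h)\<^sup>2 \<le> (norm (g h))\<^sup>2" using b by (intro power_mono) auto
    also have "\<dots> = h \<bullet> (VA *v h)" unfolding power2_norm_eq_inner g(2) g(3) ..
    finally show "b\<^sup>2 * (norm h)\<^sup>2 \<le> h \<bullet> (VA *v h)" by (simp add: power_mult_distrib)
  qed
qed

lemma q1_outer: "q1 (outer w z) = \<sigma>\<^sup>2 * ((z \<bullet> (pad e Siginf *v z)) * (w \<bullet> (VA *v w)))"
proof -
  have "outer w z ** pad e Siginf ** transpose (outer w z) = (z \<bullet> (pad e Siginf *v z)) *\<^sub>R outer w w"
    unfolding transpose_outer
    by (rule matrix_eq[THEN iffD2])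
      (simp add: matrix_vector_mul_assoc[symmetric] outer_mult matrix_vector_mult_scaleR scaleR_matrix_vector_assoc[symmetric] mult.commute)
  then show ?thesis by (simp add: q1_def inner_commute[of "outer w w"] inner_outer)
qed

text \<open>For v in the kernel, the functional v.f has variance 0, so both nonnegative parts of its
  variance vanish. On pairs (G1, 0) the map \<Gamma> reduces to G1 Z, hence the first part belongs
  to \<open>outer w (Zmat X0 *v u)\<close> with w the image of v under the transposed inverse of VA;
  by \<open>q1_outer\<close> it is a product of two positive forms, a contradiction.\<close>

lemma covariance_nonsingular:
  assumes L: "prob_space L" "sets L = sets borel"
    and ch: "\<And>u. (\<integral>x. iexp (u \<bullet> x) \<partial>L) = of_real (exp (- (q1 (fst u) + q2 (snd u)) / 2))"
    and q: "\<And>u. 0 \<le> q1 u" "\<And>u. 0 \<le> q2 u" "\<And>t u. q1 (t *\<^sub>R u) = t\<^sup>2 * q1 u" "\<And>t u. q2 (t *\<^sub>R u) = t\<^sup>2 * q2 u"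
    and VA: "invertible VA" and z: "\<And>u. u \<noteq> 0 \<Longrightarrow> 0 < (Zmat X0 *v u) \<bullet> (pad e Siginf *v (Zmat X0 *v u))"
    and u: "u \<noteq> 0"
  shows "invertible (cov_matrix L (\<lambda>G. (matrix_inv VA ** Gamma_of (pad e Siginf) X0 G) *v u))"
proof -
  let ?q = "\<lambda>u :: (real ^ ('n + 'd) ^ 'n) \<times> (real ^ ('n + 'd) ^ ('n + 'd)). q1 (fst u) + q2 (snd u)"
  define f where "f G = (matrix_inv VA ** Gamma_of (pad e Siginf) X0 G) *v u" for G
  have q0: "0 \<le> ?q u" and qs: "?q (t *\<^sub>R u) = t\<^sup>2 * ?q u" for t u using q by (simp_all add: distrib_left)
  note mom = gaussian_moments[OF L q0 qs ch]
  have lin: "linear f" unfolding f_def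
    by (rule linearI) (simp_all add: linear_add[OF linear_Gamma_of] linear_scale[OF linear_Gamma_of] matrix_mult_distribs
        matrix_vector_mult_add_rdistrib scaleR_matrix_vector_assoc[symmetric])
  obtain vv where vv: "vv > 0" "\<And>h. vv * (norm h)\<^sup>2 \<le> h \<bullet> (VA *v h)" using VA_lower[OF VA] by blast
  have ker: "v = 0" if v: "cov_matrix L f *v v = 0" for v
  proof (rule ccontr)
    assume v0: "v \<noteq> 0"
    have "linear (\<lambda>G. v \<bullet> f G)" by (rule linearI) (simp_all add: linear_add[OF lin] linear_scale[OF lin] inner_add_right)
    then obtain c where c: "\<And>G. v \<bullet> f G = c \<bullet> G" by (rule linear_functional_inner) blast
    define w where "w = v v* matrix_inv VA"
    have w0: "w \<noteq> 0"
    proof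
      assume "w = 0"
      then have "w v* VA = 0" by simp
      then have "v v* (matrix_inv VA ** VA) = 0" by (simp add: w_def vector_matrix_mul_assoc)
      then show False using v0 by (simp add: matrix_inv_left[OF VA])
    qed
    have "fst c \<bullet> G1 = outer w (Zmat X0 *v u) \<bullet> G1" for G1
    proof -
      have "Gamma_of (pad e Siginf) X0 (G1, 0) = G1 ** Zmat X0"
        by (simp add: Gamma_of_def Let_def)
      then have "v \<bullet> f (G1, 0) = w \<bullet> (G1 *v (Zmat X0 *v u))"
        by (simp add: f_def w_def matrix_vector_mul_assoc[symmetric] dot_lmul_matrix)
      then show ?thesis using c[of "(G1, 0)"] by (simp add: inner_prod_def inner_commute[of "outer _ _"] inner_outer)
    qed
    then have c1: "fst c = outer w (Zmat X0 *v u)" using vector_eq_rdot by blast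
    have "v \<bullet> (cov_matrix L f *v v) = (\<integral>x. (c \<bullet> x)\<^sup>2 \<partial>L)"
      by (rule cov_quadratic[OF lin mom(2,3) c])
    then have "?q c = 0" using v by (simp add: mom(4))
    then have "q1 (fst c) = 0" using q(1)[of "fst c"] q(2)[of "snd c"] by simp
    moreover have "w \<bullet> (VA *v w) > 0" using vv(2)[of w] vv(1) w0 by (smt (verit) mult_pos_pos zero_less_norm_iff zero_less_power)
    then have "q1 (fst c) > 0" unfolding c1 q1_outer using z[OF u] sigma_pos by simp
    ultimately show False by simp
  qed
  then show ?thesis
    unfolding f_def[symmetric] invertible_left_inverse matrix_left_invertible_ker by blast
qed

end

subsection \<open>Asymptotic normality\<close>

lemma cesaro_vector:
  fixes f :: "nat \<Rightarrow> 'a::real_normed_vector"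
  assumes f: "f \<longlonglongrightarrow> l"
  shows "(\<lambda>m. (1 / real m) *\<^sub>R (\<Sum>i<m. f i)) \<longlonglongrightarrow> l"
proof -
  have n: "(\<lambda>i. norm (f i - l)) \<longlonglongrightarrow> 0" using f by (simp add: LIM_zero tendsto_norm_zero)
  have 0: "(\<lambda>m. 1 / real m * (\<Sum>i<m. norm (f i - l) * 1)) \<longlonglongrightarrow> 0"
    by (rule cesaro_weighted[OF n norm_ge_zero, where B=1]) simp_all
  have "\<forall>\<^sub>F m in sequentially. norm ((1 / real m) *\<^sub>R (\<Sum>i<m. f i) - l) \<le> 1 / real m * (\<Sum>i<m. norm (f i - l) * 1)"
    using eventually_gt_at_top[of 0]
  proof eventually_elim
    case (elim m)
    have "(1 / real m) *\<^sub>R (\<Sum>i<m. f i) - l = (1 / real m) *\<^sub>R (\<Sum>i<m. f i - l)"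
      using elim by (simp add: sum_subtractf scaleR_diff_right sum_constant_scaleR)
    then show ?case using norm_sum[of "\<lambda>i. f i - l" "{..<m}"] by (simp add: divide_right_mono)
  qed
  then have "(\<lambda>m. (1 / real m) *\<^sub>R (\<Sum>i<m. f i) - l) \<longlonglongrightarrow> 0" by (rule Lim_null_comparison[OF _ 0])
  then show ?thesis by (rule LIM_zero_cancel)
qed

lemma inner_matrix_mult_left: "(A ** C) \<bullet> D = A \<bullet> (D ** transpose C)"
  for A :: "real ^ 'n::finite ^ 'm::finite" and C :: "real ^ 'p::finite ^ 'n" and D :: "real ^ 'p ^ 'm"
proof -
  have "(\<Sum>j\<in>UNIV. (\<Sum>l\<in>UNIV. A $ i $ l * C $ l $ j) * D $ i $ j) = (\<Sum>l\<in>UNIV. A $ i $ l * (\<Sum>j\<in>UNIV. D $ i $ j * C $ l $ j))" for i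
    unfolding sum_distrib_left sum_distrib_right by (subst sum.swap) (simp add: mult_ac)
  then show ?thesis by (simp add: inner_vec_def matrix_matrix_mult_def transpose_def)
qed

lemma inner_transpose: "transpose A \<bullet> transpose B = A \<bullet> B" for A B :: "real ^ 'n::finite ^ 'm::finite"
  unfolding inner_vec_def transpose_def by (simp, rule sum.swap)

text \<open>Cyclicity of the trace: the left-hand side is the trace of the d by d identity matrix.
  With B the inverse of P it gives the mean cost of a row at X0 in units of
  \<open>\<sigma>\<^sup>2\<close>.\<close>

lemma trace_identity:
  fixes Z :: "real ^ 'd::finite ^ 's::finite" and B :: "real ^ 'd ^ 'd" and S :: "real ^ 's ^ 's"
  assumes B: "(transpose Z ** S ** Z) ** B = mat 1" and S: "transpose S = S"
  shows "(Z ** B ** transpose Z) \<bullet> S = CARD('d)"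
proof -
  let ?P = "transpose Z ** S ** Z"
  have P: "transpose ?P = ?P" by (simp add: matrix_transpose_mul S matrix_mul_assoc)
  have "(Z ** B ** transpose Z) \<bullet> S = (Z ** B) \<bullet> (S ** Z)" using inner_matrix_mult_left[of "Z ** B" "transpose Z" S] by simp
  also have "\<dots> = (transpose B ** transpose Z) \<bullet> transpose (S ** Z)"
    unfolding inner_transpose[of "Z ** B" "S ** Z", symmetric] by (simp add: matrix_transpose_mul)
  also have "\<dots> = transpose B \<bullet> (transpose (S ** Z) ** Z)" using inner_matrix_mult_left[of "transpose B" "transpose Z"] by simp
  also have "\<dots> = (mat 1 ** transpose B) \<bullet> ?P" by (simp add: matrix_transpose_mul S)
  also have "\<dots> = mat 1 \<bullet> (?P ** B)" by (subst inner_matrix_mult_left) simp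
  also have "\<dots> = CARD('d)" unfolding B by (simp add: inner_vec_def mat_def if_distrib if_distribR cong: if_cong)
  finally show ?thesis .
qed

lemma borel_infty_case_measurable:
  fixes f :: "'w \<Rightarrow> 'a::topological_space option"
  assumes f: "f \<in> measurable M borel_infty"
  shows "(\<lambda>\<omega>. case f \<omega> of Some X \<Rightarrow> X | None \<Rightarrow> c) \<in> borel_measurable M"
    "{\<omega>\<in>space M. f \<omega> = None} \<in> sets M"
proof -
  have sets: "{None} \<in> sets borel_infty" "\<And>B :: 'a set. B \<in> sets borel \<Longrightarrow> Some ` B \<in> sets borel_infty"
    unfolding borel_infty_def by (auto intro!: sigma_sets.Basic)
  have v: "f -` A \<inter> space M \<in> sets M" if "A \<in> sets borel_infty" for A by (rule measurable_sets[OF f that])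
  have "{\<omega>\<in>space M. f \<omega> = None} = f -` {None} \<inter> space M" by auto
  then show N: "{\<omega>\<in>space M. f \<omega> = None} \<in> sets M" using v[OF sets(1)] by simp
  show "(\<lambda>\<omega>. case f \<omega> of Some X \<Rightarrow> X | None \<Rightarrow> c) \<in> borel_measurable M"
  proof (rule measurableI)
    fix A :: "'a set" assume A: "A \<in> sets borel"
    have "(\<lambda>\<omega>. case f \<omega> of Some X \<Rightarrow> X | None \<Rightarrow> c) -` A \<inter> space M =
        (f -` (Some ` A) \<inter> space M) \<union> (if c \<in> A then {\<omega>\<in>space M. f \<omega> = None} else {})"
      by (auto split: option.splits)
    then show "(\<lambda>\<omega>. case f \<omega> of Some X \<Rightarrow> X | None \<Rightarrow> c) -` A \<inter> space M \<in> sets M"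
      using v[OF sets(2)[OF A]] N by auto
  qed simp
qed

section \<open>Second-moment bounds for sums of linear images of \<open>W i\<close>\<close>

context eiv
begin

text \<open>Linear images of the \<open>W i\<close> are again independent and centred, so the mixed
  terms vanish and only the individual second moments remain.\<close>

lemma linear_sum_square:
  fixes T :: "nat \<Rightarrow> (real ^ ('n + 'd) ^ 'n) \<times> (real ^ ('n + 'd) ^ ('n + 'd)) \<Rightarrow> 'b::euclidean_space"
  assumes T: "\<And>i. linear (T i)" and c: "\<And>i w. norm (T i w) \<le> c i * norm w" "\<And>i. 0 \<le> c i"
  shows "\<And>i. (\<lambda>\<omega>. T i (W i \<omega>)) \<in> borel_measurable M" "integrable M (\<lambda>\<omega>. (norm (\<Sum>i<m. T i (W i \<omega>)))\<^sup>2)"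
    "expectation (\<lambda>\<omega>. (norm (\<Sum>i<m. T i (W i \<omega>)))\<^sup>2) \<le> Kw\<^sup>2 * CY * (\<Sum>i<m. (c i)\<^sup>2 * (1 + norm (a0 i))\<^sup>2)"
proof -
  have Tm: "T i \<in> borel_measurable borel" for i
    using T by (intro borel_measurable_continuous_onI linear_continuous_on) (simp add: linear_conv_bounded_linear)
  show rv': "(\<lambda>\<omega>. T i (W i \<omega>)) \<in> borel_measurable M" for i by (rule measurable_compose[OF W_measurable Tm])
  have le: "(norm (T i (W i \<omega>)))\<^sup>2 \<le> (c i)\<^sup>2 * (norm (W i \<omega>))\<^sup>2" for i \<omega>
    using power_mono[OF c(1)[of i "W i \<omega>"], of 2] by (simp add: power_mult_distrib)
  have I: "integrable M (\<lambda>\<omega>. (c i)\<^sup>2 * (norm (W i \<omega>))\<^sup>2)" for i using W_square(1) by simp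
  have sq: "integrable M (\<lambda>\<omega>. (norm (T i (W i \<omega>)))\<^sup>2)" for i
    by (rule Bochner_Integration.integrable_bound[OF I[of i]]) (use rv' le in auto)
  have ind: "indep_vars (\<lambda>_. borel) (\<lambda>i \<omega>. T i (W i \<omega>)) UNIV"
    by (rule indep_vars_compose2[OF W_indep]) (rule Tm)
  have zero: "expectation (\<lambda>\<omega>. b \<bullet> T i (W i \<omega>)) = 0" for b i
  proof -
    have "linear (\<lambda>w. b \<bullet> T i w)" by (rule linearI) (simp_all add: linear_add[OF T] linear_scale[OF T] inner_add_right)
    then obtain u where "\<And>w. b \<bullet> T i w = u \<bullet> w" by (rule linear_functional_inner) blast
    then show ?thesis by (simp add: mean_W)
  qed
  show "integrable M (\<lambda>\<omega>. (norm (\<Sum>i<m. T i (W i \<omega>)))\<^sup>2)" by (rule expectation_norm_sum_square(1)[OF ind sq zero])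
  have "expectation (\<lambda>\<omega>. (norm (\<Sum>i<m. T i (W i \<omega>)))\<^sup>2) = (\<Sum>i<m. expectation (\<lambda>\<omega>. (norm (T i (W i \<omega>)))\<^sup>2))"
    by (rule expectation_norm_sum_square(2)[OF ind sq zero])
  also have "\<dots> \<le> (\<Sum>i<m. (c i)\<^sup>2 * (Kw\<^sup>2 * CY * (1 + norm (a0 i))\<^sup>2))"
  proof (rule sum_mono)
    fix i
    have "expectation (\<lambda>\<omega>. (norm (T i (W i \<omega>)))\<^sup>2) \<le> (c i)\<^sup>2 * expectation (\<lambda>\<omega>. (norm (W i \<omega>))\<^sup>2)"
      using integral_mono[OF sq I le, of i] by simp
    also have "\<dots> \<le> (c i)\<^sup>2 * (Kw\<^sup>2 * CY * (1 + norm (a0 i))\<^sup>2)" by (intro mult_left_mono W_square(2)) simp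
    finally show "expectation (\<lambda>\<omega>. (norm (T i (W i \<omega>)))\<^sup>2) \<le> (c i)\<^sup>2 * (Kw\<^sup>2 * CY * (1 + norm (a0 i))\<^sup>2)" .
  qed
  also have "\<dots> = Kw\<^sup>2 * CY * (\<Sum>i<m. (c i)\<^sup>2 * (1 + norm (a0 i))\<^sup>2)" by (simp add: sum_distrib_left mult_ac)
  finally show "expectation (\<lambda>\<omega>. (norm (\<Sum>i<m. T i (W i \<omega>)))\<^sup>2) \<le> Kw\<^sup>2 * CY * (\<Sum>i<m. (c i)\<^sup>2 * (1 + norm (a0 i))\<^sup>2)" .
qed

text \<open>At the scale 1 / sqrt m the second moment is an average with weights of order
  \<open>(c i)\<^sup>2\<close>, which vanishes once \<open>c i\<close> tends to 0.\<close>

lemma null_sqrt: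
  fixes T :: "nat \<Rightarrow> (real ^ ('n + 'd) ^ 'n) \<times> (real ^ ('n + 'd) ^ ('n + 'd)) \<Rightarrow> 'b::euclidean_space"
  assumes T: "\<And>i. linear (T i)" and c: "\<And>i w. norm (T i w) \<le> c i * norm w" "\<And>i. 0 \<le> c i" "c \<longlonglongrightarrow> 0"
  shows "null_in_prob M (\<lambda>m \<omega>. (1 / sqrt (real m)) *\<^sub>R (\<Sum>i<m. T i (W i \<omega>)))"
proof (rule null_in_prob_L2)
  note * = linear_sum_square[OF T c(1,2)]
  note [measurable] = *(1)
  show "(\<lambda>\<omega>. (1 / sqrt (real m)) *\<^sub>R (\<Sum>i<m. T i (W i \<omega>))) \<in> borel_measurable M" for m by measurable
  have eq: "(norm ((1 / sqrt (real m)) *\<^sub>R (\<Sum>i<m. T i (W i \<omega>))))\<^sup>2 = 1 / real m * (norm (\<Sum>i<m. T i (W i \<omega>)))\<^sup>2" for m \<omega>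
    by (simp add: power_mult_distrib power_divide)
  show "integrable M (\<lambda>\<omega>. (norm ((1 / sqrt (real m)) *\<^sub>R (\<Sum>i<m. T i (W i \<omega>))))\<^sup>2)" for m
    unfolding eq using *(2) by simp
  show "expectation (\<lambda>\<omega>. (norm ((1 / sqrt (real m)) *\<^sub>R (\<Sum>i<m. T i (W i \<omega>))))\<^sup>2) \<le>
      Kw\<^sup>2 * CY * (1 / real m * (\<Sum>i<m. (c i)\<^sup>2 * (1 + norm (a0 i))\<^sup>2))" for m
  proof -
    have "expectation (\<lambda>\<omega>. (norm ((1 / sqrt (real m)) *\<^sub>R (\<Sum>i<m. T i (W i \<omega>))))\<^sup>2) =
        1 / real m * expectation (\<lambda>\<omega>. (norm (\<Sum>i<m. T i (W i \<omega>)))\<^sup>2)" unfolding eq by (rule integral_mult_right_zero)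
    also have "\<dots> \<le> 1 / real m * (Kw\<^sup>2 * CY * (\<Sum>i<m. (c i)\<^sup>2 * (1 + norm (a0 i))\<^sup>2))"
      by (intro mult_left_mono *(3)) simp
    finally show ?thesis by (simp add: mult_ac)
  qed
  have "(\<lambda>i. (c i)\<^sup>2) \<longlonglongrightarrow> 0" using tendsto_power[OF c(3), of 2] by simp
  from cesaro_weighted[OF this _ _ a0_mean_one_plus]
  have "(\<lambda>m. 1 / real m * (\<Sum>i<m. (c i)\<^sup>2 * (1 + norm (a0 i))\<^sup>2)) \<longlonglongrightarrow> 0" by simp
  from tendsto_mult_left[OF this, of "Kw\<^sup>2 * CY"]
  show "(\<lambda>m. Kw\<^sup>2 * CY * (1 / real m * (\<Sum>i<m. (c i)\<^sup>2 * (1 + norm (a0 i))\<^sup>2))) \<longlonglongrightarrow> 0" by simp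
qed

text \<open>At the scale 1 / m uniformly bounded maps suffice, since the second moment is then of
  order 1 / m. This is the law of large numbers behind consistency.\<close>

lemma null_mean:
  fixes T :: "nat \<Rightarrow> (real ^ ('n + 'd) ^ 'n) \<times> (real ^ ('n + 'd) ^ ('n + 'd)) \<Rightarrow> 'b::euclidean_space"
  assumes T: "\<And>i. linear (T i)" and c: "\<And>i w. norm (T i w) \<le> c * norm w" "0 \<le> c"
  shows "null_in_prob M (\<lambda>m \<omega>. (1 / real m) *\<^sub>R (\<Sum>i<m. T i (W i \<omega>)))"
proof (rule null_in_prob_L2)
  note * = linear_sum_square[where c="\<lambda>_. c", OF T c]
  note [measurable] = *(1)
  show "(\<lambda>\<omega>. (1 / real m) *\<^sub>R (\<Sum>i<m. T i (W i \<omega>))) \<in> borel_measurable M" for m by measurable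
  have eq: "(norm ((1 / real m) *\<^sub>R (\<Sum>i<m. T i (W i \<omega>))))\<^sup>2 = 1 / real m * (1 / real m) * (norm (\<Sum>i<m. T i (W i \<omega>)))\<^sup>2" for m \<omega>
    by (simp add: power_mult_distrib power_divide power2_eq_square)
  show "integrable M (\<lambda>\<omega>. (norm ((1 / real m) *\<^sub>R (\<Sum>i<m. T i (W i \<omega>))))\<^sup>2)" for m
    unfolding eq using *(2) by simp
  show "expectation (\<lambda>\<omega>. (norm ((1 / real m) *\<^sub>R (\<Sum>i<m. T i (W i \<omega>))))\<^sup>2) \<le> Kw\<^sup>2 * CY * c\<^sup>2 * (2 + 2 * vb) / real m" for m
  proof -
    have "expectation (\<lambda>\<omega>. (norm ((1 / real m) *\<^sub>R (\<Sum>i<m. T i (W i \<omega>))))\<^sup>2) =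
        1 / real m * (1 / real m) * expectation (\<lambda>\<omega>. (norm (\<Sum>i<m. T i (W i \<omega>)))\<^sup>2)" unfolding eq by (rule integral_mult_right_zero)
    also have "\<dots> \<le> 1 / real m * (1 / real m) * (Kw\<^sup>2 * CY * (\<Sum>i<m. c\<^sup>2 * (1 + norm (a0 i))\<^sup>2))"
      by (intro mult_left_mono *(3)) simp
    also have "\<dots> = 1 / real m * (Kw\<^sup>2 * CY * c\<^sup>2 * (1 / real m * (\<Sum>i<m. (1 + norm (a0 i))\<^sup>2)))"
      by (simp add: sum_distrib_left[symmetric] mult_ac)
    also have "\<dots> \<le> 1 / real m * (Kw\<^sup>2 * CY * c\<^sup>2 * (2 + 2 * vb))"
      using CY(1) by (intro mult_left_mono a0_mean_one_plus) auto
    finally show ?thesis by simp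
  qed
  show "(\<lambda>m. Kw\<^sup>2 * CY * c\<^sup>2 * (2 + 2 * vb) / real m) \<longlonglongrightarrow> 0" by (rule lim_const_over_n)
qed

lemma S_second_moment: "integrable M (\<lambda>\<omega>. (norm (S m \<omega>))\<^sup>2)" "expectation (\<lambda>\<omega>. (norm (S m \<omega>))\<^sup>2) \<le> Kw\<^sup>2 * CY * (2 + 2 * vb)"
proof -
  have *: "integrable M (\<lambda>\<omega>. (norm (\<Sum>i<m. W i \<omega>))\<^sup>2)"
    "expectation (\<lambda>\<omega>. (norm (\<Sum>i<m. W i \<omega>))\<^sup>2) \<le> Kw\<^sup>2 * CY * (\<Sum>i<m. 1\<^sup>2 * (1 + norm (a0 i))\<^sup>2)"
    by (rule linear_sum_square(2,3)[where T="\<lambda>i w. w" and c="\<lambda>_. 1"]; simp add: linear_iff)+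
  have eq: "(norm (S m \<omega>))\<^sup>2 = 1 / real m * (norm (\<Sum>i<m. W i \<omega>))\<^sup>2" for \<omega>
    by (simp add: S_def power_mult_distrib power_divide)
  show "integrable M (\<lambda>\<omega>. (norm (S m \<omega>))\<^sup>2)" unfolding eq using *(1) by simp
  have "expectation (\<lambda>\<omega>. (norm (S m \<omega>))\<^sup>2) = 1 / real m * expectation (\<lambda>\<omega>. (norm (\<Sum>i<m. W i \<omega>))\<^sup>2)"
    unfolding eq by (rule integral_mult_right_zero)
  also have "\<dots> \<le> 1 / real m * (Kw\<^sup>2 * CY * (\<Sum>i<m. 1\<^sup>2 * (1 + norm (a0 i))\<^sup>2))" by (intro mult_left_mono *(2)) simp
  also have "\<dots> = Kw\<^sup>2 * CY * (1 / real m * (\<Sum>i<m. (1 + norm (a0 i))\<^sup>2))" by (simp add: mult_ac)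
  also have "\<dots> \<le> Kw\<^sup>2 * CY * (2 + 2 * vb)" using CY(1) by (intro mult_left_mono a0_mean_one_plus) auto
  finally show "expectation (\<lambda>\<omega>. (norm (S m \<omega>))\<^sup>2) \<le> Kw\<^sup>2 * CY * (2 + 2 * vb)" .
qed

lemma Sig_symmetric: "transpose (Sig i) = Sig i"
proof -
  have "transpose (\<sigma>\<^sup>2 *\<^sub>R Sig i) = \<sigma>\<^sup>2 *\<^sub>R Sig i"
    unfolding cov_J[symmetric] by (simp add: vec_eq_iff transpose_def cov_matrix_def mult.commute)
  then show ?thesis
    using sigma_pos linear_scale[OF bounded_linear.linear[OF bounded_linear_transpose], of "\<sigma>\<^sup>2" "Sig i"] by simp
qed

end

locale eiv_estimation = eiv M X0 a0 ct J e Sig Siginf VA \<sigma> \<delta> mu4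
  for M :: "'w measure" and X0 :: "real ^ 'd::finite ^ 'n::finite" and a0 ct J and e :: "'j::finite \<Rightarrow> 'n + 'd" and Sig Siginf VA \<sigma> \<delta> mu4 +
  fixes \<kappa> :: real and est :: "nat \<Rightarrow> (nat \<Rightarrow> real ^ ('n + 'd)) \<Rightarrow> (real ^ 'd ^ 'n) option"
  assumes \<kappa>: "\<kappa> > 0" "\<And>i. \<kappa>\<^sup>2 \<le> lambda_min (Sig i)"
    and rank_Z0J: "rank (subrows e (Zmat X0)) = CARD('d)"
    and VA_nonsing: "invertible VA"
    and estimator: "ewtls_estimator J e Sig est"
begin

sublocale E: ewtls_setting e X0 Sig Siginf "\<kappa>\<^sup>2"
proof
  show "inj e" by (rule inj)
  show "rank (subrows e (Zmat X0)) = CARD('d)" by (rule rank_Z0J)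
  show "0 < \<kappa>\<^sup>2" using \<kappa> by simp
  show "transpose (Sig i) = Sig i" for i by (rule Sig_symmetric)
  show "\<kappa>\<^sup>2 * (norm x)\<^sup>2 \<le> x \<bullet> (Sig i *v x)" for i x
    using lambda_min_le[OF Sig_symmetric, of i x] mult_right_mono[OF \<kappa>(2)[of i], of "(norm x)\<^sup>2"] by simp
  show "Sig \<longlonglongrightarrow> Siginf" by (rule Sig_lim)
qed

lemma dist_null: "(\<lambda>i. dist (Sig i) Siginf) \<longlonglongrightarrow> 0" using Sig_lim by (rule tendsto_dist_iff[THEN iffD1])

lemma Wd_eq: "E.Wd (\<sigma>\<^sup>2) a0 (\<lambda>i. ct i \<omega>) i = W i \<omega>" by (simp add: E.Wd_def W_eq)

lemma Sm_eq: "E.Sm (\<sigma>\<^sup>2) a0 (\<lambda>i. ct i \<omega>) m = S m \<omega>" by (simp add: E.Sm_def Wd_eq S_def)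

definition Nn where "Nn m \<omega> = (1 / real m) *\<^sub>R (\<Sum>i<m. E.tau i *\<^sub>R outer (a0 i) (ct i \<omega>))"
definition Tn where "Tn m \<omega> = (1 / real m) *\<^sub>R (\<Sum>i<m. E.tau i *\<^sub>R outer (ct i \<omega>) (ct i \<omega>)) - \<sigma>\<^sup>2 *\<^sub>R pad e Siginf"
definition Tw where "Tw m \<omega> = (1 / real m) *\<^sub>R (\<Sum>i<m. E.tau i *\<^sub>R snd (W i \<omega>))"
text \<open>The excess of the average cost at X0 over its expectation, the noise level that
  \<open>consistency\<close> compares with.\<close>

definition Qn where "Qn m \<omega> = 1 / real m * (\<Sum>i<m. qcost e (Sig i) (E.obsv (a0 i) (ct i \<omega>)) X0) - \<sigma>\<^sup>2 * CARD('d)"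
definition Mq where "Mq i = Zmat X0 ** matrix_inv (Pmat e (Sig i) X0) ** transpose (Zmat X0)"
definition Qw where "Qw m \<omega> = (1 / real m) *\<^sub>R (\<Sum>i<m. Mq i \<bullet> snd (W i \<omega>))"
definition Gn where "Gn m \<omega> = 1 / real m * (\<Sum>i<m. dist (Sig i) Siginf * norm (W i \<omega>))"
definition Rn where "Rn m \<omega> = E.remd (\<sigma>\<^sup>2) a0 (\<lambda>i. ct i \<omega>) m"

lemma tau_norm: "norm (E.tau i *\<^sub>R w) \<le> norm w"
  using E.tau(1,2)[of i] by (simp add: mult_left_le_one_le)

lemma Nn_null: "null_in_prob M Nn"
proof -
  have "null_in_prob M (\<lambda>m \<omega>. (1 / real m) *\<^sub>R (\<Sum>i<m. E.tau i *\<^sub>R fst (W i \<omega>)))"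
  proof (rule null_mean[where c=1])
    show "linear (\<lambda>w. E.tau i *\<^sub>R fst w)" for i by (rule linearI) (simp_all add: scaleR_add_right)
    show "norm (E.tau i *\<^sub>R fst w) \<le> 1 * norm w" for i and w :: "_ \<times> _"
      using order_trans[OF tau_norm norm_fst] by simp
  qed simp
  then show ?thesis by (simp add: Nn_def[abs_def] W_eq)
qed

lemma Tw_null: "null_in_prob M Tw"
  unfolding Tw_def[abs_def]
proof (rule null_mean[where c=1])
  show "linear (\<lambda>w. E.tau i *\<^sub>R snd w)" for i by (rule linearI) (simp_all add: scaleR_add_right)
  show "norm (E.tau i *\<^sub>R snd w) \<le> 1 * norm w" for i and w :: "_ \<times> _"
    using order_trans[OF tau_norm norm_snd] by simp
qed simp

lemma Tw_measurable [measurable]: "Tw m \<in> borel_measurable M" unfolding Tw_def[abs_def] by measurable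

lemma Tn_null: "null_in_prob M Tn"
proof -
  \<comment> \<open>The deterministic part of \<open>Tn\<close>: a Cesaro mean of a convergent
    sequence minus its limit. The centred part is \<open>Tw\<close>.\<close>
  define off where "off m = (1 / real m) *\<^sub>R (\<Sum>i<m. E.tau i *\<^sub>R (\<sigma>\<^sup>2 *\<^sub>R pad e (Sig i))) - \<sigma>\<^sup>2 *\<^sub>R pad e Siginf" for m
  have "(\<lambda>i. E.tau i *\<^sub>R (\<sigma>\<^sup>2 *\<^sub>R pad e (Sig i))) \<longlonglongrightarrow> 1 *\<^sub>R (\<sigma>\<^sup>2 *\<^sub>R pad e Siginf)"
    by (intro tendsto_intros E.tau(3) pad_lim)
  from cesaro_vector[OF this] have "off \<longlonglongrightarrow> 0" unfolding off_def[abs_def] by (simp add: LIM_zero)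
  then have "(\<lambda>m. norm (off m)) \<longlonglongrightarrow> 0" by (rule tendsto_norm_zero)
  moreover have eq: "Tn m \<omega> = Tw m \<omega> + off m" for m \<omega>
    by (simp add: Tn_def Tw_def off_def W_eq scaleR_diff_right sum_subtractf)
  ultimately show ?thesis
    by (intro null_in_prob_le[OF Tw_null Tw_measurable]) (auto simp: eq norm_triangle_ineq)
qed

lemma Mq_bounded: "\<exists>B\<ge>0. \<forall>i. norm (Mq i) \<le> B"
proof -
  let ?b = "1 / (\<kappa>\<^sup>2 * (fst E.nbhd)\<^sup>2) * CARD('d)"
  have "norm (Mq i) \<le> norm (Zmat X0) * ?b * norm (Zmat X0)" for i
    unfolding Mq_def by (intro norm_matrix_mult_mono E.U_inverse_bounded E.X0_U E.Sig_V) (auto simp: norm_transpose)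
  moreover have "0 \<le> norm (Zmat X0) * ?b * norm (Zmat X0)" by simp
  ultimately show ?thesis by blast
qed

text \<open>At X0 the residual of a row consists of the error alone, so its cost is a quadratic form
  in \<open>ct i\<close> with matrix \<open>Mq i\<close>, and \<open>trace_identity\<close>
  evaluates its mean. The case m = 0 is excluded because the average of the constant would be 0
  there.\<close>

lemma Qn_eq: "m > 0 \<Longrightarrow> Qn m \<omega> = Qw m \<omega>"
proof -
  assume m: "m > 0"
  have "qcost e (Sig i) (E.obsv (a0 i) (ct i \<omega>)) X0 = Mq i \<bullet> snd (W i \<omega>) + \<sigma>\<^sup>2 * CARD('d)" for i
  proof -
    let ?Z = "Zmat X0" and ?t = "ct i \<omega>" and ?B = "matrix_inv (Pmat e (Sig i) X0)"
    have "(E.obsv (a0 i) ?t v* ?Z) \<bullet> z = (?t v* ?Z) \<bullet> z" for z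
      unfolding E.inner_obsv_Zmat by (simp add: dot_lmul_matrix)
    then have o: "E.obsv (a0 i) ?t v* ?Z = ?t v* ?Z" using vector_eq_rdot by blast
    have "qcost e (Sig i) (E.obsv (a0 i) ?t) X0 = Mq i \<bullet> outer ?t ?t"
      unfolding qcost_def multiplier_def o Mq_def inner_outer by (simp add: dot_lmul_matrix matrix_vector_mul_assoc[symmetric])
    moreover have "Mq i \<bullet> pad e (Sig i) = CARD('d)"
      unfolding Mq_def
    proof (rule trace_identity)
      show "(transpose ?Z ** pad e (Sig i) ** ?Z) ** ?B = mat 1"
        unfolding Pmat_def[symmetric] by (rule matrix_inv_right[OF pos_def_invertible[OF E.U_Pmat[OF E.X0_U E.Sig_V]]])
      show "transpose (pad e (Sig i)) = pad e (Sig i)" by (rule transpose_pad[OF Sig_symmetric])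
    qed
    ultimately show ?thesis by (simp add: W_eq inner_diff_right)
  qed
  then show ?thesis using m by (simp add: Qn_def Qw_def sum.distrib distrib_left add_divide_distrib)
qed

lemma Qw_null: "null_in_prob M Qw"
proof -
  obtain B where B: "B \<ge> 0" "\<And>i. norm (Mq i) \<le> B" using Mq_bounded by blast
  show ?thesis unfolding Qw_def[abs_def]
  proof (rule null_mean[where c=B])
    show "linear (\<lambda>w. Mq i \<bullet> snd w)" for i by (rule linearI) (simp_all add: inner_add_right)
    show "norm (Mq i \<bullet> snd w) \<le> B * norm w" for i and w :: "_ \<times> _"
      using order_trans[OF Cauchy_Schwarz_ineq2 mult_mono[OF B(2)[of i] norm_snd]] B(1) by simp
  qed (rule B)
qed

text \<open>The norms of the \<open>W i\<close> are not centred, so no cancellation is available;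
  the weights \<open>dist (Sig i) Siginf\<close> make even the expectation of the average
  vanish.\<close>

lemma Gn_null: "null_in_prob M Gn"
proof (rule null_in_prob_L1)
  have nn: "0 \<le> Gn m \<omega>" for m \<omega> by (simp add: Gn_def sum_nonneg)
  have int: "integrable M (Gn m)" for m unfolding Gn_def[abs_def] using W_norm_mean(1) by simp
  show "integrable M (\<lambda>\<omega>. norm (Gn m \<omega>))" for m using int by simp
  have le: "expectation (\<lambda>\<omega>. norm (Gn m \<omega>)) \<le> Kw * CY * (1 / real m * (\<Sum>i<m. dist (Sig i) Siginf * (1 + norm (a0 i))\<^sup>2))" for m
  proof -
    have "expectation (\<lambda>\<omega>. norm (Gn m \<omega>)) = expectation (Gn m)" using nn by simp
    also have "\<dots> = 1 / real m * (\<Sum>i<m. dist (Sig i) Siginf * expectation (\<lambda>\<omega>. norm (W i \<omega>)))"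
      unfolding Gn_def[abs_def] using W_norm_mean(1) by simp
    also have "\<dots> \<le> 1 / real m * (\<Sum>i<m. dist (Sig i) Siginf * (Kw * CY * (1 + norm (a0 i))\<^sup>2))"
    proof (intro mult_left_mono sum_mono)
      fix i
      \<comment> \<open>Squaring a quantity that is at least 1 allows the bound
        \<open>a0_mean_one_plus\<close> on quadratic averages to be reused.\<close>
      have "Kw * CY * (1 + norm (a0 i)) \<le> Kw * CY * (1 + norm (a0 i))\<^sup>2"
        using Kw(1) CY(1) by (intro mult_left_mono self_le_power) auto
      then show "expectation (\<lambda>\<omega>. norm (W i \<omega>)) \<le> Kw * CY * (1 + norm (a0 i))\<^sup>2" using W_norm_mean(2)[of i] by linarith
    qed auto
    also have "\<dots> = Kw * CY * (1 / real m * (\<Sum>i<m. dist (Sig i) Siginf * (1 + norm (a0 i))\<^sup>2))"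
      by (simp add: sum_distrib_left mult_ac)
    finally show ?thesis .
  qed
  have "(\<lambda>m. 1 / real m * (\<Sum>i<m. dist (Sig i) Siginf * (1 + norm (a0 i))\<^sup>2)) \<longlonglongrightarrow> 0"
    by (rule cesaro_weighted[OF dist_null _ _ a0_mean_one_plus]) auto
  from tendsto_mult_left[OF this, of "Kw * CY"]
  have z: "(\<lambda>m. Kw * CY * (1 / real m * (\<Sum>i<m. dist (Sig i) Siginf * (1 + norm (a0 i))\<^sup>2))) \<longlonglongrightarrow> 0" by simp
  show "(\<lambda>m. expectation (\<lambda>\<omega>. norm (Gn m \<omega>))) \<longlonglongrightarrow> 0"
    by (rule Lim_null_comparison[OF always_eventually z]) (use le in simp)
qed

text \<open>The coefficients are differences of \<open>Gmap X0\<close> in \<Sigma> and thus of order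
  \<open>dist (Sig i) Siginf\<close>; this is the case for which \<open>null_sqrt\<close> admits
  varying constants.\<close>

lemma Rn_null: "null_in_prob M Rn"
proof -
  obtain C where C: "C \<ge> 0" "\<And>w. mixed_lipschitz_with (C * norm w) E.U E.V (\<lambda>X A. E.Gmap X A w)"
    using E.Gmap_bounds by blast
  have "null_in_prob M (\<lambda>m \<omega>. (1 / sqrt (real m)) *\<^sub>R (\<Sum>i<m. E.Gmap X0 (Sig i) (W i \<omega>) - E.Gmap X0 Siginf (W i \<omega>)))"
  proof (rule null_sqrt[where c="\<lambda>i. C * dist (Sig i) Siginf"])
    show "linear (\<lambda>w. E.Gmap X0 (Sig i) w - E.Gmap X0 Siginf w)" for i
      by (rule linear_compose_sub[OF E.linear_Gmap E.linear_Gmap])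
    show "norm (E.Gmap X0 (Sig i) w - E.Gmap X0 Siginf w) \<le> C * dist (Sig i) Siginf * norm w" for i w
      using mixed_lipschitz_withD(4)[OF C(2) E.X0_U E.Sig_V E.Siginf_V, of i w] by (simp add: mult_ac)
    show "(\<lambda>i. C * dist (Sig i) Siginf) \<longlonglongrightarrow> 0" using tendsto_mult_left[OF dist_null, of C] by simp
  qed (use C(1) in simp)
  then show ?thesis by (simp add: Rn_def[abs_def] E.remd_def Wd_eq)
qed

text \<open>A single real sequence whose smallness implies every random condition of the
  deterministic estimates. \<open>Qw\<close> replaces \<open>Qn\<close>, with which it agrees for
  positive m.\<close>

definition Zn where "Zn m \<omega> = norm (Nn m \<omega>) + norm (Tn m \<omega>) + norm (Qw m \<omega>) + norm (Gn m \<omega>) + norm (Rn m \<omega>)"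

lemma outer_measurable: "(\<lambda>\<omega>. outer (ct i \<omega>) (ct i \<omega>)) \<in> borel_measurable M" "(\<lambda>\<omega>. outer (a0 i) (ct i \<omega>)) \<in> borel_measurable M"
  by (rule measurable_compose[OF rv borel_measurable_continuous_onI],
      intro continuous_intros bounded_bilinear.continuous_on[OF bounded_bilinear_outer])+

lemma Zn_measurable [measurable]: "Nn m \<in> borel_measurable M" "Tn m \<in> borel_measurable M" "Qw m \<in> borel_measurable M"
  "Gn m \<in> borel_measurable M" "Rn m \<in> borel_measurable M" "Zn m \<in> borel_measurable M"
proof -
  note [measurable] = outer_measurable
  show 1 [measurable]: "Nn m \<in> borel_measurable M" "Tn m \<in> borel_measurable M" "Qw m \<in> borel_measurable M" "Gn m \<in> borel_measurable M"
    unfolding Nn_def[abs_def] Tn_def[abs_def] Qw_def[abs_def] Gn_def[abs_def] by measurable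
  have G: "E.Gmap Y A \<in> borel_measurable borel" for Y A
    using E.linear_Gmap by (intro borel_measurable_continuous_onI linear_continuous_on) (simp add: linear_conv_bounded_linear)
  have [measurable]: "(\<lambda>\<omega>. E.Gmap Y A (W i \<omega>)) \<in> borel_measurable M" for Y A i by (rule measurable_compose[OF W_measurable G])
  show 2 [measurable]: "Rn m \<in> borel_measurable M" unfolding Rn_def[abs_def] E.remd_def Wd_eq by measurable
  show "Zn m \<in> borel_measurable M" unfolding Zn_def[abs_def] by measurable
qed

lemma Zn_null: "null_in_prob M Zn"
proof -
  have n: "null_in_prob M (\<lambda>m \<omega>. norm (F m \<omega>))" if "null_in_prob M F" for F :: "nat \<Rightarrow> 'w \<Rightarrow> 'z::real_normed_vector"
    using that by (simp add: null_in_prob_def)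
  show ?thesis unfolding Zn_def[abs_def]
    by (intro null_in_prob_add n Nn_null Tn_null Qw_null Gn_null Rn_null) measurable
qed

end

section \<open>From the deterministic estimates to the limit law of the estimator\<close>

context eiv_estimation
begin

definition rows where "rows m \<omega> = (\<lambda>i\<in>{..<m}. obs X0 a0 ct i \<omega>)"
definition cost where "cost m \<omega> X = (\<Sum>i<m. qcost e (Sig i) (E.obsv (a0 i) (ct i \<omega>)) X)"

lemma rows_measurable [measurable]: "rows m \<in> measurable M (PiM {..<m} (\<lambda>_. borel))"
  unfolding rows_def[abs_def] obs_def by (rule measurable_restrict) measurable

lemma est_measurable [measurable]: "(\<lambda>\<omega>. est m (rows m \<omega>)) \<in> measurable M borel_infty"
  using measurable_compose[OF rows_measurable] estimator unfolding ewtls_estimator_def by blast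

lemma solution_iff: "ewtls_solution J e Sig m (rows m \<omega>) X \<longleftrightarrow> rank (subrows e (Zmat X)) = CARD('d) \<and>
  (\<forall>X'. rank (subrows e (Zmat X')) = CARD('d) \<longrightarrow> cost m \<omega> X \<le> cost m \<omega> X')"
proof -
  have "(\<Sum>i<m. qcost e (Sig i) (rows m \<omega> i) X) = cost m \<omega> X" for X
    by (auto simp: cost_def rows_def obs_def E.obsv_def intro!: sum.cong)
  then show ?thesis using ewtls_solution_iff[where Sig=Sig and m=m and C="rows m \<omega>" and X=X, OF E.V_pos_def[OF E.Sig_V] enum] by simp
qed

lemma est_cases:
  "case est m (rows m \<omega>) of Some X \<Rightarrow> ewtls_solution J e Sig m (rows m \<omega>) X
    | None \<Rightarrow> \<not> (\<exists>X. ewtls_solution J e Sig m (rows m \<omega>) X)"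
proof -
  have "rows m \<omega> \<in> space (PiM {..<m} (\<lambda>_. borel))" by (simp add: rows_def space_PiM)
  then show ?thesis using estimator unfolding ewtls_estimator_def by blast
qed

lemma weighted_VA_lim: "(\<lambda>m. (1 / real m) *\<^sub>R (\<Sum>i<m. E.tau i *\<^sub>R outer (a0 i) (a0 i))) \<longlonglongrightarrow> VA"
proof -
  have d: "(\<lambda>i. 1 - E.tau i) \<longlonglongrightarrow> 0" using tendsto_diff[OF tendsto_const[of 1] E.tau(3)] by simp
  have 0: "(\<lambda>m. 1 / real m * (\<Sum>i<m. (1 - E.tau i) * (norm (a0 i))\<^sup>2)) \<longlonglongrightarrow> 0"
    by (rule cesaro_weighted[OF d _ _ vb(2)]) (use E.tau(2) in auto)
  have "(\<lambda>m. (1 / real m) *\<^sub>R (\<Sum>i<m. (1 - E.tau i) *\<^sub>R outer (a0 i) (a0 i))) \<longlonglongrightarrow> 0"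
  proof (rule Lim_null_comparison[OF always_eventually 0], rule allI, rule E.norm_mean_le)
    show "norm ((1 - E.tau i) *\<^sub>R outer (a0 i) (a0 i)) \<le> (1 - E.tau i) * (norm (a0 i))\<^sup>2" for i
      using E.tau(2)[of i] by (simp add: norm_outer power2_eq_square)
  qed simp
  from tendsto_diff[OF VA_lim this] show ?thesis
    by (simp add: scaleR_diff_left sum_subtractf scaleR_diff_right)
qed

text \<open>A statement about each \<omega>, with the choices ordered as follows: \<eta> is the
  target accuracy, \<epsilon> comes from \<open>consistency\<close> for a radius depending on
  \<eta>, and N makes the nonrandom averages close to their limits. Existence of a minimizer
  excludes the value \<open>None\<close> of the estimator.\<close>

lemma approximation:
  obtains C \<eta>0 where "C > 0" "\<eta>0 > 0" "\<And>\<eta>. 0 < \<eta> \<Longrightarrow> \<eta> \<le> \<eta>0 \<Longrightarrow>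
    \<exists>\<epsilon>>0. \<exists>N. \<forall>m\<ge>N. \<forall>\<omega>. (\<forall>i s. s \<notin> J \<longrightarrow> ct i \<omega> $ s = 0) \<longrightarrow> Zn m \<omega> < \<epsilon> \<longrightarrow>
      (\<exists>X. est m (rows m \<omega>) = Some X \<and>
        norm (sqrt (real m) *\<^sub>R (X - X0) + matrix_inv VA ** Gamma_of (pad e Siginf) X0 (S m \<omega>)) \<le> C * \<eta> * (1 + norm (S m \<omega>)))"
proof -
  obtain C \<eta>0 where C: "C > 0" "\<eta>0 > 0" "\<And>m a t s2 X \<eta>. m > 0 \<Longrightarrow> 0 < \<eta> \<Longrightarrow> \<eta> \<le> \<eta>0 \<Longrightarrow> X \<in> E.U \<Longrightarrow> E.score a t m X = 0 \<Longrightarrow>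
    norm ((1 / real m) *\<^sub>R (\<Sum>i<m. outer (a i) (a i)) - VA) \<le> \<eta> \<Longrightarrow>
    1 / real m * (\<Sum>i<m. (norm (a i))\<^sup>2) \<le> vb \<Longrightarrow>
    1 / real m * (\<Sum>i<m. (norm (a i))\<^sup>2 * dist (Sig i) Siginf) \<le> \<eta> \<Longrightarrow> dist X X0 \<le> \<eta> \<Longrightarrow>
    1 / real m * (\<Sum>i<m. dist (Sig i) Siginf * norm (E.Wd s2 a t i)) \<le> \<eta> \<Longrightarrow> norm (E.remd s2 a t m) \<le> \<eta> \<Longrightarrow>
    norm (sqrt (real m) *\<^sub>R (X - X0) + matrix_inv VA ** Gamma_of (pad e Siginf) X0 (E.Sm s2 a t m)) \<le> C * \<eta> * (1 + norm (E.Sm s2 a t m))"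
    by (rule E.normal_approximation[OF VA_nonsing vb(1)]) blast
  show thesis
  proof (rule that[OF C(1,2)])
    fix \<eta> :: real assume \<eta>: "0 < \<eta>" "\<eta> \<le> \<eta>0"
    obtain v where v: "v > 0" "\<And>h. v * (norm h)\<^sup>2 \<le> h \<bullet> (VA *v h)" using VA_lower[OF VA_nonsing] by blast
    \<comment> \<open>The bound \<open>snd E.nbhd\<close> keeps the minimizer in the open ball,
      where the first-order condition holds; the bound \<eta> is the closeness that
      \<open>normal_approximation\<close> asks for.\<close>
    have \<rho>: "min \<eta> (snd E.nbhd) > 0" using \<eta> E.nbhd(2) by simp
    obtain \<epsilon> where \<epsilon>: "\<epsilon> > 0" "\<And>m a t X. m > 0 \<Longrightarrow> (\<And>i s. s \<notin> range e \<Longrightarrow> t i $ s = 0) \<Longrightarrow>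
      norm ((1 / real m) *\<^sub>R (\<Sum>i<m. E.tau i *\<^sub>R outer (a i) (a i)) - VA) \<le> \<epsilon> \<Longrightarrow>
      norm ((1 / real m) *\<^sub>R (\<Sum>i<m. E.tau i *\<^sub>R outer (a i) (t i))) \<le> \<epsilon> \<Longrightarrow>
      norm ((1 / real m) *\<^sub>R (\<Sum>i<m. E.tau i *\<^sub>R outer (t i) (t i)) - \<sigma>\<^sup>2 *\<^sub>R pad e Siginf) \<le> \<epsilon> \<Longrightarrow>
      1 / real m * (\<Sum>i<m. qcost e (Sig i) (E.obsv (a i) (t i)) X0) \<le> \<sigma>\<^sup>2 * CARD('d) + \<epsilon> \<Longrightarrow>
      rank (subrows e (Zmat X)) = CARD('d) \<Longrightarrow>
      (\<Sum>i<m. qcost e (Sig i) (E.obsv (a i) (t i)) X) \<le> (\<Sum>i<m. qcost e (Sig i) (E.obsv (a i) (t i)) X0) \<Longrightarrow>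
      dist X X0 < min \<eta> (snd E.nbhd)"
      by (rule E.consistency[OF v \<rho>, where ?s2.0="\<sigma>\<^sup>2"]) blast
    have "(\<lambda>m. 1 / real m * (\<Sum>i<m. dist (Sig i) Siginf * (norm (a0 i))\<^sup>2)) \<longlonglongrightarrow> 0"
      by (rule cesaro_weighted[OF dist_null _ _ vb(2)]) auto
    then have "\<forall>\<^sub>F m in sequentially. 1 / real m * (\<Sum>i<m. dist (Sig i) Siginf * (norm (a0 i))\<^sup>2) < \<eta>"
      by (rule order_tendstoD(2)) (rule \<eta>)
    then have "\<forall>\<^sub>F m in sequentially. m > 0 \<and> norm ((1 / real m) *\<^sub>R (\<Sum>i<m. E.tau i *\<^sub>R outer (a0 i) (a0 i)) - VA) < \<epsilon> \<and>
        norm ((1 / real m) *\<^sub>R (\<Sum>i<m. outer (a0 i) (a0 i)) - VA) < \<eta> \<and>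
        1 / real m * (\<Sum>i<m. (norm (a0 i))\<^sup>2 * dist (Sig i) Siginf) < \<eta>"
      using tendstoD[OF weighted_VA_lim \<epsilon>(1)] tendstoD[OF VA_lim \<eta>(1)] eventually_gt_at_top[of 0]
      by eventually_elim (simp add: dist_norm mult.commute)
    then obtain N where N: "\<And>m. m \<ge> N \<Longrightarrow> m > 0" "\<And>m. m \<ge> N \<Longrightarrow> norm ((1 / real m) *\<^sub>R (\<Sum>i<m. E.tau i *\<^sub>R outer (a0 i) (a0 i)) - VA) < \<epsilon>"
      "\<And>m. m \<ge> N \<Longrightarrow> norm ((1 / real m) *\<^sub>R (\<Sum>i<m. outer (a0 i) (a0 i)) - VA) < \<eta>"
      "\<And>m. m \<ge> N \<Longrightarrow> 1 / real m * (\<Sum>i<m. (norm (a0 i))\<^sup>2 * dist (Sig i) Siginf) < \<eta>"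
      unfolding eventually_sequentially by blast
    have main: "\<exists>X. est m (rows m \<omega>) = Some X \<and>
        norm (sqrt (real m) *\<^sub>R (X - X0) + matrix_inv VA ** Gamma_of (pad e Siginf) X0 (S m \<omega>)) \<le> C * \<eta> * (1 + norm (S m \<omega>))"
      if m: "m \<ge> N" and supp: "\<forall>i s. s \<notin> J \<longrightarrow> ct i \<omega> $ s = 0" and Z: "Zn m \<omega> < min \<epsilon> \<eta>" for m \<omega>
    proof -
      have n: "norm (Nn m \<omega>) \<le> \<epsilon>" "norm (Tn m \<omega>) \<le> \<epsilon>" "\<bar>Qw m \<omega>\<bar> \<le> \<epsilon>" "\<bar>Gn m \<omega>\<bar> \<le> \<eta>" "norm (Rn m \<omega>) \<le> \<eta>"
        using Z norm_ge_zero[of "Nn m \<omega>"] norm_ge_zero[of "Tn m \<omega>"] norm_ge_zero[of "Qw m \<omega>"] norm_ge_zero[of "Gn m \<omega>"] norm_ge_zero[of "Rn m \<omega>"]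
        unfolding Zn_def real_norm_def by linarith+
      have q: "1 / real m * (\<Sum>i<m. qcost e (Sig i) (E.obsv (a0 i) (ct i \<omega>)) X0) \<le> \<sigma>\<^sup>2 * CARD('d) + \<epsilon>"
        using n(3) Qn_eq[OF N(1)[OF m], of \<omega>] unfolding Qn_def by linarith
      have close: "dist X X0 < min \<eta> (snd E.nbhd)" if "rank (subrows e (Zmat X)) = CARD('d)" "cost m \<omega> X \<le> cost m \<omega> X0" for X
        by (rule \<epsilon>(2)[OF N(1)[OF m] _ less_imp_le[OF N(2)[OF m]] n(1)[unfolded Nn_def] n(2)[unfolded Tn_def] q that(1) that(2)[unfolded cost_def]])
          (use supp range in auto)
      have "\<exists>X. rank (subrows e (Zmat X)) = CARD('d) \<and> (\<forall>X'. rank (subrows e (Zmat X')) = CARD('d) \<longrightarrow> cost m \<omega> X \<le> cost m \<omega> X')"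
        unfolding cost_def
      proof (rule E.minimizer_exists)
        fix X :: "real ^ 'd ^ 'n"
        assume "rank (subrows e (Zmat X)) = CARD('d)"
          "(\<Sum>i<m. qcost e (Sig i) (E.obsv (a0 i) (ct i \<omega>)) X) \<le> (\<Sum>i<m. qcost e (Sig i) (E.obsv (a0 i) (ct i \<omega>)) X0)"
        from close[OF this(1), unfolded cost_def, OF this(2)] show "X \<in> E.U" by (simp add: E.U_def dist_commute)
      qed
      then have "\<exists>X. ewtls_solution J e Sig m (rows m \<omega>) X" by (simp only: solution_iff)
      then obtain X where X: "est m (rows m \<omega>) = Some X" "ewtls_solution J e Sig m (rows m \<omega>) X"
        using est_cases[of m \<omega>] by (cases "est m (rows m \<omega>)") auto
      have r: "rank (subrows e (Zmat X)) = CARD('d)"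
        and opt: "\<And>X'. rank (subrows e (Zmat X')) = CARD('d) \<Longrightarrow> cost m \<omega> X \<le> cost m \<omega> X'"
        using X(2) unfolding solution_iff by auto
      have d: "dist X X0 < min \<eta> (snd E.nbhd)" by (rule close[OF r opt[OF rank_Z0J]])
      then have XU: "X \<in> E.U" and Xb: "X \<in> ball X0 (snd E.nbhd)" by (auto simp: E.U_def dist_commute)
      have sc: "E.score a0 (\<lambda>i. ct i \<omega>) m X = 0" unfolding E.score_def
        by (rule E.first_order_condition[OF Xb]) (rule opt[unfolded cost_def, OF E.U_rank])
      have "norm (sqrt (real m) *\<^sub>R (X - X0) + matrix_inv VA ** Gamma_of (pad e Siginf) X0 (E.Sm (\<sigma>\<^sup>2) a0 (\<lambda>i. ct i \<omega>) m))
          \<le> C * \<eta> * (1 + norm (E.Sm (\<sigma>\<^sup>2) a0 (\<lambda>i. ct i \<omega>) m))"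
      proof (rule C(3)[OF N(1)[OF m] \<eta> XU sc less_imp_le[OF N(3)[OF m]] vb(2) less_imp_le[OF N(4)[OF m]]])
        show "dist X X0 \<le> \<eta>" using d by simp
        show "1 / real m * (\<Sum>i<m. dist (Sig i) Siginf * norm (E.Wd (\<sigma>\<^sup>2) a0 (\<lambda>i. ct i \<omega>) i)) \<le> \<eta>"
          using n(4) unfolding Gn_def Wd_eq by linarith
        show "norm (E.remd (\<sigma>\<^sup>2) a0 (\<lambda>i. ct i \<omega>) m) \<le> \<eta>" using n(5) by (simp add: Rn_def)
      qed
      then show ?thesis using X(1) unfolding Sm_eq by blast
    qed
    show "\<exists>\<epsilon>>0. \<exists>N. \<forall>m\<ge>N. \<forall>\<omega>. (\<forall>i s. s \<notin> J \<longrightarrow> ct i \<omega> $ s = 0) \<longrightarrow> Zn m \<omega> < \<epsilon> \<longrightarrow>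
      (\<exists>X. est m (rows m \<omega>) = Some X \<and>
        norm (sqrt (real m) *\<^sub>R (X - X0) + matrix_inv VA ** Gamma_of (pad e Siginf) X0 (S m \<omega>)) \<le> C * \<eta> * (1 + norm (S m \<omega>)))"
      using main \<epsilon>(1) \<eta>(1) by (intro exI[of _ "min \<epsilon> \<eta>"] conjI exI[of _ N] allI impI) simp_all
  qed
qed

text \<open>The scaled error is compared with g (- S m), where g is the linear map in the limit. Up
  to a null set, the two differ by e' or more only if \<open>Zn\<close> is large or S is large;
  outside these events the estimator is finite, so the values of \<open>arb\<close> have no
  influence.\<close>

theorem asymptotic_normality:
  fixes arb :: "nat \<Rightarrow> 'w \<Rightarrow> real ^ 'd ^ 'n"
  assumes arb [measurable]: "\<And>m. arb m \<in> borel_measurable M" and L: "prob_space L" "sets L = sets borel"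
    and conv: "conv_in_law (\<lambda>m. distr M borel (\<lambda>\<omega>. - S m \<omega>)) L"
  shows "conv_in_law (\<lambda>m. distr M borel (\<lambda>\<omega>. case est m (rows m \<omega>) of
      Some X \<Rightarrow> sqrt (real m) *\<^sub>R (X - X0) | None \<Rightarrow> arb m \<omega>))
    (distr L borel (\<lambda>G. matrix_inv VA ** Gamma_of (pad e Siginf) X0 G))"
proof -
  define g where "g G = matrix_inv VA ** Gamma_of (pad e Siginf) X0 G" for G
  define Yn where "Yn m \<omega> = (case est m (rows m \<omega>) of Some X \<Rightarrow> sqrt (real m) *\<^sub>R (X - X0) | None \<Rightarrow> arb m \<omega>)" for m \<omega>
  have lin: "linear g" unfolding g_def[abs_def]
    by (rule linearI) (simp_all add: linear_add[OF linear_Gamma_of] linear_scale[OF linear_Gamma_of] matrix_mult_distribs)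
  then have cont: "continuous_on UNIV g" by (simp add: linear_continuous_on linear_conv_bounded_linear)
  have gm [measurable]: "g \<in> borel_measurable borel" using cont by (rule borel_measurable_continuous_onI)
  have g_neg: "g (- x) = - g x" for x by (rule linear_neg[OF lin])
  have Ym [measurable]: "Yn m \<in> borel_measurable M" for m
  proof -
    note c = borel_infty_case_measurable[OF est_measurable[of m]]
    have eq: "Yn m \<omega> = (if est m (rows m \<omega>) = None then arb m \<omega>
        else sqrt (real m) *\<^sub>R ((case est m (rows m \<omega>) of Some X \<Rightarrow> X | None \<Rightarrow> X0) - X0))" for \<omega>
      by (simp add: Yn_def split: option.split)
    note c(1)[of X0, measurable]
    show ?thesis unfolding eq[abs_def] by (rule measurable_If[OF _ _ c(2)]) measurable
  qed
  have "conv_in_law (\<lambda>m. distr M borel (Yn m)) (distr L borel g)"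
  proof (rule conv_in_law_slutsky[where U="\<lambda>m \<omega>. g (- S m \<omega>)"])
    show "prob_space M" by (rule prob_space_axioms)
    show Um [measurable]: "(\<lambda>\<omega>. g (- S m \<omega>)) \<in> borel_measurable M" for m by measurable
    show "Yn m \<in> borel_measurable M" for m by (rule Ym)
    have [measurable_cong]: "sets L = sets borel" by (rule L)
    show "prob_space (distr L borel g)" by (rule prob_space.prob_space_distr[OF L(1)]) measurable
    show "conv_in_law (\<lambda>m. distr M borel (\<lambda>\<omega>. g (- S m \<omega>))) (distr L borel g)"
      by (rule conv_in_law_continuous_map[OF _ L(2) conv cont]) measurable
    fix e' :: real assume e': "e' > 0"
    obtain C \<eta>0 where C: "C > 0" "\<eta>0 > 0" "\<And>\<eta>. 0 < \<eta> \<Longrightarrow> \<eta> \<le> \<eta>0 \<Longrightarrow>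
      \<exists>\<epsilon>>0. \<exists>N. \<forall>m\<ge>N. \<forall>\<omega>. (\<forall>i s. s \<notin> J \<longrightarrow> ct i \<omega> $ s = 0) \<longrightarrow> Zn m \<omega> < \<epsilon> \<longrightarrow>
        (\<exists>X. est m (rows m \<omega>) = Some X \<and>
          norm (sqrt (real m) *\<^sub>R (X - X0) + matrix_inv VA ** Gamma_of (pad e Siginf) X0 (S m \<omega>)) \<le> C * \<eta> * (1 + norm (S m \<omega>)))"
      by (rule approximation) blast
    define K where "K = Kw\<^sup>2 * CY * (2 + 2 * vb)"
    have K0: "K \<ge> 0" using CY(1) vb(1) by (simp add: K_def)
    show "(\<lambda>m. prob {\<omega>\<in>space M. norm (Yn m \<omega> - g (- S m \<omega>)) \<ge> e'}) \<longlonglongrightarrow> 0"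
    proof (rule LIMSEQ_I)
      fix r :: real assume r: "r > 0"
      \<comment> \<open>Chebyshev radius: the probability that |S| reaches R is at most
        \<open>K / R\<^sup>2\<close>, below r/2. The added 1 gives R at least 1, which allows
        replacing \<open>R\<^sup>2\<close> by R.\<close>
      define R where "R = 2 * K / r + 1"
      have R: "R \<ge> 1" "K / R\<^sup>2 < r / 2"
      proof -
        show 1: "R \<ge> 1" using K0 r by (simp add: R_def)
        have "K / R\<^sup>2 \<le> K / R" using 1 K0 by (intro divide_left_mono) (auto simp: power2_eq_square mult_le_cancel_left1)
        also have "\<dots> < r / 2" using 1 r by (simp add: R_def field_simps)
        finally show "K / R\<^sup>2 < r / 2" .
      qed
      \<comment> \<open>Makes the approximation error C \<eta> (1 + |S|) at most e'/2 as long as |S|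
        is below R.\<close>
      define \<eta> where "\<eta> = min \<eta>0 (e' / (2 * C * (1 + R)))"
      have CR: "2 * C * (1 + R) > 0" using C(1) R(1) by simp
      have \<eta>: "0 < \<eta>" "\<eta> \<le> \<eta>0" using C(2) e' CR by (auto simp: \<eta>_def)
      have "2 * C * (1 + R) * \<eta> \<le> 2 * C * (1 + R) * (e' / (2 * C * (1 + R)))" using CR by (intro mult_left_mono) (auto simp: \<eta>_def)
      also have "\<dots> = e'" using CR by (subst times_divide_eq_right, subst nonzero_mult_div_cancel_left) auto
      finally have \<eta>e: "C * \<eta> * (1 + R) < e'" using e' by (simp add: algebra_simps)
      obtain \<epsilon> N where \<epsilon>: "\<epsilon> > 0" "\<And>m \<omega>. m \<ge> N \<Longrightarrow> (\<forall>i s. s \<notin> J \<longrightarrow> ct i \<omega> $ s = 0) \<Longrightarrow> Zn m \<omega> < \<epsilon> \<Longrightarrow>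
        (\<exists>X. est m (rows m \<omega>) = Some X \<and>
          norm (sqrt (real m) *\<^sub>R (X - X0) + matrix_inv VA ** Gamma_of (pad e Siginf) X0 (S m \<omega>)) \<le> C * \<eta> * (1 + norm (S m \<omega>)))"
        using C(3)[OF \<eta>] by blast
      have "(\<lambda>m. prob {\<omega>\<in>space M. norm (Zn m \<omega>) \<ge> \<epsilon>}) \<longlonglongrightarrow> 0"
        using Zn_null \<epsilon>(1) unfolding null_in_prob_def by blast
      then have "\<forall>\<^sub>F m in sequentially. prob {\<omega>\<in>space M. norm (Zn m \<omega>) \<ge> \<epsilon>} < r / 2"
        by (rule order_tendstoD(2)) (use r in simp)
      then obtain N' where N': "\<And>m. m \<ge> N' \<Longrightarrow> prob {\<omega>\<in>space M. norm (Zn m \<omega>) \<ge> \<epsilon>} < r / 2"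
        unfolding eventually_sequentially by blast
      have "norm (prob {\<omega>\<in>space M. norm (Yn m \<omega> - g (- S m \<omega>)) \<ge> e'} - 0) < r" if m: "m \<ge> max N N'" for m
      proof -
        let ?A = "{\<omega>\<in>space M. norm (Yn m \<omega> - g (- S m \<omega>)) \<ge> e'}" and ?B = "{\<omega>\<in>space M. norm (Zn m \<omega>) \<ge> \<epsilon>}"
          and ?D = "{\<omega>\<in>space M. norm (S m \<omega>) \<ge> R}"
        have meas: "?B \<in> sets M" "?D \<in> sets M" by measurable
        \<comment> \<open>The inclusion holds only almost everywhere, because the pathwise estimate
          needs the errors to vanish outside J.\<close>
        have "AE \<omega> in M. \<omega> \<in> ?A \<longrightarrow> \<omega> \<in> ?B \<union> ?D"
          using supported_AE
        proof eventually_elim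
          case (elim \<omega>)
          show ?case
          proof (intro impI, rule ccontr)
            assume A: "\<omega> \<in> ?A" and "\<omega> \<notin> ?B \<union> ?D"
            then have ZS: "Zn m \<omega> < \<epsilon>" "norm (S m \<omega>) < R" by auto
            obtain X where X: "est m (rows m \<omega>) = Some X"
              "norm (sqrt (real m) *\<^sub>R (X - X0) + g (S m \<omega>)) \<le> C * \<eta> * (1 + norm (S m \<omega>))"
              using \<epsilon>(2)[of m \<omega>, OF _ elim ZS(1)] m unfolding g_def by auto
            have "C * \<eta> * (1 + norm (S m \<omega>)) \<le> C * \<eta> * (1 + R)" using C(1) \<eta>(1) ZS(2) by (intro mult_left_mono) auto
            then have "norm (Yn m \<omega> - g (- S m \<omega>)) < e'" using X \<eta>e by (simp add: Yn_def g_neg)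
            then show False using A by simp
          qed
        qed
        then have "prob ?A \<le> prob (?B \<union> ?D)" using meas by (intro finite_measure_mono_AE) auto
        also have "\<dots> \<le> prob ?B + prob ?D" by (rule measure_Un_le[OF meas])
        also have "prob ?D \<le> expectation (\<lambda>\<omega>. (norm (S m \<omega>))\<^sup>2) / R\<^sup>2"
          by (rule prob_norm_ge_square[OF S_measurable S_second_moment(1)]) (use R in simp)
        also have "\<dots> \<le> K / R\<^sup>2" using S_second_moment(2)[of m] by (intro divide_right_mono) (auto simp: K_def)
        finally have "prob ?A \<le> prob ?B + K / R\<^sup>2" by simp
        moreover have "prob ?B < r / 2" by (rule N') (use m in simp)
        ultimately have "prob ?A < r" using R(2) by linarith
        then show ?thesis by simp
      qed
      then show "\<exists>no. \<forall>m\<ge>no. norm (prob {\<omega>\<in>space M. norm (Yn m \<omega> - g (- S m \<omega>)) \<ge> e'} - 0) < r" by blast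
    qed
  qed simp
  then show ?thesis by (simp only: Yn_def[abs_def] g_def[abs_def])
qed

end

theorem theorem7:
  fixes M :: "'w measure"
    and X0 :: "real ^ 'd::finite ^ 'n::finite"
    and a0 :: "nat \<Rightarrow> real ^ 'n"
    and ct :: "nat \<Rightarrow> 'w \<Rightarrow> real ^ ('n + 'd)"
    and J :: "('n + 'd) set"
    and e :: "'j::finite \<Rightarrow> 'n + 'd"
    and Sig :: "nat \<Rightarrow> real ^ 'j ^ 'j"
    and Siginf :: "real ^ 'j ^ 'j"
    and VA :: "real ^ 'n ^ 'n"
    and \<sigma> :: real
    and mu4 :: "'n + 'd \<Rightarrow> 'n + 'd \<Rightarrow> 'n + 'd \<Rightarrow> 'n + 'd \<Rightarrow> real"
    and est :: "nat \<Rightarrow> (nat \<Rightarrow> real ^ ('n + 'd)) \<Rightarrow> (real ^ 'd ^ 'n) option"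
    and arb :: "nat \<Rightarrow> 'w \<Rightarrow> real ^ 'd ^ 'n"
  assumes prob: "prob_space M"
    and enum: "bij_betw e UNIV J"
    and indep: "prob_space.indep_vars M (\<lambda>_. borel) ct UNIV"
    and second_moments: "\<And>i. integrable M (\<lambda>\<omega>. (norm (ct i \<omega>))\<^sup>2)"
    and zero_mean: "\<And>i. (\<integral>\<omega>. ct i \<omega> \<partial>M) = 0"
    and error_free: "\<And>i j. j \<notin> J \<Longrightarrow> (\<integral>\<omega>. (ct i \<omega> $ j)\<^sup>2 \<partial>M) = 0"
    and sigma_pos: "\<sigma> > 0"
    and cov_J: "\<And>i. cov_matrix M (\<lambda>\<omega>. subrows e (ct i \<omega>)) = \<sigma>\<^sup>2 *\<^sub>R Sig i"
    and eig_bound: "\<exists>\<kappa>>0. \<forall>i. lambda_min (Sig i) \<ge> \<kappa>\<^sup>2"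
    and rank_Z0J: "rank (subrows e (Zmat X0)) = CARD('d)"
    and moments_r: "\<exists>r::real. r \<ge> 2 \<and> r > real CARD('d) * (real (card J) - (real CARD('d) + 1) / 2) \<and>
      (SUP (i, j) \<in> UNIV \<times> J. \<integral>\<^sup>+\<omega>. ennreal (\<bar>ct i \<omega> $ j\<bar> powr (2 * r)) \<partial>M) < \<infinity>"
    and moments_delta: "\<exists>\<delta>>0.
      (SUP (i, j) \<in> UNIV \<times> J. \<integral>\<^sup>+\<omega>. ennreal (\<bar>ct i \<omega> $ j\<bar> powr (4 + 2 * \<delta>)) \<partial>M) < \<infinity> \<and>
      (\<lambda>m. 1 / real m powr (1 + \<delta> / 2) * (\<Sum>i<m. norm (a0 i) powr (2 + \<delta>))) \<longlonglongrightarrow> 0"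
    and VA_lim: "(\<lambda>m. (1 / real m) *\<^sub>R (\<Sum>i<m. outer (a0 i) (a0 i))) \<longlonglongrightarrow> VA"
    and VA_nonsing: "invertible VA"
    and Sig_lim: "Sig \<longlonglongrightarrow> Siginf"
    and third: "\<And>i p q r. p \<in> J \<Longrightarrow> q \<in> J \<Longrightarrow> r \<in> J \<Longrightarrow>
      (\<integral>\<omega>. ct i \<omega> $ p * ct i \<omega> $ q * ct i \<omega> $ r \<partial>M) = 0"
    and fourth: "\<And>p q r u. p \<in> J \<Longrightarrow> q \<in> J \<Longrightarrow> r \<in> J \<Longrightarrow> u \<in> J \<Longrightarrow>
      (\<lambda>m. 1 / real m * (\<Sum>i<m. \<integral>\<omega>. ct i \<omega> $ p * ct i \<omega> $ q * ct i \<omega> $ r * ct i \<omega> $ u \<partial>M))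
        \<longlonglongrightarrow> mu4 p q r u"
    and estimator: "ewtls_estimator J e Sig est"
    \<comment> \<open>arbitrary values on the event that the estimator is infinite\<close>
    and arb_meas: "\<And>m. arb m \<in> borel_measurable M"
  shows "\<exists>L. limit_law M \<sigma> a0 ct L \<and>
    conv_in_law
      (\<lambda>m. distr M borel (\<lambda>\<omega>.
        case est m (\<lambda>i\<in>{..<m}. obs X0 a0 ct i \<omega>) of
          Some X \<Rightarrow> sqrt (real m) *\<^sub>R (X - X0)
        | None \<Rightarrow> arb m \<omega>))
      (distr L borel (\<lambda>G. matrix_inv VA ** Gamma_of (lim (Smat M \<sigma> ct)) X0 G)) \<and>
    (\<forall>u. u \<noteq> 0 \<longrightarrow>
      invertible (cov_matrix L (\<lambda>G. (matrix_inv VA ** Gamma_of (lim (Smat M \<sigma> ct)) X0 G) *v u)))"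
proof -
  interpret prob_space M by (rule prob)
  obtain \<delta> where \<delta>: "\<delta> > 0"
    "(SUP (i, j) \<in> UNIV \<times> J. \<integral>\<^sup>+\<omega>. ennreal (\<bar>ct i \<omega> $ j\<bar> powr (4 + 2 * \<delta>)) \<partial>M) < \<infinity>"
    "(\<lambda>m. 1 / real m powr (1 + \<delta> / 2) * (\<Sum>i<m. norm (a0 i) powr (2 + \<delta>))) \<longlonglongrightarrow> 0"
    using moments_delta by blast
  obtain \<kappa> where \<kappa>: "\<kappa> > 0" "\<And>i. \<kappa>\<^sup>2 \<le> lambda_min (Sig i)" using eig_bound by blast
  interpret A: eiv_estimation M X0 a0 ct J e Sig Siginf VA \<sigma> \<delta> mu4 \<kappa> est
    by (intro eiv_estimation.intro eiv.intro eiv_axioms.intro eiv_estimation_axioms.intro;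
      (rule prob enum indep second_moments zero_mean error_free sigma_pos cov_J \<delta> VA_lim Sig_lim third fourth
        \<kappa> rank_Z0J VA_nonsing estimator; assumption)?)
  obtain L q2 where L: "prob_space L" "sets L = sets borel" "indep_components L"
    "\<And>u. (\<integral>x. iexp (u \<bullet> x) \<partial>L) = of_real (exp (- (A.q1 (fst u) + q2 (snd u)) / 2))"
    and q: "\<And>u. 0 \<le> A.q1 u" "\<And>u. 0 \<le> q2 u" "\<And>t u. A.q1 (t *\<^sub>R u) = t\<^sup>2 * A.q1 u" "\<And>t u. q2 (t *\<^sub>R u) = t\<^sup>2 * q2 u"
    and conv: "conv_in_law (\<lambda>m. distr M borel (A.S m)) L" "conv_in_law (\<lambda>m. distr M borel (\<lambda>\<omega>. - A.S m \<omega>)) L"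
    by (rule A.gaussian_limit) blast
  \<comment> \<open>Positivity of \<open>Pmat e Siginf X0\<close>, restated for the vector Z u; it
    combines the rank condition at X0 with the eigenvalue bound inherited by
    \<open>Siginf\<close>.\<close>
  have pos: "0 < (Zmat X0 *v u) \<bullet> (pad e Siginf *v (Zmat X0 *v u))" if "u \<noteq> 0" for u
    using A.E.U_Pmat[OF A.E.X0_U A.E.Siginf_V] that unfolding pos_def_def Pmat_inner by blast
  have "centered_gaussian L"
    by (rule centered_gaussianI[OF L(1,2) _ _ L(4)]) (simp_all add: q distrib_left)
  then have law: "limit_law M \<sigma> a0 ct L"
    using L(3) conv(1) by (simp add: limit_law_def A.S_def[abs_def] A.W_def)
  show ?thesis
    unfolding A.Smat_lim
  proof (intro exI[of _ L] conjI allI impI)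
    show "limit_law M \<sigma> a0 ct L" by (rule law)
    show "conv_in_law (\<lambda>m. distr M borel (\<lambda>\<omega>. case est m (\<lambda>i\<in>{..<m}. obs X0 a0 ct i \<omega>) of
        Some X \<Rightarrow> sqrt (real m) *\<^sub>R (X - X0) | None \<Rightarrow> arb m \<omega>))
      (distr L borel (\<lambda>G. matrix_inv VA ** Gamma_of (pad e Siginf) X0 G))"
      by (rule A.asymptotic_normality[OF arb_meas L(1,2) conv(2), unfolded A.rows_def])
    show "invertible (cov_matrix L (\<lambda>G. (matrix_inv VA ** Gamma_of (pad e Siginf) X0 G) *v u))" if "u \<noteq> 0" for u
      by (rule A.covariance_nonsingular[OF L(1,2,4) q VA_nonsing pos that])
  qed
qed

end
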